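(* For $m=3,5,7,11,13,17,19$, the number of isomorphism classes of self-embeddings $S\cup F(S)$ lying in a closed surface, where $F(x)=x^t$ ranges over monomial power permutations of $GF(2^m)$, is exactly $1,1,4,14,12,65,88$, respectively. Moreover, for $m\in\{5,7,11,13,17,19\}$ all these self-embeddings are nonorientable.
   Context: $n=2^m-1$; a monomial power permutation is $F(x)=x^t$ with $\gcd(t,n)=1$. $S=STS(\mathcal H^n)$ is the set of 3-subsets $\{a,b,c\}$ of nonzero elements of $GF(2^m)$ with $a+b+c=0$; $F(S)=\{\{F(a),F(b),F(c)\}:\{a,b,c\}\in S\}$. For nonzero $a$, let $P_a=GF(2^m)\setminus\{0,a\}$, $s_a(y)=a+y$, $\psi_a(y)=F(F^{-1}(a)+F^{-1}(y))$; rotation lines at $a$ are the orbits on $P_a$ of the group generated by $s_a,\psi_a$. $S\cup F(S)$ (the triangles of $S$ colored black, those of $F(S)$ white, glued along edges to form a 2-complex triangulating the complete graph $K_n$) lies in a closed surface iff every point has exactly one rotation line. Such a self-embedding is orientable iff the triangles can be cyclically oriented so that every edge is traversed in opposite directions by its two incident triangles. Self-embeddings $S\cup F_1(S)$, $S\cup F_2(S)$ are isomorphic if there is a permutation $\sigma$ of the nonzero elements with either $\sigma(S)=S,\sigma(F_1(S))=F_2(S)$ or $\sigma(S)=F_2(S),\sigma(F_1(S))=S$. *)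

theory Defs
  imports Main
begin

section \<open>Steiner triple system of the Hamming code and its images\<close>

text \<open>Nonzero elements of the field (the points, n = 2^m - 1 of them).\<close>
definition nonzero_pts :: "'a::field set" where
  "nonzero_pts = UNIV - {0}"

text \<open>S = STS(H^n): 3-subsets {a,b,c} of nonzero elements with a+b+c = 0.\<close>
definition STS :: "'a::field set set" where
  "STS = {{a, b, c} | a b c. a \<noteq> 0 \<and> b \<noteq> 0 \<and> c \<noteq> 0 \<and>
            a \<noteq> b \<and> a \<noteq> c \<and> b \<noteq> c \<and> a + b + c = 0}"

text \<open>Image of a set of triangles under a point map: F(S).\<close>
definition tri_img :: "('a \<Rightarrow> 'b) \<Rightarrow> 'a set set \<Rightarrow> 'b set set" where
  "tri_img F T = (\<lambda>X. F ` X) ` T"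

text \<open>Monomial power permutation x^t with gcd(t, 2^m - 1) = 1.\<close>
definition monomial_exps :: "'a::{field,finite} itself \<Rightarrow> nat set" where
  "monomial_exps _ = {t. coprime t (card (UNIV :: 'a set) - 1)}"

section \<open>Rotation lines\<close>

definition P_set :: "'a::field \<Rightarrow> 'a set" where
  "P_set a = UNIV - {0, a}"

definition s_map :: "'a::field \<Rightarrow> 'a \<Rightarrow> 'a" where
  "s_map a y = a + y"

definition psi_map :: "('a::field \<Rightarrow> 'a) \<Rightarrow> 'a \<Rightarrow> 'a \<Rightarrow> 'a" where
  "psi_map F a y = F (inv F a + inv F y)"

text \<open>One-step relation of the generators s_a, psi_a on P_a; the orbits of the group
  they generate are the classes of the reflexive-transitive-symmetric closure.\<close>
definition rot_step :: "('a::field \<Rightarrow> 'a) \<Rightarrow> 'a \<Rightarrow> 'a rel" where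
  "rot_step F a = {(y, s_map a y) | y. y \<in> P_set a} \<union> {(y, psi_map F a y) | y. y \<in> P_set a}"

definition rotation_lines :: "('a::field \<Rightarrow> 'a) \<Rightarrow> 'a \<Rightarrow> 'a set set" where
  "rotation_lines F a = P_set a // ((rot_step F a \<union> (rot_step F a)\<inverse>)\<^sup>*)"

text \<open>S \<union> F(S) lies in a closed surface iff every point has exactly one rotation line.\<close>
definition in_closed_surface :: "('a::field \<Rightarrow> 'a) \<Rightarrow> bool" where
  "in_closed_surface F \<longleftrightarrow> (\<forall>a \<in> nonzero_pts. card (rotation_lines F a) = 1)"

section \<open>Self-embeddings and isomorphism\<close>

text \<open>The self-embeddings S \<union> F(S) in a closed surface, F monomial; each is determined
  by its white triangle set F(S).\<close>
definition surface_embeddings :: "'a::{field,finite} itself \<Rightarrow> 'a set set set" where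
  "surface_embeddings A = {tri_img (\<lambda>x. x ^ t) (STS :: 'a set set) | t.
       t \<in> monomial_exps A \<and> in_closed_surface (\<lambda>x::'a. x ^ t)}"

definition emb_iso :: "'a::field set set \<Rightarrow> 'a set set \<Rightarrow> bool" where
  "emb_iso W1 W2 \<longleftrightarrow> (\<exists>\<sigma>. bij_betw \<sigma> nonzero_pts nonzero_pts \<and>
      ((tri_img \<sigma> STS = STS \<and> tri_img \<sigma> W1 = W2) \<or>
       (tri_img \<sigma> STS = W2 \<and> tri_img \<sigma> W1 = STS)))"

definition num_iso_classes :: "'a::{field,finite} itself \<Rightarrow> nat" where
  "num_iso_classes A = card (surface_embeddings A //
      {(W1, W2). W1 \<in> surface_embeddings A \<and> W2 \<in> surface_embeddings A \<and> emb_iso W1 W2})"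

section \<open>Orientability\<close>

text \<open>A cyclic orientation of a triangle T, given as its set of three directed edges.\<close>
definition cyc_orient :: "'a set \<Rightarrow> ('a \<times> 'a) set \<Rightarrow> bool" where
  "cyc_orient T Or \<longleftrightarrow> (\<exists>a b c. T = {a, b, c} \<and> a \<noteq> b \<and> a \<noteq> c \<and> b \<noteq> c \<and>
                          Or = {(a, b), (b, c), (c, a)})"

text \<open>Triangles of S \<union> W are tagged black (True) / white (False). The complex is
  orientable iff the triangles can be cyclically oriented so that any two distinct
  triangles sharing an edge traverse it in opposite directions.\<close>
definition orientable :: "'a set set \<Rightarrow> 'a set set \<Rightarrow> bool" where
  "orientable B W \<longleftrightarrow> (\<exists>Ori :: bool \<times> 'a set \<Rightarrow> ('a \<times> 'a) set.
     let Tr = ({True} \<times> B) \<union> ({False} \<times> W) in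
     (\<forall>X \<in> Tr. cyc_orient (snd X) (Ori X)) \<and>
     (\<forall>X \<in> Tr. \<forall>Y \<in> Tr. X \<noteq> Y \<longrightarrow>
        (\<forall>x y. {x, y} \<subseteq> snd X \<inter> snd Y \<and> x \<noteq> y \<longrightarrow>
           ((x, y) \<in> Ori X \<longleftrightarrow> (y, x) \<in> Ori Y))))"

definition all_nonorientable :: "'a::{field,finite} itself \<Rightarrow> bool" where
  "all_nonorientable A \<longleftrightarrow> (\<forall>W \<in> surface_embeddings A. \<not> orientable (STS :: 'a set set) W)"

end

theory Submission
  imports Defs "HOL-Number_Theory.Number_Theory" "HOL-Computational_Algebra.Polynomial"
begin

text \<open>
  For \<open>F(x) = x^t\<close> all points look alike, so everything is read off the rotation
  \<open>\<rho>(y) = (1 + (1 + y)^(1/t))^t\<close> at the point 1: there is a single rotation line iff \<open>\<rho>\<close> has period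
  \<open>2^(m-1) - 1\<close> on \<open>GF(2^m) - {0, 1}\<close>. Since \<open>\<rho>\<close> commutes with the Frobenius map, a walk that meets a
  conjugate of its start early shows that the period is short, and \<open>(2^(m-1) - 1) / m\<close> steps suffice to show
  that it is full. If \<open>\<rho>^j(y) = 1/y\<close> for some \<open>y\<close>, then transporting an orientation along the points
  \<open>1, y, y^2, \<dots>\<close>, an odd cycle, reverses it. Finally isomorphisms between two embeddings are linear
  equivalences of power maps, which exist only if the exponents agree up to inversion and powers of 2; this is shown
  by counting the fixed points of an element of large prime order. Thus the classes correspond to the exponents modulo
  \<open>2\<close> and inversion, and each exponent is settled by an explicit walk. In the larger fields the walk runs over
  labels \<open>(j, a, b)\<close> of the elements \<open>g^(2^j \<alpha>^a \<beta>^b)\<close>, on which power maps act by addition.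
\<close>

section \<open>Pairs of fixed-point-free involutions\<close>

text \<open>Why half of all points is a full period: the rotation is a product of two
  fixed-point-free involutions, so an orbit under both consists of two rotation cycles of equal
  length that either involution exchanges. The count behind the linear equivalences replaces Sylow's
  theorem. Transporting a scalar of prime order p along an isomorphism yields a second element of
  order p in the automorphism group of a power map. Here p > m, because 2 has order m modulo p. The
  scalar fixes at least one and at most m cosets of the scalars; so p does not divide the number of
  cosets, the second element fixes one too, and thus it is conjugate to a scalar. The remaining
  obstacle is volume: for m = 19 almost 14000 exponents need a walk each. Every half step has to be
  one lookup. Adding 1 commutes with Frobenius, so it is tabulated for a single element per pair (a,
  b). For m = 13, 17, 19 the number n is prime and every element other than 0 and 1 has a label. For
  m = 11 it is 23 * 89, and elements of order 23 or 89 have none; there the few exponents are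
  checked in coordinates.\<close>

definition period :: "('b \<Rightarrow> 'b) \<Rightarrow> 'b \<Rightarrow> nat" where
  "period f x = (LEAST k. 0 < k \<and> (f ^^ k) x = x)"

lemma period_props:
  assumes "0 < k" "(f ^^ k) x = x"
  shows "0 < period f x" "(f ^^ period f x) x = x" "period f x \<le> k"
  using LeastI[of "\<lambda>k. 0 < k \<and> (f ^^ k) x = x" k] Least_le[of "\<lambda>k. 0 < k \<and> (f ^^ k) x = x" k] assms
  unfolding period_def by auto

lemma funpow_mult_fix: "(f ^^ p) x = x \<Longrightarrow> (f ^^ (p * k)) x = x"
  by (induction k) (auto simp: funpow_add)

lemma funpow_fix_mod:
  assumes "(f ^^ p) x = x" shows "(f ^^ (i mod p)) x = (f ^^ i) x"
proof -
  have "(f ^^ i) x = (f ^^ (i mod p + p * (i div p))) x" by simp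
  also have "\<dots> = (f ^^ (i mod p)) x" by (simp only: funpow_add o_apply funpow_mult_fix[OF assms])
  finally show ?thesis by simp
qed

text \<open>Dihedral action in the abstract; it is applied to \<open>s_a\<close> and
  \<open>psi_a\<close> on \<open>P_a\<close> for each point \<open>a\<close>.\<close>

locale two_involutions =
  fixes P :: "'b set" and s q :: "'b \<Rightarrow> 'b"
  assumes fin: "finite P"
    and s_in: "x \<in> P \<Longrightarrow> s x \<in> P" and ss: "x \<in> P \<Longrightarrow> s (s x) = x" and s_ne: "x \<in> P \<Longrightarrow> s x \<noteq> x"
    and q_in: "x \<in> P \<Longrightarrow> q x \<in> P" and qq: "x \<in> P \<Longrightarrow> q (q x) = x" and q_ne: "x \<in> P \<Longrightarrow> q x \<noteq> x"
begin

definition rot :: "'b \<Rightarrow> 'b" where "rot x = q (s x)"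

definition steps :: "'b rel" where
  "steps = {(y, s y) | y. y \<in> P} \<union> {(y, q y) | y. y \<in> P}"

abbreviation conn :: "'b rel" where "conn \<equiv> (steps \<union> steps\<inverse>)\<^sup>*"

lemma rot_in: "x \<in> P \<Longrightarrow> rot x \<in> P"
  by (simp add: rot_def q_in s_in)

lemma pow_in: "x \<in> P \<Longrightarrow> (rot ^^ i) x \<in> P"
  by (induction i) (auto simp: rot_in)

lemma rot_inj: "x \<in> P \<Longrightarrow> y \<in> P \<Longrightarrow> rot x = rot y \<Longrightarrow> x = y"
  unfolding rot_def by (metis qq ss s_in)

lemma pow_inj: "x \<in> P \<Longrightarrow> y \<in> P \<Longrightarrow> (rot ^^ i) x = (rot ^^ i) y \<Longrightarrow> x = y"
proof (induction i)
  case (Suc i)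
  then have "(rot ^^ i) x = (rot ^^ i) y" using rot_inj[OF pow_in pow_in] by simp
  with Suc show ?case by blast
qed simp

lemma ex_return:
  assumes x: "x \<in> P" shows "\<exists>k>0. (rot ^^ k) x = x"
proof -
  have "finite (range (\<lambda>i. (rot ^^ i) x))"
    by (rule finite_subset[OF _ fin]) (use pow_in[OF x] in blast)
  then have "\<not> inj (\<lambda>i. (rot ^^ i) x)"
    using finite_imageD[of "\<lambda>i. (rot ^^ i) x" UNIV] infinite_UNIV_nat by blast
  then obtain i j where ij: "i \<noteq> j" "(rot ^^ i) x = (rot ^^ j) x" by (auto simp: inj_on_def)
  obtain a b where ab: "a < b" "(rot ^^ a) x = (rot ^^ b) x"
    using ij by (metis linorder_neqE_nat)
  have "(rot ^^ a) x = (rot ^^ a) ((rot ^^ (b - a)) x)"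
    using ab by (metis funpow_add o_apply le_add_diff_inverse less_imp_le)
  then have "(rot ^^ (b - a)) x = x" using pow_inj x pow_in by metis
  then show ?thesis using ab(1) by (intro exI[of _ "b - a"]) auto
qed

lemma period_pos: "x \<in> P \<Longrightarrow> 0 < period rot x"
  and period_return: "x \<in> P \<Longrightarrow> (rot ^^ period rot x) x = x"
  using ex_return period_props by metis+

text \<open>If \<open>s x\<close> were a power of the rotation applied to \<open>x\<close>, passing
  to the next point of the cycle would lower the exponent by two, down to 0 or 1, where
  \<open>s\<close> or \<open>q\<close> would have a fixed point.\<close>

lemma s_not_rot: "x \<in> P \<Longrightarrow> s x \<noteq> (rot ^^ l) x"
proof (induction l arbitrary: x rule: nat_induct2)
  case 0 then show ?case by (simp add: s_ne)
next
  case 1 then show ?case using q_ne[of "s x"] s_in by (auto simp: rot_def)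
next
  case (step l)
  define z where "z = rot x"
  have z: "z \<in> P" using step.prems by (simp add: z_def rot_in)
  show ?case
  proof
    assume "s x = (rot ^^ (l + 2)) x"
    then have "s x = rot ((rot ^^ l) z)" by (simp add: z_def funpow_swap1)
    then have "q (s x) = s ((rot ^^ l) z)" using qq s_in pow_in[OF z] by (simp add: rot_def)
    then have "s z = (rot ^^ l) z" using ss[OF pow_in[OF z]] by (metis z_def rot_def)
    with step.IH[OF z] show False by blast
  qed
qed

definition cyc :: "'b \<Rightarrow> 'b set" where "cyc x = (\<lambda>i. (rot ^^ i) x) ` {..<period rot x}"

lemma pow_in_cyc: "x \<in> P \<Longrightarrow> (rot ^^ i) x \<in> cyc x"
  unfolding cyc_def
  by (rule image_eqI[where x = "i mod period rot x"])
    (simp_all add: funpow_fix_mod period_return period_pos)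

lemma cyc_sub: "x \<in> P \<Longrightarrow> cyc x \<subseteq> P"
  by (auto simp: cyc_def pow_in)

lemma card_cyc:
  assumes x: "x \<in> P" shows "card (cyc x) = period rot x"
proof -
  have *: "a = b" if "a \<le> b" "b < period rot x" "(rot ^^ a) x = (rot ^^ b) x" for a b
  proof (rule ccontr)
    assume "a \<noteq> b"
    have "(rot ^^ a) x = (rot ^^ a) ((rot ^^ (b - a)) x)"
      using that by (metis funpow_add o_apply le_add_diff_inverse)
    then have "(rot ^^ (b - a)) x = x" using pow_inj x pow_in by metis
    then have "period rot x \<le> b - a" using \<open>a \<noteq> b\<close> that(1) period_props(3)[of "b - a" rot x] by simp
    with that \<open>a \<noteq> b\<close> show False by simp
  qed
  have "inj_on (\<lambda>i. (rot ^^ i) x) {..<period rot x}"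
    using * by (intro inj_onI) (metis lessThan_iff nat_le_linear)
  then show ?thesis by (simp add: cyc_def card_image)
qed

lemma s_cyc_disjoint:
  assumes x: "x \<in> P" shows "cyc x \<inter> s ` cyc x = {}"
proof -
  have False if "(rot ^^ i) x = s ((rot ^^ k) x)" "k < period rot x" for i k
  proof -
    let ?p = "period rot x"
    \<comment> \<open>Adding whole periods brings the exponent above \<open>k\<close>, so that the
      difference of the two exponents is a natural number.\<close>
    have "(rot ^^ i) x = (rot ^^ (i + ?p * k)) x"
      by (simp only: funpow_add o_apply funpow_mult_fix[OF period_return[OF x]])
    moreover have "k \<le> i + ?p * k" using period_pos[OF x] by (cases ?p) auto
    ultimately have "(rot ^^ i) x = (rot ^^ (i + ?p * k - k)) ((rot ^^ k) x)"
      by (metis funpow_add o_apply le_add_diff_inverse2)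
    with that(1) s_not_rot[OF pow_in[OF x]] show False by metis
  qed
  then show ?thesis unfolding cyc_def by auto
qed

text \<open>The union is closed under both involutions: \<open>s\<close> exchanges the two halves,
  and \<open>q\<close> leads from an element of the cycle to the mirror image of its
  predecessor.\<close>

lemma conn_image:
  assumes x: "x \<in> P" shows "conn `` {x} = cyc x \<union> s ` cyc x"
proof
  let ?O = "cyc x \<union> s ` cyc x"
  have P: "?O \<subseteq> P" using cyc_sub[OF x] s_in by auto
  have cl_s: "s y \<in> ?O" if "y \<in> ?O" for y
    using that cyc_sub[OF x] ss by auto
  have cl_q: "q y \<in> ?O" if y: "y \<in> ?O" for y
  proof (cases "y \<in> cyc x")
    case True
    then obtain i where i: "y = (rot ^^ i) x" by (auto simp: cyc_def)
    obtain k where "y = (rot ^^ Suc k) x"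
    proof (cases i)
      \<comment> \<open>The starting point has a predecessor as well, namely the last element of its
        cycle.\<close>
      case 0
      then have "y = (rot ^^ Suc (period rot x - 1)) x"
        using i period_return[OF x] period_pos[OF x] by simp
      then show ?thesis by (rule that)
    qed (use i that in blast)
    then have "q y = s ((rot ^^ k) x)" using qq s_in pow_in[OF x] by (simp add: rot_def)
    then show ?thesis using pow_in_cyc[OF x] by auto
  next
    case False
    then obtain i where "y = s ((rot ^^ i) x)" using y by (auto simp: cyc_def)
    then have "q y = (rot ^^ Suc i) x" by (simp add: rot_def)
    then show ?thesis using pow_in_cyc[OF x, of "Suc i"] by simp
  qed
  show "conn `` {x} \<subseteq> ?O"
  proof
    fix y assume "y \<in> conn `` {x}"
    then have "(x, y) \<in> conn" by simp
    then show "y \<in> ?O"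
    proof (induction rule: rtrancl_induct)
      case base show ?case using pow_in_cyc[OF x, of 0] by simp
    next
      case (step y z)
      then have "z = s y \<or> z = q y \<or> (z \<in> P \<and> y = s z) \<or> (z \<in> P \<and> y = q z)"
        by (auto simp: steps_def)
      then have "z = s y \<or> z = q y" using ss qq by auto
      then show ?case using cl_s[OF step.IH] cl_q[OF step.IH] by blast
    qed
  qed
  have one: "(y, s y) \<in> conn" "(y, q y) \<in> conn" if "y \<in> P" for y
    using that by (auto simp: steps_def)
  have pw: "(x, (rot ^^ i) x) \<in> conn" for i
  proof (induction i)
    case (Suc i)
    let ?y = "(rot ^^ i) x"
    have "(?y, s ?y) \<in> conn" "(s ?y, q (s ?y)) \<in> conn"
      using one pow_in[OF x] s_in by blast+
    then have "(x, q (s ?y)) \<in> conn" by (rule rtrancl_trans[OF rtrancl_trans[OF Suc]])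
    then show ?case by (simp add: rot_def[of ?y])
  qed simp
  moreover have "(x, s ((rot ^^ i) x)) \<in> conn" for i
    using rtrancl_trans[OF pw one(1)[OF pow_in[OF x]]] .
  ultimately show "?O \<subseteq> conn `` {x}" by (auto simp: cyc_def)
qed

lemma card_orbit:
  assumes x: "x \<in> P" shows "card (conn `` {x}) = 2 * period rot x"
proof -
  have "inj_on s (cyc x)" using cyc_sub[OF x] ss by (intro inj_onI) (metis subsetD)
  moreover have "finite (cyc x)" by (simp add: cyc_def)
  ultimately show ?thesis
    using conn_image[OF x] s_cyc_disjoint[OF x] card_cyc[OF x]
    by (simp add: card_Un_disjoint card_image)
qed

text \<open>The relation is symmetric, so its classes are orbits. A single class therefore means
  that the orbit of any one point, of twice the size of its period, fills \<open>P\<close>.\<close>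

lemma single_orbit_iff:
  assumes x: "x \<in> P" shows "card (P // conn) = 1 \<longleftrightarrow> 2 * period rot x = card P"
proof
  have sub: "conn `` {x} \<subseteq> P" using conn_image[OF x] cyc_sub[OF x] s_in by auto
  assume "card (P // conn) = 1"
  then obtain X where X: "P // conn = {X}" by (auto simp: card_1_singleton_iff)
  have "conn `` {y} = X" if "y \<in> P" for y using quotientI[OF that, of conn] X by auto
  then have "P \<subseteq> conn `` {x}" using x by blast
  with sub have "conn `` {x} = P" by blast
  then show "2 * period rot x = card P" using card_orbit[OF x] by simp
next
  have sub: "conn `` {x} \<subseteq> P" using conn_image[OF x] cyc_sub[OF x] s_in by auto
  assume "2 * period rot x = card P"
  then have P: "conn `` {x} = P" using card_orbit[OF x] card_subset_eq[OF fin sub] by simp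
  have sym: "sym conn" by (simp add: sym_rtrancl sym_Un_converse)
  have "conn `` {y} = P" if "y \<in> P" for y
  proof -
    have xy: "(x, y) \<in> conn" using that P by auto
    then have yx: "(y, x) \<in> conn" using sym by (auto dest: symD)
    have "conn `` {y} = conn `` {x}"
      using rtrancl_trans[OF xy] rtrancl_trans[OF yx] by blast
    then show ?thesis using P by simp
  qed
  then have "P // conn = {P}" using x by (auto simp: quotient_def)
  then show "card (P // conn) = 1" by simp
qed

end

section \<open>Finite fields of characteristic two\<close>

text \<open>A prime degree leaves no subfield between {0, 1} and the whole field, so every further
  element generates the field.\<close>

locale binary_field =
  fixes m :: nat and T :: "'a::{field,finite} itself"
  assumes card_field: "card (UNIV :: 'a set) = 2 ^ m" and prime_m: "prime m"
begin

abbreviation n :: nat where "n \<equiv> 2 ^ m - 1"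

lemma m_ge_2: "2 \<le> m" using prime_m by (rule prime_ge_2_nat)

lemma card_gt: "4 \<le> (2::nat) ^ m"
  using power_increasing[OF m_ge_2, of "2::nat"] by simp

lemma n_gt: "1 < n" using card_gt by simp

lemma odd_n: "odd n" using m_ge_2 card_gt by (auto simp: even_diff_nat)

text \<open>Translation by 1 permutes the field. Comparing the sums of all elements before and after
  shows that the number of elements, \<open>2 ^ m\<close>, is 0 in the field.\<close>

lemma two_eq_0: "(2::'a) = 0"
proof -
  have "(\<Sum>x\<in>UNIV. x) = (\<Sum>x\<in>UNIV. x + 1 :: 'a)"
    by (rule sum.reindex_bij_betw[symmetric]) (auto intro!: bij_betwI[where g = "\<lambda>x. x - 1"])
  then have "of_nat (card (UNIV :: 'a set)) = (0::'a)" by (simp add: sum.distrib)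
  then show ?thesis by (simp add: card_field)
qed

lemma add_self: "x + x = (0::'a)"
  using two_eq_0 by (metis mult_2 mult_zero_left)

lemma add_add_self: "x + (x + y) = (y::'a)"
  using add_self by (metis add.assoc add_0)

lemma minus_eq: "- x = (x::'a)"
  using add_self by (metis add_eq_0_iff)

lemma add_eq_0_iff': "x + y = 0 \<longleftrightarrow> x = (y::'a)"
  by (metis add_eq_0_iff minus_eq)

text \<open>Multiplication by \<open>x\<close> permutes the nonzero elements; comparing their
  product before and after leaves the factor \<open>x ^ n\<close>.\<close>

lemma pow_n:
  assumes "x \<noteq> 0" shows "x ^ n = (1::'a)"
proof -
  let ?U = "UNIV - {0::'a}"
  have c: "card ?U = n" by (simp add: card_Diff_singleton card_field)
  have "(\<Prod>y\<in>?U. y) = (\<Prod>y\<in>?U. x * y)"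
    using assms by (intro prod.reindex_bij_betw[symmetric] bij_betwI[where g = "\<lambda>y. y / x"]) auto
  also have "\<dots> = x ^ n * (\<Prod>y\<in>?U. y)" by (simp add: prod.distrib c)
  finally show ?thesis by (simp add: prod_zero_iff)
qed

lemma frob_add: "(x + y :: 'a) ^ 2 ^ j = x ^ 2 ^ j + y ^ 2 ^ j"
proof (induction j)
  case (Suc j)
  have "(x + y) ^ 2 ^ Suc j = ((x + y) ^ 2 ^ j)\<^sup>2" by (simp add: power_mult[symmetric] mult.commute)
  also have "\<dots> = (x ^ 2 ^ j)\<^sup>2 + (y ^ 2 ^ j)\<^sup>2"
    using two_eq_0 by (simp add: Suc power2_sum)
  finally show ?case by (simp add: power_mult[symmetric] mult.commute)
qed simp

lemma pow_cong:
  assumes "x \<noteq> 0" "[k = l] (mod n)" shows "x ^ k = (x::'a) ^ l"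
proof -
  have *: "x ^ k = x ^ (k mod n)" for k
  proof -
    have "x ^ k = x ^ (n * (k div n) + k mod n)" by simp
    also have "\<dots> = x ^ (k mod n)" by (simp only: power_add power_mult pow_n[OF assms(1)]) simp
    finally show ?thesis .
  qed
  show ?thesis using *[of k] *[of l] assms(2) by (simp add: cong_def)
qed

text \<open>Positive exponents give 0 on both sides at \<open>x = 0\<close>.\<close>

lemma pow_cong':
  assumes "[k = l] (mod n)" "0 < k" "0 < l" shows "x ^ k = (x::'a) ^ l"
  using pow_cong[OF _ assms(1), of x] assms(2,3) by (cases "x = 0") (auto simp: zero_power)

lemma frob_m: "x ^ 2 ^ (m * k) = (x::'a)"
proof -
  have "[2 ^ m = 1] (mod n)" using card_gt by (simp add: cong_def le_mod_geq)
  then have "[(2 ^ m) ^ k = 1 ^ k] (mod n)" by (rule cong_pow)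
  then have "x ^ 2 ^ (m * k) = x ^ 1" by (intro pow_cong') (simp_all add: power_mult)
  then show ?thesis by simp
qed

lemma frob_frob: "((x::'a) ^ 2 ^ i) ^ 2 ^ j = x ^ 2 ^ (i + j)"
  by (simp add: power_add power_mult)

lemma frob_1: "x ^ 2 ^ 1 = x \<Longrightarrow> x = 0 \<or> x = (1::'a)"
  by (simp add: power2_eq_square)

text \<open>If \<open>m\<close> does not divide \<open>j\<close>, Bezout combines invariance under
  the Frobenius powers \<open>j\<close> and \<open>m\<close> into \<open>x ^ 2 = x\<close>.
  Primality of \<open>m\<close> enters here.\<close>

lemma frob_fix:
  assumes "x ^ 2 ^ j = (x::'a)" "x \<noteq> 0" "x \<noteq> 1" shows "m dvd j"
proof (rule ccontr)
  assume "\<not> m dvd j"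
  then have "coprime m j" using prime_m by (simp add: prime_imp_coprime)
  then have gc: "gcd j m = 1" by (metis coprime_imp_gcd_eq_1 gcd.commute)
  have "j \<noteq> 0" using \<open>\<not> m dvd j\<close> by (metis dvd_0_right)
  then obtain a b where ab: "j * a = m * b + 1"
    using bezout_nat[of j m] unfolding gc by blast
  have "x ^ 2 ^ (j * a) = x" for a
  proof (induction a)
    case (Suc a)
    have "x ^ 2 ^ (j * Suc a) = (x ^ 2 ^ (j * a)) ^ 2 ^ j" by (simp add: frob_frob add.commute)
    then show ?case using Suc assms by simp
  qed simp
  then have "x ^ 2 ^ (m * b + 1) = x" using ab by metis
  then have "(x ^ 2 ^ (m * b)) ^ 2 ^ 1 = x" by (simp only: frob_frob)
  then show False using frob_1 assms frob_m by metis
qed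

lemma frob_inj: "(x::'a) ^ 2 ^ j = y ^ 2 ^ j \<Longrightarrow> x = y"
proof -
  assume "x ^ 2 ^ j = y ^ 2 ^ j"
  then have "(x + y) ^ 2 ^ j = 0" by (simp add: frob_add add_self)
  then show ?thesis by (simp add: add_eq_0_iff')
qed

lemma frob_mod: "x ^ 2 ^ j = (x::'a) ^ 2 ^ (j mod m)"
proof -
  have "x ^ 2 ^ j = (x ^ 2 ^ (m * (j div m))) ^ 2 ^ (j mod m)" by (simp only: frob_frob) simp
  then show ?thesis by (simp only: frob_m)
qed

lemma conj_distinct:
  assumes "d \<noteq> 0" "d \<noteq> (1::'a)" shows "inj_on (\<lambda>j. d ^ 2 ^ j) {..<m}"
proof -
  have *: "i = j" if "i \<le> j" "j < m" "d ^ 2 ^ i = d ^ 2 ^ j" for i j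
  proof -
    have "(d ^ 2 ^ (j - i)) ^ 2 ^ i = d ^ 2 ^ i" using that by (simp only: frob_frob) simp
    then have "d ^ 2 ^ (j - i) = d" by (rule frob_inj)
    then have "m dvd j - i" using frob_fix assms by blast
    then have "j - i = 0" using that by (meson dvd_imp_le less_imp_diff_less not_le not_gr_zero)
    then show ?thesis using that by simp
  qed
  show ?thesis
  proof (rule inj_onI)
    fix i j assume "i \<in> {..<m}" "j \<in> {..<m}" "d ^ 2 ^ i = d ^ 2 ^ j"
    then show "i = j" using *[of i j] *[of j i] by (cases "i \<le> j") auto
  qed
qed

text \<open>A polynomial with coefficients 0 and 1 is encoded by the set of its exponents. Subsets
  of \<open>{..<m}\<close> are thus the coordinate vectors with respect to the powers of one
  element.\<close>

definition comb :: "nat set \<Rightarrow> 'a \<Rightarrow> 'a" where "comb I x = (\<Sum>i\<in>I. x ^ i)"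

definition cpoly :: "nat set \<Rightarrow> 'a poly" where "cpoly I = (\<Sum>i\<in>I. monom 1 i)"

lemma poly_cpoly: "poly (cpoly I) x = comb I x"
  by (simp add: cpoly_def comb_def poly_sum poly_monom)

lemma coeff_cpoly: "finite I \<Longrightarrow> coeff (cpoly I) i = of_bool (i \<in> I)"
  by (simp add: cpoly_def coeff_sum of_bool_def)

lemma degree_cpoly: "I \<subseteq> {..<k} \<Longrightarrow> 0 < k \<Longrightarrow> degree (cpoly I) < k"
proof -
  assume I: "I \<subseteq> {..<k}" and k: "0 < k"
  have "degree (cpoly I) \<le> k - 1"
    using I coeff_cpoly finite_subset[OF I] by (intro degree_le) auto
  then show ?thesis using k by simp
qed

lemma comb_frob: "comb I (x ^ 2 ^ j) = comb I x ^ 2 ^ j"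
proof (cases "finite I")
  case True
  then show ?thesis
    by (induction I) (auto simp: comb_def frob_add power_mult[symmetric] mult.commute)
qed (simp add: comb_def)

text \<open>Coefficients 0 and 1 are invariant under Frobenius, so all \<open>m\<close> conjugates
  of a root are roots: too many for a nonzero polynomial of degree below \<open>m\<close>.\<close>

lemma comb_zero_iff:
  assumes "d \<noteq> 0" "d \<noteq> (1::'a)" "I \<subseteq> {..<m}" "comb I d = 0" shows "I = {}"
proof (rule ccontr)
  assume ne: "I \<noteq> {}"
  have fI: "finite I" using assms(3) finite_subset by blast
  have nz: "cpoly I \<noteq> 0" using ne coeff_cpoly[OF fI] by (metis all_not_in_conv coeff_0 of_bool_eq_0_iff)
  have "(\<lambda>j. d ^ 2 ^ j) ` {..<m} \<subseteq> {x. poly (cpoly I) x = 0}"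
    using assms(4) by (auto simp: poly_cpoly comb_frob)
  then have "m \<le> card {x. poly (cpoly I) x = 0}"
    using card_mono[OF poly_roots_finite[OF nz]] card_image[OF conj_distinct[OF assms(1,2)]]
    by (metis card_lessThan)
  also have "\<dots> \<le> degree (cpoly I)" by (rule card_poly_roots_bound[OF nz])
  also have "\<dots> < m" using degree_cpoly[OF assms(3)] m_ge_2 by simp
  finally show False by simp
qed

lemma comb_sym_diff:
  assumes "finite I" "finite J"
  shows "comb I x + comb J x = comb ((I - J) \<union> (J - I)) x"
proof -
  have "comb I x = comb (I - J) x + comb (I \<inter> J) x"
    using sum.Int_Diff[OF assms(1), of _ J] by (simp add: comb_def add.commute)
  moreover have "comb J x = comb (J - I) x + comb (I \<inter> J) x"
    using sum.Int_Diff[OF assms(2), of _ I] by (simp add: comb_def add.commute Int_commute)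
  moreover have "comb ((I - J) \<union> (J - I)) x = comb (I - J) x + comb (J - I) x"
    unfolding comb_def using assms by (intro sum.union_disjoint) auto
  ultimately have "comb I x + comb J x
      = comb ((I - J) \<union> (J - I)) x + (comb (I \<inter> J) x + comb (I \<inter> J) x)" by (simp add: algebra_simps)
  then show ?thesis by (simp add: add_self)
qed

text \<open>The powers of \<open>d\<close> below \<open>m\<close> form a basis. Two equal
  combinations differ by a symmetric difference that sums to 0, and both sides have
  \<open>2 ^ m\<close> elements.\<close>

lemma comb_bij:
  assumes "d \<noteq> 0" "d \<noteq> (1::'a)" shows "bij_betw (\<lambda>I. comb I d) (Pow {..<m}) UNIV"
proof -
  have inj: "inj_on (\<lambda>I. comb I d) (Pow {..<m})"
  proof (rule inj_onI)
    fix I J assume IJ: "I \<in> Pow {..<m}" "J \<in> Pow {..<m}" "comb I d = comb J d"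
    have "comb ((I - J) \<union> (J - I)) d = 0"
      using comb_sym_diff[of I J d] IJ finite_subset[OF _ finite_lessThan[of m]] by (simp add: add_self)
    then have "(I - J) \<union> (J - I) = {}"
      by (intro comb_zero_iff[OF assms]) (use IJ(1,2) in auto)
    then show "I = J" by blast
  qed
  moreover have "(\<lambda>I. comb I d) ` Pow {..<m} = UNIV"
    using card_image[OF inj] card_field by (intro card_subset_eq) (auto simp: card_Pow)
  ultimately show ?thesis by (simp add: bij_betw_def)
qed

lemma comb_ex:
  assumes "d \<noteq> 0" "d \<noteq> (1::'a)" obtains I where "I \<subseteq> {..<m}" "x = comb I d"
proof -
  have "x \<in> (\<lambda>I. comb I d) ` Pow {..<m}"
    using bij_betw_imp_surj_on[OF comb_bij[OF assms]] by simp
  then show ?thesis using that by blast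
qed

lemma subring_UNIV:
  assumes "\<And>x y. x \<in> K \<Longrightarrow> y \<in> K \<Longrightarrow> x + y \<in> K" "\<And>x y. x \<in> K \<Longrightarrow> y \<in> K \<Longrightarrow> x * y \<in> K"
    and "0 \<in> K" "1 \<in> K" "d \<in> K" "d \<noteq> 0" "d \<noteq> (1::'a)"
  shows "K = UNIV"
proof -
  have pw: "d ^ i \<in> K" for i by (induction i) (simp_all add: assms(2,4,5))
  have "comb I d \<in> K" if "finite I" for I
    using that by (induction I) (simp_all add: comb_def assms(1,3) pw)
  then have "range (\<lambda>I. comb (I \<inter> {..<m}) d) \<subseteq> K" by auto
  moreover have "x \<in> range (\<lambda>I. comb (I \<inter> {..<m}) d)" for x
  proof -
    obtain I where "I \<subseteq> {..<m}" "x = comb I d" using comb_ex[OF assms(6,7)] .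
    then show ?thesis by (intro image_eqI[of _ _ I]) (auto simp: Int_absorb2)
  qed
  ultimately show ?thesis by blast
qed

text \<open>The relation expressing \<open>d ^ m\<close> through lower powers is a polynomial of
  degree \<open>m\<close>, and its roots are exactly the conjugates of \<open>d\<close>. The map
  sends \<open>d\<close> to a root, and its value at \<open>d\<close> determines it
  everywhere.\<close>

lemma automorphism_frob:
  assumes add: "\<And>x y. f (x + y) = f x + f (y::'a)" and mult: "\<And>x y. f (x * y) = f x * f (y::'a)"
    and one: "f 1 = (1::'a)"
  shows "\<exists>j<m. \<forall>x. f x = x ^ 2 ^ j"
proof -
  have "\<exists>d. d \<notin> {0, 1::'a}"
  proof (rule ccontr)
    assume "\<not> ?thesis"
    then have "(UNIV::'a set) \<subseteq> {0, 1}" by auto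
    then have "card (UNIV::'a set) \<le> 2" using card_mono[of "{0,1::'a}" UNIV] by simp
    then show False using card_field card_gt by simp
  qed
  then obtain d where d: "d \<noteq> 0" "d \<noteq> (1::'a)" by auto
  have f0: "f 0 = 0" using add[of 0 0] by (simp only: add_0_left add_self)
  have fp: "f (x ^ i) = f x ^ i" for x i by (induction i) (auto simp: one mult)
  have fc: "f (comb I x) = comb I (f x)" for I x
  proof (cases "finite I")
    case True then show ?thesis by (induction I) (auto simp: comb_def add f0 fp)
  qed (simp add: comb_def f0)
  obtain I where I: "I \<subseteq> {..<m}" "d ^ m = comb I d" using comb_ex[OF d] .
  let ?J = "insert m I"
  have fI: "finite I" using I finite_subset by blast
  have mI: "m \<notin> I" using I by auto
  have cJ: "comb ?J x = x ^ m + comb I x" for x using fI mI by (simp add: comb_def)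
  have root: "poly (cpoly ?J) d = 0" using I cJ by (simp add: poly_cpoly add_self)
  have nz: "cpoly ?J \<noteq> 0" using coeff_cpoly[of ?J m] fI by (metis coeff_0 finite_insert insertI1 of_bool_eq_1_iff zero_neq_one)
  have deg: "degree (cpoly ?J) < Suc m" using I by (intro degree_cpoly) auto
  let ?C = "(\<lambda>j. d ^ 2 ^ j) ` {..<m}"
  have sub: "?C \<subseteq> {x. poly (cpoly ?J) x = 0}" using root by (auto simp: poly_cpoly comb_frob)
  have "card {x. poly (cpoly ?J) x = 0} \<le> card ?C"
    using card_poly_roots_bound[OF nz] deg card_image[OF conj_distinct[OF d]] by simp
  then have eq: "?C = {x. poly (cpoly ?J) x = 0}"
    by (rule card_seteq[OF poly_roots_finite[OF nz] sub])
  have "comb ?J (f d) = 0" using fc[of ?J d] root f0 by (simp add: poly_cpoly)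
  then have "f d \<in> ?C" unfolding eq by (simp add: poly_cpoly)
  then obtain j where j: "j < m" "f d = d ^ 2 ^ j" by auto
  have "f x = x ^ 2 ^ j" for x
  proof -
    obtain I where "x = comb I d" using comb_ex[OF d] .
    then show ?thesis using fc j comb_frob by simp
  qed
  then show ?thesis using j by blast
qed

text \<open>Otherwise, with \<open>e\<close> the difference of the residues, all \<open>n\<close>
  nonzero elements would be roots of a polynomial of degree \<open>e\<close>, where 0 <
  \<open>e\<close> < \<open>n\<close>.\<close>

lemma pow_eq_imp_cong:
  assumes "\<And>x::'a. x \<noteq> 0 \<Longrightarrow> x ^ k = x ^ l" shows "[k = l] (mod n)"
proof -
  have *: "k mod n = l mod n" if le: "k mod n \<le> l mod n" and pw: "\<And>x::'a. x \<noteq> 0 \<Longrightarrow> x ^ k = x ^ l" for k l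
  proof (rule ccontr)
    assume ne: "k mod n \<noteq> l mod n"
    define e where "e = l mod n - k mod n"
    have e: "0 < e" "e < n" using le ne n_gt mod_less_divisor[of n l] unfolding e_def by linarith+
    have "x ^ e = 1" if "x \<noteq> 0" for x :: 'a
    proof -
      have "x ^ (k mod n) = x ^ (l mod n)"
        using pw[OF that] pow_cong[OF that, of "k mod n" k] pow_cong[OF that, of "l mod n" l] by (simp add: cong_def)
      also have "\<dots> = x ^ (k mod n) * x ^ e" using le by (simp add: e_def power_add[symmetric])
      finally show ?thesis using that by simp
    qed
    then have "UNIV - {0::'a} \<subseteq> {x. poly (monom 1 e - 1) x = 0}" by (auto simp: poly_monom)
    moreover have nz: "monom 1 e - 1 \<noteq> (0 :: 'a poly)"
    proof
      assume "monom 1 e - 1 = (0 :: 'a poly)"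
      then have "poly (monom 1 e - 1 :: 'a poly) 0 = 0" by simp
      then show False using e(1) by (simp add: poly_monom zero_power)
    qed
    ultimately have "card (UNIV - {0::'a}) \<le> degree (monom 1 e - 1 :: 'a poly)"
      by (metis le_trans[OF card_mono[OF poly_roots_finite[OF nz]] card_poly_roots_bound[OF nz]])
    also have "\<dots> \<le> e" by (intro degree_diff_le) (auto simp: degree_monom_le)
    finally show False using e by (simp add: card_Diff_singleton card_field)
  qed
  show ?thesis unfolding cong_def
  proof (cases "k mod n \<le> l mod n")
    case True then show "k mod n = l mod n" by (rule *[OF _ assms])
  next
    case False
    then have "l mod n \<le> k mod n" by simp
    then have "l mod n = k mod n" by (rule *[OF _ assms[symmetric]])
    then show "k mod n = l mod n" by simp
  qed
qed

end

section \<open>Rotation lines of a power permutation\<close>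

context binary_field
begin

definition rho :: "nat \<Rightarrow> nat \<Rightarrow> 'a \<Rightarrow> 'a" where
  "rho t t' y = (1 + (1 + y) ^ t') ^ t"

text \<open>Both exponents are positive so that the two power maps are inverse to each other at 0 as
  well.\<close>

definition inv_exps :: "nat \<Rightarrow> nat \<Rightarrow> bool" where
  "inv_exps t t' \<longleftrightarrow> 0 < t \<and> 0 < t' \<and> [t * t' = 1] (mod n)"

lemma inv_exps_sym: "inv_exps t t' \<Longrightarrow> inv_exps t' t"
  by (simp add: inv_exps_def mult.commute)

lemma coprime_inv_exps:
  assumes "coprime t n" obtains t' where "inv_exps t t'"
proof -
  obtain u where u: "[t * u = 1] (mod n)" using cong_solve_coprime_nat[OF assms] by auto
  have "t \<noteq> 0" using assms n_gt by (metis coprime_0_left_iff nat_dvd_1_iff_1 less_irrefl)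
  moreover have "[t * (u + k) = 1] (mod k)" if "[t * u = 1] (mod k)" for k
    using that by (simp add: cong_def distrib_left)
  note this[OF u]
  \<comment> \<open>Adding the modulus keeps the congruence and makes the inverse positive.\<close>
  ultimately show ?thesis using that[of "u + n"] n_gt by (simp add: inv_exps_def)
qed

lemma pow_pow_inv:
  assumes "inv_exps t t'" shows "(x ^ t) ^ t' = (x::'a)" "(x ^ t') ^ t = x"
proof -
  have "x ^ (t * t') = x ^ 1" using assms unfolding inv_exps_def by (intro pow_cong') auto
  then show "(x ^ t) ^ t' = (x::'a)" "(x ^ t') ^ t = x"
    by (simp_all add: power_mult[symmetric] mult.commute)
qed

lemma pow_eq_iff: "inv_exps t t' \<Longrightarrow> x ^ t = (y::'a) ^ t \<longleftrightarrow> x = y"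
  by (metis pow_pow_inv(1))

lemma inv_pow:
  assumes "inv_exps t t'" shows "inv_into UNIV (\<lambda>x::'a. x ^ t) = (\<lambda>x. x ^ t')"
  using pow_pow_inv[OF assms] by (intro inv_equality) auto

lemma psi_pow:
  assumes "inv_exps t t'" shows "psi_map (\<lambda>x::'a. x ^ t) a y = (a ^ t' + y ^ t') ^ t"
  by (simp add: psi_map_def inv_pow[OF assms])

lemma involutions:
  assumes inv: "inv_exps t t'" and a: "a \<noteq> (0::'a)"
  shows "two_involutions (P_set a) (s_map a) (psi_map (\<lambda>x. x ^ t) a)"
proof
  have pos: "0 < t" "0 < t'" using inv by (auto simp: inv_exps_def)
  fix x assume x: "x \<in> P_set a"
  then have x0: "x \<noteq> 0" "x \<noteq> a" by (auto simp: P_set_def)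
  show "s_map a x \<in> P_set a" using x0 by (auto simp: s_map_def P_set_def add_eq_0_iff')
  show "s_map a (s_map a x) = x" by (simp add: s_map_def add_add_self)
  show "s_map a x \<noteq> x" using a by (simp add: s_map_def)
  have ne: "a ^ t' \<noteq> x ^ t'" using x0 pow_eq_iff[OF inv_exps_sym[OF inv]] by auto
  then have "(a ^ t' + x ^ t') ^ t \<noteq> 0" by (simp add: add_eq_0_iff')
  moreover have "(a ^ t' + x ^ t') ^ t \<noteq> (a ^ t') ^ t" using x0 pos pow_eq_iff[OF inv] by auto
  ultimately show "psi_map (\<lambda>x. x ^ t) a x \<in> P_set a"
    by (simp add: P_set_def psi_pow[OF inv] pow_pow_inv[OF inv])
  show "psi_map (\<lambda>x. x ^ t) a (psi_map (\<lambda>x. x ^ t) a x) = x"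
    by (simp add: psi_pow[OF inv] pow_pow_inv[OF inv] add_add_self)
  show "psi_map (\<lambda>x. x ^ t) a x \<noteq> x"
  proof
    assume "psi_map (\<lambda>x. x ^ t) a x = x"
    then have "(a ^ t' + x ^ t') ^ t = (x ^ t') ^ t" by (simp add: psi_pow[OF inv] pow_pow_inv[OF inv])
    then show False using a pos by (simp add: pow_eq_iff[OF inv])
  qed
qed simp

text \<open>Power maps are multiplicative, so multiplication by \<open>a\<close> carries the
  rotation at the point 1 to the rotation at \<open>a\<close>.\<close>

lemma rot_scale:
  assumes inv: "inv_exps t t'" and a: "a \<noteq> (0::'a)"
  shows "two_involutions.rot (s_map a) (psi_map (\<lambda>x. x ^ t) a) (a * y) = a * rho t t' y"
proof -
  have "(a ^ t' + (a + a * y) ^ t') ^ t = (a ^ t') ^ t * (1 + (1 + y) ^ t') ^ t"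
    by (simp add: power_mult_distrib[symmetric] distrib_left)
  then show ?thesis
    by (simp add: two_involutions.rot_def[OF involutions[OF assms]] psi_pow[OF inv] s_map_def
        rho_def pow_pow_inv[OF inv])
qed

lemma rot_scale_pow:
  assumes inv: "inv_exps t t'" and a: "a \<noteq> (0::'a)"
  shows "(two_involutions.rot (s_map a) (psi_map (\<lambda>x. x ^ t) a) ^^ k) (a * y) = a * (rho t t' ^^ k) y"
  by (induction k) (simp_all add: rot_scale[OF assms])

lemma card_P_set: "a \<noteq> (0::'a) \<Longrightarrow> card (P_set a) = 2 ^ m - 2"
  by (simp add: P_set_def card_Diff_subset card_field)

lemma closed_surface_iff:
  assumes inv: "inv_exps t t'" and x: "x \<noteq> 0" "x \<noteq> (1::'a)"
  shows "in_closed_surface (\<lambda>x::'a. x ^ t) \<longleftrightarrow> 2 * period (rho t t') x = 2 ^ m - 2"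
proof -
  have "card (rotation_lines (\<lambda>x. x ^ t) a) = 1 \<longleftrightarrow> 2 * period (rho t t') x = 2 ^ m - 2"
    if a: "a \<noteq> 0" for a :: 'a
  proof -
    let ?r = "two_involutions.rot (s_map a) (psi_map (\<lambda>x. x ^ t) a)"
    have "period ?r (a * x) = period (rho t t') x"
      using a by (simp add: period_def rot_scale_pow[OF inv a])
    moreover have "a * x \<in> P_set a" using x a by (simp add: P_set_def)
    moreover have "rotation_lines (\<lambda>x. x ^ t) a
      = P_set a // (two_involutions.steps (P_set a) (s_map a) (psi_map (\<lambda>x. x ^ t) a)
         \<union> (two_involutions.steps (P_set a) (s_map a) (psi_map (\<lambda>x. x ^ t) a))\<inverse>)\<^sup>*"
      by (simp add: rotation_lines_def rot_step_def two_involutions.steps_def[OF involutions[OF inv a]])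
    ultimately show ?thesis
      using two_involutions.single_orbit_iff[OF involutions[OF inv a], of "a * x"] card_P_set[OF a] by simp
  qed
  then show ?thesis
    unfolding in_closed_surface_def nonzero_pts_def by (metis DiffD2 DiffI UNIV_I empty_iff insertE insertI1 zero_neq_one)
qed

lemma rho_frob: "rho t t' (y ^ 2 ^ j) = rho t t' y ^ 2 ^ j"
proof -
  have *: "1 + z ^ 2 ^ j = (1 + z) ^ 2 ^ j" for z :: 'a by (simp add: frob_add)
  have **: "(z ^ 2 ^ j) ^ i = (z ^ i) ^ 2 ^ j" for z :: 'a and i
    by (simp add: power_mult[symmetric] mult.commute)
  show ?thesis by (simp only: rho_def * **)
qed

lemma rho_pow_frob: "(rho t t' ^^ k) (y ^ 2 ^ j) = (rho t t' ^^ k) y ^ 2 ^ j"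
  by (induction k) (simp_all add: rho_frob)

text \<open>Having reached a conjugate of its start, the walk continues as the conjugate of what
  came before, because \<open>rho\<close> commutes with Frobenius; on each repetition the twists add
  up.\<close>

lemma rho_pow_conj:
  assumes "(rho t t' ^^ k) x = x ^ 2 ^ c" shows "(rho t t' ^^ (k * i)) x = x ^ 2 ^ (c * i)"
proof (induction i)
  case (Suc i)
  have "(rho t t' ^^ (k * Suc i)) x = (rho t t' ^^ k) ((rho t t' ^^ (k * i)) x)"
    by (simp add: funpow_add)
  also have "\<dots> = (x ^ 2 ^ c) ^ 2 ^ (c * i)" by (simp add: Suc rho_pow_frob assms)
  finally show ?case by (simp add: frob_frob)
qed simp

lemma not_closed_surface:
  assumes inv: "inv_exps t t'" and x: "x \<noteq> 0" "x \<noteq> (1::'a)"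
    and k: "0 < k" "k < 2 ^ (m - 1) - 1" "(rho t t' ^^ k) x = x"
  shows "\<not> in_closed_surface (\<lambda>x::'a. x ^ t)"
proof -
  have "(2::nat) ^ m = 2 * 2 ^ (m - 1)" using m_ge_2 by (metis Suc_diff_1 power_Suc less_le_trans pos2)
  then show ?thesis
    using period_props(3)[OF k(1,3)] k(2) closed_surface_iff[OF inv x] by linarith
qed

text \<open>After \<open>m\<close> returns to a conjugate the total twist is a multiple of
  \<open>m\<close>, hence trivial, and the walk is closed.\<close>

lemma not_closed_surface_conj:
  assumes inv: "inv_exps t t'" and x: "x \<noteq> 0" "x \<noteq> (1::'a)"
    and k: "0 < k" "k * m < 2 ^ (m - 1) - 1" "(rho t t' ^^ k) x = x ^ 2 ^ c"
  shows "\<not> in_closed_surface (\<lambda>x::'a. x ^ t)"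
proof (rule not_closed_surface[OF inv x _ k(2)])
  show "0 < k * m" using k m_ge_2 by simp
  show "(rho t t' ^^ (k * m)) x = x"
    using rho_pow_conj[OF k(3), of m] frob_m[of x c] by (simp add: mult.commute)
qed

text \<open>The indices at which the walk meets a conjugate of its start are the multiples of the
  least positive one, \<open>d\<close>. It divides \<open>N\<close> but no \<open>N div q\<close>,
  so \<open>d = N\<close>. Going round \<open>i\<close> times twists by \<open>c * i\<close>, which
  is trivial only if the prime \<open>m\<close> divides \<open>i\<close>; hence the period is
  \<open>N * m\<close>.\<close>

lemma closed_surface:
  assumes inv: "inv_exps t t'" and x: "x \<noteq> 0" "x \<noteq> (1::'a)"
    and N: "N * m = 2 ^ (m - 1) - 1" "0 < N" and c: "(rho t t' ^^ N) x = x ^ 2 ^ c" "\<not> m dvd c"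
    and q: "\<And>q j. prime q \<Longrightarrow> q dvd N \<Longrightarrow> (rho t t' ^^ (N div q)) x \<noteq> x ^ 2 ^ j"
  shows "in_closed_surface (\<lambda>x::'a. x ^ t)"
proof -
  let ?Q = "\<lambda>k. \<exists>j. (rho t t' ^^ k) x = x ^ 2 ^ j"
  define d where "d = (LEAST k. 0 < k \<and> ?Q k)"
  have d: "0 < d" "?Q d" and dmin: "\<And>k. 0 < k \<Longrightarrow> ?Q k \<Longrightarrow> d \<le> k"
    using LeastI[of "\<lambda>k. 0 < k \<and> ?Q k" N] Least_le[of "\<lambda>k. 0 < k \<and> ?Q k"] N c unfolding d_def by auto
  have dvd: "d dvd k" if k: "?Q k" for k
  proof (rule ccontr)
    assume nd: "\<not> d dvd k"
    obtain j where j: "(rho t t' ^^ d) x = x ^ 2 ^ j" using d by blast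
    obtain l where l: "(rho t t' ^^ k) x = x ^ 2 ^ l" using k by blast
    define i where "i = j * (k div d)"
    let ?y = "(rho t t' ^^ (k mod d)) x"
    have "(rho t t' ^^ k) x = (rho t t' ^^ (k mod d + d * (k div d))) x" by simp
    also have "\<dots> = ?y ^ 2 ^ i"
      by (simp only: funpow_add o_apply rho_pow_conj[OF j] rho_pow_frob i_def)
    finally have "?y ^ 2 ^ i = x ^ 2 ^ l" using l by simp
    \<comment> \<open>The Frobenius power \<open>(m - 1) * i\<close> is the inverse of the power
      \<open>i\<close>.\<close>
    then have "(?y ^ 2 ^ i) ^ 2 ^ ((m - 1) * i) = x ^ 2 ^ (l + (m - 1) * i)" by (simp add: frob_frob)
    moreover have "i + (m - 1) * i = m * i" using m_ge_2 by (simp add: algebra_simps)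
    ultimately have "?y = x ^ 2 ^ (l + (m - 1) * i)" by (simp only: frob_frob frob_m)
    moreover have "0 < k mod d" using nd by (simp add: dvd_eq_mod_eq_0)
    ultimately have "d \<le> k mod d" using dmin by blast
    then show False using d(1) by (meson mod_less_divisor not_le)
  qed
  have "d = N"
  proof (rule ccontr)
    assume "d \<noteq> N"
    obtain e where e: "N = d * e" using dvd[of N] c(1) by (auto elim: dvdE)
    then have "e \<noteq> 1" using \<open>d \<noteq> N\<close> by auto
    then obtain q where q': "prime q" "q dvd e" using prime_factor_nat by blast
    then obtain f where f: "e = q * f" by (auto elim: dvdE)
    have "N div q = d * f" using e f q'(1) prime_gt_0_nat by (simp add: ac_simps)
    moreover obtain j where "(rho t t' ^^ d) x = x ^ 2 ^ j" using d by blast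
    ultimately have "?Q (N div q)" using rho_pow_conj by metis
    then show False using q[OF q'(1)] q'(2) e by auto
  qed
  have per: "(rho t t' ^^ (N * m)) x = x" using rho_pow_conj[OF c(1), of m] frob_m[of x c] by (simp add: mult.commute)
  let ?p = "period (rho t t') x"
  have pos: "0 < N * m" using N(2) m_ge_2 by (simp del: N(1))
  note pp = period_props[OF pos per]
  \<comment> \<open>An exact return counts as meeting a conjugate with trivial twist.\<close>
  have "?Q ?p" using pp(2) by (intro exI[of _ 0]) simp
  then obtain i where i: "?p = N * i" using dvd \<open>d = N\<close> by (auto elim: dvdE)
  have "x ^ 2 ^ (c * i) = x" using rho_pow_conj[OF c(1), of i] pp(2) i by simp
  then have "m dvd c * i" using frob_fix x by blast
  then have "m dvd i" using c(2) prime_m by (simp add: prime_dvd_mult_iff)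
  moreover have "i > 0" using pp(1) i by simp
  ultimately have "m \<le> i" by (simp add: dvd_imp_le)
  then have "?p = N * m" using pp(3) i N(2) by (metis le_antisym mult_le_mono2)
  moreover have "(2::nat) ^ m = 2 * 2 ^ (m - 1)" using m_ge_2 by (metis Suc_diff_1 power_Suc less_le_trans pos2)
  ultimately show ?thesis using closed_surface_iff[OF inv x] N(1) by simp
qed

section \<open>Orientability\<close>

text \<open>A cyclic orientation uses each edge in exactly one direction, and at every vertex one
  edge enters and the other leaves.\<close>

lemma cyc_orient_flip:
  assumes "cyc_orient {a, b, c} Or" "a \<noteq> b" "a \<noteq> c" "b \<noteq> c"
  shows "(b, a) \<in> Or \<longleftrightarrow> (a, b) \<notin> Or" "(a, c) \<in> Or \<longleftrightarrow> (a, b) \<notin> Or"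
proof -
  obtain x y z where xyz: "{a, b, c} = {x, y, z}" "x \<noteq> y" "x \<noteq> z" "y \<noteq> z" "Or = {(x, y), (y, z), (z, x)}"
    using assms(1) unfolding cyc_orient_def by blast
  then have "a = x \<or> a = y \<or> a = z" "b = x \<or> b = y \<or> b = z" "c = x \<or> c = y \<or> c = z" by blast+
  then show "(b, a) \<in> Or \<longleftrightarrow> (a, b) \<notin> Or" "(a, c) \<in> Or \<longleftrightarrow> (a, b) \<notin> Or"
    using xyz(2-) assms(2-) by auto
qed

text \<open>Scaling by \<open>a\<close> turns the walk from \<open>y\<close> to its reciprocal
  around the point 1 into a walk from \<open>a * y\<close> to \<open>a / y\<close> around
  \<open>a\<close>. So one hypothesis serves at every vertex of the closed path through the powers
  of \<open>y\<close>.\<close>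

lemma not_orientable:
  assumes inv: "inv_exps t t'" and y: "y \<noteq> 0" "y \<noteq> (1::'a)" and j: "(rho t t' ^^ j) y = inverse y"
  shows "\<not> orientable STS (tri_img (\<lambda>x::'a. x ^ t) STS)"
proof
  let ?F = "\<lambda>x::'a. x ^ t"
  assume "orientable STS (tri_img ?F STS)"
  then obtain Ori where O:
    "(\<forall>X \<in> {True} \<times> STS \<union> {False} \<times> tri_img ?F STS. cyc_orient (snd X) (Ori X)) \<and>
     (\<forall>X \<in> {True} \<times> STS \<union> {False} \<times> tri_img ?F STS. \<forall>Y \<in> {True} \<times> STS \<union> {False} \<times> tri_img ?F STS. X \<noteq> Y \<longrightarrow>
        (\<forall>x y. {x, y} \<subseteq> snd X \<inter> snd Y \<and> x \<noteq> y \<longrightarrow> ((x, y) \<in> Ori X \<longleftrightarrow> (y, x) \<in> Ori Y)))"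
    unfolding orientable_def Let_def by (elim exE)
  note co = O[THEN conjunct1, rule_format] and ed = O[THEN conjunct2, rule_format]
  let ?psi = "psi_map ?F"
  \<comment> \<open>\<open>chi a b\<close> and \<open>om a b\<close> tell whether the black,
    respectively white, triangle on the edge {a, b} runs from \<open>a\<close> to
    \<open>b\<close>.\<close>
  define chi where "chi a b = ((a, b) \<in> Ori (True, {a, b, s_map a b}))" for a b
  define om where "om a b = ((a, b) \<in> Ori (False, {a, b, ?psi a b}))" for a b
  have sts: "{a, b, a + b} \<in> STS" if "a \<noteq> 0" "b \<in> P_set a" for a b :: 'a
  proof -
    have "a \<noteq> a + b" "b \<noteq> a + b" "a + b \<noteq> 0" "a + b + (a + b) = 0" "b \<noteq> 0" "a \<noteq> b"
      using that add_self by (auto simp: P_set_def add_eq_0_iff')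
    then show ?thesis using that(1) unfolding STS_def by blast
  qed
  have black: "(True, {a, b, s_map a b}) \<in> {True} \<times> STS" if "a \<noteq> 0" "b \<in> P_set a" for a b :: 'a
    using sts[OF that] by (simp add: s_map_def)
  have white: "(False, {a, b, ?psi a b}) \<in> {False} \<times> tri_img ?F STS" if "a \<noteq> 0" "b \<in> P_set a" for a b :: 'a
  proof -
    have "b ^ t' \<in> P_set (a ^ t')" using that inv pow_eq_iff[OF inv_exps_sym[OF inv]]
      by (auto simp: P_set_def inv_exps_def)
    then have "?F ` {a ^ t', b ^ t', a ^ t' + b ^ t'} \<in> tri_img ?F STS"
      unfolding tri_img_def using that sts by (intro imageI) auto
    then show ?thesis by (simp add: psi_pow[OF inv] pow_pow_inv[OF inv])
  qed
  have swap: "a \<in> P_set b" "b \<noteq> 0" if "a \<noteq> 0" "b \<in> P_set a" for a b :: 'a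
    using that by (auto simp: P_set_def)
  have chi1: "chi b a = (\<not> chi a b)" "chi a (s_map a b) = (\<not> chi a b)" if ab: "a \<noteq> 0" "b \<in> P_set a" for a b :: 'a
  proof -
    interpret two_involutions "P_set a" "s_map a" "?psi a" using involutions[OF inv ab(1)] .
    have eqs: "{b, a, s_map b a} = {a, b, s_map a b}" "{a, s_map a b, s_map a (s_map a b)} = {a, b, s_map a b}"
      using ss[OF ab(2)] by (auto simp: s_map_def add.commute)
    have "cyc_orient {a, b, s_map a b} (Ori (True, {a, b, s_map a b}))" using co[OF UnI1[OF black[OF ab]]] by simp
    from cyc_orient_flip[OF this] show "chi b a = (\<not> chi a b)" "chi a (s_map a b) = (\<not> chi a b)"
      using s_in[OF ab(2)] s_ne[OF ab(2)] ab(2) unfolding chi_def eqs by (auto simp: P_set_def)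
  qed
  have om1: "om b a = (\<not> om a b)" "om a (?psi a b) = (\<not> om a b)" if ab: "a \<noteq> 0" "b \<in> P_set a" for a b :: 'a
  proof -
    interpret two_involutions "P_set a" "s_map a" "?psi a" using involutions[OF inv ab(1)] .
    have eqs: "{b, a, ?psi b a} = {a, b, ?psi a b}" "{a, ?psi a b, ?psi a (?psi a b)} = {a, b, ?psi a b}"
      using qq[OF ab(2)] by (auto simp: psi_map_def add.commute)
    have "cyc_orient {a, b, ?psi a b} (Ori (False, {a, b, ?psi a b}))" using co[OF UnI2[OF white[OF ab]]] by simp
    from cyc_orient_flip[OF this] show "om b a = (\<not> om a b)" "om a (?psi a b) = (\<not> om a b)"
      using q_in[OF ab(2)] q_ne[OF ab(2)] ab(2) unfolding om_def eqs by (auto simp: P_set_def)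
  qed
  have chi_om: "chi a b = (\<not> om a b)" if ab: "a \<noteq> 0" "b \<in> P_set a" for a b :: 'a
  proof -
    have "(a, b) \<in> Ori (True, {a, b, s_map a b}) \<longleftrightarrow> (b, a) \<in> Ori (False, {a, b, ?psi a b})"
      using ed[OF UnI1[OF black[OF ab]] UnI2[OF white[OF ab]], of a b] ab(2) by (auto simp: P_set_def)
    moreover have "{b, a, ?psi b a} = {a, b, ?psi a b}" by (auto simp: psi_map_def add.commute)
    ultimately have "chi a b = om b a" by (simp add: chi_def om_def)
    then show ?thesis using om1(1)[OF ab] by simp
  qed
  \<comment> \<open>Four sign changes cancel: through the black triangle, across an edge, through
    the white triangle, and across the next edge.\<close>
  have chi_rot: "chi a (two_involutions.rot (s_map a) (?psi a) b) = chi a b" if ab: "a \<noteq> 0" "b \<in> P_set a" for a b :: 'a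
  proof -
    interpret two_involutions "P_set a" "s_map a" "?psi a" using involutions[OF inv ab(1)] .
    note sb = s_in[OF ab(2)]
    show ?thesis
      using chi_om[OF ab(1) q_in[OF sb]] om1(2)[OF ab(1) sb] chi_om[OF ab(1) sb] chi1(2)[OF ab]
      by (simp add: rot_def)
  qed
  have chi_pow: "chi a (a * (rho t t' ^^ k) y) = chi a (a * y)" if a: "a \<noteq> 0" for a k
  proof -
    interpret two_involutions "P_set a" "s_map a" "?psi a" using involutions[OF inv a] .
    have P: "a * y \<in> P_set a" using a y by (simp add: P_set_def)
    have "chi a ((rot ^^ k) (a * y)) = chi a (a * y)"
      by (induction k) (simp_all add: chi_rot[OF a pow_in[OF P]])
    then show ?thesis by (simp add: rot_scale_pow[OF inv a])
  qed
  \<comment> \<open>Around \<open>y ^ Suc k\<close>, the edge to the next power is carried to the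
    edge back to \<open>y ^ k\<close>, which is the previous edge read backwards.\<close>
  have step: "chi (y ^ Suc k) (y ^ Suc k * y) = (\<not> chi (y ^ k) (y ^ k * y))" for k
  proof -
    have "chi (y ^ Suc k) (y ^ Suc k * y) = chi (y ^ Suc k) (y ^ Suc k * inverse y)"
      using chi_pow[of "y ^ Suc k" j] y j by simp
    also have "y ^ Suc k * inverse y = y ^ k" using y by (simp add: field_simps)
    also have "chi (y ^ Suc k) (y ^ k) = (\<not> chi (y ^ k) (y ^ Suc k))"
      using chi1(1)[of "y ^ k" "y ^ Suc k"] y by (simp add: P_set_def)
    finally show ?thesis by (simp add: mult.commute)
  qed
  have "chi (y ^ k) (y ^ k * y) = (even k \<longleftrightarrow> chi 1 y)" for k
  proof (induction k)
    case (Suc k) then show ?case using step[of k] by auto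
  qed simp
  \<comment> \<open>After \<open>n\<close> steps the edge {1, y} is reached again, but with an odd
    number of sign changes.\<close>
  from this[of n] show False using odd_n pow_n[OF y(1)] by simp
qed

end

section \<open>Linear equivalence of power permutations\<close>

text \<open>For prime \<open>p\<close>, every orbit of a map whose \<open>p\<close>-th iterate is
  the identity has one or \<open>p\<close> elements, so the points that are not fixed fall into
  blocks of size \<open>p\<close>.\<close>

lemma card_fixpoints_cong:
  assumes "finite B" "prime p" and U: "\<And>x. x \<in> B \<Longrightarrow> U x \<in> B" "\<And>x. x \<in> B \<Longrightarrow> (U ^^ p) x = x"
  shows "[card B = card {x \<in> B. U x = x}] (mod p)"
proof -
  define orb where "orb x = (\<lambda>i. (U ^^ i) x) ` {..<p}" for x
  let ?F = "{x \<in> B. U x = x}" and ?N = "{x \<in> B. U x \<noteq> x}"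
  have p0: "0 < p" using assms(2) prime_gt_0_nat by blast
  have fa: "(U ^^ a) ((U ^^ b) x) = (U ^^ (a + b)) x" for a b x by (simp add: funpow_add)
  have pB: "(U ^^ i) x \<in> B" if "x \<in> B" for x i by (induction i) (simp_all add: that U(1))
  have all: "(U ^^ i) x \<in> orb x" if "x \<in> B" for x i
    unfolding orb_def by (rule image_eqI[of _ _ "i mod p"]) (simp_all add: funpow_fix_mod[OF U(2)[OF that]] p0)
  have inj: "inj_on (\<lambda>i. (U ^^ i) x) {..<p}" if x: "x \<in> ?N" for x
  proof -
    have *: False if ij: "i < j" "j < p" "(U ^^ i) x = (U ^^ j) x" for i j
    proof -
      have r: "(U ^^ (j - i)) x = x"
      proof -
        have "(U ^^ (j - i)) x = (U ^^ (j - i)) ((U ^^ p) x)" using U(2) x by simp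
        also have "\<dots> = (U ^^ (p - i)) ((U ^^ j) x)" using ij by (simp only: fa) (simp add: add.commute)
        also have "\<dots> = (U ^^ p) x" using ij by (simp only: ij(3)[symmetric] fa) simp
        finally show ?thesis using U(2) x by simp
      qed
      have "coprime p (j - i)"
        using assms(2) ij by (intro prime_imp_coprime) (auto dest: dvd_imp_le)
      then have gc: "gcd (j - i) p = 1" by (metis coprime_imp_gcd_eq_1 gcd.commute)
      have "j - i \<noteq> 0" using ij by simp
      \<comment> \<open>A repetition within \<open>p\<close> steps makes \<open>x\<close> invariant
        under the iterate \<open>j - i\<close> as well as under \<open>p\<close>; Bezout then makes
        it a fixed point of \<open>U\<close>.\<close>
      from bezout_nat[OF this, of p] obtain a b where "(j - i) * a = p * b + 1" unfolding gc by blast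
      then have "(U ^^ (p * b + 1)) x = x" using funpow_mult_fix[OF r, of a] by simp
      moreover have "(U ^^ (p * b + 1)) x = U ((U ^^ (p * b)) x)" by simp
      ultimately have "U x = x" using funpow_mult_fix[of p U x b] U(2) x by simp
      then show False using x by simp
    qed
    show ?thesis
    proof (rule inj_onI)
      fix i j assume "i \<in> {..<p}" "j \<in> {..<p}" "(U ^^ i) x = (U ^^ j) x"
      then show "i = j" using *[of i j] *[of j i] by (cases i j rule: linorder_cases) auto
    qed
  qed
  have orb_same: "orb y = orb x" if x: "x \<in> B" and y: "y \<in> orb x" for x y
  proof -
    obtain i where i: "i < p" "y = (U ^^ i) x" using y by (auto simp: orb_def)
    have yB: "y \<in> B" using i pB[OF x] by simp
    have yx: "(U ^^ (p - i)) y = x" using i U(2)[OF x] by (simp add: fa)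
    have "(U ^^ k) x \<in> orb y" for k using all[OF yB, of "k + (p - i)"] by (simp only: fa[symmetric] yx)
    moreover have "(U ^^ k) y \<in> orb x" for k using all[OF x, of "k + i"] by (simp only: fa[symmetric] i(2))
    ultimately show ?thesis unfolding orb_def by blast
  qed
  have ON: "orb x \<subseteq> ?N" if x: "x \<in> ?N" for x
  proof
    fix y assume y: "y \<in> orb x"
    then have "y \<in> B" using x pB by (auto simp: orb_def)
    moreover have "U y \<noteq> y"
    proof
      assume "U y = y"
      then have "(U ^^ i) y = y" for i by (induction i) simp_all
      then have "orb y = {y}" using p0 by (auto simp: orb_def)
      moreover have "orb y = orb x" using orb_same x y by blast
      moreover have "x \<in> orb x" "U x \<in> orb x" using all[of x 0] all[of x 1] x by simp_all
      ultimately show False using x by auto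
    qed
    ultimately show "y \<in> ?N" by simp
  qed
  have "p dvd card ?N"
  proof -
    have un: "?N = \<Union> (orb ` ?N)"
    proof
      show "?N \<subseteq> \<Union> (orb ` ?N)" using all[of _ 0] by force
    qed (use ON in blast)
    have "p * card (orb ` ?N) = card (\<Union> (orb ` ?N))"
    proof (rule card_partition)
      show "finite (orb ` ?N)" "finite (\<Union> (orb ` ?N))" using assms(1) by (simp_all add: un[symmetric])
      show "card c = p" if "c \<in> orb ` ?N" for c using that card_image[OF inj] by (auto simp: orb_def)
      show "c1 \<inter> c2 = {}" if "c1 \<in> orb ` ?N" "c2 \<in> orb ` ?N" "c1 \<noteq> c2" for c1 c2
      proof (rule ccontr)
        assume "c1 \<inter> c2 \<noteq> {}"
        then obtain y where "y \<in> c1" "y \<in> c2" by blast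
        then have "orb y = c1" "orb y = c2" using that(1,2) orb_same by auto
        then show False using that(3) by simp
      qed
    qed
    then have "card ?N = p * card (orb ` ?N)" by (simp only: un[symmetric])
    then show ?thesis by (rule dvdI)
  qed
  moreover have "card B = card ?F + card ?N"
  proof -
    have "B = ?F \<union> ?N" by blast
    then show ?thesis using card_Un_disjoint[of ?F ?N] assms(1) by (simp add: disjoint_iff)
  qed
  ultimately show ?thesis by (auto simp: cong_def elim!: dvdE)
qed

context binary_field
begin

text \<open>Over the field {0, 1} the additive bijections are exactly the invertible linear
  maps.\<close>

definition additive :: "('a \<Rightarrow> 'a) \<Rightarrow> bool" where
  "additive f \<longleftrightarrow> bij f \<and> (\<forall>x y. f (x + y) = f x + f y)"

lemma additive_comp: "additive f \<Longrightarrow> additive g \<Longrightarrow> additive (\<lambda>x. f (g x))"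
  unfolding additive_def using bij_comp[of g f] by (auto simp: comp_def)

lemma additive_mult: "c \<noteq> 0 \<Longrightarrow> additive (\<lambda>x. c * x)"
  unfolding additive_def by (auto simp: distrib_left intro!: bijI' exI[of _ "_ / c"])

lemma additive_inv:
  assumes "additive f" shows "additive (inv_into UNIV f)"
proof -
  have b: "bij f" and a: "\<And>x y. f (x + y) = f x + f y" using assms by (auto simp: additive_def)
  have "inv_into UNIV f (x + y) = inv_into UNIV f x + inv_into UNIV f y" for x y
    using a b by (metis bij_inv_eq_iff)
  then show ?thesis using b by (simp add: additive_def bij_imp_bij_inv)
qed

lemma additive_0: "additive f \<Longrightarrow> f 0 = 0"
  unfolding additive_def by (metis add_self)

lemma additive_eq_0: "additive f \<Longrightarrow> f x = 0 \<longleftrightarrow> x = 0"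
  using additive_0 unfolding additive_def by (metis bij_pointE)

lemma additive_inv_simps: "additive f \<Longrightarrow> inv_into UNIV f (f x) = x" "additive f \<Longrightarrow> f (inv_into UNIV f x) = x"
  unfolding additive_def by (simp_all add: bij_is_inj bij_is_surj surj_f_inv_f)

text \<open>The elements \<open>y\<close> with \<open>th (y * x) * th 1 = th y * th x\<close> for
  all \<open>x\<close> form a subring. It contains \<open>d\<close>, so it is the whole field, and
  \<open>th\<close> divided by \<open>th 1\<close> is a field automorphism.\<close>

lemma semilinear:
  assumes th: "additive th" and d: "\<And>x. th (d * x) = w * th x" "d \<noteq> 0" "d \<noteq> 1"
  shows "\<exists>j<m. \<forall>x. th x = th 1 * x ^ 2 ^ j"
proof -
  have add: "\<And>x y. th (x + y) = th x + th y" using th by (simp add: additive_def)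
  have t1: "th 1 \<noteq> 0" using additive_eq_0[OF th] by simp
  define K where "K = {y. \<forall>x. th (y * x) * th 1 = th y * th x}"
  have "K = UNIV"
  proof (rule subring_UNIV)
    show "x + y \<in> K" if "x \<in> K" "y \<in> K" for x y
      using that by (simp add: K_def distrib_right add)
    show "x * y \<in> K" if x: "x \<in> K" and y: "y \<in> K" for x y
    proof -
      have "th (x * y * z) * th 1 = th (x * y) * th z" for z
      proof -
        have "th (x * (y * z)) * th 1 = th x * th (y * z)" "th (y * z) * th 1 = th y * th z"
          "th (x * y) * th 1 = th x * th y" using x y by (simp_all add: K_def)
        then have "(th (x * y * z) * th 1) * th 1 = (th (x * y) * th z) * th 1"
          by (metis mult.assoc mult.commute)
        then show ?thesis using t1 by simp
      qed
      then show ?thesis by (simp add: K_def)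
    qed
    show "0 \<in> K" "1 \<in> K" by (simp_all add: K_def additive_0[OF th])
    have "th d = w * th 1" using d(1)[of 1] by simp
    then show "d \<in> K" by (simp add: K_def d(1))
  qed (use d in auto)
  then have mult: "th (x * y) * th 1 = th x * th y" for x y by (auto simp: K_def)
  define f where "f x = th x / th 1" for x
  have "\<exists>j<m. \<forall>x. f x = x ^ 2 ^ j"
  proof (rule automorphism_frob)
    show "f (x + y) = f x + f y" for x y by (simp add: f_def add add_divide_distrib)
    show "f (x * y) = f x * f y" for x y using mult[of x y] t1 by (simp add: f_def field_simps)
    show "f 1 = 1" using t1 by (simp add: f_def)
  qed
  then show ?thesis using t1 by (auto simp: f_def field_simps)
qed

text \<open>The exponent \<open>n div p\<close> is not a multiple of \<open>n\<close>, so some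
  nonzero element has a power \<open>n div p\<close> different from 1, and that power is the
  required root.\<close>

lemma root_of_unity:
  assumes "prime p" "p dvd n" obtains w where "w \<noteq> 1" "w \<noteq> 0" "w ^ p = (1::'a)"
proof -
  have "\<exists>x::'a. x \<noteq> 0 \<and> x ^ (n div p) \<noteq> 1"
  proof (rule ccontr)
    assume "\<not> ?thesis"
    then have "[n div p = 0] (mod n)" by (intro pow_eq_imp_cong) auto
    then have "n dvd n div p" by (simp add: cong_0_iff)
    moreover have "n div p < n" "0 < n div p"
      using assms(2) n_gt prime_gt_1_nat[OF assms(1)] dvd_imp_le[OF assms(2)]
      by (simp_all add: div_less_dividend div_greater_zero_iff)
    ultimately show False by (simp add: nat_dvd_not_less)
  qed
  then obtain x :: 'a where x: "x \<noteq> 0" "x ^ (n div p) \<noteq> 1" by blast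
  have "(x ^ (n div p)) ^ p = 1" using pow_n[OF x(1)] assms(2) by (simp add: power_mult[symmetric])
  then show ?thesis using that[of "x ^ (n div p)"] x by simp
qed

text \<open>The order of 2 modulo \<open>p\<close> divides the prime \<open>m\<close> and is not 1.
  So it is \<open>m\<close>, and it divides \<open>p - 1\<close>.\<close>

lemma prime_factor_gt:
  assumes "prime p" "p dvd n" shows "m < p"
proof -
  have od: "odd p" using assms odd_n by (meson dvd_trans)
  have "[2 ^ m = 1] (mod p)"
    using assms(2) card_gt by (simp add: cong_altdef_nat)
  then have "ord p 2 dvd m" using ord_divides[of 2 m p] by blast
  moreover have "ord p 2 \<noteq> 1"
  proof
    assume "ord p 2 = 1"
    then have "[2 ^ 1 = 1] (mod p)" using ord[of 2 p] by metis
    then have "p dvd 1" by (simp add: cong_altdef_nat)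
    then show False using assms(1) by simp
  qed
  ultimately have "ord p 2 = m" using prime_m by (metis prime_nat_iff)
  moreover have "ord p 2 dvd p - 1"
    using od assms(1) by (intro order_divides_totient[of p 2, unfolded totient_prime[OF assms(1)]])
       (simp add: coprime_commute prime_imp_coprime)
  ultimately have "m \<le> p - 1" using prime_gt_1_nat[OF assms(1)] by (simp add: dvd_imp_le)
  then show ?thesis using prime_gt_1_nat[OF assms(1)] by simp
qed

text \<open>The automorphism group of the power map under linear equivalence, seen on the side of
  its values: applying \<open>f\<close> afterwards amounts to applying some linear \<open>g\<close>
  before.\<close>

definition lin_auts :: "nat \<Rightarrow> ('a \<Rightarrow> 'a) set" where
  "lin_auts t = {f. additive f \<and> (\<exists>g. additive g \<and> (\<forall>x. f (x ^ t) = g x ^ t))}"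

lemma lin_auts_comp:
  assumes "f \<in> lin_auts t" "g \<in> lin_auts t" shows "(\<lambda>x. f (g x)) \<in> lin_auts t"
proof -
  obtain f' g' where fg: "additive f" "additive g" "additive f'" "additive g'"
    "\<And>x. f (x ^ t) = f' x ^ t" "\<And>x. g (x ^ t) = g' x ^ t"
    using assms unfolding lin_auts_def by auto
  have eq: "f (g (x ^ t)) = f' (g' x) ^ t" for x by (simp only: fg(5,6))
  show ?thesis unfolding lin_auts_def mem_Collect_eq
    using additive_comp[OF fg(1,2)] additive_comp[OF fg(3,4)] eq
    by (intro conjI exI[of _ "\<lambda>x. f' (g' x)"] allI)
qed

text \<open>Every \<open>c\<close> is a \<open>t\<close>-th power, so a factor in front of
  \<open>x ^ t\<close> can be moved inside. These scalars form the subgroup whose cosets are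
  counted.\<close>

lemma lin_auts_mult:
  assumes "inv_exps t t'" "c \<noteq> 0" shows "(\<lambda>x. c * x) \<in> lin_auts t"
proof -
  have "c * x ^ t = (c ^ t' * x) ^ t" for x by (simp add: power_mult_distrib pow_pow_inv[OF assms(1)])
  moreover have "c ^ t' \<noteq> 0" using assms(2) by simp
  ultimately show ?thesis
    unfolding lin_auts_def mem_Collect_eq using assms(2)
    by (intro conjI additive_mult exI[of _ "\<lambda>x. c ^ t' * x"] allI)
qed

text \<open>A coset of the group of scalars in \<^term>\<open>lin_auts t\<close> is represented by its unique member fixing 1;
  an automorphism \<open>u\<close> acts on cosets from the left.\<close>

definition norm_auts :: "nat \<Rightarrow> ('a \<Rightarrow> 'a) set" where "norm_auts t = {f \<in> lin_auts t. f 1 = 1}"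

definition coset_act :: "('a \<Rightarrow> 'a) \<Rightarrow> ('a \<Rightarrow> 'a) \<Rightarrow> 'a \<Rightarrow> 'a" where
  "coset_act u f = (\<lambda>x. u (f (inv_into UNIV (\<lambda>x. u (f x)) 1 * x)))"

text \<open>Scaling the argument by the preimage of 1 restores the value 1 at 1 without leaving the
  coset.\<close>

lemma coset_act_props:
  assumes t: "inv_exps t t'" and u: "u \<in> lin_auts t" and f: "f \<in> lin_auts t"
  shows "coset_act u f \<in> norm_auts t"
    and "\<exists>c. c \<noteq> 0 \<and> coset_act u f = (\<lambda>x. u (f (c * x)))"
proof -
  let ?c = "inv_into UNIV (\<lambda>x. u (f x)) 1"
  have a: "additive (\<lambda>x. u (f x))" using lin_auts_comp[OF u f] by (simp add: lin_auts_def)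
  have c: "u (f ?c) = 1" using additive_inv_simps(2)[OF a] .
  then have c0: "?c \<noteq> 0" using additive_0[OF a] by auto
  show "\<exists>c. c \<noteq> 0 \<and> coset_act u f = (\<lambda>x. u (f (c * x)))" using c0 by (auto simp: coset_act_def)
  show "coset_act u f \<in> norm_auts t"
    using lin_auts_comp[OF u lin_auts_comp[OF f lin_auts_mult[OF t c0]]] c
    by (simp add: norm_auts_def coset_act_def)
qed

lemma norm_unique:
  assumes "f \<in> norm_auts t" "h \<in> norm_auts t" "h = (\<lambda>x. f (c * x))" shows "h = f"
proof -
  have "f c = f 1" using assms by (auto simp: norm_auts_def)
  moreover have "additive f" using assms(1) by (simp add: norm_auts_def lin_auts_def)
  ultimately have "c = 1" by (metis additive_inv_simps(1))
  then show ?thesis using assms by simp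
qed

text \<open>Up to a scalar in the argument, iterating the action applies the iterates of
  \<open>u\<close> on the left; uniqueness of the representative then removes the scalar.\<close>

lemma coset_act_pow:
  assumes t: "inv_exps t t'" and u: "u \<in> lin_auts t" and p: "\<And>x. (u ^^ p) x = x" and f: "f \<in> norm_auts t"
  shows "(coset_act u ^^ p) f = f"
proof -
  have *: "(\<exists>c. c \<noteq> 0 \<and> (coset_act u ^^ i) f = (\<lambda>x. (u ^^ i) (f (c * x)))) \<and> (coset_act u ^^ i) f \<in> norm_auts t" for i
  proof (induction i)
    case (Suc i)
    let ?g = "(coset_act u ^^ i) f"
    have g: "?g \<in> lin_auts t" using Suc by (simp add: norm_auts_def)
    obtain c where c: "c \<noteq> 0" "?g = (\<lambda>x. (u ^^ i) (f (c * x)))" using Suc by blast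
    obtain c' where c': "c' \<noteq> 0" "coset_act u ?g = (\<lambda>x. u (?g (c' * x)))"
      using coset_act_props(2)[OF t u g] by blast
    have "(coset_act u ^^ Suc i) f = (\<lambda>x. (u ^^ Suc i) (f (c * c' * x)))"
      using c(2) c'(2) by (simp add: mult.assoc)
    then show ?case using c(1) c'(1) coset_act_props(1)[OF t u g] by (auto intro!: exI[of _ "c * c'"])
  qed (use f in \<open>auto intro!: exI[of _ 1]\<close>)
  obtain c where "(coset_act u ^^ p) f = (\<lambda>x. f (c * x))" using *[of p] p by auto
  then show ?thesis using norm_unique[OF f] *[of p] by blast
qed

text \<open>For multiplication by a \<open>p\<close>-th root of unity the fixed cosets are
  represented by Frobenius powers: the identity is one, and there are at most \<open>m\<close> <
  \<open>p\<close>. So \<open>p\<close> does not divide the number of cosets, and any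
  \<open>u\<close> whose \<open>p\<close>-th iterate is the identity has a fixed coset too. For such
  a coset, \<open>f\<close> conjugates \<open>u\<close> to a scalar.\<close>

lemma coset_fixpoint:
  assumes t: "inv_exps t t'" and p: "prime p" "p dvd n" and u: "u \<in> lin_auts t" "\<And>x. (u ^^ p) x = x"
  obtains f c where "f \<in> norm_auts t" "c \<noteq> 0" "\<And>x. u (f x) = f (c * x)"
proof -
  let ?B = "norm_auts t"
  have fin: "finite ?B" by simp
  have id: "(\<lambda>x. x) \<in> ?B" using lin_auts_mult[OF t, of 1] by (simp add: norm_auts_def)
  have cong: "[card ?B = card {f \<in> ?B. coset_act v f = f}] (mod p)"
    if "v \<in> lin_auts t" "\<And>x. (v ^^ p) x = x" for v
    using fin p(1) coset_act_props(1)[OF t that(1)] coset_act_pow[OF t that]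
    by (intro card_fixpoints_cong) (auto simp: norm_auts_def)
  obtain w where w: "w \<noteq> 1" "w \<noteq> 0" "w ^ p = (1::'a)" using root_of_unity[OF p] .
  have wp: "((\<lambda>x. w * x) ^^ i) x = w ^ i * x" for i x by (induction i) (simp_all add: mult.assoc)
  let ?F = "{f \<in> ?B. coset_act (\<lambda>x. w * x) f = f}"
  \<comment> \<open>A fixed representative intertwines \<open>w\<close> with another scalar, so it
    is semilinear; fixing 1, it is a Frobenius power.\<close>
  have "?F \<subseteq> (\<lambda>j x. x ^ 2 ^ j) ` {..<m}"
  proof
    fix f assume f: "f \<in> ?F"
    then have fB: "f \<in> lin_auts t" "additive f" "f 1 = 1" by (auto simp: norm_auts_def lin_auts_def)
    obtain c where c: "c \<noteq> 0" "f = (\<lambda>x. w * f (c * x))"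
      using coset_act_props(2)[OF t lin_auts_mult[OF t w(2)] fB(1)] f by auto
    have "f (c * x) = inverse w * f x" for x using fun_cong[OF c(2), of x] w(2) by (simp add: field_simps)
    moreover have "c \<noteq> 1" using fun_cong[OF c(2), of 1] fB(3) w(1) by auto
    ultimately obtain j where "j < m" "\<forall>x. f x = f 1 * x ^ 2 ^ j" using semilinear[OF fB(2) _ c(1)] by blast
    then show "f \<in> (\<lambda>j x. x ^ 2 ^ j) ` {..<m}" using fB(3) by auto
  qed
  then have "card ?F \<le> m" using card_mono[of "(\<lambda>j (x::'a). x ^ 2 ^ j) ` {..<m}" ?F] card_image_le[of "{..<m}" "\<lambda>j (x::'a). x ^ 2 ^ j"] by simp
  then have "card ?F < p" using prime_factor_gt[OF p] by simp
  moreover have "(\<lambda>x. x) \<in> ?F"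
  proof -
    note wt = lin_auts_mult[OF t w(2)]
    have idt: "(\<lambda>x. x) \<in> lin_auts t" using id by (simp add: norm_auts_def)
    obtain c where "coset_act (\<lambda>x. w * x) (\<lambda>x. x) = (\<lambda>x. w * (c * x))"
      using coset_act_props(2)[OF t wt idt] by blast
    then have "coset_act (\<lambda>x. w * x) (\<lambda>x. x) = (\<lambda>x. x)"
      using norm_unique[OF id coset_act_props(1)[OF t wt idt], of "w * c"] by (simp add: mult.assoc)
    then show ?thesis using id by simp
  qed
  then have "0 < card ?F" using card_gt_0_iff[of ?F] by auto
  ultimately have "\<not> p dvd card ?F" by (simp add: nat_dvd_not_less)
  then have nd: "\<not> p dvd card ?B"
    using cong[OF lin_auts_mult[OF t w(2)]] w(3) wp by (simp add: cong_dvd_iff)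
  have "card {f \<in> ?B. coset_act u f = f} \<noteq> 0"
    using cong[OF u] nd by (metis cong_dvd_iff dvd_0_right)
  then have "{f \<in> ?B. coset_act u f = f} \<noteq> {}" by (metis card.empty)
  then obtain f where f: "f \<in> ?B" "coset_act u f = f" by blast
  obtain c where c: "c \<noteq> 0" "f = (\<lambda>x. u (f (c * x)))"
    using coset_act_props(2)[OF t u(1), of f] f by (auto simp: norm_auts_def)
  have "u (f x) = f (inverse c * x)" for x using fun_cong[OF c(2), of "inverse c * x"] c(1) by (simp add: mult.assoc[symmetric])
  then show ?thesis using that[of f "inverse c"] f c by simp
qed

text \<open>Conjugating multiplication by \<open>w\<close> with \<open>si\<close> gives an
  automorphism \<open>u\<close> of the second power map. A coset fixed by \<open>u\<close> provides
  \<open>f\<close> that conjugates \<open>u\<close> back to a scalar, so \<open>f\<close> followed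
  by the inverse of \<open>si\<close> is semilinear. On the side of the arguments this turns a
  single power map with exponent \<open>e\<close> into an additive map, and a multiplicative
  additive map is a Frobenius power.\<close>

theorem linear_equiv_cong:
  assumes t1: "inv_exps t1 t1'" and t2: "inv_exps t2 t2'"
    and si: "additive si" and ta: "additive ta" and eq: "\<And>x. si (x ^ t1) = ta x ^ t2"
  shows "\<exists>j. [t2 = t1 * 2 ^ j] (mod n)"
proof -
  obtain p where p: "prime p" "p dvd n" using prime_factor_nat[of n] n_gt by auto
  obtain w where w: "w \<noteq> 1" "w \<noteq> 0" "w ^ p = (1::'a)" using root_of_unity[OF p] .
  define u where "u x = si (w * inv_into UNIV si x)" for x
  have us: "u (si x) = si (w * x)" for x by (simp add: u_def additive_inv_simps[OF si])
  have "u \<in> lin_auts t2"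
  proof -
    define g where "g y = ta (w ^ t1' * inv_into UNIV ta y)" for y
    have "u (y ^ t2) = g y ^ t2" for y
    proof -
      let ?x = "inv_into UNIV ta y"
      have "y ^ t2 = si (?x ^ t1)" by (simp add: eq additive_inv_simps[OF ta])
      then have "u (y ^ t2) = si (w * ?x ^ t1)" by (simp add: us)
      also have "w * ?x ^ t1 = (w ^ t1' * ?x) ^ t1" by (simp add: power_mult_distrib pow_pow_inv[OF t1])
      finally show ?thesis by (simp add: eq g_def)
    qed
    moreover have "additive g" unfolding g_def
      by (rule additive_comp[OF ta additive_comp[OF additive_mult additive_inv[OF ta]]]) (use w in simp)
    moreover have "additive u" unfolding u_def
      by (rule additive_comp[OF si additive_comp[OF additive_mult additive_inv[OF si]]]) (use w in simp)
    ultimately show ?thesis unfolding lin_auts_def mem_Collect_eq by blast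
  qed
  moreover have "(u ^^ p) x = x" for x
  proof -
    have "(u ^^ i) (si y) = si (w ^ i * y)" for i y by (induction i) (simp_all add: us mult.assoc)
    from this[of p "inv_into UNIV si x"] show ?thesis by (simp add: w additive_inv_simps[OF si])
  qed
  ultimately obtain f c where f: "f \<in> norm_auts t2" and c: "c \<noteq> 0" "\<And>x. u (f x) = f (c * x)"
    using coset_fixpoint[OF t2 p, of u] by blast
  have fa: "additive f" using f by (simp add: norm_auts_def lin_auts_def)
  have "\<exists>g. additive g \<and> (\<forall>x. f (x ^ t2) = g x ^ t2)"
    using f unfolding norm_auts_def lin_auts_def mem_Collect_eq by (elim conjE)
  then obtain g where g': "additive g \<and> (\<forall>x. f (x ^ t2) = g x ^ t2)" by (elim exE)
  note g = g'[THEN conjunct1] g'[THEN conjunct2, rule_format]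
  define th where "th x = inv_into UNIV si (f x)" for x
  have tha: "additive th" unfolding th_def by (rule additive_comp[OF additive_inv[OF si] fa])
  have fs: "f x = si (th x)" for x by (simp add: th_def additive_inv_simps[OF si])
  have "th (c * x) = w * th x" for x
  proof -
    have "si (w * th x) = si (th (c * x))" using c(2)[of x] by (simp add: fs us)
    then show ?thesis using si by (metis additive_inv_simps(1))
  qed
  moreover have "c \<noteq> 1"
  proof
    assume "c = 1"
    then have "th 1 = w * th 1" using \<open>\<And>x. th (c * x) = w * th x\<close>[of 1] by simp
    then show False using w additive_eq_0[OF tha, of 1] by simp
  qed
  ultimately obtain j where j: "\<And>x. th x = th 1 * x ^ 2 ^ j" using semilinear[OF tha _ c(1)] by blast
  let ?a = "th 1"
  have a0: "?a \<noteq> 0" using additive_eq_0[OF tha] by simp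
  \<comment> \<open>Up to scalars, this is the exponent of \<open>g\<close> followed by the inverse
    of \<open>ta\<close>.\<close>
  define e where "e = t2 * 2 ^ j * t1'"
  have ge: "g x = ta (?a ^ t1' * x ^ e)" for x
  proof -
    have "?a * (x ^ t2) ^ 2 ^ j = (?a ^ t1' * x ^ e) ^ t1"
      by (simp add: power_mult_distrib pow_pow_inv[OF t1] e_def power_mult)
    then have "g x ^ t2 = ta (?a ^ t1' * x ^ e) ^ t2"
      using g(2)[of x] fs[of "x ^ t2"] j[of "x ^ t2"] eq[of "?a ^ t1' * x ^ e"] by simp
    then show ?thesis using pow_eq_iff[OF t2] by simp
  qed
  define h where "h x = inverse (?a ^ t1') * inv_into UNIV ta (g x)" for x
  have h: "h x = x ^ e" for x using a0 by (simp add: h_def ge additive_inv_simps[OF ta])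
  have "additive h" unfolding h_def
    by (rule additive_comp[OF additive_mult additive_comp[OF additive_inv[OF ta] g(1)]]) (use a0 in simp)
  then obtain l where l: "\<And>x::'a. x ^ e = x ^ 2 ^ l"
    using automorphism_frob[of "\<lambda>x. x ^ e"] unfolding additive_def h by (metis power_mult_distrib power_one)
  have "[e = 2 ^ l] (mod n)" using l by (intro pow_eq_imp_cong) blast
  \<comment> \<open>The factor \<open>t1\<close> cancels \<open>t1'\<close>, and the power of 2
    completes \<open>2 ^ j\<close> to a power of \<open>2 ^ m\<close>, which is 1 modulo
    \<open>n\<close>.\<close>
  then have "[e * (t1 * 2 ^ ((m - 1) * j)) = 2 ^ l * (t1 * 2 ^ ((m - 1) * j))] (mod n)" by (rule cong_scalar_right)
  moreover have "[e * (t1 * 2 ^ ((m - 1) * j)) = t2] (mod n)"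
  proof -
    have "j + (m - 1) * j = m * j" using m_ge_2 by (cases m) auto
    then have e1: "(2::nat) ^ j * 2 ^ ((m - 1) * j) = (2 ^ m) ^ j" by (simp only: power_add[symmetric] power_mult[symmetric])
    have e2: "e * (t1 * 2 ^ ((m - 1) * j)) = t2 * ((t1 * t1') * (2 ^ j * 2 ^ ((m - 1) * j)))"
      by (simp only: e_def ac_simps)
    have m1: "[2 ^ m = 1] (mod n)" using card_gt by (simp add: cong_def le_mod_geq)
    have t11: "[t1 * t1' = 1] (mod n)" using t1 by (simp add: inv_exps_def)
    have "[t2 * ((t1 * t1') * (2 ^ m) ^ j) = t2 * (1 * 1 ^ j)] (mod n)"
      by (intro cong_mult cong_refl cong_pow t11 m1)
    then show ?thesis unfolding e2 e1 by simp
  qed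
  ultimately have "[t2 = 2 ^ l * (t1 * 2 ^ ((m - 1) * j))] (mod n)"
    by (rule cong_trans[OF cong_sym, rotated])
  moreover have "2 ^ l * (t1 * 2 ^ ((m - 1) * j)) = t1 * 2 ^ (l + (m - 1) * j)" by (simp add: power_add)
  ultimately have "[t2 = t1 * 2 ^ (l + (m - 1) * j)] (mod n)" by (simp only:)
  then show ?thesis by blast
qed

end

section \<open>Isomorphism classes\<close>

lemma tri_img_tri_img: "tri_img f (tri_img g T) = tri_img (\<lambda>x. f (g x)) T"
  by (simp add: tri_img_def image_image)

text \<open>Isomorphisms are prescribed on nonzero elements only, so images can be compared only for
  triangles that avoid 0.\<close>

definition on_nonzero :: "'a::field set set \<Rightarrow> bool" where
  "on_nonzero T \<longleftrightarrow> (\<forall>X\<in>T. X \<subseteq> nonzero_pts)"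

lemma tri_img_cong: "on_nonzero T \<Longrightarrow> (\<And>x. x \<in> nonzero_pts \<Longrightarrow> f x = g x) \<Longrightarrow> tri_img f T = tri_img g T"
  unfolding tri_img_def on_nonzero_def by (intro image_cong) (auto simp: subset_eq image_def)

lemma tri_img_id: "tri_img (\<lambda>x. x) T = T"
  by (simp add: tri_img_def)

lemma on_nonzero_STS: "on_nonzero STS"
  by (auto simp: on_nonzero_def STS_def nonzero_pts_def)

lemma on_nonzero_img: "on_nonzero T \<Longrightarrow> (\<And>x. x \<in> nonzero_pts \<Longrightarrow> f x \<in> nonzero_pts) \<Longrightarrow> on_nonzero (tri_img f T)"
  by (fastforce simp: on_nonzero_def tri_img_def)

lemma emb_iso_refl: "emb_iso W W"
  unfolding emb_iso_def by (intro exI[of _ "\<lambda>x. x"]) (simp add: tri_img_id bij_betw_def)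

lemma emb_iso_sym:
  assumes W: "on_nonzero W1" "on_nonzero W2" and iso: "emb_iso W1 W2" shows "emb_iso W2 W1"
proof -
  obtain si where si: "bij_betw si nonzero_pts nonzero_pts"
    and c: "(tri_img si STS = STS \<and> tri_img si W1 = W2) \<or> (tri_img si STS = W2 \<and> tri_img si W1 = STS)"
    using iso unfolding emb_iso_def by blast
  let ?i = "inv_into nonzero_pts si"
  have inv: "tri_img ?i (tri_img si T) = T" if "on_nonzero T" for T
    using tri_img_cong[OF that, of "\<lambda>x. ?i (si x)" "\<lambda>x. x"] bij_betw_inv_into_left[OF si]
    by (simp add: tri_img_tri_img tri_img_id)
  show ?thesis unfolding emb_iso_def
    by (rule exI[of _ ?i]) (use bij_betw_inv_into[OF si] c inv[OF W(1)] inv[OF on_nonzero_STS] in auto)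
qed

lemma emb_iso_trans:
  assumes "emb_iso W1 W2" "emb_iso W2 W3" shows "emb_iso W1 W3"
proof -
  obtain f where f: "bij_betw f nonzero_pts nonzero_pts"
    "(tri_img f STS = STS \<and> tri_img f W1 = W2) \<or> (tri_img f STS = W2 \<and> tri_img f W1 = STS)"
    using assms(1) unfolding emb_iso_def by blast
  obtain g where g: "bij_betw g nonzero_pts nonzero_pts"
    "(tri_img g STS = STS \<and> tri_img g W2 = W3) \<or> (tri_img g STS = W3 \<and> tri_img g W2 = STS)"
    using assms(2) unfolding emb_iso_def by blast
  have "bij_betw (\<lambda>x. g (f x)) nonzero_pts nonzero_pts" using bij_betw_trans[OF f(1) g(1)] by (simp add: comp_def)
  moreover have "tri_img (\<lambda>x. g (f x)) T = tri_img g (tri_img f T)" for T by (simp only: tri_img_tri_img)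
  then have "(tri_img (\<lambda>x. g (f x)) STS = STS \<and> tri_img (\<lambda>x. g (f x)) W1 = W3) \<or>
    (tri_img (\<lambda>x. g (f x)) STS = W3 \<and> tri_img (\<lambda>x. g (f x)) W1 = STS)"
    using f(2) g(2) by metis
  ultimately show ?thesis unfolding emb_iso_def by blast
qed

context binary_field
begin

abbreviation white :: "nat \<Rightarrow> 'a set set" where "white t \<equiv> tri_img (\<lambda>x. x ^ t) STS"

lemma on_nonzero_white: "on_nonzero (white t)"
  by (intro on_nonzero_img on_nonzero_STS) (simp add: nonzero_pts_def)

text \<open>The representation inside \<open>STS\<close> may list the same three points in another
  order; their sum over the set does not depend on it.\<close>

lemma STS_iff: "{a, b, c} \<in> STS \<longleftrightarrow> a \<noteq> 0 \<and> b \<noteq> 0 \<and> c \<noteq> 0 \<and> a \<noteq> b \<and> a \<noteq> c \<and> b \<noteq> c \<and> a + b + c = (0::'a)"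
  (is "?L \<longleftrightarrow> ?R")
proof
  assume ?L
  then obtain x y z where xyz: "{a, b, c} = {x, y, z}" "x \<noteq> 0" "y \<noteq> 0" "z \<noteq> 0" "x \<noteq> y" "x \<noteq> z" "y \<noteq> z" "x + y + z = 0"
    unfolding STS_def by blast
  have "card {a, b, c} = 3" using xyz by simp
  then have d: "a \<noteq> b" "a \<noteq> c" "b \<noteq> c" by (auto simp: card_insert_if split: if_splits)
  have "\<Sum>{a, b, c} = \<Sum>{x, y, z}" using xyz(1) by simp
  then have "a + b + c = x + y + z" using d xyz(5-7) by (simp add: add.assoc)
  moreover have "a \<in> {x, y, z}" "b \<in> {x, y, z}" "c \<in> {x, y, z}" using xyz(1) by blast+
  ultimately show ?R using d xyz by auto
qed (auto simp: STS_def)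

lemma additive_STS_sub:
  assumes "additive f" shows "tri_img f STS \<subseteq> STS"
proof
  fix Y assume "Y \<in> tri_img f STS"
  then obtain X where X: "X \<in> STS" "Y = f ` X" unfolding tri_img_def by blast
  then obtain a b c where "X = {a, b, c}" unfolding STS_def by blast
  with X have abc: "{a, b, c} \<in> STS" "Y = {f a, f b, f c}" by simp_all
  have add: "\<And>x y. f (x + y) = f x + f y" and inj: "\<And>x y. f x = f y \<longleftrightarrow> x = y"
    using assms unfolding additive_def by (auto dest: bij_is_inj injD)
  have "f a + f b + f c = 0" using abc(1) additive_0[OF assms] by (simp add: STS_iff add[symmetric])
  then have "{f a, f b, f c} \<in> STS" using abc(1) additive_eq_0[OF assms] by (simp add: STS_iff inj)
  then show "Y \<in> STS" using abc(2) by simp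
qed

lemma additive_STS:
  assumes "additive f" shows "tri_img f STS = STS"
proof
  show "tri_img f STS \<subseteq> STS" using additive_STS_sub[OF assms] .
  have "tri_img f (tri_img (inv_into UNIV f) STS) \<subseteq> tri_img f STS"
    using additive_STS_sub[OF additive_inv[OF assms]] by (auto simp: tri_img_def)
  then show "STS \<subseteq> tri_img f STS" by (simp add: tri_img_tri_img additive_inv_simps[OF assms] tri_img_id)
qed

text \<open>The triple through distinct nonzero \<open>x\<close> and \<open>y\<close> is {x, y, x +
  y}, so preserving triples means preserving sums: the automorphisms of the triple system are the
  invertible linear maps.\<close>

lemma STS_additive:
  assumes "bij_betw si nonzero_pts nonzero_pts" "tri_img si STS = (STS :: 'a set set)"
  shows "additive (\<lambda>x. if x = 0 then 0 else si x)" (is "additive ?f")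
proof -
  have nz: "si x \<noteq> 0" if "x \<noteq> 0" for x
    using assms(1) that unfolding bij_betw_def nonzero_pts_def by blast
  have si_inj: "x = y" if "x \<noteq> 0" "y \<noteq> 0" "si x = si y" for x y
    using bij_betw_imp_inj_on[OF assms(1)] that unfolding inj_on_def nonzero_pts_def by blast
  have "inj ?f"
  proof (rule injI)
    fix x y assume "?f x = ?f y"
    then show "x = y" using nz[of x] nz[of y] si_inj[of x y] by (cases "x = 0"; cases "y = 0") simp_all
  qed
  then have "bij ?f" using finite_UNIV_inj_surj[OF finite_class.finite_UNIV] unfolding bij_def by blast
  moreover have "?f (x + y) = ?f x + ?f y" for x y
  proof (cases "x = 0 \<or> y = 0 \<or> x = y")
    case True then show ?thesis by (auto simp: add_self)
  next
    case False
    then have "x + y \<noteq> 0" "x \<noteq> x + y" "y \<noteq> x + y" by (auto simp: add_eq_0_iff')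
    then have "{x, y, x + y} \<in> STS" using False by (simp add: STS_iff add_self)
    then have "si ` {x, y, x + y} \<in> tri_img si STS" unfolding tri_img_def by (rule imageI)
    then have "{si x, si y, si (x + y)} \<in> STS" using assms(2) by simp
    then have "si x + si y + si (x + y) = 0" by (simp add: STS_iff)
    then show ?thesis using False \<open>x + y \<noteq> 0\<close> by (simp add: add_eq_0_iff')
  qed
  ultimately show ?thesis by (simp add: additive_def)
qed

lemma additive_frob: "additive (\<lambda>x. x ^ 2 ^ j)"
proof -
  have "inj (\<lambda>x::'a. x ^ 2 ^ j)" using frob_inj by (auto intro: injI)
  then have "bij (\<lambda>x::'a. x ^ 2 ^ j)" using finite_UNIV_inj_surj[OF finite_class.finite_UNIV] unfolding bij_def by blast
  then show ?thesis by (simp add: additive_def frob_add)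
qed

text \<open>Frobenius is linear and preserves the black triangles, so a factor \<open>2 ^ j\<close>
  of the exponent is absorbed.\<close>

lemma white_frob:
  assumes "[t = s * 2 ^ j] (mod n)" "0 < t" "0 < s" shows "white t = white s"
proof -
  have "x ^ t = (x ^ 2 ^ j) ^ s" for x :: 'a
    using pow_cong'[OF assms(1,2), of x] assms(3) by (simp add: power_mult[symmetric] mult.commute)
  then have "white t = tri_img (\<lambda>x. x ^ s) (tri_img (\<lambda>x. x ^ 2 ^ j) STS)" by (simp add: tri_img_tri_img)
  then show ?thesis by (simp add: additive_STS[OF additive_frob])
qed

lemma bij_pow_nonzero:
  assumes "inv_exps t t'" shows "bij_betw (\<lambda>x::'a. x ^ t) nonzero_pts nonzero_pts"
  using pow_pow_inv[OF assms] assms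
  by (intro bij_betwI[where g = "\<lambda>x. x ^ t'"]) (auto simp: nonzero_pts_def inv_exps_def)

text \<open>The inverse power map exchanges the two colours.\<close>

lemma white_inv:
  assumes "inv_exps t t'" shows "emb_iso (white t) (white t')"
  unfolding emb_iso_def
  by (rule exI[of _ "\<lambda>x. x ^ t'"])
    (simp add: tri_img_tri_img pow_pow_inv[OF assms] tri_img_id bij_pow_nonzero[OF inv_exps_sym[OF assms]])

text \<open>Both kinds of isomorphism are linear equivalences of power maps: of the two given ones
  if colours are kept, of the inverse of the first with the second if they are exchanged.\<close>

lemma emb_iso_imp_cong:
  assumes t1: "inv_exps t1 t1'" and t2: "inv_exps t2 t2'" and iso: "emb_iso (white t1) (white t2)"
  shows "\<exists>j. [t2 = t1 * 2 ^ j] (mod n) \<or> [t2 = t1' * 2 ^ j] (mod n)"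
proof -
  obtain si where si: "bij_betw si nonzero_pts nonzero_pts"
    and c: "(tri_img si STS = STS \<and> tri_img si (white t1) = white t2) \<or>
            (tri_img si STS = white t2 \<and> tri_img si (white t1) = STS)"
    using iso unfolding emb_iso_def by blast
  note b1 = bij_pow_nonzero[OF t1] and b2 = bij_pow_nonzero[OF inv_exps_sym[OF t2]]
  have pos: "0 < t1" "0 < t2" "0 < t1'" "0 < t2'" using t1 t2 by (auto simp: inv_exps_def)
  have bk: "tri_img (\<lambda>x. x ^ t2') (white t2) = STS" by (simp add: tri_img_tri_img pow_pow_inv[OF t2] tri_img_id)
  \<comment> \<open>The permutation is arbitrary at 0, where a linear map needs the value 0.\<close>
  let ?f0 = "\<lambda>f (x::'a). if x = 0 then 0 else f x :: 'a"
  from c show ?thesis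
  proof
    assume c: "tri_img si STS = STS \<and> tri_img si (white t1) = white t2"
    define ta where "ta = (\<lambda>x. si (x ^ t1) ^ t2')"
    have "bij_betw ta nonzero_pts nonzero_pts"
      using bij_betw_trans[OF b1 bij_betw_trans[OF si b2]] by (simp add: ta_def comp_def)
    moreover have "tri_img ta STS = tri_img (\<lambda>x. x ^ t2') (tri_img si (white t1))"
      by (simp only: ta_def tri_img_tri_img)
    then have "tri_img ta STS = STS" by (simp only: c[THEN conjunct2] bk)
    ultimately have "additive (?f0 ta)" by (rule STS_additive)
    moreover have "additive (?f0 si)" using STS_additive[OF si] c by blast
    moreover have "?f0 si (x ^ t1) = ?f0 ta x ^ t2" for x
      using pos by (simp add: ta_def pow_pow_inv[OF t2])
    ultimately show ?thesis using linear_equiv_cong[OF t1 t2] by blast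
  next
    assume c: "tri_img si STS = white t2 \<and> tri_img si (white t1) = STS"
    define ta where "ta = (\<lambda>x. si x ^ t2')"
    define ka where "ka = (\<lambda>x. si (x ^ t1))"
    have "bij_betw ta nonzero_pts nonzero_pts"
      using bij_betw_trans[OF si b2] by (simp add: ta_def comp_def)
    moreover have "tri_img ta STS = tri_img (\<lambda>x. x ^ t2') (tri_img si STS)"
      by (simp only: ta_def tri_img_tri_img)
    then have "tri_img ta STS = STS" by (simp only: c[THEN conjunct1] bk)
    ultimately have "additive (?f0 ta)" by (rule STS_additive)
    moreover have "additive (?f0 ka)"
    proof (rule STS_additive)
      show "bij_betw ka nonzero_pts nonzero_pts" using bij_betw_trans[OF b1 si] by (simp add: ka_def comp_def)
      have "tri_img ka STS = tri_img si (white t1)" by (simp only: ka_def tri_img_tri_img)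
      then show "tri_img ka STS = STS" by (simp only: c[THEN conjunct2])
    qed
    moreover have "?f0 ka (x ^ t1') = ?f0 ta x ^ t2" for x
      using pos by (simp add: ta_def ka_def pow_pow_inv[OF t2] pow_pow_inv[OF t1])
    ultimately show ?thesis using linear_equiv_cong[OF inv_exps_sym[OF t1] t2] by blast
  qed
qed

lemma ex_nontrivial: "\<exists>x::'a. x \<noteq> 0 \<and> x \<noteq> 1"
proof (rule ccontr)
  assume "\<not> ?thesis"
  then have "(UNIV::'a set) \<subseteq> {0, 1}" by auto
  then have "card (UNIV::'a set) \<le> 2" using card_mono[of "{0,1::'a}" UNIV] by simp
  then show False using card_field card_gt by simp
qed

text \<open>The map \<open>h\<close>, half of a rotation step, conjugates \<open>rho t t'\<close> to
  \<open>rho t' t\<close>, so corresponding points have equal periods.\<close>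

lemma closed_surface_inv:
  assumes t: "inv_exps t t'"
  shows "in_closed_surface (\<lambda>x::'a. x ^ t') \<longleftrightarrow> in_closed_surface (\<lambda>x::'a. x ^ t)"
proof -
  obtain x :: 'a where x: "x \<noteq> 0" "x \<noteq> 1" using ex_nontrivial by blast
  define h where "h y = (1 + y) ^ t'" for y :: 'a
  have pw: "(rho t' t ^^ k) (h y) = h ((rho t t' ^^ k) y)" for k y
    by (induction k) (simp_all add: h_def rho_def)
  have inj: "h y = h z \<longleftrightarrow> y = z" for y z
    by (simp add: h_def pow_eq_iff[OF inv_exps_sym[OF t]])
  have "h x \<noteq> 0" using x by (simp add: h_def add_eq_0_iff')
  moreover have "h x \<noteq> 1" using x inj[of x 0] by (simp add: h_def)
  moreover have "period (rho t' t) (h x) = period (rho t t') x"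
    by (simp add: period_def pw inj)
  ultimately show ?thesis using closed_surface_iff[OF inv_exps_sym[OF t]] closed_surface_iff[OF t x] by metis
qed

text \<open>The inverse of \<open>s * 2 ^ j\<close> is \<open>s' * 2 ^ i\<close> with
  \<open>i + j\<close> a multiple of \<open>m\<close>. The two Frobenius powers cancel and the
  rotation is the same map.\<close>

lemma closed_surface_frob:
  assumes s: "inv_exps s s'" and t: "[t = s * 2 ^ j] (mod n)" "0 < t"
  shows "in_closed_surface (\<lambda>x::'a. x ^ t) \<longleftrightarrow> in_closed_surface (\<lambda>x::'a. x ^ s)"
proof -
  obtain x :: 'a where x: "x \<noteq> 0" "x \<noteq> 1" using ex_nontrivial by blast
  have s0: "0 < s" "0 < s'" using s by (auto simp: inv_exps_def)
  define i where "i = (m - 1) * j"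
  have ij: "i + j = m * j" using m_ge_2 by (cases m) (auto simp: i_def)
  have m1: "[2 ^ m = 1] (mod n)" using card_gt by (simp add: cong_def le_mod_geq)
  have "[t * (s' * 2 ^ i) = (s * 2 ^ j) * (s' * 2 ^ i)] (mod n)" using t(1) by (rule cong_scalar_right)
  also have "(s * 2 ^ j) * (s' * 2 ^ i) = (s * s') * 2 ^ (i + j)" by (simp add: power_add ac_simps)
  also have "\<dots> = (s * s') * (2 ^ m) ^ j" by (simp only: ij power_mult)
  also have "[\<dots> = 1 * 1 ^ j] (mod n)"
    by (intro cong_mult cong_pow m1) (use s in \<open>simp add: inv_exps_def\<close>)
  finally have ti: "inv_exps t (s' * 2 ^ i)" using t(2) s0 by (simp add: inv_exps_def)
  have xt: "y ^ t = (y ^ s) ^ 2 ^ j" for y :: 'a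
    using pow_cong'[OF t, of y] s0 by (simp add: power_mult)
  have "rho t (s' * 2 ^ i) y = rho s s' y" for y
  proof -
    have "1 + (1 + y) ^ (s' * 2 ^ i) = (1 + (1 + y) ^ s') ^ 2 ^ i" by (simp add: frob_add power_mult)
    then have "rho t (s' * 2 ^ i) y = (((1 + (1 + y) ^ s') ^ 2 ^ i) ^ s) ^ 2 ^ j" by (simp add: rho_def xt)
    also have "\<dots> = ((1 + (1 + y) ^ s') ^ s) ^ 2 ^ (i + j)"
      by (simp add: power_mult[symmetric] power_add ac_simps)
    also have "\<dots> = (1 + (1 + y) ^ s') ^ s" by (simp only: ij frob_m)
    finally show ?thesis by (simp add: rho_def)
  qed
  then have "rho t (s' * 2 ^ i) = rho s s'" by blast
  then show ?thesis using closed_surface_iff[OF ti x] closed_surface_iff[OF s x] by simp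
qed

text \<open>Representatives of the units modulo \<open>n\<close> up to powers of 2 and inversion.
  The congruence between \<open>t * r\<close> and \<open>2 ^ j\<close> expresses that
  \<open>t\<close> is a power of 2 times the inverse of \<open>r\<close> without naming that
  inverse.\<close>

definition half_system :: "nat set \<Rightarrow> bool" where
  "half_system R \<longleftrightarrow> finite R \<and> (\<forall>r\<in>R. coprime r n)
    \<and> (\<forall>t. coprime t n \<longrightarrow> (\<exists>r\<in>R. \<exists>j. [t = r * 2 ^ j] (mod n) \<or> [t * r = 2 ^ j] (mod n)))
    \<and> (\<forall>r\<in>R. \<forall>s\<in>R. \<forall>j. [s = r * 2 ^ j] (mod n) \<or> [s * r = 2 ^ j] (mod n) \<longrightarrow> r = s)"

lemma cong_mult_inv:
  assumes "inv_exps r r'" shows "[t * r = k] (mod n) \<longleftrightarrow> [t = r' * k] (mod n)"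
proof -
  have r: "[r * r' = 1] (mod n)" using assms by (simp add: inv_exps_def)
  show ?thesis
  proof
    assume "[t * r = k] (mod n)"
    then have "[t * (r * r') = r' * k] (mod n)"
      using cong_scalar_right[of "t * r" k n r'] by (simp add: ac_simps)
    moreover have "[t * (r * r') = t * 1] (mod n)" using cong_mult[OF cong_refl r] .
    ultimately show "[t = r' * k] (mod n)" using cong_trans[OF cong_sym] by fastforce
  next
    assume "[t = r' * k] (mod n)"
    then have "[t * r = k * (r * r')] (mod n)"
      using cong_scalar_right[of t "r' * k" n r] by (simp add: ac_simps)
    moreover have "[k * (r * r') = k * 1] (mod n)" using cong_mult[OF cong_refl r] .
    ultimately show "[t * r = k] (mod n)" using cong_trans by fastforce
  qed
qed

lemma coprime_pos: "coprime t n \<Longrightarrow> 0 < t"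
  using coprime_inv_exps inv_exps_def by metis

lemma half_system_cover:
  assumes R: "half_system R" and t: "coprime t n"
  obtains r r' where "r \<in> R" "inv_exps r r'" "white t = white r \<or> white t = white r'"
    "in_closed_surface (\<lambda>x::'a. x ^ t) \<longleftrightarrow> in_closed_surface (\<lambda>x::'a. x ^ r)"
proof -
  obtain r j where r: "r \<in> R" "[t = r * 2 ^ j] (mod n) \<or> [t * r = 2 ^ j] (mod n)"
    using R t unfolding half_system_def by blast
  then have "coprime r n" using R unfolding half_system_def by blast
  then obtain r' where r': "inv_exps r r'" using coprime_inv_exps by blast
  have pos: "0 < r" "0 < r'" "0 < t" using r' coprime_pos[OF t] by (auto simp: inv_exps_def)
  from r(2) show ?thesis
  proof
    assume c: "[t = r * 2 ^ j] (mod n)"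
    show ?thesis using that[OF r(1) r'] white_frob[OF c] pos closed_surface_frob[OF r' c] by blast
  next
    assume "[t * r = 2 ^ j] (mod n)"
    then have c: "[t = r' * 2 ^ j] (mod n)" using cong_mult_inv[OF r'] by blast
    show ?thesis
      using that[OF r(1) r'] white_frob[OF c] pos closed_surface_frob[OF inv_exps_sym[OF r'] c] closed_surface_inv[OF r']
      by blast
  qed
qed

text \<open>Frobenius and inversion bring every embedding to a representative, and by linear
  equivalence the isomorphism class determines the exponent up to these two operations.\<close>

theorem num_iso_classes_half_system:
  assumes R: "half_system R"
  shows "num_iso_classes T = card {r \<in> R. in_closed_surface (\<lambda>x::'a. x ^ r)}"
proof -
  let ?SE = "surface_embeddings T"
  let ?rel = "{(W1, W2). W1 \<in> ?SE \<and> W2 \<in> ?SE \<and> emb_iso W1 W2}"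
  let ?G = "{r \<in> R. in_closed_surface (\<lambda>x::'a. x ^ r)}"
  have SE: "W \<in> ?SE \<longleftrightarrow> (\<exists>t. W = white t \<and> coprime t n \<and> in_closed_surface (\<lambda>x::'a. x ^ t))" for W
    by (auto simp: surface_embeddings_def monomial_exps_def card_field)
  have on: "on_nonzero W" if "W \<in> ?SE" for W using that on_nonzero_white by (auto simp: SE)
  have eq: "equiv ?SE ?rel"
  proof (rule equivI)
    show "?rel \<subseteq> ?SE \<times> ?SE" by auto
    show "refl_on ?SE ?rel" by (auto simp: refl_on_def emb_iso_refl)
    show "sym ?rel" using emb_iso_sym on unfolding sym_def by blast
    show "trans ?rel" using emb_iso_trans unfolding trans_def by blast
  qed
  have cop: "coprime r n" if "r \<in> R" for r using R that unfolding half_system_def by blast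
  have in_SE: "white r \<in> ?SE" if "r \<in> ?G" for r using that cop unfolding SE by blast
  have "bij_betw (\<lambda>r. ?rel `` {white r}) ?G (?SE // ?rel)"
  proof (rule bij_betw_imageI)
    show "inj_on (\<lambda>r. ?rel `` {white r}) ?G"
    proof (rule inj_onI)
      fix r s assume rs: "r \<in> ?G" "s \<in> ?G" "?rel `` {white r} = ?rel `` {white s}"
      have iso: "emb_iso (white r) (white s)"
        using eq_equiv_class[OF rs(3) eq in_SE[OF rs(2)]] by simp
      have "coprime r n" "coprime s n" using rs(1,2) cop by simp_all
      then obtain r' s' where r': "inv_exps r r'" and s': "inv_exps s s'" using coprime_inv_exps by metis
      obtain j where "[s = r * 2 ^ j] (mod n) \<or> [s = r' * 2 ^ j] (mod n)"
        using emb_iso_imp_cong[OF r' s' iso] by blast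
      then have "[s = r * 2 ^ j] (mod n) \<or> [s * r = 2 ^ j] (mod n)" using cong_mult_inv[OF r'] by blast
      then show "r = s" using R rs(1,2) unfolding half_system_def by blast
    qed
    show "(\<lambda>r. ?rel `` {white r}) ` ?G = ?SE // ?rel"
    proof
      show "(\<lambda>r. ?rel `` {white r}) ` ?G \<subseteq> ?SE // ?rel"
        by (intro image_subsetI quotientI in_SE)
      show "?SE // ?rel \<subseteq> (\<lambda>r. ?rel `` {white r}) ` ?G"
      proof
        fix X assume "X \<in> ?SE // ?rel"
        then obtain W where W: "W \<in> ?SE" "X = ?rel `` {W}" by (rule quotientE)
        then obtain t where t: "W = white t" "coprime t n" "in_closed_surface (\<lambda>x::'a. x ^ t)" unfolding SE by blast
        obtain r r' where r: "r \<in> R" "inv_exps r r'" "white t = white r \<or> white t = white r'"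
          "in_closed_surface (\<lambda>x::'a. x ^ r)" using half_system_cover[OF R t(2)] t(3) by metis
        have rG: "r \<in> ?G" using r by simp
        have "emb_iso (white r) (white t)" using r(3) white_inv[OF r(2)] emb_iso_refl by metis
        then have "(white r, white t) \<in> ?rel" using in_SE[OF rG] W t by simp
        then have "?rel `` {white r} = X" unfolding W(2) t(1) by (rule equiv_class_eq[OF eq])
        then show "X \<in> (\<lambda>r. ?rel `` {white r}) ` ?G" using rG by blast
      qed
    qed
  qed
  then show ?thesis unfolding num_iso_classes_def by (rule bij_betw_same_card[symmetric])
qed

text \<open>A white set is, as a set, that of a representative or of the inverse of one; hence two
  refutations for each representative.\<close>

theorem all_nonorientable_half_system:
  assumes R: "half_system R"
    and no: "\<And>r r'. r \<in> R \<Longrightarrow> inv_exps r r' \<Longrightarrow> in_closed_surface (\<lambda>x::'a. x ^ r)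
      \<Longrightarrow> \<not> orientable STS (white r) \<and> \<not> orientable STS (white r')"
  shows "all_nonorientable T"
proof -
  have "\<not> orientable STS W" if "W \<in> surface_embeddings T" for W
  proof -
    obtain t where t: "W = white t" "coprime t n" "in_closed_surface (\<lambda>x::'a. x ^ t)"
      using \<open>W \<in> surface_embeddings T\<close> by (auto simp: surface_embeddings_def monomial_exps_def card_field)
    obtain r r' where r: "r \<in> R" "inv_exps r r'" "white t = white r \<or> white t = white r'"
      "in_closed_surface (\<lambda>x::'a. x ^ r)" using half_system_cover[OF R t(2)] t(3) by metis
    then show ?thesis using no[OF r(1,2,4)] t(1) by metis
  qed
  then show ?thesis by (simp add: all_nonorientable_def)
qed

end

section \<open>Roots of binary polynomials\<close>

primrec bpoly :: "bool list \<Rightarrow> 'b::field poly" where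
  "bpoly [] = 0" | "bpoly (b # bs) = pCons (of_bool b) (bpoly bs)"

fun xorl :: "bool list \<Rightarrow> bool list \<Rightarrow> bool list" where
  "xorl [] ys = ys" | "xorl xs [] = xs" | "xorl (x # xs) (y # ys) = (x \<noteq> y) # xorl xs ys"

primrec sqrl :: "bool list \<Rightarrow> bool list" where
  "sqrl [] = []" | "sqrl (b # bs) = b # False # sqrl bs"

text \<open>Coefficient lists start with the constant term, and \<open>q\<close> is the modulus
  without its leading term, so the coefficient that leaves the list at the top returns as a multiple
  of \<open>q\<close>.\<close>

definition timesX :: "bool list \<Rightarrow> bool list \<Rightarrow> bool list" where
  "timesX q xs = xorl (False # butlast xs) (if last xs then q else [])"

text \<open>Horner's scheme for the remainder modulo the monic polynomial with lower part
  \<open>q\<close>.\<close>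

primrec reml :: "bool list \<Rightarrow> bool list \<Rightarrow> bool list" where
  "reml q [] = replicate (length q) False" | "reml q (b # bs) = xorl [b] (timesX q (reml q bs))"

text \<open>The counter is a list of which only the length matters: one squaring for each
  element.\<close>

primrec sqr_iter :: "bool list \<Rightarrow> bool list \<Rightarrow> bool list \<Rightarrow> bool list" where
  "sqr_iter q [] s = s" | "sqr_iter q (_ # k) s = sqr_iter q k (reml q (sqrl s))"

context binary_field
begin

lemma of_bool_xor: "of_bool (a \<noteq> b) = (of_bool a + of_bool b :: 'a)"
  using add_self[of 1] by (cases a; cases b) auto

lemma bpoly_xorl: "bpoly (xorl xs ys) = (bpoly xs + bpoly ys :: 'a poly)"
  by (induction xs ys rule: xorl.induct) (simp_all add: of_bool_xor two_eq_0)

lemma poly_add_self: "p + p = (0 :: 'a poly)"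
  by (rule poly_eqI) (simp only: coeff_add add_self coeff_0)

lemma poly_sq_add: "(p + q :: 'a poly)\<^sup>2 = p\<^sup>2 + q\<^sup>2"
  using poly_add_self[of "p * q"] by (simp add: power2_eq_square algebra_simps)

lemma bpoly_sqrl: "bpoly (sqrl xs) = (bpoly xs :: 'a poly)\<^sup>2"
proof (induction xs)
  case (Cons b xs)
  have "(pCons (of_bool b) (bpoly xs) :: 'a poly) = [:of_bool b:] + pCons 0 (bpoly xs)" by simp
  then have "(pCons (of_bool b) (bpoly xs) :: 'a poly)\<^sup>2 = [:of_bool b:]\<^sup>2 + (pCons 0 (bpoly xs))\<^sup>2" by (simp only: poly_sq_add)
  then show ?case using Cons by (cases b) (simp_all add: power2_eq_square)
qed simp

lemma bpoly_False: "bpoly (replicate k False) = 0"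
  by (induction k) simp_all

lemma bpoly_snoc: "bpoly (xs @ [b]) = (bpoly xs + monom (of_bool b) (length xs) :: 'a poly)"
  by (induction xs) (simp_all add: monom_Suc monom_0)

lemma length_xorl: "length (xorl xs ys) = max (length xs) (length ys)"
  by (induction xs ys rule: xorl.induct) simp_all

lemma length_timesX: "length xs = length q \<Longrightarrow> 0 < length q \<Longrightarrow> length (timesX q xs) = length q"
  by (simp add: timesX_def length_xorl)

lemma length_reml: "0 < length q \<Longrightarrow> length (reml q xs) = length q"
  by (induction xs) (auto simp: length_xorl length_timesX max_def Suc_le_eq)

lemma timesX_cong:
  assumes "length xs = length q" "0 < length q"
  shows "(monom 1 (length q) + bpoly q :: 'a poly) dvd bpoly (timesX q xs) - pCons 0 (bpoly xs)"
proof -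
  let ?p = "monom 1 (length q) + bpoly q :: 'a poly"
  obtain k where k: "length q = Suc k" using assms(2) by (cases "length q") auto
  have "xs = butlast xs @ [last xs]" using assms by (metis append_butlast_last_id length_greater_0_conv)
  then have "bpoly xs = (bpoly (butlast xs) + monom (of_bool (last xs)) k :: 'a poly)"
    using bpoly_snoc[of "butlast xs" "last xs"] assms k by simp
  then have "pCons 0 (bpoly xs) = (pCons 0 (bpoly (butlast xs)) + monom (of_bool (last xs)) (length q) :: 'a poly)"
    by (simp add: k monom_Suc)
  then have "bpoly (timesX q xs) - pCons 0 (bpoly xs)
      = bpoly (if last xs then q else []) - (monom (of_bool (last xs)) (length q) :: 'a poly)"
    by (simp add: timesX_def bpoly_xorl)
  also have "\<dots> = (if last xs then ?p - (monom 1 (length q) + monom 1 (length q)) else 0)"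
    by simp
  also have "\<dots> = (if last xs then ?p else 0)" by (simp add: poly_add_self)
  finally show ?thesis by simp
qed

lemma reml_cong:
  assumes "0 < length q"
  shows "(monom 1 (length q) + bpoly q :: 'a poly) dvd bpoly (reml q xs) - bpoly xs"
proof (induction xs)
  case Nil show ?case by (simp add: bpoly_False)
next
  case (Cons b xs)
  have "bpoly (reml q (b # xs)) - bpoly (b # xs)
     = (bpoly (timesX q (reml q xs)) - pCons 0 (bpoly (reml q xs))) + pCons 0 (bpoly (reml q xs) - bpoly xs :: 'a poly)"
    by (simp add: bpoly_xorl)
  moreover have "(monom 1 (length q) + bpoly q :: 'a poly) dvd pCons 0 (bpoly (reml q xs) - bpoly xs)"
    using dvd_mult[OF Cons, of "[:0, 1:]"] by simp
  ultimately show ?case using timesX_cong[OF length_reml[OF assms] assms] by (metis dvd_add)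
qed

lemma sqr_iter_cong:
  assumes "0 < length q"
  shows "(monom 1 (length q) + bpoly q :: 'a poly) dvd bpoly (sqr_iter q k s) - bpoly s ^ 2 ^ length k"
proof (induction k arbitrary: s)
  case (Cons x k)
  let ?p = "monom 1 (length q) + bpoly q :: 'a poly" and ?r = "bpoly (reml q (sqrl s)) :: 'a poly"
  have "?p dvd ?r - bpoly s ^ 2" using reml_cong[OF assms, of "sqrl s"] by (simp add: bpoly_sqrl)
  moreover have "?r - bpoly s ^ 2 dvd ?r ^ 2 ^ length k - (bpoly s ^ 2) ^ 2 ^ length k"
    by (simp add: power_diff_sumr2)
  ultimately have d1: "?p dvd ?r ^ 2 ^ length k - (bpoly s ^ 2) ^ 2 ^ length k" by (rule dvd_trans)
  have d2: "?p dvd bpoly (sqr_iter q k (reml q (sqrl s))) - ?r ^ 2 ^ length k" by (rule Cons.IH)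
  show ?case using dvd_add[OF d2 d1] by (simp add: power_mult)
qed simp

text \<open>The computed equation, whose right side is \<open>X\<close> padded with zeros, says that
  \<open>X ^ m + q\<close> divides \<open>X - X ^ (2 ^ m)\<close>, which vanishes on the whole
  field. The cofactor has degree at most \<open>2 ^ m - m\<close> and cannot vanish at all
  \<open>2 ^ m\<close> elements, so the divisor has a root.\<close>

lemma ex_root:
  assumes "sqr_iter q k [False, True] = xorl [False, True] (replicate l False)" "length k = m" "length q = m"
  obtains g :: 'a where "g ^ m = poly (bpoly q) g"
proof -
  let ?p = "monom 1 m + bpoly q :: 'a poly" and ?X = "[:0, 1:] :: 'a poly"
  have m0: "0 < length q" using assms(3) m_ge_2 by simp
  have "?p dvd ?X - ?X ^ 2 ^ m"
    using sqr_iter_cong[OF m0, of k "[False, True]"] assms by (simp add: bpoly_xorl bpoly_False)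
  then obtain r where r: "?X - ?X ^ 2 ^ m = ?p * r" by (elim dvdE)
  have X: "?X = monom 1 1" by (simp add: monom_Suc monom_0)
  have Xp: "?X ^ 2 ^ m = monom 1 (2 ^ m)" unfolding X by (simp add: monom_power)
  have nz: "?X - ?X ^ 2 ^ m \<noteq> 0"
  proof
    assume "?X - ?X ^ 2 ^ m = 0"
    then have "?X = ?X ^ 2 ^ m" by simp
    then have "monom 1 1 = (monom 1 (2 ^ m) :: 'a poly)" using X Xp by metis
    then have "(1::nat) = 2 ^ m" by (metis degree_monom_eq zero_neq_one)
    then show False using card_gt by simp
  qed
  have degq: "degree (bpoly q :: 'a poly) < m"
  proof -
    have "degree (bpoly q :: 'a poly) \<le> length q - 1" for q
    proof (induction q)
      case (Cons b q) then show ?case by (cases q) (auto simp: degree_pCons_eq_if)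
    qed simp
    then show ?thesis using assms(3) m0 by (metis Suc_diff_1 less_Suc_eq_le)
  qed
  then have degp: "degree ?p = m" by (subst degree_add_eq_left) (simp_all add: degree_monom_eq)
  have r0: "r \<noteq> 0" "?p \<noteq> 0" using r nz by auto
  have "degree (?X - ?X ^ 2 ^ m) \<le> 2 ^ m"
    unfolding Xp by (intro degree_diff_le) (simp_all add: degree_monom_eq)
  then have degr: "degree r + m \<le> 2 ^ m" using r degree_mult_eq[OF r0(2,1)] degp by simp
  have "\<exists>g. poly ?p g = 0"
  proof (rule ccontr)
    assume np: "\<not> ?thesis"
    have "poly (?X - ?X ^ 2 ^ m) g = 0" for g using frob_m[of g 1] by simp
    then have "poly r g = 0" for g using np r by (metis mult_eq_0_iff poly_mult)
    then have "(UNIV::'a set) \<subseteq> {x. poly r x = 0}" by auto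
    then have "card (UNIV::'a set) \<le> degree r"
      using card_poly_roots_bound[OF r0(1)] card_mono[OF poly_roots_finite[OF r0(1)]] le_trans by blast
    then show False using degr card_field m_ge_2 by simp
  qed
  then obtain g where "poly ?p g = 0" by blast
  then have "g ^ m + poly (bpoly q) g = 0" by (simp add: poly_monom)
  then show ?thesis using that add_eq_0_iff' by blast
qed

end

section \<open>Coordinates of exponents\<close>

text \<open>If the order were a proper divisor of the product, some prime factor could be cancelled
  from the product with the power still being 1.\<close>

lemma ordI:
  fixes a N :: nat
  assumes "[a ^ prod_list ps = 1] (mod N)" "\<forall>p\<in>set ps. prime p \<and> \<not> [a ^ (prod_list ps div p) = 1] (mod N)"
  shows "ord N a = prod_list (ps :: nat list)"
proof (rule ccontr)
  assume ne: "ord N a \<noteq> prod_list ps"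
  have "ord N a dvd prod_list ps" using assms(1) ord_divides by blast
  then obtain e where e: "prod_list ps = ord N a * e" by (elim dvdE)
  have "e \<noteq> 1" using ne e by auto
  then obtain q where q: "prime q" "q dvd e" using prime_factor_nat by blast
  have "q dvd prod_list ps" using q e by simp
  moreover have "q \<in> set ps" if "q dvd prod_list ps" "\<forall>p\<in>set ps. prime p" for ps :: "nat list"
    using that
  proof (induction ps)
    case Nil then show ?case using q(1) by simp
  next
    case (Cons p ps)
    from Cons.prems(1) have "q dvd p \<or> q dvd prod_list ps" using prime_dvd_multD[OF q(1)] by simp
    then show ?case using Cons primes_dvd_imp_eq[OF q(1)] by auto
  qed
  ultimately have "q \<in> set ps" using assms(2) by blast
  obtain f where f: "e = q * f" using q(2) by (elim dvdE)
  have "prod_list ps div q = ord N a * f" using e f q(1) by (simp add: ac_simps prime_gt_0_nat)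
  then have "ord N a dvd prod_list ps div q" by simp
  then have "[a ^ (prod_list ps div q) = 1] (mod N)" using ord_divides by blast
  then show False using assms(2) \<open>q \<in> set ps\<close> by blast
qed

text \<open>One of each two opposite pairs modulo \<open>L\<close> and \<open>H\<close>. The second
  coordinate decides only where the first is its own negative.\<close>

definition half_pairs :: "nat \<Rightarrow> nat \<Rightarrow> (nat \<times> nat) set" where
  "half_pairs L H = {(a, b). a < L \<and> b < H \<and> (0 < a \<and> 2 * a < L \<or> (a = 0 \<or> 2 * a = L) \<and> 2 * b \<le> H)}"

text \<open>The units modulo \<open>n\<close> as a direct product of cyclic groups generated by 2,
  \<open>al\<close> and \<open>be\<close>. Independence is assumed; that the three generate all
  units follows by counting.\<close>

locale exponent_coords = binary_field m T for m and T :: "'a::{field,finite} itself" +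
  fixes al be L H :: nat
  assumes al: "[al ^ L = 1] (mod n)" and be: "[be ^ H = 1] (mod n)" and pos: "0 < L" "0 < H"
    and coords_one: "\<And>j a b. [2 ^ j * al ^ a * be ^ b = 1] (mod n) \<Longrightarrow> m dvd j \<and> L dvd a \<and> H dvd b"
    and totient_n: "totient n = m * L * H"
begin

definition ex :: "nat \<Rightarrow> nat \<Rightarrow> nat" where "ex a b = al ^ a * be ^ b"

lemma two_m: "[2 ^ m = 1] (mod n)" using card_gt by (simp add: cong_def le_mod_geq)

lemma two_mult: "[2 ^ (m * k) = 1] (mod n)" using cong_pow[OF two_m, of k] by (simp add: power_mult)
lemma al_mult: "[al ^ (L * k) = 1] (mod n)" using cong_pow[OF al, of k] by (simp add: power_mult)
lemma be_mult: "[be ^ (H * k) = 1] (mod n)" using cong_pow[OF be, of k] by (simp add: power_mult)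

lemma pow_mod_cong:
  assumes "[x ^ k = 1] (mod N)" shows "[x ^ i = x ^ (i mod k)] (mod (N::nat))"
proof -
  have "[x ^ (k * (i div k)) * x ^ (i mod k) = 1 * x ^ (i mod k)] (mod N)"
    using cong_pow[OF assms, of "i div k"] by (intro cong_mult) (simp_all add: power_mult)
  then show ?thesis by (simp add: power_add[symmetric])
qed

lemma coords_mod: "[2 ^ j * ex a b = 2 ^ (j mod m) * ex (a mod L) (b mod H)] (mod n)"
  unfolding ex_def by (intro cong_mult pow_mod_cong two_m al be)

text \<open>Division is replaced by multiplication with the element whose coordinates complete
  \<open>j'\<close>, \<open>a'\<close> and \<open>b'\<close> to multiples of the three
  orders.\<close>

lemma coords_cancel:
  assumes "[2 ^ j * ex a b = 2 ^ j' * ex a' b'] (mod n)"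
  shows "[j = j'] (mod m)" "[a = a'] (mod L)" "[b = b'] (mod H)"
proof -
  define j2 a2 b2 where "j2 = (m - 1) * j'" and "a2 = (L - 1) * a'" and "b2 = (H - 1) * b'"
  have s: "j' + j2 = m * j'" "a' + a2 = L * a'" "b' + b2 = H * b'"
    using m_ge_2 pos by (auto simp: j2_def a2_def b2_def algebra_simps)
  have "[2 ^ j * ex a b * (2 ^ j2 * ex a2 b2) = 2 ^ j' * ex a' b' * (2 ^ j2 * ex a2 b2)] (mod n)"
    by (intro cong_mult assms cong_refl)
  also have "2 ^ j' * ex a' b' * (2 ^ j2 * ex a2 b2) = 2 ^ (m * j') * al ^ (L * a') * be ^ (H * b')"
    by (simp only: s[symmetric]) (simp only: power_add ex_def ac_simps)
  also have "[\<dots> = 1 * 1 * 1] (mod n)" by (intro cong_mult two_mult al_mult be_mult)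
  finally have "[2 ^ (j + j2) * al ^ (a + a2) * be ^ (b + b2) = 1] (mod n)"
    by (simp add: power_add ex_def ac_simps)
  from coords_one[OF this] have d: "m dvd j + j2" "L dvd a + a2" "H dvd b + b2" by auto
  have aux: "[x = x'] (mod k)" if "k dvd x + y" "x' + y = k * x'" for x x' y k :: nat
  proof -
    have "[x + y = x' + y] (mod k)" using that by (simp add: cong_def mod_eq_0_iff_dvd)
    then show ?thesis by (simp add: cong_add_rcancel_nat)
  qed
  show "[j = j'] (mod m)" "[a = a'] (mod L)" "[b = b'] (mod H)"
    using aux[OF d(1) s(1)] aux[OF d(2) s(2)] aux[OF d(3) s(3)] by auto
qed

lemma coords_coprime: "coprime (2 ^ j * ex a b) n"
proof -
  have "[(2 ^ j * ex a b) * (2 ^ ((m - 1) * j) * ex ((L - 1) * a) ((H - 1) * b)) = 1] (mod n)"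
  proof -
    have s: "j + (m - 1) * j = m * j" "a + (L - 1) * a = L * a" "b + (H - 1) * b = H * b"
      using m_ge_2 pos by (auto simp: algebra_simps)
    have "(2 ^ j * ex a b) * (2 ^ ((m - 1) * j) * ex ((L - 1) * a) ((H - 1) * b))
       = 2 ^ (m * j) * al ^ (L * a) * be ^ (H * b)"
      by (simp only: s[symmetric]) (simp only: power_add ex_def ac_simps)
    moreover have "[2 ^ (m * j) * al ^ (L * a) * be ^ (H * b) = 1 * 1 * 1] (mod n)"
      by (intro cong_mult two_mult al_mult be_mult)
    ultimately show ?thesis by simp
  qed
  then show ?thesis using coprime_iff_invertible_nat[of _ n] by auto
qed

text \<open>Distinct coordinate triples within range give distinct units, and there are as many
  triples as units.\<close>

lemma coords_surj:
  assumes "coprime t n" obtains j a b where "a < L" "b < H" "[t = 2 ^ j * ex a b] (mod n)"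
proof -
  let ?D = "{..<m} \<times> {..<L} \<times> {..<H}" and ?f = "\<lambda>(j, a, b). (2 ^ j * ex a b) mod n"
  have inj: "inj_on ?f ?D"
  proof (rule inj_onI, clarsimp)
    fix j a b j' a' b'
    assume *: "j < m" "a < L" "b < H" "j' < m" "a' < L" "b' < H"
      and "2 ^ j * ex a b mod (2 ^ m - Suc 0) = 2 ^ j' * ex a' b' mod (2 ^ m - Suc 0)"
    then have "[2 ^ j * ex a b = 2 ^ j' * ex a' b'] (mod n)" by (simp add: cong_def)
    from coords_cancel[OF this] show "j = j' \<and> a = a' \<and> b = b'" using * by (simp add: cong_def)
  qed
  have sub: "?f ` ?D \<subseteq> totatives n"
  proof
    fix x assume "x \<in> ?f ` ?D"
    then obtain j a b where x: "x = (2 ^ j * ex a b) mod n" by auto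
    have c: "coprime x n" using coords_coprime[of j a b] unfolding x by (metis coprime_mod_left_iff n_gt not_less_zero gr_zeroI)
    then have "0 < x" by (rule coprime_pos)
    moreover have "x \<le> n" using n_gt by (simp add: x less_imp_le)
    ultimately show "x \<in> totatives n" using c by (simp add: totatives_def)
  qed
  have "?f ` ?D = totatives n"
    using sub card_image[OF inj] totient_n by (intro card_subset_eq) (simp_all add: totient_def card_cartesian_product)
  moreover have "t mod n \<in> totatives n"
  proof -
    have c: "coprime (t mod n) n" using assms n_gt by (metis coprime_mod_left_iff not_less_zero gr_zeroI)
    then show ?thesis using coprime_pos[OF c] n_gt by (simp add: totatives_def less_imp_le)
  qed
  ultimately obtain j a b where "a < L" "b < H" "t mod n = (2 ^ j * ex a b) mod n" by force
  then show ?thesis using that by (simp add: cong_def)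
qed

lemma al_be_pos: "0 < al" "0 < be"
proof -
  have "al \<noteq> 0" using al pos n_gt by (metis cong_0_1_nat cong_sym nat_neq_iff power_0_left pos(1))
  moreover have "be \<noteq> 0" using be pos n_gt by (metis cong_0_1_nat cong_sym nat_neq_iff power_0_left)
  ultimately show "0 < al" "0 < be" by auto
qed

lemma ex_pos: "0 < ex a b" using al_be_pos by (simp add: ex_def)

lemma inj_ex: "inj_on (\<lambda>(a, b). ex a b) ({..<L} \<times> {..<H})"
proof (rule inj_onI, clarsimp)
  fix a b a' b' assume *: "a < L" "b < H" "a' < L" "b' < H" "ex a b = ex a' b'"
  then have "[2 ^ 0 * ex a b = 2 ^ 0 * ex a' b'] (mod n)" by simp
  from coords_cancel[OF this] show "a = a' \<and> b = b'" using * by (simp add: cong_def)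
qed

text \<open>In coordinates a power of 2 changes only \<open>j\<close>, and inversion negates
  \<open>a\<close> and \<open>b\<close>; so one pair from each two opposite ones represents all
  units.\<close>

lemma half_system_pairs: "half_system ((\<lambda>(a, b). ex a b) ` half_pairs L H)"
proof -
  let ?R = "(\<lambda>(a, b). ex a b) ` half_pairs L H"
  have "half_pairs L H \<subseteq> {..<L} \<times> {..<H}" by (auto simp: half_pairs_def)
  then have fin: "finite (half_pairs L H)" by (rule finite_subset) simp
  have neg: "\<exists>(c, d) \<in> half_pairs L H. (c = a \<and> d = b) \<or> ([c + a = 0] (mod L) \<and> [d + b = 0] (mod H))"
    if ab: "a < L" "b < H" for a b
  proof -
    have z: "[(L - a) mod L + a = 0] (mod L)" "[(H - b) mod H + b = 0] (mod H)"
      using ab by (simp_all add: cong_def mod_simps)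
    show ?thesis
    proof (cases "(a, b) \<in> half_pairs L H")
      case False
      then consider "a \<noteq> 0" "2 * a > L" | "a = 0 \<or> 2 * a = L" "2 * b > H"
        using ab by (auto simp: half_pairs_def) linarith+
      then have "((L - a) mod L, (H - b) mod H) \<in> half_pairs L H"
      proof cases
        case 1 then show ?thesis using ab by (auto simp: half_pairs_def)
      next
        case 2
        then have "b \<noteq> 0" by auto
        then show ?thesis using 2 ab by (auto simp: half_pairs_def)
      qed
      then show ?thesis using z by blast
    qed blast
  qed
  have uniq: "(a, b) = (c, d)"
    if "(a, b) \<in> half_pairs L H" "(c, d) \<in> half_pairs L H"
      "[a + c = 0] (mod L)" "[b + d = 0] (mod H)" for a b c d
  proof -
    have lt: "a < L" "b < H" "c < L" "d < H" using that by (auto simp: half_pairs_def)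
    have "L dvd a + c" "H dvd b + d" using that by (auto simp: cong_0_iff)
    then obtain k l where kl: "a + c = L * k" "b + d = H * l" by (auto elim!: dvdE)
    have "L * k < L * 2" "H * l < H * 2" using kl lt by linarith+
    then have "k = 0 \<or> k = 1" "l = 0 \<or> l = 1" by auto
    then have ac: "a + c = 0 \<or> a + c = L" and bd: "b + d = 0 \<or> b + d = H" using kl by auto
    have "a = c" using ac that(1,2) lt unfolding half_pairs_def by auto
    then have "a = 0 \<or> 2 * a = L" using ac by auto
    then have "2 * b \<le> H" "2 * d \<le> H" using that(1,2) \<open>a = c\<close> unfolding half_pairs_def by auto
    then have "b = d" using bd by auto
    with \<open>a = c\<close> show ?thesis by simp
  qed
  show ?thesis unfolding half_system_def
  proof (intro conjI ballI allI impI)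
    show "finite ?R" using fin by simp
    show "coprime r n" if "r \<in> ?R" for r using that coords_coprime[of 0] by auto
    show "\<exists>r\<in>?R. \<exists>j. [t = r * 2 ^ j] (mod n) \<or> [t * r = 2 ^ j] (mod n)" if t: "coprime t n" for t
    proof -
      obtain j a b where ab: "a < L" "b < H" "[t = 2 ^ j * ex a b] (mod n)" using coords_surj[OF t] .
      obtain c d where cd: "(c, d) \<in> half_pairs L H"
        "(c = a \<and> d = b) \<or> ([c + a = 0] (mod L) \<and> [d + b = 0] (mod H))" using neg[OF ab(1,2)] by blast
      from cd(2) show ?thesis
      proof
        assume "c = a \<and> d = b"
        then show ?thesis using cd(1) ab(3) by (intro bexI[of _ "ex c d"]) (auto simp: mult.commute)
      next
        assume z: "[c + a = 0] (mod L) \<and> [d + b = 0] (mod H)"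
        have "[t * ex c d = 2 ^ j * ex a b * ex c d] (mod n)" using ab(3) by (rule cong_scalar_right)
        also have "2 ^ j * ex a b * ex c d = 2 ^ j * ex (c + a) (d + b)" by (simp add: ex_def power_add ac_simps)
        also have "[ex (c + a) (d + b) = 1] (mod n)"
          using coords_mod[of 0 "c + a" "d + b"] z by (simp add: cong_def ex_def)
        then have "[2 ^ j * ex (c + a) (d + b) = 2 ^ j * 1] (mod n)" by (intro cong_mult cong_refl)
        finally have "[t * ex c d = 2 ^ j] (mod n)" by simp
        then show ?thesis using cd(1) by (intro bexI[of _ "ex c d"]) auto
      qed
    qed
    show "r = s" if rs: "r \<in> ?R" "s \<in> ?R" "[s = r * 2 ^ j] (mod n) \<or> [s * r = 2 ^ j] (mod n)" for r s j
    proof -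
      obtain a b c d where ab: "(a, b) \<in> half_pairs L H" "r = ex a b" and cd: "(c, d) \<in> half_pairs L H" "s = ex c d"
        using rs by auto
      have lt: "a < L" "b < H" "c < L" "d < H" using ab cd by (auto simp: half_pairs_def)
      from rs(3) show ?thesis
      proof
        assume "[s = r * 2 ^ j] (mod n)"
        then have "[2 ^ 0 * ex c d = 2 ^ j * ex a b] (mod n)" by (simp add: ab cd mult.commute)
        from coords_cancel(2,3)[OF this] show ?thesis using lt ab cd by (simp add: cong_def)
      next
        assume "[s * r = 2 ^ j] (mod n)"
        then have "[2 ^ 0 * ex (a + c) (b + d) = 2 ^ j * ex 0 0] (mod n)" by (simp add: ab cd ex_def power_add ac_simps)
        from coords_cancel(2,3)[OF this] show ?thesis using uniq[OF ab(1) cd(1)] ab cd by auto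
      qed
    qed
  qed
qed

end

section \<open>Walks along rotation lines\<close>

definition pl :: "nat \<Rightarrow> nat \<Rightarrow> nat \<Rightarrow> nat" where "pl k x y = (x + y) mod k"

text \<open>Half steps: a rotation adds 1 and takes a power twice, with mutually inverse exponents,
  so swapping the arguments after each half step gives one uniform rule.\<close>

primrec rr :: "nat \<Rightarrow> 'b::field \<Rightarrow> nat \<Rightarrow> nat \<Rightarrow> 'b" where
  "rr 0 x t t' = x" | "rr (Suc k) x t t' = rr k ((1 + x) ^ t) t' t"

definition fr :: "nat \<Rightarrow> 'b::field \<Rightarrow> 'b" where "fr e x = x ^ 2 ^ e"

definition elm :: "nat \<Rightarrow> nat \<Rightarrow> 'b::field \<Rightarrow> nat \<Rightarrow> nat \<Rightarrow> nat \<Rightarrow> 'b" where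
  "elm al be g j a b = g ^ (2 ^ j * (al ^ a * be ^ b))"

definition runm :: "nat \<Rightarrow> nat \<Rightarrow> 'b::field \<Rightarrow> nat \<Rightarrow> nat \<Rightarrow> nat \<Rightarrow> nat \<Rightarrow> nat \<Rightarrow> nat \<Rightarrow> nat \<Rightarrow> nat \<Rightarrow> 'b" where
  "runm al be g k j a b u v w z = rr k (elm al be g j a b) (al ^ u * be ^ v) (al ^ w * be ^ z)"

text \<open>Each round is 144 half steps, that is 72 rotations, so that long step counts are written
  with digits of base 72.\<close>

primrec it :: "nat \<Rightarrow> 'b::field \<Rightarrow> nat \<Rightarrow> nat \<Rightarrow> 'b" where
  "it 0 x t t' = x" | "it (Suc k) x t t' = it k (rr 144 x t t') t t'"

definition itm :: "nat \<Rightarrow> nat \<Rightarrow> nat \<Rightarrow> 'b::field \<Rightarrow> nat \<Rightarrow> nat \<Rightarrow> nat \<Rightarrow> nat \<Rightarrow> 'b" where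
  "itm al be k x u v w z = it k x (al ^ u * be ^ v) (al ^ w * be ^ z)"

text \<open>Leaving the first label open means equality up to Frobenius.\<close>

definition samem :: "nat \<Rightarrow> nat \<Rightarrow> 'b::field \<Rightarrow> nat \<Rightarrow> nat \<Rightarrow> 'b \<Rightarrow> bool" where
  "samem al be g a b x \<longleftrightarrow> (\<exists>i. x = elm al be g i a b)"

text \<open>Opaque copies of the identity and of doubling: applied to a digit they are unfolded
  successor by successor, as a counter.\<close>

definition un :: "nat \<Rightarrow> nat" where "un x = x"
definition un2 :: "nat \<Rightarrow> nat" where "un2 x = 2 * x"

context binary_field
begin

lemma rr_rho: "rr (2 * k) x t' t = (rho t t' ^^ k) x"
proof (induction k arbitrary: x)
  case (Suc k)
  have "rr (2 * Suc k) x t' t = rr (2 * k) (rho t t' x) t' t" by (simp add: rho_def)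
  then show ?case using Suc by (simp add: funpow_swap1)
qed simp

lemma it_rho: "it k x t' t = (rho t t' ^^ (72 * k)) x"
proof (induction k arbitrary: x)
  case (Suc k)
  have "rr 144 x t' t = (rho t t' ^^ 72) x" using rr_rho[of 72] by simp
  then have "it (Suc k) x t' t = (rho t t' ^^ (72 * k)) ((rho t t' ^^ 72) x)" using Suc by simp
  also have "\<dots> = (rho t t' ^^ (72 * k + 72)) x" by (simp only: funpow_add o_apply)
  finally show ?case by (simp add: algebra_simps)
qed simp

end

text \<open>One letter packs the high base-72 digits of the two labels of the starting point, below
  4 and below 3, and the class of the certificate.\<close>

fun decode3 :: "nat \<Rightarrow> nat \<times> nat \<times> nat" where
  "decode3 x = (x mod 4, x div 4 mod 3, x div 12)"

definition lt :: "nat \<Rightarrow> nat \<Rightarrow> bool" where "lt x y \<longleftrightarrow> x < y"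

definition hi :: "nat \<Rightarrow> nat \<Rightarrow> nat" where "hi p x = 72 * p + x"

text \<open>A row of certificates for the exponents with first coordinate \<open>u\<close>: each certificate names a
  starting point and the number of steps after which the walk returns to a Frobenius conjugate of it;
  exponents of class 3 are deferred to the list \<open>gs\<close>.\<close>

definition entm :: "nat \<Rightarrow> nat \<Rightarrow> (nat \<times> nat) list \<Rightarrow> (char \<Rightarrow> nat) \<Rightarrow> nat \<Rightarrow> 'b::field \<Rightarrow> nat \<times> nat \<times> nat \<Rightarrow>
    nat \<Rightarrow> nat \<Rightarrow> nat \<Rightarrow> nat \<Rightarrow> nat \<Rightarrow> nat \<Rightarrow> (char list \<Rightarrow> bool) \<Rightarrow> char list \<Rightarrow> bool" where
  "entm al be gs ix bd g pqk c1 c2 u nu v nv rest cs = (case pqk of (p, q, k) \<Rightarrow>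
     if k = 3 then (u, v) \<in> set gs \<and> rest cs
     else if k < 3 then samem al be g (hi p c1) (hi q c2) (runm al be g (2 * (k + 1)) 0 (hi p c1) (hi q c2) nu nv u v)
         \<and> rest cs
     else (case cs of c4 # c5 # cs' \<Rightarrow> lt (hi (k - 4) (ix c4)) bd \<and>
         samem al be g (hi p c1) (hi q c2) (itm al be (un (hi (k - 4) (ix c4)))
            (runm al be g (Suc (Suc (un2 (ix c5)))) 0 (hi p c1) (hi q c2) nu nv u v) nu nv u v)
         \<and> rest cs' | _ \<Rightarrow> False))"

primrec rowm :: "nat \<Rightarrow> nat \<Rightarrow> (nat \<times> nat) list \<Rightarrow> (char \<Rightarrow> nat) \<Rightarrow> nat \<Rightarrow> 'b::field \<Rightarrow> nat \<Rightarrow> nat \<Rightarrow>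
    (nat \<times> nat) list \<Rightarrow> char list \<Rightarrow> bool" where
  "rowm al be gs ix bd g u nu [] cs = True"
| "rowm al be gs ix bd g u nu (x # vs) cs = (case cs of c1 # c2 # c3 # cs1 \<Rightarrow>
     entm al be gs ix bd g (decode3 (ix c3)) (ix c1) (ix c2) u nu (fst x) (snd x) (rowm al be gs ix bd g u nu vs) cs1
     | _ \<Rightarrow> False)"

definition advm :: "nat \<Rightarrow> nat \<Rightarrow> nat \<Rightarrow> nat \<Rightarrow> nat \<Rightarrow> nat \<Rightarrow> nat \<times> nat \<Rightarrow> 'b::field \<Rightarrow> 'b" where
  "advm al be nu nv u v s x = itm al be (un (fst s)) (rr (un2 (snd s)) x (al ^ nu * be ^ nv) (al ^ u * be ^ v)) nu nv u v"

text \<open>One walk cut into segments: at every cut before the end a conjugate of the start is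
  excluded, and at the end exactly the conjugate with twist \<open>c\<close> is required.\<close>

primrec goodm :: "nat \<Rightarrow> nat \<Rightarrow> 'b::field \<Rightarrow> nat \<Rightarrow> nat \<Rightarrow> nat \<Rightarrow> nat \<Rightarrow> (nat \<times> nat) list \<Rightarrow> nat \<Rightarrow> 'b \<Rightarrow> bool" where
  "goodm al be g nu nv u v [] c x \<longleftrightarrow> x = elm al be g c 0 0"
| "goodm al be g nu nv u v (s # ss) c x \<longleftrightarrow> (ss = [] \<or> \<not> samem al be g 0 0 (advm al be nu nv u v s x))
     \<and> goodm al be g nu nv u v ss c (advm al be nu nv u v s x)"

definition amount :: "nat \<times> nat \<Rightarrow> nat" where "amount s = 72 * fst s + snd s"

section \<open>Field elements labelled by exponent coordinates\<close>

locale label_field = exponent_coords m T al be L H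
  for m and T :: "'a::{field,finite} itself" and al be L H +
  fixes g :: 'a
  assumes g0: "g \<noteq> 0" and g_order: "\<And>k. g ^ k = 1 \<Longrightarrow> n dvd k"
begin

abbreviation "E \<equiv> elm al be g"
abbreviation "R \<equiv> runm al be g"

lemma E_ex: "E j a b = g ^ (2 ^ j * ex a b)" by (simp add: elm_def ex_def)

lemma E_mod: "E j a b = E (j mod m) (a mod L) (b mod H)"
  unfolding E_ex by (rule pow_cong[OF g0 coords_mod])

lemma E_pl: "E (pl m j i) (pl L a u) (pl H b v) = E (j + i) (a + u) (b + v)"
  using E_mod[of "j + i" "a + u" "b + v"] by (simp add: pl_def)

lemma E_j: "E (pl m j i) a b = E (j + i) a b"
  using E_mod[of "j + i" a b] E_mod[of "(j + i) mod m" a b] by (simp add: pl_def)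

lemma E_frob: "E j a b ^ 2 ^ i = E (j + i) a b"
  by (simp add: E_ex power_mult[symmetric] power_add ac_simps)

lemma E_pow: "E j a b ^ ex u v = E j (pl L a u) (pl H b v)"
proof -
  have "E j a b ^ ex u v = E (j + 0) (a + u) (b + v)"
    by (simp add: E_ex ex_def power_mult[symmetric] power_add ac_simps)
  then show ?thesis using E_pl[of j 0 a u b v] E_mod[of "pl m j 0"] E_mod[of j]
    by (simp add: pl_def)
qed

text \<open>Exponents of \<open>g\<close> are determined modulo \<open>n\<close>, and coordinates of
  units are unique. The first coordinate is left out because it is only a Frobenius twist.\<close>

lemma E_cong: "E j a b = E j' a' b' \<Longrightarrow> [a = a'] (mod L) \<and> [b = b'] (mod H)"
proof -
  let ?k = "2 ^ j * ex a b" and ?l = "2 ^ j' * ex a' b'"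
  assume "E j a b = E j' a' b'"
  \<comment> \<open>The common factor is the inverse of \<open>g ^ ?l\<close>, since
    \<open>g ^ n = 1\<close>.\<close>
  then have "g ^ ?k * g ^ ((n - 1) * ?l) = g ^ ?l * g ^ ((n - 1) * ?l)" by (simp add: E_ex)
  also have "\<dots> = g ^ (?l + (n - 1) * ?l)" by (simp only: power_add)
  also have nl: "?l + (n - 1) * ?l = n * ?l" using n_gt by (cases n) auto
  also have "g ^ (n * ?l) = 1" by (simp only: power_mult pow_n[OF g0] power_one)
  finally have "n dvd ?k + (n - 1) * ?l" by (intro g_order) (simp add: power_add)
  then have "[?k + (n - 1) * ?l = ?l + (n - 1) * ?l] (mod n)"
    unfolding nl cong_def by (metis dvd_eq_mod_eq_0 mod_mult_self1_is_0)
  then have "[?k = ?l] (mod n)" by (simp only: cong_add_rcancel_nat)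
  then show ?thesis using coords_cancel by blast
qed

text \<open>The exponent of \<open>g\<close> is a unit modulo \<open>n\<close>, hence not a multiple
  of \<open>n\<close>.\<close>

lemma E_ne: "E j a b \<noteq> 0" "E j a b \<noteq> 1"
proof -
  show "E j a b \<noteq> 0" using g0 by (simp add: E_ex)
  show "E j a b \<noteq> 1"
  proof
    assume "E j a b = 1"
    then have "n dvd 2 ^ j * ex a b" using g_order by (simp add: E_ex)
    then show False using coords_coprime[of j a b] n_gt
      by (metis coprime_common_divisor dvd_refl nat_dvd_1_iff_1 less_irrefl)
  qed
qed

lemma R_0: "R 0 j a b u v w z = E j a b" by (simp add: runm_def)

lemma itm_0: "itm al be 0 x u v w z = x" by (simp add: itm_def)

lemma itm_Suc: "itm al be (Suc k) (E j a b) u v w z = itm al be k (R 144 j a b u v w z) u v w z"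
  by (simp add: itm_def runm_def)

lemma samem_E: "samem al be g a b (E j a b) = True" by (auto simp: samem_def)

text \<open>Coordinates add when exponents are multiplied, and coordinates congruent to 0 belong to
  the exponent 1.\<close>

lemma inv_exps_neg:
  assumes "[u + nu = 0] (mod L)" "[v + nv = 0] (mod H)" shows "inv_exps (ex u v) (ex nu nv)"
proof -
  have "ex u v * ex nu nv = 2 ^ 0 * ex (u + nu) (v + nv)" by (simp add: ex_def power_add ac_simps)
  also have "[\<dots> = 2 ^ (0 mod m) * ex ((u + nu) mod L) ((v + nv) mod H)] (mod n)" by (rule coords_mod)
  also have "2 ^ (0 mod m) * ex ((u + nu) mod L) ((v + nv) mod H) = 1"
    using assms by (simp add: cong_def ex_def)
  finally show ?thesis using ex_pos by (simp add: inv_exps_def)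
qed

lemma run_rho: "R (2 * k) j a b nu nv u v = (rho (ex u v) (ex nu nv) ^^ k) (E j a b)"
  by (simp add: runm_def rr_rho ex_def)

lemma itm_rho: "itm al be k x nu nv u v = (rho (ex u v) (ex nu nv) ^^ (72 * k)) x"
  by (simp add: itm_def it_rho ex_def)

lemma same_not_closed:
  assumes "[u + nu = 0] (mod L)" "[v + nv = 0] (mod H)" "0 < k" "k * m < 2 ^ (m - 1) - 1"
    and "samem al be g a b ((rho (ex u v) (ex nu nv) ^^ k) (E 0 a b))"
  shows "\<not> in_closed_surface (\<lambda>x::'a. x ^ ex u v)"
proof -
  obtain i where "(rho (ex u v) (ex nu nv) ^^ k) (E 0 a b) = E 0 a b ^ 2 ^ i"
    using assms(5) E_frob[of 0 a b] by (auto simp: samem_def)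
  then show ?thesis using not_closed_surface_conj[OF inv_exps_neg[OF assms(1,2)] E_ne assms(3,4)] by blast
qed

text \<open>Every certified walk returns to a conjugate within \<open>72 * bd\<close> rotations, and
  the bound on \<open>bd\<close> makes this too early for a single rotation line. Deferred exponents
  are only checked to occur in \<open>gs\<close>.\<close>

lemma row_sound:
  assumes u: "[u + nu = 0] (mod L)" and bd: "72 * bd * m < 2 ^ (m - 1) - 1" "1 \<le> bd" and ix: "\<And>c. ix c < 72"
  shows "rowm al be gs ix bd g u nu vs cs \<Longrightarrow> \<forall>(v, nv) \<in> set vs. [v + nv = 0] (mod H) \<Longrightarrow>
    \<forall>v \<in> fst ` set vs. (u, v) \<in> set gs \<or> \<not> in_closed_surface (\<lambda>x::'a. x ^ ex u v)"
proof (induction vs arbitrary: cs)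
  case (Cons vv vs)
  obtain v nv where vv: "vv = (v, nv)" by (cases vv)
  have v: "[v + nv = 0] (mod H)" using Cons.prems(2) vv by simp
  obtain c1 c2 c3 cs1 where cs: "cs = c1 # c2 # c3 # cs1"
    using Cons.prems(1) by (auto split: list.splits)
  obtain p q k where pqk: "decode3 (ix c3) = (p, q, k)" by (cases "decode3 (ix c3)")
  let ?a = "hi p (ix c1)" and ?b = "hi q (ix c2)"
  have ent: "entm al be gs ix bd g (p, q, k) (ix c1) (ix c2) u nu v nv (rowm al be gs ix bd g u nu vs) cs1"
    using Cons.prems(1) by (simp add: vv cs pqk del: decode3.simps)
  have small: "l * m < 2 ^ (m - 1) - 1" if "l \<le> 72 * bd" for l
    using le_less_trans[OF mult_le_mono1[OF that] bd(1)] .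
  have fin: ?case if "rowm al be gs ix bd g u nu vs cs2"
    "(u, v) \<in> set gs \<or> \<not> in_closed_surface (\<lambda>x::'a. x ^ ex u v)" for cs2
    using Cons.IH[OF that(1)] Cons.prems(2) that(2) vv by simp
  consider "k = 3" | "k < 3" | "3 < k" by linarith
  then show ?case
  proof cases
    case 1
    then have "(u, v) \<in> set gs" and r: "rowm al be gs ix bd g u nu vs cs1" using ent by (auto simp: entm_def)
    then show ?thesis using fin[OF r] by blast
  next
    case 2
    then have "samem al be g ?a ?b (R (2 * (k + 1)) 0 ?a ?b nu nv u v)" and r: "rowm al be gs ix bd g u nu vs cs1"
      using ent by (auto simp: entm_def)
    then have s: "samem al be g ?a ?b ((rho (ex u v) (ex nu nv) ^^ (k + 1)) (E 0 ?a ?b))" by (simp only: run_rho)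
    have "(k + 1) * m < 2 ^ (m - 1) - 1" using 2 bd(2) by (intro small) linarith
    then have "\<not> in_closed_surface (\<lambda>x::'a. x ^ ex u v)" by (intro same_not_closed[OF u v _ _ s]) simp_all
    then show ?thesis using fin[OF r] by blast
  next
    case 3
    then obtain c4 c5 cs2 where cs1: "cs1 = c4 # c5 # cs2" using ent by (auto simp: entm_def split: list.splits)
    let ?k4 = "hi (k - 4) (ix c4)"
    have b4: "lt ?k4 bd" and s: "samem al be g ?a ?b (itm al be (un ?k4)
            (R (Suc (Suc (un2 (ix c5)))) 0 ?a ?b nu nv u v) nu nv u v)"
      and r: "rowm al be gs ix bd g u nu vs cs2"
      using ent 3 unfolding cs1 by (auto simp: entm_def)
    \<comment> \<open>The two extra successors are one more rotation, so that a walk of length 0 is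
      never certified.\<close>
    have "Suc (Suc (un2 (ix c5))) = 2 * (ix c5 + 1)" by (simp add: un2_def)
    then have "samem al be g ?a ?b ((rho (ex u v) (ex nu nv) ^^ (72 * ?k4)) ((rho (ex u v) (ex nu nv) ^^ (ix c5 + 1)) (E 0 ?a ?b)))"
      using s by (simp only: itm_rho run_rho un_def)
    then have s: "samem al be g ?a ?b ((rho (ex u v) (ex nu nv) ^^ (72 * ?k4 + (ix c5 + 1))) (E 0 ?a ?b))"
      by (simp only: funpow_add o_apply)
    have "ix c5 + 1 \<le> 72" using ix[of c5] by simp
    then have "72 * ?k4 + (ix c5 + 1) \<le> 72 * bd" using b4 unfolding lt_def by linarith
    from small[OF this] have "\<not> in_closed_surface (\<lambda>x::'a. x ^ ex u v)"
      by (intro same_not_closed[OF u v _ _ s]) simp_all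
    then show ?thesis using fin[OF r] by blast
  qed
qed simp

lemma advm_rho: "advm al be nu nv u v s x = (rho (ex u v) (ex nu nv) ^^ amount s) x"
  by (simp add: advm_def itm_rho un_def un2_def amount_def rr_rho[of _ x, folded ex_def] ex_def[symmetric] funpow_add)

lemma goodm_sound:
  "goodm al be g nu nv u v ss c x \<Longrightarrow>
    (rho (ex u v) (ex nu nv) ^^ sum_list (map amount ss)) x = E c 0 0 \<and>
    (\<forall>k. 0 < k \<longrightarrow> k < length ss \<longrightarrow> \<not> samem al be g 0 0 ((rho (ex u v) (ex nu nv) ^^ sum_list (map amount (take k ss))) x))"
proof (induction ss arbitrary: x)
  case (Cons s ss)
  let ?f = "rho (ex u v) (ex nu nv)" and ?y = "(rho (ex u v) (ex nu nv) ^^ amount s) x"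
  have g1: "ss = [] \<or> \<not> samem al be g 0 0 ?y" and g2: "goodm al be g nu nv u v ss c ?y"
    using Cons.prems by (simp_all add: advm_rho)
  note IH = Cons.IH[OF g2]
  have c: "(?f ^^ (amount s + k)) x = (?f ^^ k) ?y" for k by (simp only: add.commute[of "amount s"] funpow_add o_apply)
  show ?case
  proof (intro conjI allI impI)
    show "(?f ^^ sum_list (map amount (s # ss))) x = E c 0 0" using IH c by simp
    fix k assume k: "0 < k" "k < length (s # ss)"
    show "\<not> samem al be g 0 0 ((?f ^^ sum_list (map amount (take k (s # ss)))) x)"
    proof (cases "k = 1")
      case True then show ?thesis using g1 k by auto
    next
      case False
      then obtain i where i: "k = Suc i" "0 < i" "i < length ss" using k by (cases k) auto
      then show ?thesis using IH c by simp
    qed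
  qed
qed simp

text \<open>The quotients of \<open>N\<close> by its prime divisors all occur among the cuts, so a
  single walk of length \<open>N\<close> settles every condition of
  \<open>closed_surface\<close>.\<close>

lemma goodm_closed:
  assumes u: "[u + nu = 0] (mod L)" and v: "[v + nv = 0] (mod H)"
    and good: "goodm al be g nu nv u v ss c (E 0 0 0)" and c: "0 < c" "c < m"
    and N: "sum_list (map amount ss) * m = 2 ^ (m - 1) - 1" "0 < sum_list (map amount ss)"
    and q: "\<And>q. prime q \<Longrightarrow> q dvd sum_list (map amount ss) \<Longrightarrow>
      \<exists>k. 0 < k \<and> k < length ss \<and> sum_list (map amount ss) div q = sum_list (map amount (take k ss))"
  shows "in_closed_surface (\<lambda>x::'a. x ^ ex u v)"
proof (rule closed_surface[OF inv_exps_neg[OF u v] E_ne N])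
  note S = goodm_sound[OF good]
  show "(rho (ex u v) (ex nu nv) ^^ sum_list (map amount ss)) (E 0 0 0) = E 0 0 0 ^ 2 ^ c"
    using S E_frob[of 0 0 0 c] by simp
  show "\<not> m dvd c" using c by (simp add: nat_dvd_not_less)
  fix p j assume "prime p" "p dvd sum_list (map amount ss)"
  from q[OF this] obtain k where k: "0 < k" "k < length ss"
    "sum_list (map amount ss) div p = sum_list (map amount (take k ss))" by blast
  then have "\<not> samem al be g 0 0 ((rho (ex u v) (ex nu nv) ^^ (sum_list (map amount ss) div p)) (E 0 0 0))"
    using S by simp
  then show "(rho (ex u v) (ex nu nv) ^^ (sum_list (map amount ss) div p)) (E 0 0 0) \<noteq> E 0 0 0 ^ 2 ^ j"
    using E_frob[of 0 0 0 j] by (auto simp: samem_def)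
qed

text \<open>A walk that ends with twist 0 is closed after \<open>N\<close> steps already, while a
  single rotation line needs \<open>N * m\<close>.\<close>

lemma goodm_not_closed:
  assumes u: "[u + nu = 0] (mod L)" and v: "[v + nv = 0] (mod H)"
    and good: "goodm al be g nu nv u v ss 0 (E 0 0 0)"
    and N: "sum_list (map amount ss) * m = 2 ^ (m - 1) - 1" "0 < sum_list (map amount ss)"
  shows "\<not> in_closed_surface (\<lambda>x::'a. x ^ ex u v)"
proof (rule not_closed_surface[OF inv_exps_neg[OF u v] E_ne N(2)])
  show "sum_list (map amount ss) < 2 ^ (m - 1) - 1"
    using mult_le_mono2[OF m_ge_2, of "sum_list (map amount ss)"] N by linarith
  show "(rho (ex u v) (ex nu nv) ^^ sum_list (map amount ss)) (E 0 0 0) = E 0 0 0" using goodm_sound[OF good] by blast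
qed

lemma samem_00: "0 < a \<and> a < L \<or> 0 < b \<and> b < H \<Longrightarrow> samem al be g 0 0 (E i a b) = False"
  unfolding samem_def by (auto dest!: E_cong simp: cong_def)

text \<open>Since \<open>be ^ h\<close> is -1 modulo \<open>n\<close>, shifting the last label by
  \<open>h\<close> inverts the element; so the walk leads to the reciprocal of its start.\<close>

lemma run_not_orientable:
  assumes u: "[u + nu = 0] (mod L)" and v: "[v + nv = 0] (mod H)"
    and h: "n dvd be ^ h + 1" and b': "b' = pl H b h" and r: "R (un2 k) 0 a b nu nv u v = E 0 a b'"
  shows "\<not> orientable STS (tri_img (\<lambda>x::'a. x ^ ex u v) STS)"
proof (rule not_orientable[OF inv_exps_neg[OF u v] E_ne])
  have "E 0 a b * E 0 a (b + h) = g ^ (ex a b * (be ^ h + 1))"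
    by (simp add: E_ex ex_def power_add[symmetric] algebra_simps)
  also obtain i where "be ^ h + 1 = n * i" using h by (elim dvdE)
  then have "g ^ (ex a b * (be ^ h + 1)) = (g ^ n) ^ (i * ex a b)" by (simp add: power_mult[symmetric] ac_simps)
  also have "\<dots> = 1" by (simp only: pow_n[OF g0] power_one)
  finally have "E 0 a b * E 0 a (b + h) = 1" .
  moreover have "E 0 a b' = E 0 a (b + h)" using E_mod[of 0 a "b + h"] E_mod[of 0 a b'] by (simp add: b' pl_def)
  ultimately have "E 0 a b' = inverse (E 0 a b)" using E_ne(1)[of 0 a b] by (simp add: field_simps)
  then show "(rho (ex u v) (ex nu nv) ^^ k) (E 0 a b) = inverse (E 0 a b)"
    using r run_rho[of k] by (simp add: un2_def)
qed

end

context exponent_coords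
begin

text \<open>\<open>gs\<close> holds the deferred exponents, which are split into those with a single
  rotation line, \<open>g1\<close>, and the others, \<open>g2\<close>.\<close>

theorem count_classes:
  assumes cover: "\<And>a b. (a, b) \<in> half_pairs L H \<Longrightarrow> (a, b) \<in> set gs \<or> \<not> in_closed_surface (\<lambda>x::'a. x ^ ex a b)"
    and g1: "\<And>a b. (a, b) \<in> set g1 \<Longrightarrow> in_closed_surface (\<lambda>x::'a. x ^ ex a b)"
    and g2: "\<And>a b. (a, b) \<in> set g2 \<Longrightarrow> \<not> in_closed_surface (\<lambda>x::'a. x ^ ex a b)"
    and gs: "set gs \<subseteq> set g1 \<union> set g2" and half: "set g1 \<subseteq> half_pairs L H" and dist: "distinct g1"
  shows "num_iso_classes T = length g1"
proof -
  let ?e = "\<lambda>(a, b). ex a b"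
  have "{r \<in> ?e ` half_pairs L H. in_closed_surface (\<lambda>x::'a. x ^ r)} = ?e ` set g1"
  proof
    show "{r \<in> ?e ` half_pairs L H. in_closed_surface (\<lambda>x::'a. x ^ r)} \<subseteq> ?e ` set g1"
    proof clarify
      fix a b assume "(a, b) \<in> half_pairs L H" "in_closed_surface (\<lambda>x::'a. x ^ ex a b)"
      then have "(a, b) \<in> set g1" using cover[of a b] g2[of a b] gs by blast
      then show "ex a b \<in> ?e ` set g1" by force
    qed
  qed (use half g1 in auto)
  then have "num_iso_classes T = card (?e ` set g1)"
    using num_iso_classes_half_system[OF half_system_pairs] by simp
  moreover have "inj_on ?e (set g1)"
    by (rule inj_on_subset[OF inj_ex]) (use half in \<open>auto simp: half_pairs_def\<close>)
  ultimately show ?thesis by (simp only: card_image distinct_card[OF dist])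
qed

end

context label_field
begin

theorem classes_nonorientable:
  assumes cover: "\<And>a b. (a, b) \<in> half_pairs L H \<Longrightarrow> in_closed_surface (\<lambda>x::'a. x ^ ex a b) \<Longrightarrow> (a, b) \<in> set g1"
    and no: "\<And>a b. (a, b) \<in> set g1 \<Longrightarrow> \<exists>a' b'. [a + a' = 0] (mod L) \<and> [b + b' = 0] (mod H)
      \<and> \<not> orientable STS (white (ex a b)) \<and> \<not> orientable STS (white (ex a' b'))"
  shows "all_nonorientable T"
proof (rule all_nonorientable_half_system[OF half_system_pairs])
  fix r r' assume "r \<in> (\<lambda>(a, b). ex a b) ` half_pairs L H" "in_closed_surface (\<lambda>x::'a. x ^ r)" and r': "inv_exps r r'"
  then obtain a b where ab: "r = ex a b" "(a, b) \<in> set g1" using cover by auto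
  obtain a' b' where ab': "[a + a' = 0] (mod L)" "[b + b' = 0] (mod H)"
     "\<not> orientable STS (white (ex a b))" "\<not> orientable STS (white (ex a' b'))" using no[OF ab(2)] by blast
  have i: "inv_exps r (ex a' b')" using inv_exps_neg[OF ab'(1,2)] ab by simp
  have "[r' = ex a' b' * 2 ^ 0] (mod n)"
    using cong_mult_inv[OF i, of r' 1] r' by (simp add: inv_exps_def mult.commute)
  from white_frob[OF this] have "white r' = white (ex a' b')" using r' ex_pos by (auto simp: inv_exps_def)
  then show "\<not> orientable STS (white r) \<and> \<not> orientable STS (white r')" using ab ab' by simp
qed

text \<open>This enumerates the tables: where it is used, \<open>L\<close> and \<open>H\<close> are
  coprime, so shifting both labels by one visits every pair \<open>(a, b)\<close>, and
  \<open>w\<close> is a power that is cheap to compute.\<close>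

lemma E_next:
  assumes "[w = 2 ^ J * (al * be)] (mod n)" shows "E j a b ^ w = E (j + J) (Suc a) (Suc b)"
proof -
  have "E j a b ^ w = E j a b ^ (2 ^ J * (al * be))" using pow_cong[OF E_ne(1) assms] .
  then show ?thesis by (simp add: E_ex ex_def power_mult[symmetric] power_add ac_simps)
qed

end

section \<open>Tables\<close>

text \<open>Tables are balanced trees, so that splitting them into rewrite rules takes little time.\<close>

datatype 's tr = Lf 's | Nd "'s tr" "'s tr"

primrec tr_all :: "('s \<Rightarrow> bool) \<Rightarrow> 's tr \<Rightarrow> bool" where
  "tr_all P (Lf x) = P x" | "tr_all P (Nd t u) = (tr_all P t \<and> tr_all P u)"

lemma tr_all_mono: "tr_all P t \<Longrightarrow> (\<And>x. P x \<Longrightarrow> Q x) \<Longrightarrow> tr_all Q t"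
  by (induction t) simp_all

definition nd :: "'t tr \<Rightarrow> 't tr \<times> 's \<Rightarrow> 't tr \<times> 's" where "nd t p = (case p of (u, z) \<Rightarrow> (Nd t u, z))"

definition glue :: "('s \<Rightarrow> 't tr \<times> 's) \<Rightarrow> 't tr \<times> 's \<Rightarrow> 't tr \<times> 's" where
  "glue h p = (case p of (t, y) \<Rightarrow> nd t (h y))"

text \<open>Iterates \<open>h\<close> as often as the binary numeral says, passing a state along and
  collecting the leaves in a tree of logarithmic depth.\<close>

primrec orb :: "('s \<Rightarrow> 't tr \<times> 's) \<Rightarrow> num \<Rightarrow> 's \<Rightarrow> 't tr \<times> 's" where
  "orb h num.One = h"
| "orb h (num.Bit0 k) = (\<lambda>x. glue (orb h k) (orb h k x))"
| "orb h (num.Bit1 k) = (\<lambda>x. glue h (glue (orb h k) (orb h k x)))"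

definition leaf :: "('s \<Rightarrow> 's) \<Rightarrow> 's \<Rightarrow> 's tr \<times> 's" where "leaf f x = (Lf x, f x)"

definition sc :: "nat \<Rightarrow> nat \<Rightarrow> nat" where "sc k x = Suc x mod k"

text \<open>The state is a sum of \<open>x\<close> and \<open>y\<close> with value \<open>z\<close>
  modulo \<open>k\<close>. A row runs through \<open>y\<close>; after \<open>k\<close> leaves
  \<open>y\<close> and \<open>z\<close> are back, and passing to the next \<open>x\<close> only
  raises \<open>z\<close> by one.\<close>

definition sum_leaf :: "nat \<Rightarrow> nat \<times> nat \<times> nat \<Rightarrow> (nat \<times> nat \<times> nat) tr \<times> nat \<times> nat \<times> nat" where
  "sum_leaf k s = (case s of (x, y, z) \<Rightarrow> (Lf s, x, sc k y, sc k z))"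

definition sum_up :: "nat \<Rightarrow> (nat \<times> nat \<times> nat) tr \<times> nat \<times> nat \<times> nat \<Rightarrow> (nat \<times> nat \<times> nat) tr \<times> nat \<times> nat \<times> nat" where
  "sum_up k p = (case p of (t, x, y, z) \<Rightarrow> (t, sc k x, y, sc k z))"

definition sum_row :: "nat \<Rightarrow> num \<Rightarrow> nat \<times> nat \<times> nat \<Rightarrow> (nat \<times> nat \<times> nat) tr \<times> nat \<times> nat \<times> nat" where
  "sum_row k K s = sum_up k (orb (sum_leaf k) K s)"

definition sum_ok :: "nat \<Rightarrow> nat \<times> nat \<times> nat \<Rightarrow> bool" where
  "sum_ok k s = (case s of (x, y, z) \<Rightarrow> pl k x y = z)"

lemma orb_simps:
  "orb h num.One x = h x" "orb h (num.Bit0 K) x = glue (orb h K) (orb h K x)"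
  "orb h (num.Bit1 K) x = glue h (orb h (num.Bit0 K) x)"
  "glue h (t, y) = nd t (h y)" "nd t (u, z) = (Nd t u, z)" "leaf f x = (Lf x, f x)"
  "sum_leaf k (a, b, c) = (Lf (a, b, c), a, sc k b, sc k c)" "sum_row k K r = sum_up k (orb (sum_leaf k) K r)"
  "sum_up k (v, a, b, c) = (v, sc k a, b, sc k c)"
  by (simp_all add: glue_def nd_def leaf_def sum_leaf_def sum_row_def sum_up_def)

lemma glue_all:
  assumes "tr_all P (fst p) \<and> I (snd p)" "\<And>x. I x \<Longrightarrow> tr_all P (fst (f x)) \<and> I (snd (f x))"
  shows "tr_all P (fst (glue f p)) \<and> I (snd (glue f p))"
proof -
  have "tr_all P (fst p)" "tr_all P (fst (f (snd p)))" "I (snd (f (snd p)))" using assms by simp_all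
  then show ?thesis by (simp add: glue_def nd_def case_prod_beta)
qed

lemma orb_all:
  assumes h: "\<And>x. I x \<Longrightarrow> tr_all P (fst (h x)) \<and> I (snd (h x))"
  shows "I x \<Longrightarrow> tr_all P (fst (orb h k x)) \<and> I (snd (orb h k x))"
proof (induction k arbitrary: x)
  case One then show ?case unfolding orb.simps by (rule h)
next
  case (Bit0 k) show ?case unfolding orb.simps by (intro glue_all[where I = I] Bit0.IH Bit0.prems)
next
  case (Bit1 k)
  show ?case unfolding orb.simps by (intro glue_all[where I = I] Bit1.IH Bit1.prems h)
qed

lemma orb_leaf_all:
  assumes "\<And>x. I x \<Longrightarrow> I (f x)" "I x" shows "tr_all I (fst (orb (leaf f) k x))"
  using orb_all[of I I "leaf f" x k] assms by (simp add: leaf_def)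

text \<open>The whole addition table is correct because raising one summand and the value together
  preserves a correct sum.\<close>

lemma sum_ok_all: "tr_all (sum_ok k) (fst (orb (sum_row k K) K (0, 0, 0)))"
proof -
  have s: "pl k x (sc k y) = sc k (pl k x y)" "pl k (sc k x) y = sc k (pl k x y)" for x y
    by (simp_all add: pl_def sc_def mod_Suc_eq mod_add_left_eq mod_add_right_eq)
  have "sum_ok k x \<Longrightarrow> tr_all (sum_ok k) (fst (sum_leaf k x)) \<and> sum_ok k (snd (sum_leaf k x))" for x
    by (cases x) (simp add: sum_leaf_def sum_ok_def s)
  then have r: "sum_ok k x \<Longrightarrow> tr_all (sum_ok k) (fst (orb (sum_leaf k) K x)) \<and> sum_ok k (snd (orb (sum_leaf k) K x))" for x
    by (rule orb_all)
  have "sum_ok k x \<Longrightarrow> tr_all (sum_ok k) (fst (sum_row k K x)) \<and> sum_ok k (snd (sum_row k K x))" for x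
    using r[of x] by (simp add: sum_row_def sum_up_def sum_ok_def s case_prod_beta)
  then show ?thesis using orb_all[of "sum_ok k" "sum_ok k" "sum_row k K" "(0, 0, 0)" K] by (simp add: sum_ok_def pl_def)
qed

lemma sum_ok_simp: "sum_ok k (x, y, z) \<longleftrightarrow> pl k x y = z" by (simp add: sum_ok_def)

context label_field
begin

text \<open>A table entry: an element in coordinates together with its label. The negative
  \<open>nj\<close> of the first label is carried along so that its twist can be undone without a
  subtraction.\<close>

definition okp :: "nat \<times> nat \<times> nat \<times> nat \<times> 'a \<Rightarrow> bool" where
  "okp s = (case s of (j, nj, a, b, x) \<Rightarrow> x = E j a b \<and> [j + nj = 0] (mod m))"

text \<open>The lookup from coordinates to labels, under a pending Frobenius power
  \<open>e\<close>.\<close>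

definition lookp :: "nat \<times> nat \<times> nat \<times> nat \<times> 'a \<Rightarrow> bool" where
  "lookp s = (case s of (j, nj, a, b, x) \<Rightarrow> (\<forall>e. fr e x = E (pl m e j) a b))"

definition nxr :: "nat \<Rightarrow> nat \<Rightarrow> 'a \<Rightarrow> nat \<Rightarrow> nat \<Rightarrow> nat \<Rightarrow> nat \<Rightarrow> 'a" where
  "nxr k i y u v w z = rr k ((y ^ 2 ^ i) ^ ex u v) (ex w z) (ex u v)"

text \<open>Adding 1 commutes with Frobenius, so the half step from label \<open>(i, a, b)\<close>
  is the one from \<open>(0, a, b)\<close> twisted by \<open>i\<close>, and \<open>fr nj\<close>
  removes the twist of the stored element. One rule for each pair \<open>(a, b)\<close> is therefore
  enough.\<close>

definition stepp :: "nat \<times> nat \<times> nat \<times> nat \<times> 'a \<Rightarrow> bool" where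
  "stepp s = (case s of (j, nj, a, b, x) \<Rightarrow>
     (\<forall>k i u v w z. R (Suc k) i a b u v w z = nxr k i (fr nj (1 + x)) u v w z))"

lemma okp_lookp: "okp s \<Longrightarrow> lookp s"
  by (cases s) (simp add: okp_def lookp_def fr_def E_frob E_j add.commute)

lemma okp_stepp: "okp s \<Longrightarrow> stepp s"
proof -
  assume "okp s"
  moreover obtain j nj a b x where s: "s = (j, nj, a, b, x)" by (cases s)
  ultimately have x: "x = E j a b" and jn: "[j + nj = 0] (mod m)" by (simp_all add: okp_def)
  have "fr nj (1 + x) = 1 + E (j + nj) a b" by (simp add: fr_def frob_add x E_frob)
  also have "E (j + nj) a b = E 0 a b" using E_mod[of "j + nj" a b] E_mod[of 0 a b] jn by (simp add: cong_def)
  finally have e: "fr nj (1 + x) ^ 2 ^ i = 1 + E i a b" for i using E_frob[of 0 a b i] by (simp add: frob_add)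
  show ?thesis by (simp add: s stepp_def nxr_def e runm_def ex_def)
qed

lemma nxr_E: "nxr k i (E c a b) u v w z = R k (pl m i c) (pl L a u) (pl H b v) w z u v"
  by (simp add: nxr_def E_frob E_pow runm_def ex_def[symmetric] E_j add.commute)

lemma okp_next:
  assumes "okp (j, nj, a, b, x)" "[w = 2 ^ J * (al * be)] (mod n)" "[J + NJ = 0] (mod m)"
  shows "okp (pl m j J, pl m nj NJ, pl L a 1, pl H b 1, x ^ w)"
proof -
  have x: "x = E j a b" and jn: "[j + nj = 0] (mod m)" using assms by (simp_all add: okp_def)
  have "x ^ w = E (pl m j J) (pl L a 1) (pl H b 1)" using E_next[OF assms(2), of j a b] by (simp add: x E_pl)
  moreover have "[(j + J) mod m + (nj + NJ) mod m = 0] (mod m)"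
  proof -
    have "[(j + J) + (nj + NJ) = 0] (mod m)" using cong_add[OF jn assms(3)] by (simp add: ac_simps)
    then show ?thesis by (simp add: cong_def mod_add_eq)
  qed
  ultimately show ?thesis by (simp add: okp_def pl_def)
qed

end

section \<open>Digits, letters and counters\<close>

named_theorems dd

text \<open>Numbers are separate constants, so that a lookup compares single symbols and no
  arithmetic is done on the way. The largest modulus of a label is 257.\<close>

definition [dd]: "d0 = (0::nat)"
definition [dd]: "d1 = (1::nat)"
definition [dd]: "d2 = (2::nat)"
definition [dd]: "d3 = (3::nat)"
definition [dd]: "d4 = (4::nat)"
definition [dd]: "d5 = (5::nat)"
definition [dd]: "d6 = (6::nat)"
definition [dd]: "d7 = (7::nat)"
definition [dd]: "d8 = (8::nat)"
definition [dd]: "d9 = (9::nat)"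
definition [dd]: "d10 = (10::nat)"
definition [dd]: "d11 = (11::nat)"
definition [dd]: "d12 = (12::nat)"
definition [dd]: "d13 = (13::nat)"
definition [dd]: "d14 = (14::nat)"
definition [dd]: "d15 = (15::nat)"
definition [dd]: "d16 = (16::nat)"
definition [dd]: "d17 = (17::nat)"
definition [dd]: "d18 = (18::nat)"
definition [dd]: "d19 = (19::nat)"
definition [dd]: "d20 = (20::nat)"
definition [dd]: "d21 = (21::nat)"
definition [dd]: "d22 = (22::nat)"
definition [dd]: "d23 = (23::nat)"
definition [dd]: "d24 = (24::nat)"
definition [dd]: "d25 = (25::nat)"
definition [dd]: "d26 = (26::nat)"
definition [dd]: "d27 = (27::nat)"
definition [dd]: "d28 = (28::nat)"
definition [dd]: "d29 = (29::nat)"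
definition [dd]: "d30 = (30::nat)"
definition [dd]: "d31 = (31::nat)"
definition [dd]: "d32 = (32::nat)"
definition [dd]: "d33 = (33::nat)"
definition [dd]: "d34 = (34::nat)"
definition [dd]: "d35 = (35::nat)"
definition [dd]: "d36 = (36::nat)"
definition [dd]: "d37 = (37::nat)"
definition [dd]: "d38 = (38::nat)"
definition [dd]: "d39 = (39::nat)"
definition [dd]: "d40 = (40::nat)"
definition [dd]: "d41 = (41::nat)"
definition [dd]: "d42 = (42::nat)"
definition [dd]: "d43 = (43::nat)"
definition [dd]: "d44 = (44::nat)"
definition [dd]: "d45 = (45::nat)"
definition [dd]: "d46 = (46::nat)"
definition [dd]: "d47 = (47::nat)"
definition [dd]: "d48 = (48::nat)"
definition [dd]: "d49 = (49::nat)"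
definition [dd]: "d50 = (50::nat)"
definition [dd]: "d51 = (51::nat)"
definition [dd]: "d52 = (52::nat)"
definition [dd]: "d53 = (53::nat)"
definition [dd]: "d54 = (54::nat)"
definition [dd]: "d55 = (55::nat)"
definition [dd]: "d56 = (56::nat)"
definition [dd]: "d57 = (57::nat)"
definition [dd]: "d58 = (58::nat)"
definition [dd]: "d59 = (59::nat)"
definition [dd]: "d60 = (60::nat)"
definition [dd]: "d61 = (61::nat)"
definition [dd]: "d62 = (62::nat)"
definition [dd]: "d63 = (63::nat)"
definition [dd]: "d64 = (64::nat)"
definition [dd]: "d65 = (65::nat)"
definition [dd]: "d66 = (66::nat)"
definition [dd]: "d67 = (67::nat)"
definition [dd]: "d68 = (68::nat)"
definition [dd]: "d69 = (69::nat)"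
definition [dd]: "d70 = (70::nat)"
definition [dd]: "d71 = (71::nat)"
definition [dd]: "d72 = (72::nat)"
definition [dd]: "d73 = (73::nat)"
definition [dd]: "d74 = (74::nat)"
definition [dd]: "d75 = (75::nat)"
definition [dd]: "d76 = (76::nat)"
definition [dd]: "d77 = (77::nat)"
definition [dd]: "d78 = (78::nat)"
definition [dd]: "d79 = (79::nat)"
definition [dd]: "d80 = (80::nat)"
definition [dd]: "d81 = (81::nat)"
definition [dd]: "d82 = (82::nat)"
definition [dd]: "d83 = (83::nat)"
definition [dd]: "d84 = (84::nat)"
definition [dd]: "d85 = (85::nat)"
definition [dd]: "d86 = (86::nat)"
definition [dd]: "d87 = (87::nat)"
definition [dd]: "d88 = (88::nat)"
definition [dd]: "d89 = (89::nat)"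
definition [dd]: "d90 = (90::nat)"
definition [dd]: "d91 = (91::nat)"
definition [dd]: "d92 = (92::nat)"
definition [dd]: "d93 = (93::nat)"
definition [dd]: "d94 = (94::nat)"
definition [dd]: "d95 = (95::nat)"
definition [dd]: "d96 = (96::nat)"
definition [dd]: "d97 = (97::nat)"
definition [dd]: "d98 = (98::nat)"
definition [dd]: "d99 = (99::nat)"
definition [dd]: "d100 = (100::nat)"
definition [dd]: "d101 = (101::nat)"
definition [dd]: "d102 = (102::nat)"
definition [dd]: "d103 = (103::nat)"
definition [dd]: "d104 = (104::nat)"
definition [dd]: "d105 = (105::nat)"
definition [dd]: "d106 = (106::nat)"
definition [dd]: "d107 = (107::nat)"
definition [dd]: "d108 = (108::nat)"
definition [dd]: "d109 = (109::nat)"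
definition [dd]: "d110 = (110::nat)"
definition [dd]: "d111 = (111::nat)"
definition [dd]: "d112 = (112::nat)"
definition [dd]: "d113 = (113::nat)"
definition [dd]: "d114 = (114::nat)"
definition [dd]: "d115 = (115::nat)"
definition [dd]: "d116 = (116::nat)"
definition [dd]: "d117 = (117::nat)"
definition [dd]: "d118 = (118::nat)"
definition [dd]: "d119 = (119::nat)"
definition [dd]: "d120 = (120::nat)"
definition [dd]: "d121 = (121::nat)"
definition [dd]: "d122 = (122::nat)"
definition [dd]: "d123 = (123::nat)"
definition [dd]: "d124 = (124::nat)"
definition [dd]: "d125 = (125::nat)"
definition [dd]: "d126 = (126::nat)"
definition [dd]: "d127 = (127::nat)"
definition [dd]: "d128 = (128::nat)"
definition [dd]: "d129 = (129::nat)"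
definition [dd]: "d130 = (130::nat)"
definition [dd]: "d131 = (131::nat)"
definition [dd]: "d132 = (132::nat)"
definition [dd]: "d133 = (133::nat)"
definition [dd]: "d134 = (134::nat)"
definition [dd]: "d135 = (135::nat)"
definition [dd]: "d136 = (136::nat)"
definition [dd]: "d137 = (137::nat)"
definition [dd]: "d138 = (138::nat)"
definition [dd]: "d139 = (139::nat)"
definition [dd]: "d140 = (140::nat)"
definition [dd]: "d141 = (141::nat)"
definition [dd]: "d142 = (142::nat)"
definition [dd]: "d143 = (143::nat)"
definition [dd]: "d144 = (144::nat)"
definition [dd]: "d145 = (145::nat)"
definition [dd]: "d146 = (146::nat)"
definition [dd]: "d147 = (147::nat)"
definition [dd]: "d148 = (148::nat)"
definition [dd]: "d149 = (149::nat)"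
definition [dd]: "d150 = (150::nat)"
definition [dd]: "d151 = (151::nat)"
definition [dd]: "d152 = (152::nat)"
definition [dd]: "d153 = (153::nat)"
definition [dd]: "d154 = (154::nat)"
definition [dd]: "d155 = (155::nat)"
definition [dd]: "d156 = (156::nat)"
definition [dd]: "d157 = (157::nat)"
definition [dd]: "d158 = (158::nat)"
definition [dd]: "d159 = (159::nat)"
definition [dd]: "d160 = (160::nat)"
definition [dd]: "d161 = (161::nat)"
definition [dd]: "d162 = (162::nat)"
definition [dd]: "d163 = (163::nat)"
definition [dd]: "d164 = (164::nat)"
definition [dd]: "d165 = (165::nat)"
definition [dd]: "d166 = (166::nat)"
definition [dd]: "d167 = (167::nat)"
definition [dd]: "d168 = (168::nat)"
definition [dd]: "d169 = (169::nat)"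
definition [dd]: "d170 = (170::nat)"
definition [dd]: "d171 = (171::nat)"
definition [dd]: "d172 = (172::nat)"
definition [dd]: "d173 = (173::nat)"
definition [dd]: "d174 = (174::nat)"
definition [dd]: "d175 = (175::nat)"
definition [dd]: "d176 = (176::nat)"
definition [dd]: "d177 = (177::nat)"
definition [dd]: "d178 = (178::nat)"
definition [dd]: "d179 = (179::nat)"
definition [dd]: "d180 = (180::nat)"
definition [dd]: "d181 = (181::nat)"
definition [dd]: "d182 = (182::nat)"
definition [dd]: "d183 = (183::nat)"
definition [dd]: "d184 = (184::nat)"
definition [dd]: "d185 = (185::nat)"
definition [dd]: "d186 = (186::nat)"
definition [dd]: "d187 = (187::nat)"
definition [dd]: "d188 = (188::nat)"
definition [dd]: "d189 = (189::nat)"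
definition [dd]: "d190 = (190::nat)"
definition [dd]: "d191 = (191::nat)"
definition [dd]: "d192 = (192::nat)"
definition [dd]: "d193 = (193::nat)"
definition [dd]: "d194 = (194::nat)"
definition [dd]: "d195 = (195::nat)"
definition [dd]: "d196 = (196::nat)"
definition [dd]: "d197 = (197::nat)"
definition [dd]: "d198 = (198::nat)"
definition [dd]: "d199 = (199::nat)"
definition [dd]: "d200 = (200::nat)"
definition [dd]: "d201 = (201::nat)"
definition [dd]: "d202 = (202::nat)"
definition [dd]: "d203 = (203::nat)"
definition [dd]: "d204 = (204::nat)"
definition [dd]: "d205 = (205::nat)"
definition [dd]: "d206 = (206::nat)"
definition [dd]: "d207 = (207::nat)"
definition [dd]: "d208 = (208::nat)"
definition [dd]: "d209 = (209::nat)"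
definition [dd]: "d210 = (210::nat)"
definition [dd]: "d211 = (211::nat)"
definition [dd]: "d212 = (212::nat)"
definition [dd]: "d213 = (213::nat)"
definition [dd]: "d214 = (214::nat)"
definition [dd]: "d215 = (215::nat)"
definition [dd]: "d216 = (216::nat)"
definition [dd]: "d217 = (217::nat)"
definition [dd]: "d218 = (218::nat)"
definition [dd]: "d219 = (219::nat)"
definition [dd]: "d220 = (220::nat)"
definition [dd]: "d221 = (221::nat)"
definition [dd]: "d222 = (222::nat)"
definition [dd]: "d223 = (223::nat)"
definition [dd]: "d224 = (224::nat)"
definition [dd]: "d225 = (225::nat)"
definition [dd]: "d226 = (226::nat)"
definition [dd]: "d227 = (227::nat)"
definition [dd]: "d228 = (228::nat)"
definition [dd]: "d229 = (229::nat)"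
definition [dd]: "d230 = (230::nat)"
definition [dd]: "d231 = (231::nat)"
definition [dd]: "d232 = (232::nat)"
definition [dd]: "d233 = (233::nat)"
definition [dd]: "d234 = (234::nat)"
definition [dd]: "d235 = (235::nat)"
definition [dd]: "d236 = (236::nat)"
definition [dd]: "d237 = (237::nat)"
definition [dd]: "d238 = (238::nat)"
definition [dd]: "d239 = (239::nat)"
definition [dd]: "d240 = (240::nat)"
definition [dd]: "d241 = (241::nat)"
definition [dd]: "d242 = (242::nat)"
definition [dd]: "d243 = (243::nat)"
definition [dd]: "d244 = (244::nat)"
definition [dd]: "d245 = (245::nat)"
definition [dd]: "d246 = (246::nat)"
definition [dd]: "d247 = (247::nat)"
definition [dd]: "d248 = (248::nat)"
definition [dd]: "d249 = (249::nat)"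
definition [dd]: "d250 = (250::nat)"
definition [dd]: "d251 = (251::nat)"
definition [dd]: "d252 = (252::nat)"
definition [dd]: "d253 = (253::nat)"
definition [dd]: "d254 = (254::nat)"
definition [dd]: "d255 = (255::nat)"
definition [dd]: "d256 = (256::nat)"
definition [dd]: "d257 = (257::nat)"

definition digits :: "nat list" where "digits = [
  d0, d1, d2, d3, d4, d5, d6, d7, d8, d9, d10, d11, d12, d13, d14, d15, d16, d17, d18, d19, d20,
  d21, d22, d23, d24, d25, d26, d27, d28, d29, d30, d31, d32, d33, d34, d35, d36, d37, d38, d39,
  d40, d41, d42, d43, d44, d45, d46, d47, d48, d49, d50, d51, d52, d53, d54, d55, d56, d57, d58,
  d59, d60, d61, d62, d63, d64, d65, d66, d67, d68, d69, d70, d71, d72, d73, d74, d75, d76, d77,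
  d78, d79, d80, d81, d82, d83, d84, d85, d86, d87, d88, d89, d90, d91, d92, d93, d94, d95, d96,
  d97, d98, d99, d100, d101, d102, d103, d104, d105, d106, d107, d108, d109, d110, d111, d112,
  d113, d114, d115, d116, d117, d118, d119, d120, d121, d122, d123, d124, d125, d126, d127,
  d128, d129, d130, d131, d132, d133, d134, d135, d136, d137, d138, d139, d140, d141, d142,
  d143, d144, d145, d146, d147, d148, d149, d150, d151, d152, d153, d154, d155, d156, d157,
  d158, d159, d160, d161, d162, d163, d164, d165, d166, d167, d168, d169, d170, d171, d172,
  d173, d174, d175, d176, d177, d178, d179, d180, d181, d182, d183, d184, d185, d186, d187,
  d188, d189, d190, d191, d192, d193, d194, d195, d196, d197, d198, d199, d200, d201, d202,
  d203, d204, d205, d206, d207, d208, d209, d210, d211, d212, d213, d214, d215, d216, d217,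
  d218, d219, d220, d221, d222, d223, d224, d225, d226, d227, d228, d229, d230, d231, d232,
  d233, d234, d235, d236, d237, d238, d239, d240, d241, d242, d243, d244, d245, d246, d247,
  d248, d249, d250, d251, d252, d253, d254, d255, d256, d257]"

lemma digits_upt: "digits = [0..<258]"
  by (simp add: digits_def dd upt_conv_Cons)

lemma take_digits_upt: "k \<le> 258 \<Longrightarrow> take k digits = [0..<k]"
  unfolding digits_upt using take_upt[of 0 k 258] by (simp only: add_0)

lemma sc_tab:
  assumes "0 < k" "k \<le> 258"
  shows "list_all (\<lambda>(x, y). sc k x = y) (zip (take k digits) (tl (take k digits) @ [0]))"
proof -
  have "tl [0..<k] @ [0] = map (sc k) [0..<k]"
  proof (rule nth_equalityI)
    fix i assume i: "i < length (tl [0..<k] @ [0])"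
    then have "i < k" using assms by simp
    then consider "Suc i < k" | "Suc i = k" by linarith
    then show "(tl [0..<k] @ [0]) ! i = map (sc k) [0..<k] ! i"
      using assms by cases (auto simp: nth_append sc_def nth_tl)
  qed (use assms in simp)
  then show ?thesis using assms by (simp add: take_digits_upt list_all_length)
qed

lemma un_tab: "un d0 = 0 \<and> list_all (\<lambda>(x, y). un y = Suc (un x)) (zip digits (tl digits))"
  by (simp add: digits_def un_def dd)

lemma un2_tab: "un2 d0 = 0 \<and> list_all (\<lambda>(x, y). un2 y = Suc (Suc (un2 x))) (zip digits (tl digits))"
  by (simp add: digits_def un2_def dd)

lemmas list_tab_simps = digits_def list.sel zip_Cons_Cons zip_Nil zip.simps(1) list.pred_inject case_prod_conv
  simp_thms take_0 take_Suc_Cons drop_0 drop_Suc_Cons append_Cons append_Nil list.map prod.sel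

lemmas un_simps = un_tab[simplified list_tab_simps]
lemmas un2_simps = un2_tab[simplified list_tab_simps]

text \<open>Seventy-two characters serve as the digits of base 72.\<close>

definition alphabet :: string where
  "alphabet = ''ABCDEFGHIJKLMNOPQRSTUVWXYZabcdefghijklmnopqrstuvwxyz0123456789+-=.,:;/!?''"

text \<open>The remainder keeps the value below 72 also for characters outside the alphabet.\<close>

definition ix :: "char \<Rightarrow> nat" where "ix c = length (takeWhile (\<lambda>x. x \<noteq> c) alphabet) mod 72"

lemma ix_less: "ix c < 72" by (simp add: ix_def)

lemma length_takeWhile_nth:
  "distinct xs \<Longrightarrow> i < length xs \<Longrightarrow> length (takeWhile (\<lambda>x. x \<noteq> xs ! i) xs) = i"
proof (induction xs arbitrary: i)
  case (Cons x xs)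
  then show ?case by (cases i) (auto simp: nth_mem)
qed simp

lemma ix_tab: "list_all (\<lambda>(c, x). ix c = x) (zip alphabet digits)"
proof -
  have "distinct alphabet" "length alphabet = 72" by (simp_all add: alphabet_def)
  then show ?thesis by (simp add: list_all_length digits_upt ix_def length_takeWhile_nth)
qed

lemmas ix_simps = ix_tab[simplified list_tab_simps alphabet_def]

lemma hi_tab: "list_all (\<lambda>(x, y). hi d1 x = y) (zip (take (un d72) digits) (drop (un d72) digits)) \<and>
   list_all (\<lambda>(x, y). hi d2 x = y) (zip (take (un d72) digits) (drop (un d144) digits)) \<and>
   list_all (\<lambda>(x, y). hi d3 x = y) (zip (take (un d72) digits) (drop (un d216) digits))"
  by (simp add: digits_def hi_def un_def dd)

lemmas hi_simps = hi_tab[simplified list_tab_simps un_simps]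

lemma hi_0: "hi d0 x = x" by (simp add: hi_def dd)

definition decode_list :: "(nat \<times> nat \<times> nat) list" where
  "decode_list = concat (map (\<lambda>k. concat (map (\<lambda>q. map (\<lambda>p. (p, q, k)) [d0, d1, d2, d3]) [d0, d1, d2])) [d0, d1, d2, d3, d4, d5])"

lemma decode3_tab: "list_all (\<lambda>(x, y). decode3 x = y) (zip digits decode_list)"
  by (simp add: digits_def decode_list_def dd)

lemmas decode3_simps = decode3_tab[simplified list_tab_simps decode_list_def concat.simps]

text \<open>The bounds belong to the degrees 13, 17 and 19: that many blocks of 72 rotations must
  stay below \<open>(2 ^ (m - 1) - 1) / m\<close>. The numbers 4 and 53 are the largest that do, and
  144 exhausts a low digit with high digit 0 or 1.\<close>

lemma lt_tab: "list_all (\<lambda>x. lt x d4) (take (un d4) digits) \<and> list_all (\<lambda>x. lt x d53) (take (un d53) digits)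
   \<and> list_all (\<lambda>x. lt x d144) (take (un d144) digits)"
  by (simp add: digits_def lt_def un_def dd)

lemmas lt_simps = lt_tab[simplified list_tab_simps un_simps]

lemma row_simps:
  "rowm al be gs ix bd g u nu [] cs = True"
  "rowm al be gs ix bd g u nu (x # vs) (c1 # c2 # c3 # cs) =
     entm al be gs ix bd g (decode3 (ix c3)) (ix c1) (ix c2) u nu (fst x) (snd x) (rowm al be gs ix bd g u nu vs) cs"
  by simp_all

text \<open>A name for the claim to be checked separates reading a certificate from walking.\<close>

definition walk_samem :: "nat \<Rightarrow> nat \<Rightarrow> 'b::field \<Rightarrow> nat \<Rightarrow> nat \<Rightarrow> nat \<Rightarrow> nat \<Rightarrow> nat \<Rightarrow> nat \<Rightarrow> nat \<Rightarrow> bool" where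
  "walk_samem al be g k a b u nu v nv = samem al be g a b (runm al be g k d0 a b nu nv u v)"

definition walk_longm :: "nat \<Rightarrow> nat \<Rightarrow> 'b::field \<Rightarrow> nat \<Rightarrow> nat \<Rightarrow> nat \<Rightarrow> nat \<Rightarrow> nat \<Rightarrow> nat \<Rightarrow> nat \<Rightarrow> nat \<Rightarrow> bool" where
  "walk_longm al be g k l a b u nu v nv = samem al be g a b (itm al be (un l) (runm al be g k d0 a b nu nv u v) nu nv u v)"

text \<open>Classes 0 to 2 are walks of one to three rotations, class 3 is a deferral, and classes 4
  and 5 supply the high digit of the number of blocks.\<close>

lemma ent_simps:
  "entm al be gs ix bd g (p, q, d0) c1 c2 u nu v nv rest cs \<longleftrightarrow>
     walk_samem al be g (Suc (Suc 0)) (hi p c1) (hi q c2) u nu v nv \<and> rest cs"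
  "entm al be gs ix bd g (p, q, d1) c1 c2 u nu v nv rest cs \<longleftrightarrow>
     walk_samem al be g (Suc (Suc (Suc (Suc 0)))) (hi p c1) (hi q c2) u nu v nv \<and> rest cs"
  "entm al be gs ix bd g (p, q, d2) c1 c2 u nu v nv rest cs \<longleftrightarrow>
     walk_samem al be g (Suc (Suc (Suc (Suc (Suc (Suc 0)))))) (hi p c1) (hi q c2) u nu v nv \<and> rest cs"
  "entm al be gs ix bd g (p, q, d3) c1 c2 u nu v nv rest cs \<longleftrightarrow> (u, v) \<in> set gs \<and> rest cs"
  "entm al be gs ix bd g (p, q, d4) c1 c2 u nu v nv rest (c4 # c5 # cs) \<longleftrightarrow> lt (ix c4) bd \<and>
     walk_longm al be g (Suc (Suc (un2 (ix c5)))) (ix c4) (hi p c1) (hi q c2) u nu v nv \<and> rest cs"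
  "entm al be gs ix bd g (p, q, d5) c1 c2 u nu v nv rest (c4 # c5 # cs) \<longleftrightarrow> lt (hi d1 (ix c4)) bd \<and>
     walk_longm al be g (Suc (Suc (un2 (ix c5)))) (hi d1 (ix c4)) (hi p c1) (hi q c2) u nu v nv \<and> rest cs"
  by (simp_all add: entm_def walk_samem_def walk_longm_def dd eval_nat_numeral hi_def)

text \<open>Postpones the exclusion of a conjugate until the walk has been evaluated to a
  label.\<close>

definition good_nextm :: "nat \<Rightarrow> nat \<Rightarrow> 'b::field \<Rightarrow> nat \<Rightarrow> nat \<Rightarrow> nat \<Rightarrow> nat \<Rightarrow> (nat \<times> nat) list \<Rightarrow> nat \<Rightarrow> 'b \<Rightarrow> bool" where
  "good_nextm al be g nu nv u v ss c y \<longleftrightarrow> (ss = [] \<or> \<not> samem al be g d0 d0 y) \<and> goodm al be g nu nv u v ss c y"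

lemma good_simps:
  "goodm al be g nu nv u v ((q, r) # ss) c (elm al be g i a b) \<longleftrightarrow>
    good_nextm al be g nu nv u v ss c (itm al be (un q) (runm al be g (un2 r) i a b nu nv u v) nu nv u v)"
  "good_nextm al be g nu nv u v [] c y \<longleftrightarrow> y = elm al be g c d0 d0"
  "good_nextm al be g nu nv u v (s # ss) c y \<longleftrightarrow> \<not> samem al be g d0 d0 y \<and> goodm al be g nu nv u v (s # ss) c y"
  by (simp_all add: good_nextm_def advm_def runm_def dd)

definition suc144 :: nat where "suc144 = un2 d72"

context label_field
begin

lemma itm_suc144: "itm al be (Suc k) (E j a b) u v w z = itm al be k (R suc144 j a b u v w z) u v w z"
  by (simp add: itm_Suc suc144_def un2_def dd)

text \<open>Adding \<open>m - 1\<close> modulo \<open>m\<close> lowers the pending Frobenius power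
  by one, paid for by a squaring. Repeated, this searches a conjugacy class for the conjugate stored
  in the table.\<close>

lemma fr_step: "fr e (x::'a) = fr (pl m e (m - 1)) (x ^ 2)"
proof -
  have "(x ^ 2) ^ 2 ^ pl m e (m - 1) = x ^ 2 ^ (1 + pl m e (m - 1))" using frob_frob[of x 1] by simp
  also have "\<dots> = x ^ 2 ^ ((1 + pl m e (m - 1)) mod m)" by (rule frob_mod)
  also have "(1 + pl m e (m - 1)) mod m = e mod m"
    using m_ge_2 by (simp add: pl_def mod_simps)
  finally show ?thesis using frob_mod[of x e] by (simp add: fr_def)
qed

end

section \<open>Bit operations, modular powers and prime \<open>n\<close>\<close>

definition xr :: "bool \<Rightarrow> bool \<Rightarrow> bool" where "xr a b = (a \<noteq> b)"
definition sq :: "'b::field \<Rightarrow> 'b" where "sq x = x ^ 2"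
definition tg :: "'b::field \<Rightarrow> 'b \<Rightarrow> 'b" where "tg x y = x * y"
text \<open>One addition in Horner's scheme, with the coefficient as a condition.\<close>

definition cnd :: "bool \<Rightarrow> 'b::field \<Rightarrow> 'b \<Rightarrow> 'b" where "cnd b x y = of_bool b * x + y"

lemma bit_simps:
  "xr True True = False" "xr True False = True" "xr False True = True" "xr False False = False"
  "(\<not> True) = False" "(\<not> False) = True"
  "cnd True x 0 = x" "cnd False x y = y" "cnd True x y = x + y" "tg x 0 = 0" "x + 0 = x"
  by (simp_all add: xr_def cnd_def tg_def)

definition pm :: "nat \<Rightarrow> nat \<Rightarrow> nat \<Rightarrow> nat" where "pm k x e = x ^ e mod k"
definition sqm :: "nat \<Rightarrow> nat \<Rightarrow> nat" where "sqm k x = x * x mod k"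

text \<open>Binary exponentiation with a reduction after every product keeps the numbers
  small.\<close>

lemma pm_simps:
  "pm k x 1 = x mod k" "pm k x (Suc 0) = x mod k"
  "pm k x (numeral (Num.Bit0 e)) = sqm k (pm k x (numeral e))"
  "pm k x (numeral (Num.Bit1 e)) = x * sqm k (pm k x (numeral e)) mod k"
proof -
  show "pm k x 1 = x mod k" "pm k x (Suc 0) = x mod k" by (simp_all add: pm_def)
  show "pm k x (numeral (Num.Bit0 e)) = sqm k (pm k x (numeral e))"
    unfolding pm_def sqm_def numeral_Bit0 power_add by (simp only: mod_mult_eq)
  show "pm k x (numeral (Num.Bit1 e)) = x * sqm k (pm k x (numeral e)) mod k"
    unfolding pm_def sqm_def numeral_Bit1 power_add power_one_right
    by (simp only: mod_mult_eq) (simp only: mod_mult_right_eq mult.commute)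
qed

context binary_field
begin

lemma numeral_simps: "numeral (Num.Bit0 k) = (0::'a)" "numeral (Num.Bit1 k) = (1::'a)"
  by (simp_all add: numeral_Bit0 numeral_Bit1 add_self)

lemma sq_add: "sq (x + y :: 'a) = sq x + sq y"
  using frob_add[of x y 1] by (simp add: sq_def)

lemma of_bool_xr: "of_bool (xr a b) = (of_bool a + of_bool b :: 'a)"
  by (simp add: xr_def of_bool_xor two_eq_0)

text \<open>For prime \<open>n\<close> an exponent that is not a multiple of \<open>n\<close> is
  invertible, and an injective power map sends only 1 to 1.\<close>

lemma prime_order:
  assumes "prime n" "x \<noteq> 0" "x \<noteq> (1::'a)" "x ^ k = 1" shows "n dvd k"
proof (rule ccontr)
  assume "\<not> n dvd k"
  then have "coprime k n" using prime_imp_coprime[OF assms(1)] coprime_commute by blast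
  then obtain k' where "inv_exps k k'" using coprime_inv_exps by blast
  then have "x = 1" using pow_pow_inv(1)[of k k' x] assms(4) by simp
  then show False using assms(3) by simp
qed

text \<open>The three orders are pairwise coprime and divide \<open>totient n\<close>, so their
  product \<open>n - 1\<close> does, which forces \<open>n\<close> to be prime. In a relation
  between the generators, raising to the product of two of the orders leaves only the third
  factor.\<close>

lemma cyclic_coords:
  assumes al: "ord n al = L" and be: "ord n be = H" and cop: "coprime L (m * H)" "coprime H (m * L)"
    and prod: "n - 1 = m * L * H"
  shows "exponent_coords TYPE('a) m al be L H" "prime n"
proof -
  have L0: "0 < L" "0 < H" using prod n_gt by (auto intro: gr0I)
  have al1: "[al ^ L = 1] (mod n)" and be1: "[be ^ H = 1] (mod n)" using ord al be by metis+
  have m1: "[2 ^ m = 1] (mod n)" using card_gt by (simp add: cong_def le_mod_geq)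
  have two: "m dvd j" if "[2 ^ j = 1] (mod n)" for j
  proof -
    have "ord n 2 dvd m" using m1 ord_divides by blast
    moreover have "ord n 2 \<noteq> 1"
    proof
      assume "ord n 2 = 1"
      then have "[2 ^ 1 = 1] (mod n)" using ord[of 2 n] by metis
      then have "n dvd 1" by (simp add: cong_altdef_nat)
      then show False using n_gt by simp
    qed
    ultimately have "ord n 2 = m" using prime_m by (metis prime_nat_iff)
    then show ?thesis using that ord_divides[of 2 j n] by metis
  qed
  have coprimes: "coprime al n" "coprime be n" "coprime 2 n"
    using L0 al be odd_n ord_eq_0[of n al] ord_eq_0[of n be] by (auto simp: coprime_commute)
  have d: "L dvd totient n" "H dvd totient n" "m dvd totient n"
    using coprimes al be order_divides_totient[of n al] order_divides_totient[of n be]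
      two[OF euler_theorem[of 2 n]] by (auto simp: coprime_commute)
  have "coprime (m * L) H" "coprime m L" using cop by (auto simp: coprime_commute)
  then have "m * L * H dvd totient n" using d by (intro divides_mult) auto
  then have "n - 1 \<le> totient n" using prod n_gt by (intro dvd_imp_le) auto
  then have tn: "totient n = n - 1" using totient_less[of n] n_gt by simp
  then show "prime n" using n_gt by (intro totient_imp_prime) auto
  have C: "m dvd j \<and> L dvd a \<and> H dvd b" if *: "[2 ^ j * al ^ a * be ^ b = 1] (mod n)" for j a b
  proof -
    have pow: "[2 ^ (j * k) * al ^ (a * k) * be ^ (b * k) = 1] (mod n)" for k
      using cong_pow[OF *, of k] by (simp add: power_mult_distrib power_mult)
    have drop: "[x = 1] (mod n)" if "[x * y = 1] (mod n)" "[y = 1] (mod n)" for x y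
      using cong_trans[OF cong_sym[OF cong_scalar_left[OF that(2), of x]] that(1)] by simp
    have mp: "[x ^ (i * k) = 1] (mod n)" if "[x ^ k = 1] (mod n)" for x i k :: nat
      using cong_pow[OF that, of i] by (simp add: power_mult[symmetric] mult.commute)
    have A: "L dvd a"
    proof -
      have "[al ^ (a * (m * H)) * (2 ^ (j * (m * H)) * be ^ (b * (m * H))) = 1] (mod n)"
        using pow[of "m * H"] by (simp add: ac_simps)
      moreover have "[2 ^ (j * (m * H)) * be ^ (b * (m * H)) = 1 * 1] (mod n)"
        using mp[OF m1, of "j * H"] mp[OF be1, of "b * m"] by (intro cong_mult) (simp_all add: ac_simps)
      ultimately have "[al ^ (a * (m * H)) = 1] (mod n)" using drop by simp
      then have "L dvd a * (m * H)" using ord_divides[of al "a * (m * H)" n] al by metis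
      then show ?thesis using cop(1) by (simp add: coprime_dvd_mult_left_iff)
    qed
    have B: "H dvd b"
    proof -
      have "[be ^ (b * (m * L)) * (2 ^ (j * (m * L)) * al ^ (a * (m * L))) = 1] (mod n)"
        using pow[of "m * L"] by (simp add: ac_simps)
      moreover have "[2 ^ (j * (m * L)) * al ^ (a * (m * L)) = 1 * 1] (mod n)"
        using mp[OF m1, of "j * L"] mp[OF al1, of "a * m"] by (intro cong_mult) (simp_all add: ac_simps)
      ultimately have "[be ^ (b * (m * L)) = 1] (mod n)" using drop by simp
      then have "H dvd b * (m * L)" using ord_divides[of be "b * (m * L)" n] be by metis
      then show ?thesis using cop(2) by (simp add: coprime_dvd_mult_left_iff)
    qed
    obtain a' b' where "a = L * a'" "b = H * b'" using A B by (elim dvdE)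
    then have "[al ^ a = 1] (mod n)" "[be ^ b = 1] (mod n)"
      using mp[OF al1, of a'] mp[OF be1, of b'] by (simp_all add: mult.commute)
    then have "[al ^ a * be ^ b = 1 * 1] (mod n)" by (rule cong_mult)
    moreover have "[2 ^ j * (al ^ a * be ^ b) = 1] (mod n)" using * by (simp only: mult.assoc)
    ultimately have "[2 ^ j = 1] (mod n)" using drop by simp
    then show ?thesis using A B two by simp
  qed
  show "exponent_coords TYPE('a) m al be L H"
  proof (intro exponent_coords.intro exponent_coords_axioms.intro)
    show "binary_field TYPE('a) m" by (rule binary_field_axioms)
  qed (use al1 be1 L0 C tn prod in simp_all)
qed

end

text \<open>An exponent \<open>(u, v)\<close> with its inverse \<open>(nu, nv)\<close>, the twist
  \<open>c\<close> at the end of its long walk, and one orientation walk each for the exponent and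
  its inverse: a number of rotations, the labels of the start, and the shifted label of its
  reciprocal.\<close>

type_synonym cert = "nat \<times> nat \<times> nat \<times> nat \<times> nat \<times> (nat \<times> nat \<times> nat \<times> nat) \<times> nat \<times> nat \<times> nat \<times> nat"

definition cert_pair :: "cert \<Rightarrow> nat \<times> nat" where "cert_pair x = (case x of (u, nu, v, nv, c, o1, o2) \<Rightarrow> (u, v))"

definition cert_good :: "nat \<Rightarrow> nat \<Rightarrow> 'b::field \<Rightarrow> (nat \<times> nat) list \<Rightarrow> cert \<Rightarrow> bool" where
  "cert_good al be g ss x = (case x of (u, nu, v, nv, c, o1, o2) \<Rightarrow> goodm al be g nu nv u v ss c (elm al be g d0 d0 d0))"

definition cert_ori :: "nat \<Rightarrow> nat \<Rightarrow> 'b::field \<Rightarrow> cert \<Rightarrow> bool" where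
  "cert_ori al be g x = (case x of (u, nu, v, nv, c, (k, a, b, b'), (l, e, f, f')) \<Rightarrow>
     runm al be g (un2 k) d0 a b nu nv u v = elm al be g d0 a b' \<and>
     runm al be g (un2 l) d0 e f u v nu nv = elm al be g d0 e f')"

definition cert_arith :: "nat \<Rightarrow> nat \<Rightarrow> nat \<Rightarrow> nat \<Rightarrow> cert \<Rightarrow> bool" where
  "cert_arith m L H h x = (case x of (u, nu, v, nv, c, (k, a, b, b'), (l, e, f, f')) \<Rightarrow>
     (u + nu) mod L = 0 \<and> (v + nv) mod H = 0 \<and> 0 < c \<and> c < m \<and> b' = (b + h) mod H \<and> f' = (f + h) mod H
     \<and> u < L \<and> v < H \<and> (0 < u \<and> 2 * u < L \<or> (u = 0 \<or> 2 * u = L) \<and> 2 * v \<le> H))"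

definition cert_liftbad :: "nat \<Rightarrow> nat \<Rightarrow> 'b::field \<Rightarrow> (nat \<times> nat) list \<Rightarrow> nat \<times> nat \<times> nat \<times> nat \<Rightarrow> bool" where
  "cert_liftbad al be g ss x = (case x of (u, nu, v, nv) \<Rightarrow> goodm al be g nu nv u v ss d0 (elm al be g d0 d0 d0))"

context label_field
begin

text \<open>As \<open>L\<close> is odd, only the first coordinate 0 is its own negative. Hence the
  rows \<open>us\<close> run over first coordinates below \<open>L / 2\<close> with all second ones,
  and a separate row for 0 stops at \<open>H / 2\<close>. All deferred exponents share the same cut
  points \<open>ss\<close>, and \<open>h\<close> is the shift that inverts elements.\<close>

theorem certified_classes:
  assumes L: "odd L" and bd: "72 * bd * m < 2 ^ (m - 1) - 1" "1 \<le> bd" and h: "n dvd be ^ h + 1"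
    and rows: "list_all (\<lambda>(u, nu, s). rowm al be gs ix bd g u nu vs s) us" "rowm al be gs ix bd g d0 d0 vs0 s0"
    and us: "map fst us = [1..<(L + 1) div 2]" "list_all (\<lambda>(u, nu, s). (u + nu) mod L = 0) us"
    and vs: "map fst vs = [0..<H]" "list_all (\<lambda>(v, nv). (v + nv) mod H = 0) vs"
    and vs0: "map fst vs0 = [0..<H div 2 + 1]" "list_all (\<lambda>(v, nv). (v + nv) mod H = 0) vs0"
    and gs: "gs = map cert_pair gl @ map (\<lambda>(u, nu, v, nv). (u, v)) bl"
    and gl: "list_all (cert_good al be g ss) gl" "list_all (cert_ori al be g) gl" "list_all (cert_arith m L H h) gl"
    and bl: "list_all (cert_liftbad al be g ss) bl" "list_all (\<lambda>(u, nu, v, nv). (u + nu) mod L = 0 \<and> (v + nv) mod H = 0) bl"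
    and N: "sum_list (map amount ss) = N" "N * m = 2 ^ (m - 1) - 1" "0 < N"
    and q: "N = prod_list ps" "\<forall>p\<in>set ps. prime p \<and> (\<exists>k\<in>{0<..<length ss}. N div p = sum_list (map amount (take k ss)))"
    and dist: "distinct (map cert_pair gl)"
  shows "num_iso_classes T = length gl" "all_nonorientable T"
proof -
  let ?S = "\<lambda>u v. in_closed_surface (\<lambda>x::'a. x ^ ex u v)"
  have d0: "d0 = 0" by (simp add: dd)
  have cov: "(a, b) \<in> set gs \<or> \<not> ?S a b" if ab: "(a, b) \<in> half_pairs L H" for a b
  proof (cases "a = 0")
    case True
    then have "b \<in> set (map fst vs0)" using ab unfolding vs0(1) by (auto simp: half_pairs_def)
    then have b: "b \<in> fst ` set vs0" by simp
    have v: "\<forall>(v, nv) \<in> set vs0. [v + nv = 0] (mod H)" using vs0(2) by (auto simp: list_all_iff cong_def)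
    have "[d0 + d0 = 0] (mod L)" by (simp add: d0)
    from row_sound[OF this bd ix_less rows(2) v] show ?thesis using b True by (simp only: d0)
  next
    case False
    then have a: "0 < a" "2 * a < L" using ab L by (auto simp: half_pairs_def)
    then have "a < (L + 1) div 2" by linarith
    then have "a \<in> set (map fst us)" unfolding us(1) using a(1) by simp
    then obtain nu s where us': "(a, nu, s) \<in> set us" by auto
    then have r: "rowm al be gs ix bd g a nu vs s" and nu: "[a + nu = 0] (mod L)"
      using rows(1) us(2) by (auto simp: list_all_iff cong_def)
    have "b \<in> set (map fst vs)" using ab unfolding vs(1) by (auto simp: half_pairs_def)
    then have b: "b \<in> fst ` set vs" by simp
    have v: "\<forall>(v, nv) \<in> set vs. [v + nv = 0] (mod H)" using vs(2) by (auto simp: list_all_iff cong_def)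
    from row_sound[OF nu bd ix_less r v] show ?thesis using b by blast
  qed
  have pq: "\<exists>k. 0 < k \<and> k < length ss \<and> N div p = sum_list (map amount (take k ss))" if p: "prime p" "p dvd N" for p
  proof -
    have "p \<in> set ps" if "p dvd prod_list ps" "\<forall>p\<in>set ps. prime p" for ps :: "nat list"
      using that
    proof (induction ps)
      case Nil then show ?case using p(1) by simp
    next
      case (Cons r rs)
      from Cons.prems(1) have "p dvd r \<or> p dvd prod_list rs" using prime_dvd_multD[OF p(1)] by simp
      then show ?case using Cons primes_dvd_imp_eq[OF p(1)] by auto
    qed
    then have "p \<in> set ps" using p(2) q by blast
    with q(2) obtain k where "k \<in> {0<..<length ss}" "N div p = sum_list (map amount (take k ss))" by blast
    then show ?thesis by (intro exI[of _ k]) simp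
  qed
  have good: "?S u v" if mem: "(u, nu, v, nv, c, o1, o2) \<in> set gl" for u nu v nv c o1 o2
  proof -
    obtain k a b b' l e f f' where o: "o1 = (k, a, b, b')" "o2 = (l, e, f, f')" by (cases o1; cases o2)
    have ar: "[u + nu = 0] (mod L)" "[v + nv = 0] (mod H)" "0 < c" "c < m"
      using gl(3) mem o by (auto simp: list_all_iff cert_arith_def cong_def)
    have g: "goodm al be g nu nv u v ss c (E 0 0 0)" using gl(1) mem by (auto simp: list_all_iff cert_good_def d0)
    show ?thesis by (rule goodm_closed[OF ar(1,2) g ar(3,4)]) (use N pq in auto)
  qed
  have bad: "\<not> ?S u v" if mem: "(u, nu, v, nv) \<in> set bl" for u nu v nv
  proof -
    have ar: "[u + nu = 0] (mod L)" "[v + nv = 0] (mod H)" using bl(2) mem by (auto simp: list_all_iff cong_def)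
    have g: "goodm al be g nu nv u v ss 0 (E 0 0 0)" using bl(1) mem by (auto simp: list_all_iff cert_liftbad_def d0)
    show ?thesis by (rule goodm_not_closed[OF ar g]) (use N in auto)
  qed
  have g1: "?S a b" if "(a, b) \<in> set (map cert_pair gl)" for a b
    using that good by (auto simp: cert_pair_def)
  have g2: "\<not> ?S a b" if "(a, b) \<in> set (map (\<lambda>(u, nu, v, nv). (u, v)) bl)" for a b
    using that bad by auto
  have "set (map cert_pair gl) \<subseteq> half_pairs L H"
    using gl(3) by (auto simp: list_all_iff cert_pair_def cert_arith_def half_pairs_def)
  from count_classes[of gs "map cert_pair gl" "map (\<lambda>(u, nu, v, nv). (u, v)) bl", OF cov g1 g2 _ this dist]
  show "num_iso_classes T = length gl" by (simp add: gs)
  show "all_nonorientable T"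
  proof (rule classes_nonorientable)
    show "(a, b) \<in> set (map cert_pair gl)" if "(a, b) \<in> half_pairs L H" "?S a b" for a b
      using cov[OF that(1)] that(2) g2[of a b] unfolding gs set_append by blast
    fix a b assume "(a, b) \<in> set (map cert_pair gl)"
    then obtain nu nv c k x y y' l e f f' where gl': "(a, nu, b, nv, c, (k, x, y, y'), (l, e, f, f')) \<in> set gl"
      by (auto simp: cert_pair_def)
    then have ar: "[a + nu = 0] (mod L)" "[b + nv = 0] (mod H)" "[nu + a = 0] (mod L)" "[nv + b = 0] (mod H)"
      "y' = pl H y h" "f' = pl H f h"
      using gl(3) by (auto simp: list_all_iff cert_arith_def cong_def pl_def add.commute)
    have o: "R (un2 k) 0 x y nu nv a b = E 0 x y'" "R (un2 l) 0 e f a b nu nv = E 0 e f'"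
      using gl(2) gl' by (auto simp: list_all_iff cert_ori_def d0)
    show "\<exists>a' b'. [a + a' = 0] (mod L) \<and> [b + b' = 0] (mod H)
      \<and> \<not> orientable STS (white (ex a b)) \<and> \<not> orientable STS (white (ex a' b'))"
      using ar run_not_orientable[OF ar(1,2) h ar(5) o(1)] run_not_orientable[OF ar(3,4) h ar(6) o(2)] by blast
  qed
qed

end

section \<open>Fields with few exponents\<close>

primrec frs :: "nat \<Rightarrow> 'b::field \<Rightarrow> 'b" where
  "frs 0 x = x" | "frs (Suc k) x = frs k (sq x)"

primrec conj_of :: "nat \<Rightarrow> 'b::field \<Rightarrow> 'b \<Rightarrow> bool" where
  "conj_of 0 x y = False" | "conj_of (Suc k) x y = (y = x \<or> conj_of k (sq x) y)"

lemma frs_pow: "frs k x = x ^ 2 ^ k"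
  by (induction k arbitrary: x) (simp_all add: sq_def flip: power_mult)

lemma conj_of_iff: "conj_of k x y \<longleftrightarrow> (\<exists>j<k. y = x ^ 2 ^ j)"
proof (induction k arbitrary: x)
  case (Suc k)
  have "(\<exists>j<Suc k. y = x ^ 2 ^ j) \<longleftrightarrow> y = x \<or> (\<exists>j<k. y = x ^ 2 ^ Suc j)" by (subst Ex_less_Suc2) simp
  then show ?case using Suc by (simp add: sq_def flip: power_mult)
qed simp

lemma pw_simps:
  fixes x :: "'b::field"
  shows "x ^ numeral (num.Bit0 k) = sq (x ^ numeral k)" "x ^ numeral (num.Bit1 k) = x * sq (x ^ numeral k)"
    "x ^ numeral num.One = x" "x ^ 1 = x"
  by (simp_all only: sq_def numeral_Bit0 numeral_Bit1 numeral_One power_add power2_eq_square power_one_right ac_simps)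

lemma prime_dvd_prod_list_mem: "prime q \<Longrightarrow> q dvd prod_list ps \<Longrightarrow> \<forall>p\<in>set ps. prime p \<Longrightarrow> (q::nat) \<in> set ps"
  by (induction ps) (auto simp: prime_dvd_mult_iff primes_dvd_imp_eq)

context binary_field
begin

lemma add_eq_zero_iff: "x + y = 0 \<longleftrightarrow> x = (y::'a)"
proof
  assume "x + y = 0"
  then have "x + y + y = y" by simp
  then show "x = y" by (simp add: add.assoc add_self)
qed (simp add: add_self)

lemma coordinates_zero:
  assumes "d \<noteq> 0" "d \<noteq> (1::'a)" "(\<Sum>i<m. of_bool (bs ! i) * d ^ i) = 0" "i < m" shows "\<not> bs ! i"
proof -
  have "of_bool (bs ! i) * d ^ i = (if bs ! i then d ^ i else 0)" for i by simp
  then have "comb {i \<in> {..<m}. bs ! i} d = 0"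
    using assms(3) unfolding comb_def by (subst sum.inter_filter) simp_all
  then have "{i \<in> {..<m}. bs ! i} = {}" by (intro comb_zero_iff[OF assms(1,2)]) auto
  then show ?thesis using assms(4) by auto
qed

end

context exponent_coords
begin

text \<open>Replaces a product of powers by its residue \<open>t\<close>. The test on
  \<open>t * t'\<close> also ensures that both residues are positive.\<close>

lemma reduced_exponent:
  assumes t: "t = (al ^ a * be ^ b) mod n" "t * t' mod n = 1"
  shows "inv_exps t t'" "(\<lambda>x::'a. x ^ ex a b) = (\<lambda>x. x ^ t)" "[ex a b = t] (mod n)"
proof -
  have "1 mod n = 1" using n_gt by simp
  then show i: "inv_exps t t'" using t(2) by (cases "t = 0"; cases "t' = 0") (simp_all add: inv_exps_def cong_def)
  show c: "[ex a b = t] (mod n)" by (simp add: t(1) ex_def cong_def)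
  show "(\<lambda>x::'a. x ^ ex a b) = (\<lambda>x. x ^ t)"
  proof
    fix x :: 'a
    show "x ^ ex a b = x ^ t"
    proof (cases "x = 0")
      case True then show ?thesis using ex_pos[of a b] i by (simp add: inv_exps_def power_0_left)
    next
      case False then show ?thesis by (rule pow_cong[OF _ c])
    qed
  qed
qed

text \<open>Here walks run on coordinate vectors, and every exponent is given with its inverse. A
  refutation in \<open>bl\<close> is either a return to a conjugate before
  \<open>(2 ^ (m - 1) - 1) / m\<close> rotations, or an exact return before the full period.\<close>

theorem direct_classes:
  fixes gl :: "(nat \<times> nat \<times> nat \<times> nat \<times> nat) list" and bl :: "(nat \<times> nat \<times> nat \<times> nat \<times> nat \<times> nat \<times> 'a) list"
    and ol :: "(nat \<times> nat \<times> 'a \<times> nat \<times> 'a \<times> nat) list" and x :: 'a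
  assumes cover: "half_pairs L H \<subseteq> set (map (\<lambda>(a, b, _). (a, b)) gl) \<union> set (map (\<lambda>(a, b, _). (a, b)) bl)"
    and half: "set (map (\<lambda>(a, b, _). (a, b)) gl) \<subseteq> half_pairs L H" and dist: "distinct (map (\<lambda>(a, b, _). (a, b)) gl)"
    and gl: "list_all (\<lambda>(a, b, t, t', c). t = (al ^ a * be ^ b) mod n \<and> t * t' mod n = 1 \<and> 0 < c \<and> c < m) gl"
      "list_all (\<lambda>(a, b, t, t', c). rr (un2 N) x t' t = frs (un c) x \<and>
         list_all (\<lambda>k. \<not> conj_of (un d) x (rr (un2 k) x t' t)) ks) gl"
    and x: "x \<noteq> 0" "x \<noteq> 1" and d: "d = m" and N: "N * m = 2 ^ (m - 1) - 1" "0 < N"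
    and ps: "N = prod_list ps" "\<forall>p\<in>set ps. prime p \<and> N div p \<in> set ks"
    and bl: "list_all (\<lambda>(a, b, t, t', k, c, y). t = (al ^ a * be ^ b) mod n \<and> t * t' mod n = 1 \<and> 0 < k \<and>
         (k * m < 2 ^ (m - 1) - 1 \<or> c = 0 \<and> k < 2 ^ (m - 1) - 1)) bl"
      "list_all (\<lambda>(a, b, t, t', k, c, y). y \<noteq> 0 \<and> y \<noteq> 1 \<and> rr (un2 k) y t' t = frs (un c) y) bl"
  shows "num_iso_classes T = length gl"
    and "map (\<lambda>(a, b, t, t', c). (t, t')) gl = map (\<lambda>(t, t', _). (t, t')) ol \<Longrightarrow>
      list_all (\<lambda>(t, t', y, k, z, l). y \<noteq> 0 \<and> y \<noteq> 1 \<and> z \<noteq> 0 \<and> z \<noteq> 1 \<and>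
        rr (un2 k) y t' t * y = 1 \<and> rr (un2 l) z t t' * z = 1) ol \<Longrightarrow> all_nonorientable T"
proof -
  let ?S = "\<lambda>a b. in_closed_surface (\<lambda>x::'a. x ^ ex a b)"
  \<comment> \<open>Conjugates repeat with period \<open>m\<close>, so it is enough to compare with
    \<open>m\<close> of them.\<close>
  have frob: "x ^ 2 ^ j = x ^ 2 ^ (j mod m)" for j by (rule pow_cong[OF x(1) pow_mod_cong[OF two_m]])
  have good: "?S a b" if ab: "(a, b) \<in> set (map (\<lambda>(a, b, _). (a, b)) gl)" for a b
  proof -
    obtain t t' c where e: "(a, b, t, t', c) \<in> set gl" using ab by auto
    then have t: "t = (al ^ a * be ^ b) mod n" "t * t' mod n = 1" and c: "0 < c" "c < m"
      and r: "rr (un2 N) x t' t = frs (un c) x" and k: "\<forall>k\<in>set ks. \<not> conj_of (un d) x (rr (un2 k) x t' t)"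
      using gl by (auto simp: list_all_iff)
    have "in_closed_surface (\<lambda>x::'a. x ^ t)"
    proof (rule closed_surface[OF reduced_exponent(1)[OF t] x N])
      show "(rho t t' ^^ N) x = x ^ 2 ^ c" using r by (simp add: un2_def un_def rr_rho frs_pow)
      show "\<not> m dvd c" using c by (simp add: nat_dvd_not_less)
      fix q j assume q: "prime q" "q dvd N"
      have "q \<in> set ps" using q ps by (intro prime_dvd_prod_list_mem) auto
      then have "\<not> conj_of m x (rr (2 * (N div q)) x t' t)" using k ps(2) by (simp add: un2_def un_def d)
      then show "(rho t t' ^^ (N div q)) x \<noteq> x ^ 2 ^ j"
        using frob[of j] m_ge_2 by (auto simp: conj_of_iff rr_rho)
    qed
    then show ?thesis by (simp only: reduced_exponent(2)[OF t])
  qed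
  have bad: "\<not> ?S a b" if ab: "(a, b) \<in> set (map (\<lambda>(a, b, _). (a, b)) bl)" for a b
  proof -
    obtain t t' k c y where e: "(a, b, t, t', k, c, y) \<in> set bl" using ab by auto
    then have t: "t = (al ^ a * be ^ b) mod n" "t * t' mod n = 1" and k: "0 < k"
        "k * m < 2 ^ (m - 1) - 1 \<or> c = 0 \<and> k < 2 ^ (m - 1) - 1"
      and y: "y \<noteq> 0" "y \<noteq> 1" and r: "rr (un2 k) y t' t = frs (un c) y"
      using bl by (auto simp: list_all_iff)
    have r: "(rho t t' ^^ k) y = y ^ 2 ^ c" using r by (simp add: un2_def un_def rr_rho frs_pow)
    have "\<not> in_closed_surface (\<lambda>x::'a. x ^ t)" using k(2)
    proof
      assume "k * m < 2 ^ (m - 1) - 1"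
      then show ?thesis by (rule not_closed_surface_conj[OF reduced_exponent(1)[OF t] y k(1) _ r])
    next
      assume *: "c = 0 \<and> k < 2 ^ (m - 1) - 1"
      then have "(rho t t' ^^ k) y = y" using r by simp
      with * show ?thesis using not_closed_surface[OF reduced_exponent(1)[OF t] y k(1)] by blast
    qed
    then show ?thesis by (simp only: reduced_exponent(2)[OF t] not_False_eq_True)
  qed
  have c: "(a, b) \<in> set (map (\<lambda>(a, b, _). (a, b)) gl) \<or> \<not> ?S a b" if "(a, b) \<in> half_pairs L H" for a b
    using subsetD[OF cover that] bad[of a b] by blast
  have "num_iso_classes T = length (map (\<lambda>(a, b, _). (a, b)) gl)"
    by (rule count_classes[where ?g2.0 = "[]", OF c good _ _ half dist]) auto
  then show "num_iso_classes T = length gl" by simp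
  assume ol: "map (\<lambda>(a, b, t, t', c). (t, t')) gl = map (\<lambda>(t, t', _). (t, t')) ol"
    "list_all (\<lambda>(t, t', y, k, z, l). y \<noteq> 0 \<and> y \<noteq> 1 \<and> z \<noteq> 0 \<and> z \<noteq> 1 \<and>
        rr (un2 k) y t' t * y = 1 \<and> rr (un2 l) z t t' * z = 1) ol"
  show "all_nonorientable T"
  proof (rule all_nonorientable_half_system[OF half_system_pairs])
    fix r r' assume "r \<in> (\<lambda>(a, b). ex a b) ` half_pairs L H" and S: "in_closed_surface (\<lambda>x::'a. x ^ r)" and r': "inv_exps r r'"
    then obtain a b where ab: "(a, b) \<in> half_pairs L H" "r = ex a b" by auto
    then have "(a, b) \<in> set (map (\<lambda>(a, b, _). (a, b)) gl)" using c[OF ab(1)] S by simp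
    then obtain t t' cc where e: "(a, b, t, t', cc) \<in> set gl" by auto
    then have t: "t = (al ^ a * be ^ b) mod n" "t * t' mod n = 1" using gl(1) by (auto simp: list_all_iff)
    note red = reduced_exponent[OF t]
    have "(t, t') \<in> set (map (\<lambda>(a, b, t, t', c). (t, t')) gl)" using e by force
    then have "(t, t') \<in> set (map (\<lambda>(t, t', _). (t, t')) ol)" by (simp only: ol(1))
    then obtain y k z l where "(t, t', y, k, z, l) \<in> set ol" by auto
    then have y: "y \<noteq> 0" "y \<noteq> 1" "rr (un2 k) y t' t * y = 1" and z: "z \<noteq> 0" "z \<noteq> 1" "rr (un2 l) z t t' * z = 1"
      using ol(2) by (auto simp: list_all_iff)
    have inv: "w = inverse u" if "w * u = 1" for w u :: 'a using that inverse_unique[of u w] by (simp add: mult.commute)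
    have "\<not> orientable STS (white t)"
      using not_orientable[OF red(1) y(1,2), of k] inv[OF y(3)] by (simp add: un2_def rr_rho)
    moreover have "\<not> orientable STS (white t')"
      using not_orientable[OF inv_exps_sym[OF red(1)] z(1,2), of l] inv[OF z(3)] by (simp add: un2_def rr_rho)
    moreover have "white r = white t" using red(2) ab(2) by simp
    moreover have "white r' = white t'"
    proof -
      \<comment> \<open>The inverses \<open>r'\<close> and \<open>t'\<close> may differ as numbers,
        but they are congruent and so define the same white triangles.\<close>
      have "[r' * t = r' * r] (mod n)" using cong_sym[OF cong_scalar_left[OF red(3), of r']] ab(2) by simp
      moreover have "[r' * r = 1] (mod n)" using r' by (simp add: inv_exps_def mult.commute)
      ultimately have "[r' * t = 1] (mod n)" by (rule cong_trans)
      then have "[r' = t' * 2 ^ 0] (mod n)" using cong_mult_inv[OF red(1), of r' 1] by simp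
      from white_frob[OF this] show ?thesis using r' red(1) by (auto simp: inv_exps_def)
    qed
    ultimately show "\<not> orientable STS (white r) \<and> \<not> orientable STS (white r')" by simp
  qed
qed

end

lemma suc144_simp: "suc144 = un2 d72" by (simp add: suc144_def)

context binary_field
begin

lemma of_bool_not: "of_bool (\<not> b) = (1 + of_bool b :: 'a)"
  by (simp add: two_eq_0)

lemma char2_simps: "x + x = (0::'a)" "x + (x + y) = (y::'a)" "(x + y) + z = x + (y + z :: 'a)" "y + x = (x + y::'a)" "y + (x + z) = x + (y + z :: 'a)"
  by (simp_all add: add_self add_add_self ac_simps)

lemma sq_simps: "sq (x * y) = sq x * sq (y::'a)" "sq (of_bool b) = (of_bool b :: 'a)" "sq (x ^ k) = (x::'a) ^ (2 * k)"
  by (simp_all add: sq_def power_mult_distrib mult.commute flip: power_mult)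

end

lemma horner_simps:
  fixes g :: "'b::field"
  shows "cnd b x y = of_bool b * x + y" "tg g (x + y) = tg g x + tg g y" "tg g (of_bool b * x) = of_bool b * (g * x)"
    "g * (g * x) = g\<^sup>2 * x" "g * (g ^ k * x) = g ^ Suc k * x"
    "tg g 0 = 0" "(x + y) * z = x * z + y * z" "(x * y) * z = x * (y * z)" "(x + y) + z = x + (y + z)" "x + 0 = x"
    "Suc (numeral i) = numeral (i + Num.One)"
  by (simp_all add: cnd_def tg_def distrib_left distrib_right power2_eq_square ac_simps)

lemma tg_simps:
  fixes g :: "'b::field"
  shows "tg g (x + y) = tg g x + tg g y" "tg g (of_bool b * g ^ numeral i) = of_bool b * g ^ numeral (i + Num.One)"
    "tg g (g ^ numeral i) = g ^ numeral (i + Num.One)" "tg g 0 = 0" "tg g (g\<^sup>2) = g ^ 3"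
    "tg g (of_bool b * g) = of_bool b * g\<^sup>2" "tg g (of_bool b) = of_bool b * g"
  by (simp_all add: tg_def distrib_left power2_eq_square power3_eq_cube flip: power_Suc)

lemma ord_pmI:
  assumes "pm N a (prod_list ps) = 1 mod N" "\<forall>p\<in>set ps. prime p \<and> pm N a (prod_list ps div p) \<noteq> 1 mod N"
  shows "ord N a = prod_list ps"
  by (rule ordI) (use assms in \<open>simp_all add: cong_def pm_def\<close>)

text \<open>A common divisor divides the difference 1, so explicit multipliers certify
  coprimality.\<close>

lemma coprime_bezout: "a * x = Suc (b * y) \<Longrightarrow> coprime a b"
proof (rule coprimeI)
  fix c assume "a * x = Suc (b * y)" "c dvd a" "c dvd b"
  then have "c dvd Suc (b * y)" "c dvd b * y" by (metis dvd_mult2)+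
  then show "is_unit c" using dvd_diff_nat[of c "Suc (b * y)" "b * y"] by simp
qed

context label_field
begin

lemma okp_all_lookp: "tr_all okp t \<Longrightarrow> tr_all lookp t"
  by (erule tr_all_mono) (rule okp_lookp)

lemma okp_all_stepp: "tr_all okp t \<Longrightarrow> tr_all stepp t"
  by (erule tr_all_mono) (rule okp_stepp)

end

abbreviation (input) "ff \<equiv> False"
abbreviation (input) "tt \<equiv> True"

definition not_conj :: "nat \<Rightarrow> 'b::field \<Rightarrow> nat \<Rightarrow> nat \<Rightarrow> nat \<Rightarrow> bool" where
  "not_conj d x t t' k \<longleftrightarrow> \<not> conj_of (un d) x (rr (un2 k) x t' t)"

definition dgood :: "nat \<Rightarrow> nat list \<Rightarrow> nat \<Rightarrow> 'b::field \<Rightarrow> nat \<times> nat \<times> nat \<times> nat \<times> nat \<Rightarrow> bool" where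
  "dgood N ks d x = (\<lambda>(a, b, t, t', c). rr (un2 N) x t' t = frs (un c) x \<and>
     list_all (\<lambda>k. \<not> conj_of (un d) x (rr (un2 k) x t' t)) ks)"

definition dbad :: "nat \<times> nat \<times> nat \<times> nat \<times> nat \<times> nat \<times> 'b::field \<Rightarrow> bool" where
  "dbad = (\<lambda>(a, b, t, t', k, c, y). y \<noteq> 0 \<and> y \<noteq> 1 \<and> rr (un2 k) y t' t = frs (un c) y)"

definition dori :: "nat \<times> nat \<times> 'b::field \<times> nat \<times> 'b \<times> nat \<Rightarrow> bool" where
  "dori = (\<lambda>(t, t', y, k, z, l). y \<noteq> 0 \<and> y \<noteq> 1 \<and> z \<noteq> 0 \<and> z \<noteq> 1 \<and>
     rr (un2 k) y t' t * y = 1 \<and> rr (un2 l) z t t' * z = 1)"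

lemma dbad_simp: "dbad (a, b, t, t', k, c, y) \<longleftrightarrow> y \<noteq> 0 \<and> y \<noteq> 1 \<and> rr (un2 k) y t' t = frs (un c) y"
  by (simp add: dbad_def)

lemma dori_simp: "dori (t, t', y, k, z, l) \<longleftrightarrow> y \<noteq> 0 \<and> y \<noteq> 1 \<and> z \<noteq> 0 \<and> z \<noteq> 1 \<and>
    rr (un2 k) y t' t * y = 1 \<and> rr (un2 l) z t t' * z = 1"
  by (simp add: dori_def)

lemma dgood_simps:
  "dgood N ks d x (a, b, t, t', c) \<longleftrightarrow> rr (un2 N) x t' t = frs (un c) x \<and> list_all (not_conj d x t t') ks"
  "not_conj d x t t' k \<longleftrightarrow> \<not> conj_of (un d) x (rr (un2 k) x t' t)"
  by (simp_all add: dgood_def not_conj_def[abs_def])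

section \<open>The field with 8 elements\<close>

definition v3 :: "'b::field \<Rightarrow> bool \<Rightarrow> bool \<Rightarrow> bool \<Rightarrow> 'b" where
  "v3 g b0 b1 b2 =
    of_bool b0 + of_bool b1 * g + of_bool b2 * g ^ 2"

locale gf3 =
  fixes g :: "'a::{field,finite}"
  assumes card_gf: "card (UNIV :: 'a set) = 2 ^ 3" and root: "g ^ 3 = 1 + g"
begin

sublocale binary_field 3 "TYPE('a)"
  by unfold_locales (use card_gf in simp_all)

lemma g_ne: "g \<noteq> 0" "g \<noteq> 1"
  using root by (auto simp: numeral_simps)

text \<open>Powers up to twice the top exponent are what squaring a coordinate vector
  produces.\<close>

lemma g_pow:
  "g ^ 4 = g + g ^ 2"
proof -
  have p4: "g ^ 4 = g + g ^ 2"
    using power_add[of g 1 3]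
    by (simp add: root distrib_left char2_simps flip: power_Suc power_Suc2 power_add power2_eq_square)
  show "g ^ 4 = g + g ^ 2"
    by (fact p4)+
qed

lemma v_add: "v3 g b0 b1 b2 + v3 g c0 c1 c2 =
  v3 g (xr b0 c0) (xr b1 c1) (xr b2 c2)"
  by (simp add: v3_def of_bool_xr distrib_right ac_simps)

lemma v_one: "1 + v3 g b0 b1 b2 = v3 g (\<not> b0) b1 b2"
  by (simp add: v3_def of_bool_not ac_simps)

text \<open>Multiplication by \<open>g\<close> shifts the bits; a top bit that leaves the vector
  comes back through \<open>root\<close>.\<close>

lemma v_tg:
  "tg g (v3 g b0 b1 False) = v3 g False b0 b1"
  "tg g (v3 g b0 b1 True) = v3 g True (\<not> b0) b1"
  by (simp_all only: v3_def tg_simps root of_bool_not of_bool_eq mult_1 mult_zero_left add_0_left add_0_right distrib_left distrib_right add_num_simps arith_simps add.assoc add.commute add.left_commute)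

text \<open>Squaring is linear, so it recombines the bits as prescribed by \<open>root\<close> and
  \<open>g_pow\<close>.\<close>

lemma v_sq: "sq (v3 g b0 b1 b2) =
    v3 g b0 b2 (xr b1 b2)"
  by (simp only: v3_def sq_add sq_simps sq_def[of g] arith_simps mult_1_right root g_pow of_bool_xr distrib_left distrib_right add.assoc add.commute add.left_commute)

text \<open>Horner's scheme in the bits of the left factor.\<close>

lemma v_mult: "v3 g b0 b1 b2 * X =
    cnd b0 X (tg g (cnd b1 X (tg g (cnd b2 X 0))))"
  by (simp only: v3_def horner_simps add_num_simps)

lemma v_g: "v3 g False True False = g" and v_zero: "v3 g False False False = 0"
  by (simp_all add: v3_def)

text \<open>The powers of \<open>g\<close> form a basis because \<open>g\<close> is neither 0 nor
  1.\<close>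

lemma v_eq_0: "v3 g b0 b1 b2 = 0 \<longleftrightarrow> \<not> b0 \<and> \<not> b1 \<and> \<not> b2"
proof -
  have "(\<Sum>i<3. of_bool ([b0, b1, b2] ! i) * g ^ i) = v3 g b0 b1 b2"
    by (simp add: v3_def eval_nat_numeral ac_simps)
  then have "\<not> [b0, b1, b2] ! i" if "v3 g b0 b1 b2 = 0" "i < 3" for i
    using coordinates_zero[OF g_ne, of "[b0, b1, b2]" i] that by simp
  note this[of 0] this[of 1] this[of 2]
  then show ?thesis by (auto simp: v_zero)
qed

lemma v_eq: "v3 g b0 b1 b2 = v3 g c0 c1 c2 \<longleftrightarrow> b0 = c0 \<and> b1 = c1 \<and> b2 = c2"
  by (subst add_eq_zero_iff[symmetric]) (simp add: v_add v_eq_0 xr_def)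

lemma v_eq_1: "v3 g b0 b1 b2 = 1 \<longleftrightarrow> b0 \<and> \<not> b1 \<and> \<not> b2"
proof -
  have "1 = v3 g True False False" by (simp add: v3_def)
  then show ?thesis using v_eq[of b0 b1 b2 True False False] by simp
qed

text \<open>Modulo 7 the number 2 has order 3 and 6 = -1 has order 2, which accounts for all units;
  \<open>al\<close> is trivial.\<close>

lemma coords: "exponent_coords TYPE('a) 3 1 6 1 2"
proof -
  have "ord n 1 = prod_list []" "ord n 6 = prod_list [2]"
    by (rule ord_pmI; simp add: pm_simps sqm_def)+
  then have o: "ord n 1 = 1" "ord n 6 = 2" by simp_all
  have "coprime (1::nat) (3 * 2)" "coprime (2::nat) (3 * 1)" "n - 1 = 3 * 1 * 2"
    using coprime_bezout[of 1 1 "3 * 2" 0] coprime_bezout[of 2 2 "3 * 1" 1] by simp_all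
  from cyclic_coords(1)[OF o this] show ?thesis .
qed

text \<open>An entry consists of the two coordinates, the exponent, its inverse and the final twist.
  The exponent 6 is inversion: \<open>rho y = 1 + 1/y\<close> has order 3, which is the full period
  only in this field.\<close>

definition gl :: "(nat \<times> nat \<times> nat \<times> nat \<times> nat) list" where "gl = [
  (d0, d1, 6, 6, d1)]"

text \<open>After the exponent and its inverse come the number of rotations, the twist reached and
  the starting element. For the exponent 1 the rotation is the identity.\<close>

definition bl :: "(nat \<times> nat \<times> nat \<times> nat \<times> nat \<times> nat \<times> 'a) list" where "bl = [
  (d0, d0, 1, 1, d1, d0, v3 g ff tt ff)]"

lemmas comp_simps = rr.simps un_simps un2_simps pw_simps v_add v_one v_tg v_sq v_mult v_eq v_eq_0 v_eq_1 bit_simps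
  frs.simps conj_of.simps list.pred_inject case_prod_conv simp_thms

text \<open>The number of steps is \<open>(2 ^ 2 - 1) / 3 = 1\<close>; having no prime divisor, it
  needs no intermediate test.\<close>

lemma good_cert: "list_all (dgood d1 [] d3 (v3 g False True False)) gl"
  unfolding gl_def by (simp only: comp_simps dgood_simps)

lemmas good = good_cert[unfolded dgood_def]

lemma bad_cert: "list_all dbad bl"
  unfolding bl_def by (simp only: comp_simps dbad_simp)

lemmas bad = bad_cert[unfolded dbad_def]

theorem classes: "num_iso_classes TYPE('a) = 1"
proof -
  interpret exponent_coords 3 "TYPE('a)" 1 6 1 2 by (rule coords)
  have upt: "take (un d1) digits = [0..<1]" "take (un d2) digits = [0..<2]"
    by (simp_all add: un_def dd take_digits_upt)
  have cov: "list_all (\<lambda>a. list_all (\<lambda>b. 0 < a \<and> 2 * a < 1 \<or> (a = 0 \<or> 2 * a = 1) \<and> 2 * b \<le> 2 \<longrightarrow>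
      (a, b) \<in> set (map (\<lambda>(a, b, _). (a, b)) gl) \<union> set (map (\<lambda>(a, b, _). (a, b)) bl)) (take (un d2) digits)) (take (un d1) digits)"
    by (simp only: list_tab_simps un_simps) (simp add: gl_def bl_def dd)
  have cover: "half_pairs 1 2 \<subseteq> set (map (\<lambda>(a, b, _). (a, b)) gl) \<union> set (map (\<lambda>(a, b, _). (a, b)) bl)"
  proof (rule subsetI)
    fix p assume "p \<in> half_pairs 1 2"
    then have "fst p \<in> set [0..<1]" "snd p \<in> set [0..<2]" "(\<lambda>a b. 0 < a \<and> 2 * a < 1 \<or> (a = 0 \<or> 2 * a = 1) \<and> 2 * b \<le> 2) (fst p) (snd p)"
      unfolding half_pairs_def by (simp_all only: set_upt mem_Collect_eq case_prod_beta atLeastLessThan_iff zero_le simp_thms)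
    moreover have "\<forall>a\<in>set [0..<1]. \<forall>b\<in>set [0..<2]. 0 < a \<and> 2 * a < 1 \<or> (a = 0 \<or> 2 * a = 1) \<and> 2 * b \<le> 2 \<longrightarrow> (a, b) \<in> set (map (\<lambda>(a, b, _). (a, b)) gl) \<union> set (map (\<lambda>(a, b, _). (a, b)) bl)"
      using cov by (simp only: upt list_all_iff)
    ultimately have "(fst p, snd p) \<in> set (map (\<lambda>(a, b, _). (a, b)) gl) \<union> set (map (\<lambda>(a, b, _). (a, b)) bl)" by metis
    then show "p \<in> set (map (\<lambda>(a, b, _). (a, b)) gl) \<union> set (map (\<lambda>(a, b, _). (a, b)) bl)" by (simp only: prod.collapse)
  qed
  have half: "set (map (\<lambda>(a, b, _). (a, b)) gl) \<subseteq> half_pairs 1 2" and dist: "distinct (map (\<lambda>(a, b, _). (a, b)) gl)"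
    and len: "length gl = 1"
    by (simp_all add: gl_def half_pairs_def dd)
  have gl: "list_all (\<lambda>(a, b, t, t', c). t = (1 ^ a * 6 ^ b) mod n \<and> t * t' mod n = 1 \<and> 0 < c \<and> c < 3) gl"
    by (simp add: gl_def dd)
  have bl: "list_all (\<lambda>(a, b, t, t', k, c, y). t = (1 ^ a * 6 ^ b) mod n \<and> t * t' mod n = 1 \<and> 0 < k \<and>
      (k * 3 < 2 ^ (3 - 1) - 1 \<or> c = 0 \<and> k < 2 ^ (3 - 1) - 1)) bl"
    by (simp add: bl_def dd)
  have x: "v3 g False True False \<noteq> 0" "v3 g False True False \<noteq> 1" by (simp_all add: v_eq_0 v_eq_1)
  have N: "d3 = 3" "d1 * 3 = 2 ^ (3 - 1) - 1" "0 < d1" "d1 = prod_list ([] :: nat list)"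
    and q: "\<forall>p\<in>set ([] :: nat list). prime p \<and> d1 div p \<in> set []" by (simp_all add: dd)
  note r = direct_classes[OF cover half dist gl good x N q bl bad]
  show "num_iso_classes TYPE('a) = 1" using r(1) len by simp
qed

end

lemma classes_3:
  assumes card: "card (UNIV :: 'a::{field,finite} set) = 2 ^ 3"
  shows "num_iso_classes TYPE('a) = 1"
proof -
  interpret binary_field 3 "TYPE('a)" by unfold_locales (use card in simp_all)
  \<comment> \<open>The first list is the defining polynomial without its leading term; the second
    only counts the squarings.\<close>
  obtain g :: 'a where "g ^ 3 = poly (bpoly [True, True, False]) g"
    by (rule ex_root[of "[True, True, False]" "[True, True, True]" 3]) (simp_all add: timesX_def numeral_eq_Suc)
  then have "g ^ 3 = 1 + g" by (simp add: eval_nat_numeral algebra_simps)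
  from gf3.classes[OF gf3.intro[OF card this]] show ?thesis by simp
qed

section \<open>The field with 32 elements\<close>

definition v5 :: "'b::field \<Rightarrow> bool \<Rightarrow> bool \<Rightarrow> bool \<Rightarrow> bool \<Rightarrow> bool \<Rightarrow> 'b" where
  "v5 g b0 b1 b2 b3 b4 =
    of_bool b0 + of_bool b1 * g + of_bool b2 * g ^ 2 + of_bool b3 * g ^ 3 + of_bool b4 * g ^ 4"

locale gf5 =
  fixes g :: "'a::{field,finite}"
  assumes card_gf: "card (UNIV :: 'a set) = 2 ^ 5" and root: "g ^ 5 = 1 + g ^ 2"
begin

sublocale binary_field 5 "TYPE('a)"
  by unfold_locales (use card_gf in simp_all)

lemma g_ne: "g \<noteq> 0" "g \<noteq> 1"
  using root by (auto simp: numeral_simps)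

lemma g_pow:
  "g ^ 6 = g + g ^ 3"
  "g ^ 7 = g ^ 2 + g ^ 4"
  "g ^ 8 = 1 + g ^ 2 + g ^ 3"
proof -
  have p6: "g ^ 6 = g + g ^ 3"
    using power_add[of g 1 5]
    by (simp add: root distrib_left char2_simps flip: power_Suc power_Suc2 power_add power2_eq_square)
  have p7: "g ^ 7 = g ^ 2 + g ^ 4"
    using power_add[of g 2 5]
    by (simp add: root p6 distrib_left char2_simps flip: power_Suc power_Suc2 power_add power2_eq_square)
  have p8: "g ^ 8 = 1 + g ^ 2 + g ^ 3"
    using power_add[of g 3 5]
    by (simp add: root p6 p7 distrib_left char2_simps flip: power_Suc power_Suc2 power_add power2_eq_square)
  show "g ^ 6 = g + g ^ 3" "g ^ 7 = g ^ 2 + g ^ 4" "g ^ 8 = 1 + g ^ 2 + g ^ 3"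
    by (fact p6 p7 p8)+
qed

lemma v_add: "v5 g b0 b1 b2 b3 b4 + v5 g c0 c1 c2 c3 c4 =
  v5 g (xr b0 c0) (xr b1 c1) (xr b2 c2) (xr b3 c3) (xr b4 c4)"
  by (simp add: v5_def of_bool_xr distrib_right ac_simps)

lemma v_one: "1 + v5 g b0 b1 b2 b3 b4 = v5 g (\<not> b0) b1 b2 b3 b4"
  by (simp add: v5_def of_bool_not ac_simps)

lemma v_tg:
  "tg g (v5 g b0 b1 b2 b3 False) = v5 g False b0 b1 b2 b3"
  "tg g (v5 g b0 b1 b2 b3 True) = v5 g True b0 (\<not> b1) b2 b3"
  by (simp_all only: v5_def tg_simps root of_bool_not of_bool_eq mult_1 mult_zero_left add_0_left add_0_right distrib_left distrib_right add_num_simps arith_simps add.assoc add.commute add.left_commute)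

lemma v_sq: "sq (v5 g b0 b1 b2 b3 b4) =
    v5 g (xr b0 b4) b3 (xr b1 b4) (xr b3 b4) b2"
  by (simp only: v5_def sq_add sq_simps sq_def[of g] arith_simps mult_1_right root g_pow of_bool_xr distrib_left distrib_right add.assoc add.commute add.left_commute)

lemma v_mult: "v5 g b0 b1 b2 b3 b4 * X =
    cnd b0 X (tg g (cnd b1 X (tg g (cnd b2 X (tg g (cnd b3 X (tg g (cnd b4 X 0))))))))"
  by (simp only: v5_def horner_simps add_num_simps)

lemma v_g: "v5 g False True False False False = g" and v_zero: "v5 g False False False False False = 0"
  by (simp_all add: v5_def)

lemma v_eq_0: "v5 g b0 b1 b2 b3 b4 = 0 \<longleftrightarrow> \<not> b0 \<and> \<not> b1 \<and> \<not> b2 \<and> \<not> b3 \<and> \<not> b4"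
proof -
  have "(\<Sum>i<5. of_bool ([b0, b1, b2, b3, b4] ! i) * g ^ i) = v5 g b0 b1 b2 b3 b4"
    by (simp add: v5_def eval_nat_numeral ac_simps)
  then have "\<not> [b0, b1, b2, b3, b4] ! i" if "v5 g b0 b1 b2 b3 b4 = 0" "i < 5" for i
    using coordinates_zero[OF g_ne, of "[b0, b1, b2, b3, b4]" i] that by simp
  note this[of 0] this[of 1] this[of 2] this[of 3] this[of 4]
  then show ?thesis by (auto simp: v_zero)
qed

lemma v_eq: "v5 g b0 b1 b2 b3 b4 = v5 g c0 c1 c2 c3 c4 \<longleftrightarrow> b0 = c0 \<and> b1 = c1 \<and> b2 = c2 \<and> b3 = c3 \<and> b4 = c4"
  by (subst add_eq_zero_iff[symmetric]) (simp add: v_add v_eq_0 xr_def)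

lemma v_eq_1: "v5 g b0 b1 b2 b3 b4 = 1 \<longleftrightarrow> b0 \<and> \<not> b1 \<and> \<not> b2 \<and> \<not> b3 \<and> \<not> b4"
proof -
  have "1 = v5 g True False False False False" by (simp add: v5_def)
  then show ?thesis using v_eq[of b0 b1 b2 b3 b4 True False False False False] by simp
qed

text \<open>Modulo 31 the orders of 2, 5 and 30 = -1 are 5, 3 and 2, with product 30.\<close>

lemma coords: "exponent_coords TYPE('a) 5 5 30 3 2"
proof -
  have "ord n 5 = prod_list [3]" "ord n 30 = prod_list [2]"
    by (rule ord_pmI; simp add: pm_simps sqm_def)+
  then have o: "ord n 5 = 3" "ord n 30 = 2" by simp_all
  have "coprime (3::nat) (5 * 2)" "coprime (2::nat) (5 * 3)" "n - 1 = 5 * 3 * 2"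
    using coprime_bezout[of 3 7 "5 * 2" 2] coprime_bezout[of 2 8 "5 * 3" 1] by simp_all
  from cyclic_coords(1)[OF o this] show ?thesis .
qed

definition gl :: "(nat \<times> nat \<times> nat \<times> nat \<times> nat) list" where "gl = [
  (d1, d0, 5, 25, d4)]"

text \<open>The exponents 1 and 30 are the identity and inversion, whose rotations have order 1 and
  3 in every field.\<close>

definition bl :: "(nat \<times> nat \<times> nat \<times> nat \<times> nat \<times> nat \<times> 'a) list" where "bl = [
  (d0, d0, 1, 1, d1, d0, v5 g ff tt ff ff ff),
  (d0, d1, 30, 30, d3, d0, v5 g ff tt ff ff ff),
  (d1, d1, 26, 6, d1, d2, v5 g ff tt ff ff ff)]"

text \<open>After the exponent and its inverse come, for each of the two, an element and the number
  of rotations that take it to its reciprocal.\<close>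

definition ol :: "(nat \<times> nat \<times> 'a \<times> nat \<times> 'a \<times> nat) list" where "ol = [
  (5, 25, v5 g tt tt tt ff ff, d1, v5 g ff tt ff ff ff, d1)]"

lemmas comp_simps = rr.simps un_simps un2_simps pw_simps v_add v_one v_tg v_sq v_mult v_eq v_eq_0 v_eq_1 bit_simps
  frs.simps conj_of.simps list.pred_inject case_prod_conv simp_thms

text \<open>The walk has \<open>15 / 5 = 3\<close> steps, and the only quotient by a prime divisor
  is 1.\<close>

lemma good_cert: "list_all (dgood d3 [d1] d5 (v5 g False True False False False)) gl"
  unfolding gl_def by (simp only: comp_simps dgood_simps)

lemmas good = good_cert[unfolded dgood_def]

lemma bad_cert: "list_all dbad bl"
  unfolding bl_def by (simp only: comp_simps dbad_simp)

lemmas bad = bad_cert[unfolded dbad_def]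

lemma ori_cert: "list_all dori ol"
  unfolding ol_def by (simp only: comp_simps dori_simp)

lemmas ori = ori_cert[unfolded dori_def]

theorem classes: "num_iso_classes TYPE('a) = 1" "all_nonorientable TYPE('a)"
proof -
  interpret exponent_coords 5 "TYPE('a)" 5 30 3 2 by (rule coords)
  have upt: "take (un d3) digits = [0..<3]" "take (un d2) digits = [0..<2]"
    by (simp_all add: un_def dd take_digits_upt)
  have cov: "list_all (\<lambda>a. list_all (\<lambda>b. 0 < a \<and> 2 * a < 3 \<or> (a = 0 \<or> 2 * a = 3) \<and> 2 * b \<le> 2 \<longrightarrow>
      (a, b) \<in> set (map (\<lambda>(a, b, _). (a, b)) gl) \<union> set (map (\<lambda>(a, b, _). (a, b)) bl)) (take (un d2) digits)) (take (un d3) digits)"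
    by (simp only: list_tab_simps un_simps) (simp add: gl_def bl_def dd)
  have cover: "half_pairs 3 2 \<subseteq> set (map (\<lambda>(a, b, _). (a, b)) gl) \<union> set (map (\<lambda>(a, b, _). (a, b)) bl)"
  proof (rule subsetI)
    fix p assume "p \<in> half_pairs 3 2"
    then have "fst p \<in> set [0..<3]" "snd p \<in> set [0..<2]" "(\<lambda>a b. 0 < a \<and> 2 * a < 3 \<or> (a = 0 \<or> 2 * a = 3) \<and> 2 * b \<le> 2) (fst p) (snd p)"
      unfolding half_pairs_def by (simp_all only: set_upt mem_Collect_eq case_prod_beta atLeastLessThan_iff zero_le simp_thms)
    moreover have "\<forall>a\<in>set [0..<3]. \<forall>b\<in>set [0..<2]. 0 < a \<and> 2 * a < 3 \<or> (a = 0 \<or> 2 * a = 3) \<and> 2 * b \<le> 2 \<longrightarrow> (a, b) \<in> set (map (\<lambda>(a, b, _). (a, b)) gl) \<union> set (map (\<lambda>(a, b, _). (a, b)) bl)"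
      using cov by (simp only: upt list_all_iff)
    ultimately have "(fst p, snd p) \<in> set (map (\<lambda>(a, b, _). (a, b)) gl) \<union> set (map (\<lambda>(a, b, _). (a, b)) bl)" by metis
    then show "p \<in> set (map (\<lambda>(a, b, _). (a, b)) gl) \<union> set (map (\<lambda>(a, b, _). (a, b)) bl)" by (simp only: prod.collapse)
  qed
  have half: "set (map (\<lambda>(a, b, _). (a, b)) gl) \<subseteq> half_pairs 3 2" and dist: "distinct (map (\<lambda>(a, b, _). (a, b)) gl)"
    and len: "length gl = 1"
    by (simp_all add: gl_def half_pairs_def dd)
  have gl: "list_all (\<lambda>(a, b, t, t', c). t = (5 ^ a * 30 ^ b) mod n \<and> t * t' mod n = 1 \<and> 0 < c \<and> c < 5) gl"
    by (simp add: gl_def dd)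
  have bl: "list_all (\<lambda>(a, b, t, t', k, c, y). t = (5 ^ a * 30 ^ b) mod n \<and> t * t' mod n = 1 \<and> 0 < k \<and>
      (k * 5 < 2 ^ (5 - 1) - 1 \<or> c = 0 \<and> k < 2 ^ (5 - 1) - 1)) bl"
    by (simp add: bl_def dd)
  have x: "v5 g False True False False False \<noteq> 0" "v5 g False True False False False \<noteq> 1" by (simp_all add: v_eq_0 v_eq_1)
  have N: "d5 = 5" "d3 * 5 = 2 ^ (5 - 1) - 1" "0 < d3" "d3 = prod_list [3]"
    and q: "\<forall>p\<in>set [3]. prime p \<and> d3 div p \<in> set [d1]" by (simp_all add: dd)
  note r = direct_classes[OF cover half dist gl good x N q bl bad]
  show "num_iso_classes TYPE('a) = 1" using r(1) len by simp
  show "all_nonorientable TYPE('a)" by (rule r(2)[OF _ ori]) (simp add: gl_def ol_def)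
qed

end

lemma classes_5:
  assumes card: "card (UNIV :: 'a::{field,finite} set) = 2 ^ 5"
  shows "num_iso_classes TYPE('a) = 1 \<and> all_nonorientable TYPE('a)"
proof -
  interpret binary_field 5 "TYPE('a)" by unfold_locales (use card in simp_all)
  obtain g :: 'a where "g ^ 5 = poly (bpoly [True, False, True, False, False]) g"
    by (rule ex_root[of "[True, False, True, False, False]" "[True, True, True, True, True]" 5]) (simp_all add: timesX_def numeral_eq_Suc)
  then have "g ^ 5 = 1 + g ^ 2" by (simp add: eval_nat_numeral algebra_simps)
  from gf5.classes[OF gf5.intro[OF card this]] show ?thesis by simp
qed

section \<open>The field with 128 elements\<close>

definition v7 :: "'b::field \<Rightarrow> bool \<Rightarrow> bool \<Rightarrow> bool \<Rightarrow> bool \<Rightarrow> bool \<Rightarrow> bool \<Rightarrow> bool \<Rightarrow> 'b" where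
  "v7 g b0 b1 b2 b3 b4 b5 b6 =
    of_bool b0 + of_bool b1 * g + of_bool b2 * g ^ 2 + of_bool b3 * g ^ 3 + of_bool b4 * g ^ 4 +
    of_bool b5 * g ^ 5 + of_bool b6 * g ^ 6"

locale gf7 =
  fixes g :: "'a::{field,finite}"
  assumes card_gf: "card (UNIV :: 'a set) = 2 ^ 7" and root: "g ^ 7 = 1 + g"
begin

sublocale binary_field 7 "TYPE('a)"
  by unfold_locales (use card_gf in simp_all)

lemma g_ne: "g \<noteq> 0" "g \<noteq> 1"
  using root by (auto simp: numeral_simps)

lemma g_pow:
  "g ^ 8 = g + g ^ 2"
  "g ^ 9 = g ^ 2 + g ^ 3"
  "g ^ 10 = g ^ 3 + g ^ 4"
  "g ^ 11 = g ^ 4 + g ^ 5"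
  "g ^ 12 = g ^ 5 + g ^ 6"
proof -
  have p8: "g ^ 8 = g + g ^ 2"
    using power_add[of g 1 7]
    by (simp add: root distrib_left char2_simps flip: power_Suc power_Suc2 power_add power2_eq_square)
  have p9: "g ^ 9 = g ^ 2 + g ^ 3"
    using power_add[of g 2 7]
    by (simp add: root p8 distrib_left char2_simps flip: power_Suc power_Suc2 power_add power2_eq_square)
  have p10: "g ^ 10 = g ^ 3 + g ^ 4"
    using power_add[of g 3 7]
    by (simp add: root p8 distrib_left char2_simps flip: power_Suc power_Suc2 power_add power2_eq_square)
  have p11: "g ^ 11 = g ^ 4 + g ^ 5"
    using power_add[of g 4 7]
    by (simp add: root p8 distrib_left char2_simps flip: power_Suc power_Suc2 power_add power2_eq_square)
  have p12: "g ^ 12 = g ^ 5 + g ^ 6"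
    using power_add[of g 5 7]
    by (simp add: root p8 distrib_left char2_simps flip: power_Suc power_Suc2 power_add power2_eq_square)
  show "g ^ 8 = g + g ^ 2" "g ^ 9 = g ^ 2 + g ^ 3" "g ^ 10 = g ^ 3 + g ^ 4" "g ^ 11 = g ^ 4 + g ^ 5" "g ^ 12 = g ^ 5 + g ^ 6"
    by (fact p8 p9 p10 p11 p12)+
qed

lemma v_add: "v7 g b0 b1 b2 b3 b4 b5 b6 + v7 g c0 c1 c2 c3 c4 c5 c6 =
  v7 g (xr b0 c0) (xr b1 c1) (xr b2 c2) (xr b3 c3) (xr b4 c4) (xr b5 c5) (xr b6 c6)"
  by (simp add: v7_def of_bool_xr distrib_right ac_simps)

lemma v_one: "1 + v7 g b0 b1 b2 b3 b4 b5 b6 = v7 g (\<not> b0) b1 b2 b3 b4 b5 b6"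
  by (simp add: v7_def of_bool_not ac_simps)

lemma v_tg:
  "tg g (v7 g b0 b1 b2 b3 b4 b5 False) = v7 g False b0 b1 b2 b3 b4 b5"
  "tg g (v7 g b0 b1 b2 b3 b4 b5 True) = v7 g True (\<not> b0) b1 b2 b3 b4 b5"
  by (simp_all only: v7_def tg_simps root of_bool_not of_bool_eq mult_1 mult_zero_left add_0_left add_0_right distrib_left distrib_right add_num_simps arith_simps add.assoc add.commute add.left_commute)

lemma v_sq: "sq (v7 g b0 b1 b2 b3 b4 b5 b6) =
    v7 g b0 b4 (xr b1 b4) b5 (xr b2 b5) b6 (xr b3 b6)"
  by (simp only: v7_def sq_add sq_simps sq_def[of g] arith_simps mult_1_right root g_pow of_bool_xr distrib_left distrib_right add.assoc add.commute add.left_commute)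

lemma v_mult: "v7 g b0 b1 b2 b3 b4 b5 b6 * X =
    cnd b0 X (tg g (cnd b1 X (tg g (cnd b2 X (tg g (cnd b3 X (tg g (cnd b4 X (tg g (cnd b5 X (tg g (cnd b6 X 0))))))))))))"
  by (simp only: v7_def horner_simps add_num_simps)

lemma v_g: "v7 g False True False False False False False = g" and v_zero: "v7 g False False False False False False False = 0"
  by (simp_all add: v7_def)

lemma v_eq_0: "v7 g b0 b1 b2 b3 b4 b5 b6 = 0 \<longleftrightarrow> \<not> b0 \<and> \<not> b1 \<and> \<not> b2 \<and> \<not> b3 \<and> \<not> b4 \<and> \<not> b5 \<and> \<not> b6"
proof -
  have "(\<Sum>i<7. of_bool ([b0, b1, b2, b3, b4, b5, b6] ! i) * g ^ i) = v7 g b0 b1 b2 b3 b4 b5 b6"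
    by (simp add: v7_def eval_nat_numeral ac_simps)
  then have "\<not> [b0, b1, b2, b3, b4, b5, b6] ! i" if "v7 g b0 b1 b2 b3 b4 b5 b6 = 0" "i < 7" for i
    using coordinates_zero[OF g_ne, of "[b0, b1, b2, b3, b4, b5, b6]" i] that by simp
  note this[of 0] this[of 1] this[of 2] this[of 3] this[of 4] this[of 5] this[of 6]
  then show ?thesis by (auto simp: v_zero)
qed

lemma v_eq: "v7 g b0 b1 b2 b3 b4 b5 b6 = v7 g c0 c1 c2 c3 c4 c5 c6 \<longleftrightarrow> b0 = c0 \<and> b1 = c1 \<and> b2 = c2 \<and> b3 = c3 \<and> b4 = c4 \<and> b5 = c5 \<and> b6 = c6"
  by (subst add_eq_zero_iff[symmetric]) (simp add: v_add v_eq_0 xr_def)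

lemma v_eq_1: "v7 g b0 b1 b2 b3 b4 b5 b6 = 1 \<longleftrightarrow> b0 \<and> \<not> b1 \<and> \<not> b2 \<and> \<not> b3 \<and> \<not> b4 \<and> \<not> b5 \<and> \<not> b6"
proof -
  have "1 = v7 g True False False False False False False" by (simp add: v7_def)
  then show ?thesis using v_eq[of b0 b1 b2 b3 b4 b5 b6 True False False False False False False] by simp
qed

text \<open>Modulo 127 the orders of 2, 22 and 126 = -1 are 7, 9 and 2, with product 126.\<close>

lemma coords: "exponent_coords TYPE('a) 7 22 126 9 2"
proof -
  have "ord n 22 = prod_list [3, 3]" "ord n 126 = prod_list [2]"
    by (rule ord_pmI; simp add: pm_simps sqm_def)+
  then have o: "ord n 22 = 9" "ord n 126 = 2" by simp_all
  have "coprime (9::nat) (7 * 2)" "coprime (2::nat) (7 * 9)" "n - 1 = 7 * 9 * 2"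
    using coprime_bezout[of 9 11 "7 * 2" 7] coprime_bezout[of 2 32 "7 * 9" 1] by simp_all
  from cyclic_coords(1)[OF o this] show ?thesis .
qed

definition gl :: "(nat \<times> nat \<times> nat \<times> nat \<times> nat) list" where "gl = [
  (d2, d0, 103, 37, d1), (d3, d0, 107, 19, d5), (d4, d0, 68, 99, d3), (d4, d1, 59, 28, d4)]"

definition bl :: "(nat \<times> nat \<times> nat \<times> nat \<times> nat \<times> nat \<times> 'a) list" where "bl = [
  (d0, d0, 1, 1, d1, d0, v7 g ff tt ff ff ff ff ff),
  (d0, d1, 126, 126, d3, d0, v7 g ff tt ff ff ff ff ff),
  (d1, d0, 22, 52, d1, d6, v7 g ff tt ff ff ff ff ff),
  (d1, d1, 105, 75, d1, d1, v7 g ff ff ff tt tt ff ff),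
  (d2, d1, 24, 90, d1, d4, v7 g ff ff tt tt tt ff ff),
  (d3, d1, 20, 108, d2, d2, v7 g ff ff ff tt tt ff ff)]"

definition ol :: "(nat \<times> nat \<times> 'a \<times> nat \<times> 'a \<times> nat) list" where "ol = [
  (103, 37, v7 g ff tt ff tt ff ff ff, d3, v7 g ff ff ff tt tt ff ff, d3),
  (107, 19, v7 g tt tt ff ff ff ff ff, d2, v7 g tt tt ff tt ff ff ff, d2),
  (68, 99, v7 g ff tt ff tt tt ff ff, d11, v7 g ff tt ff ff ff ff ff, d11),
  (59, 28, v7 g tt ff tt tt tt ff ff, d14, v7 g tt tt ff tt ff ff ff, d14)]"

lemmas comp_simps = rr.simps un_simps un2_simps pw_simps v_add v_one v_tg v_sq v_mult v_eq v_eq_0 v_eq_1 bit_simps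
  frs.simps conj_of.simps list.pred_inject case_prod_conv simp_thms

text \<open>The walk has \<open>63 / 7 = 9\<close> steps, and the only quotient by a prime divisor
  is 3.\<close>

lemma good_cert: "list_all (dgood d9 [d3] d7 (v7 g False True False False False False False)) gl"
  unfolding gl_def by (simp only: comp_simps dgood_simps)

lemmas good = good_cert[unfolded dgood_def]

lemma bad_cert: "list_all dbad bl"
  unfolding bl_def by (simp only: comp_simps dbad_simp)

lemmas bad = bad_cert[unfolded dbad_def]

lemma ori_cert: "list_all dori ol"
  unfolding ol_def by (simp only: comp_simps dori_simp)

lemmas ori = ori_cert[unfolded dori_def]

theorem classes: "num_iso_classes TYPE('a) = 4" "all_nonorientable TYPE('a)"
proof -
  interpret exponent_coords 7 "TYPE('a)" 22 126 9 2 by (rule coords)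
  have upt: "take (un d9) digits = [0..<9]" "take (un d2) digits = [0..<2]"
    by (simp_all add: un_def dd take_digits_upt)
  have cov: "list_all (\<lambda>a. list_all (\<lambda>b. 0 < a \<and> 2 * a < 9 \<or> (a = 0 \<or> 2 * a = 9) \<and> 2 * b \<le> 2 \<longrightarrow>
      (a, b) \<in> set (map (\<lambda>(a, b, _). (a, b)) gl) \<union> set (map (\<lambda>(a, b, _). (a, b)) bl)) (take (un d2) digits)) (take (un d9) digits)"
    by (simp only: list_tab_simps un_simps) (simp add: gl_def bl_def dd)
  have cover: "half_pairs 9 2 \<subseteq> set (map (\<lambda>(a, b, _). (a, b)) gl) \<union> set (map (\<lambda>(a, b, _). (a, b)) bl)"
  proof (rule subsetI)
    fix p assume "p \<in> half_pairs 9 2"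
    then have "fst p \<in> set [0..<9]" "snd p \<in> set [0..<2]" "(\<lambda>a b. 0 < a \<and> 2 * a < 9 \<or> (a = 0 \<or> 2 * a = 9) \<and> 2 * b \<le> 2) (fst p) (snd p)"
      unfolding half_pairs_def by (simp_all only: set_upt mem_Collect_eq case_prod_beta atLeastLessThan_iff zero_le simp_thms)
    moreover have "\<forall>a\<in>set [0..<9]. \<forall>b\<in>set [0..<2]. 0 < a \<and> 2 * a < 9 \<or> (a = 0 \<or> 2 * a = 9) \<and> 2 * b \<le> 2 \<longrightarrow> (a, b) \<in> set (map (\<lambda>(a, b, _). (a, b)) gl) \<union> set (map (\<lambda>(a, b, _). (a, b)) bl)"
      using cov by (simp only: upt list_all_iff)
    ultimately have "(fst p, snd p) \<in> set (map (\<lambda>(a, b, _). (a, b)) gl) \<union> set (map (\<lambda>(a, b, _). (a, b)) bl)" by metis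
    then show "p \<in> set (map (\<lambda>(a, b, _). (a, b)) gl) \<union> set (map (\<lambda>(a, b, _). (a, b)) bl)" by (simp only: prod.collapse)
  qed
  have half: "set (map (\<lambda>(a, b, _). (a, b)) gl) \<subseteq> half_pairs 9 2" and dist: "distinct (map (\<lambda>(a, b, _). (a, b)) gl)"
    and len: "length gl = 4"
    by (simp_all add: gl_def half_pairs_def dd)
  have gl: "list_all (\<lambda>(a, b, t, t', c). t = (22 ^ a * 126 ^ b) mod n \<and> t * t' mod n = 1 \<and> 0 < c \<and> c < 7) gl"
    by (simp add: gl_def dd)
  have bl: "list_all (\<lambda>(a, b, t, t', k, c, y). t = (22 ^ a * 126 ^ b) mod n \<and> t * t' mod n = 1 \<and> 0 < k \<and>
      (k * 7 < 2 ^ (7 - 1) - 1 \<or> c = 0 \<and> k < 2 ^ (7 - 1) - 1)) bl"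
    by (simp add: bl_def dd)
  have x: "v7 g False True False False False False False \<noteq> 0" "v7 g False True False False False False False \<noteq> 1" by (simp_all add: v_eq_0 v_eq_1)
  have N: "d7 = 7" "d9 * 7 = 2 ^ (7 - 1) - 1" "0 < d9" "d9 = prod_list [3, 3]"
    and q: "\<forall>p\<in>set [3, 3]. prime p \<and> d9 div p \<in> set [d3]" by (simp_all add: dd)
  note r = direct_classes[OF cover half dist gl good x N q bl bad]
  show "num_iso_classes TYPE('a) = 4" using r(1) len by simp
  show "all_nonorientable TYPE('a)" by (rule r(2)[OF _ ori]) (simp add: gl_def ol_def)
qed

end

lemma classes_7:
  assumes card: "card (UNIV :: 'a::{field,finite} set) = 2 ^ 7"
  shows "num_iso_classes TYPE('a) = 4 \<and> all_nonorientable TYPE('a)"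
proof -
  interpret binary_field 7 "TYPE('a)" by unfold_locales (use card in simp_all)
  obtain g :: 'a where "g ^ 7 = poly (bpoly [True, True, False, False, False, False, False]) g"
    by (rule ex_root[of "[True, True, False, False, False, False, False]" "[True, True, True, True, True, True, True]" 7]) (simp_all add: timesX_def numeral_eq_Suc)
  then have "g ^ 7 = 1 + g" by (simp add: eval_nat_numeral algebra_simps)
  from gf7.classes[OF gf7.intro[OF card this]] show ?thesis by simp
qed

section \<open>The field with 2048 elements\<close>

definition v11 :: "'b::field \<Rightarrow> bool \<Rightarrow> bool \<Rightarrow> bool \<Rightarrow> bool \<Rightarrow> bool \<Rightarrow> bool \<Rightarrow> bool \<Rightarrow> bool \<Rightarrow> bool \<Rightarrow> bool \<Rightarrow> bool \<Rightarrow> 'b" where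
  "v11 g b0 b1 b2 b3 b4 b5 b6 b7 b8 b9 b10 =
    of_bool b0 + of_bool b1 * g + of_bool b2 * g ^ 2 + of_bool b3 * g ^ 3 + of_bool b4 * g ^ 4 +
    of_bool b5 * g ^ 5 + of_bool b6 * g ^ 6 + of_bool b7 * g ^ 7 + of_bool b8 * g ^ 8 +
    of_bool b9 * g ^ 9 + of_bool b10 * g ^ 10"

locale gf11 =
  fixes g :: "'a::{field,finite}"
  assumes card_gf: "card (UNIV :: 'a set) = 2 ^ 11" and root: "g ^ 11 = 1 + g ^ 2"
begin

sublocale binary_field 11 "TYPE('a)"
  by unfold_locales (use card_gf in simp_all)

lemma g_ne: "g \<noteq> 0" "g \<noteq> 1"
  using root by (auto simp: numeral_simps)

lemma g_pow:
  "g ^ 12 = g + g ^ 3"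
  "g ^ 13 = g ^ 2 + g ^ 4"
  "g ^ 14 = g ^ 3 + g ^ 5"
  "g ^ 15 = g ^ 4 + g ^ 6"
  "g ^ 16 = g ^ 5 + g ^ 7"
  "g ^ 17 = g ^ 6 + g ^ 8"
  "g ^ 18 = g ^ 7 + g ^ 9"
  "g ^ 19 = g ^ 8 + g ^ 10"
  "g ^ 20 = 1 + g ^ 2 + g ^ 9"
proof -
  have p12: "g ^ 12 = g + g ^ 3"
    using power_add[of g 1 11]
    by (simp add: root distrib_left char2_simps flip: power_Suc power_Suc2 power_add power2_eq_square)
  have p13: "g ^ 13 = g ^ 2 + g ^ 4"
    using power_add[of g 2 11]
    by (simp add: root p12 distrib_left char2_simps flip: power_Suc power_Suc2 power_add power2_eq_square)
  have p14: "g ^ 14 = g ^ 3 + g ^ 5"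
    using power_add[of g 3 11]
    by (simp add: root p12 p13 distrib_left char2_simps flip: power_Suc power_Suc2 power_add power2_eq_square)
  have p15: "g ^ 15 = g ^ 4 + g ^ 6"
    using power_add[of g 4 11]
    by (simp add: root p12 p13 distrib_left char2_simps flip: power_Suc power_Suc2 power_add power2_eq_square)
  have p16: "g ^ 16 = g ^ 5 + g ^ 7"
    using power_add[of g 5 11]
    by (simp add: root p12 p13 distrib_left char2_simps flip: power_Suc power_Suc2 power_add power2_eq_square)
  have p17: "g ^ 17 = g ^ 6 + g ^ 8"
    using power_add[of g 6 11]
    by (simp add: root p12 p13 distrib_left char2_simps flip: power_Suc power_Suc2 power_add power2_eq_square)
  have p18: "g ^ 18 = g ^ 7 + g ^ 9"
    using power_add[of g 7 11]
    by (simp add: root p12 p13 distrib_left char2_simps flip: power_Suc power_Suc2 power_add power2_eq_square)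
  have p19: "g ^ 19 = g ^ 8 + g ^ 10"
    using power_add[of g 8 11]
    by (simp add: root p12 p13 distrib_left char2_simps flip: power_Suc power_Suc2 power_add power2_eq_square)
  have p20: "g ^ 20 = 1 + g ^ 2 + g ^ 9"
    using power_add[of g 9 11]
    by (simp add: root p12 p13 distrib_left char2_simps flip: power_Suc power_Suc2 power_add power2_eq_square)
  show "g ^ 12 = g + g ^ 3" "g ^ 13 = g ^ 2 + g ^ 4" "g ^ 14 = g ^ 3 + g ^ 5" "g ^ 15 = g ^ 4 + g ^ 6" "g ^ 16 = g ^ 5 + g ^ 7" "g ^ 17 = g ^ 6 + g ^ 8" "g ^ 18 = g ^ 7 + g ^ 9" "g ^ 19 = g ^ 8 + g ^ 10" "g ^ 20 = 1 + g ^ 2 + g ^ 9"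
    by (fact p12 p13 p14 p15 p16 p17 p18 p19 p20)+
qed

lemma v_add: "v11 g b0 b1 b2 b3 b4 b5 b6 b7 b8 b9 b10 + v11 g c0 c1 c2 c3 c4 c5 c6 c7 c8 c9 c10 =
  v11 g (xr b0 c0) (xr b1 c1) (xr b2 c2) (xr b3 c3) (xr b4 c4) (xr b5 c5) (xr b6 c6) (xr b7 c7) (xr b8 c8) (xr b9 c9) (xr b10 c10)"
  by (simp add: v11_def of_bool_xr distrib_right ac_simps)

lemma v_one: "1 + v11 g b0 b1 b2 b3 b4 b5 b6 b7 b8 b9 b10 = v11 g (\<not> b0) b1 b2 b3 b4 b5 b6 b7 b8 b9 b10"
  by (simp add: v11_def of_bool_not ac_simps)

lemma v_tg:
  "tg g (v11 g b0 b1 b2 b3 b4 b5 b6 b7 b8 b9 False) = v11 g False b0 b1 b2 b3 b4 b5 b6 b7 b8 b9"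
  "tg g (v11 g b0 b1 b2 b3 b4 b5 b6 b7 b8 b9 True) = v11 g True b0 (\<not> b1) b2 b3 b4 b5 b6 b7 b8 b9"
  by (simp_all only: v11_def tg_simps root of_bool_not of_bool_eq mult_1 mult_zero_left add_0_left add_0_right distrib_left distrib_right add_num_simps arith_simps add.assoc add.commute add.left_commute)

lemma v_sq: "sq (v11 g b0 b1 b2 b3 b4 b5 b6 b7 b8 b9 b10) =
    v11 g (xr b0 b10) b6 (xr b1 b10) (xr b6 b7) b2 (xr b7 b8) b3 (xr b8 b9) b4 (xr b9 b10) b5"
  by (simp only: v11_def sq_add sq_simps sq_def[of g] arith_simps mult_1_right root g_pow of_bool_xr distrib_left distrib_right add.assoc add.commute add.left_commute)

lemma v_mult: "v11 g b0 b1 b2 b3 b4 b5 b6 b7 b8 b9 b10 * X =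
    cnd b0 X (tg g (cnd b1 X (tg g (cnd b2 X (tg g (cnd b3 X (tg g (cnd b4 X (tg g (cnd b5 X (tg g (cnd b6 X (tg g (cnd b7 X (tg g (cnd b8 X (tg g (cnd b9 X (tg g (cnd b10 X 0))))))))))))))))))))"
  by (simp only: v11_def horner_simps add_num_simps)

lemma v_g: "v11 g False True False False False False False False False False False = g" and v_zero: "v11 g False False False False False False False False False False False = 0"
  by (simp_all add: v11_def)

lemma v_eq_0: "v11 g b0 b1 b2 b3 b4 b5 b6 b7 b8 b9 b10 = 0 \<longleftrightarrow> \<not> b0 \<and> \<not> b1 \<and> \<not> b2 \<and> \<not> b3 \<and> \<not> b4 \<and> \<not> b5 \<and> \<not> b6 \<and> \<not> b7 \<and> \<not> b8 \<and> \<not> b9 \<and> \<not> b10"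
proof -
  have "(\<Sum>i<11. of_bool ([b0, b1, b2, b3, b4, b5, b6, b7, b8, b9, b10] ! i) * g ^ i) = v11 g b0 b1 b2 b3 b4 b5 b6 b7 b8 b9 b10"
    by (simp add: v11_def eval_nat_numeral ac_simps)
  then have "\<not> [b0, b1, b2, b3, b4, b5, b6, b7, b8, b9, b10] ! i" if "v11 g b0 b1 b2 b3 b4 b5 b6 b7 b8 b9 b10 = 0" "i < 11" for i
    using coordinates_zero[OF g_ne, of "[b0, b1, b2, b3, b4, b5, b6, b7, b8, b9, b10]" i] that by simp
  note this[of 0] this[of 1] this[of 2] this[of 3] this[of 4] this[of 5] this[of 6] this[of 7] this[of 8] this[of 9] this[of 10]
  then show ?thesis by (auto simp: v_zero)
qed

lemma v_eq: "v11 g b0 b1 b2 b3 b4 b5 b6 b7 b8 b9 b10 = v11 g c0 c1 c2 c3 c4 c5 c6 c7 c8 c9 c10 \<longleftrightarrow> b0 = c0 \<and> b1 = c1 \<and> b2 = c2 \<and> b3 = c3 \<and> b4 = c4 \<and> b5 = c5 \<and> b6 = c6 \<and> b7 = c7 \<and> b8 = c8 \<and> b9 = c9 \<and> b10 = c10"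
  by (subst add_eq_zero_iff[symmetric]) (simp add: v_add v_eq_0 xr_def)

lemma v_eq_1: "v11 g b0 b1 b2 b3 b4 b5 b6 b7 b8 b9 b10 = 1 \<longleftrightarrow> b0 \<and> \<not> b1 \<and> \<not> b2 \<and> \<not> b3 \<and> \<not> b4 \<and> \<not> b5 \<and> \<not> b6 \<and> \<not> b7 \<and> \<not> b8 \<and> \<not> b9 \<and> \<not> b10"
proof -
  have "1 = v11 g True False False False False False False False False False False" by (simp add: v11_def)
  then show ?thesis using v_eq[of b0 b1 b2 b3 b4 b5 b6 b7 b8 b9 b10 True False False False False False False False False False False] by simp
qed

text \<open>Since \<open>n\<close> is \<open>23 * 89\<close>, the criterion for prime
  \<open>n\<close> does not apply. The generators come from the Chinese remainder theorem: 1425 is 1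
  modulo 89 and -1 modulo 23, whereas 24 is 1 modulo 23 and has order 88 modulo 89. The number 2 has
  order 11 modulo both primes.\<close>

lemma coords: "exponent_coords TYPE('a) 11 1425 24 2 88"
proof -
  have "ord 23 (2::nat) = prod_list [11]" "ord 23 (1425::nat) = prod_list [2]" "ord 89 (24::nat) = prod_list [2, 2, 2, 11]"
    by (rule ord_pmI; simp add: pm_simps sqm_def)+
  then have o: "ord 23 (2::nat) = 11" "ord 23 (1425::nat) = 2" "ord 89 (24::nat) = 88" by simp_all
  have n: "n = 23 * 89" by simp
  have al: "[1425 = 1] (mod (89::nat))" and be: "[24 = 1] (mod (23::nat))" and two: "[2 ^ 11 = 1] (mod (23::nat))" "[2 ^ 11 = 1] (mod (89::nat))"
    and al2: "[1425 ^ 2 = 1] (mod (23::nat))"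
    by (simp_all add: cong_def)
  have drop: "[x = 1] (mod k)" if "[x * y = 1] (mod k)" "[y = 1] (mod k)" for x y k :: nat
    using cong_trans[OF cong_sym[OF cong_scalar_left[OF that(2), of x]] that(1)] by simp
  have pw: "[x ^ i = 1] (mod k)" if "[x = 1] (mod k)" for x i k :: nat using cong_pow[OF that, of i] by simp
  have pw2: "[x ^ (j * i) = 1] (mod k)" if "[x ^ j = 1] (mod k)" for x i j k :: nat
    using pw[OF that, of i] by (simp add: power_mult)
  have C: "11 dvd j \<and> 2 dvd a \<and> 88 dvd b" if *: "[2 ^ j * 1425 ^ a * 24 ^ b = 1] (mod n)" for j a b
  proof -
    have m23: "[2 ^ j * 1425 ^ a * 24 ^ b = 1] (mod (23::nat))" and m89: "[2 ^ j * 1425 ^ a * 24 ^ b = 1] (mod (89::nat))"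
      using * unfolding n by (auto intro: cong_dvd_modulus_nat)
    \<comment> \<open>Modulo 23 the factor 24 disappears.\<close>
    have A: "[2 ^ j * 1425 ^ a = 1] (mod (23::nat))" using drop[OF m23 pw[OF be]] .
    \<comment> \<open>Squaring removes 1425 and leaves a power of 2, whose order 11 is odd.\<close>
    have "[2 ^ (j * 2) * 1425 ^ (2 * a) = 1] (mod (23::nat))"
      using pw[OF A, of 2] by (simp only: power_mult_distrib power_mult[symmetric] mult.commute)
    from drop[OF this pw2[OF al2]] have "11 dvd j * 2" using ord_divides[of 2 "j * 2" 23] o by metis
    then have j: "11 dvd j" using prime_dvd_mult_iff[of 11 j "2::nat"] by auto
    then obtain i where i: "j = 11 * i" by (elim dvdE)
    have "[1425 ^ a * 2 ^ j = 1] (mod (23::nat))" using A by (simp only: mult.commute)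
    from drop[OF this] have a: "2 dvd a" using pw2[OF two(1), of i] i ord_divides[of 1425 a 23] o by metis
    \<comment> \<open>Modulo 89 the factor 1425 disappears, and so does the power of 2,
      \<open>j\<close> being a multiple of 11.\<close>
    have "[24 ^ b * (2 ^ j * 1425 ^ a) = 1] (mod (89::nat))" using m89 by (simp only: mult.commute)
    moreover have "[2 ^ j * 1425 ^ a = 1 * 1] (mod (89::nat))" unfolding i by (intro cong_mult pw2 pw two al)
    ultimately have "[24 ^ b = 1] (mod (89::nat))" using drop by simp
    then show ?thesis using j a ord_divides[of 24 b 89] o by metis
  qed
  have "totient n = totient 23 * totient 89"
    unfolding n by (intro totient_mult_coprime coprime_bezout[of 23 31 89 8]) simp
  moreover have "totient 23 = 22" "totient 89 = (88::nat)" by (simp_all add: totient_prime)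
  ultimately have t: "totient n = 11 * 2 * 88" by simp
  have "[1425 ^ 2 = 1] (mod n)" "pm n 24 88 = 1" by (simp_all add: cong_def pm_simps sqm_def)
  then show ?thesis
    using C t by unfold_locales (simp_all add: pm_def cong_def)
qed

definition gl :: "(nat \<times> nat \<times> nat \<times> nat \<times> nat) list" where "gl = [
  (d0, d5, 1841, 944, d4), (d0, d8, 1680, 898, d6), (d0, d12, 1956, 2002, d5),
  (d0, d13, 1910, 254, d2), (d0, d15, 921, 1358, d7), (d0, d17, 323, 507, d3),
  (d0, d20, 645, 530, d9), (d0, d28, 737, 1036, d4), (d0, d37, 1588, 553, d5),
  (d1, d1, 1448, 827, d7), (d1, d5, 1218, 321, d6), (d1, d6, 574, 781, d10),
  (d1, d22, 390, 1034, d6), (d1, d24, 1517, 1402, d7)]"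

text \<open>Starting elements vary, because an early return may occur on a cycle that does not meet
  any conjugate of \<open>g\<close>.\<close>

definition bl :: "(nat \<times> nat \<times> nat \<times> nat \<times> nat \<times> nat \<times> 'a) list" where "bl = [
  (d0, d0, 1, 1, d1, d0, v11 g ff tt ff ff ff ff ff ff ff ff ff),
  (d0, d1, 24, 1450, d1, d4, v11 g ff tt tt ff tt tt ff tt tt ff ff),
  (d0, d2, 576, 231, d1, d6, v11 g ff ff tt tt tt ff ff ff tt ff ff),
  (d0, d3, 1542, 1289, d1, d2, v11 g ff tt tt tt tt tt ff tt ff ff ff),
  (d0, d4, 162, 139, d5, d4, v11 g ff tt ff ff ff ff ff ff ff ff ff),
  (d0, d6, 1197, 1404, d1, d4, v11 g ff tt ff ff tt ff tt ff ff ff ff),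
  (d0, d7, 70, 1082, d12, d4, v11 g ff tt tt ff ff tt ff ff ff ff ff),
  (d0, d9, 1427, 208, d4, d2, v11 g ff tt ff ff tt ff ff ff ff ff ff),
  (d0, d10, 1496, 691, d1, d3, v11 g ff ff tt tt ff ff ff ff ff ff ff),
  (d0, d11, 1105, 967, d1, d4, v11 g ff tt tt ff tt ff tt ff tt ff ff),
  (d0, d14, 806, 1887, d1, d10, v11 g ff ff ff ff ff tt tt ff ff ff ff),
  (d0, d16, 1634, 1933, d12, d9, v11 g ff tt ff ff ff tt ff ff ff ff ff),
  (d0, d18, 1611, 277, d9, d3, v11 g ff tt tt tt ff ff ff ff ff ff ff),
  (d0, d19, 1818, 438, d2, d8, v11 g ff ff ff tt ff ff tt ff ff ff ff),
  (d0, d21, 1151, 875, d5, d7, v11 g ff tt tt tt tt ff ff ff ff ff ff),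
  (d0, d22, 1013, 1657, d6, d2, v11 g ff ff tt tt tt ff ff ff ff ff ff),
  (d0, d23, 1795, 1519, d5, d6, v11 g ff ff tt ff tt tt ff ff ff ff ff),
  (d0, d24, 93, 2025, d7, d0, v11 g ff ff ff ff tt tt ff ff ff ff ff),
  (d0, d25, 185, 852, d10, d3, v11 g ff ff ff tt tt ff ff ff ff ff ff),
  (d0, d26, 346, 1059, d1, d5, v11 g ff tt ff ff ff ff ff ff ff ff ff),
  (d0, d27, 116, 300, d44, d9, v11 g ff ff ff tt ff ff ff ff ff ff ff),
  (d0, d29, 1312, 1749, d7, d1, v11 g ff ff ff tt ff ff ff ff ff ff ff),
  (d0, d30, 783, 1864, d1, d4, v11 g ff ff ff tt tt ff tt tt ff ff ff),
  (d0, d31, 369, 760, d1, d2, v11 g ff ff tt ff tt ff ff tt ff ff ff),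
  (d0, d32, 668, 714, d15, d0, v11 g ff tt ff ff ff tt ff ff ff ff ff),
  (d0, d33, 1703, 1565, d3, d5, v11 g ff tt tt ff tt ff tt ff ff ff ff),
  (d0, d34, 1979, 1174, d2, d10, v11 g ff tt ff ff tt ff ff ff tt ff ff),
  (d0, d35, 415, 1243, d2, d3, v11 g ff ff ff ff tt tt tt tt ff ff ff),
  (d0, d36, 1772, 990, d2, d2, v11 g ff ff tt tt tt ff tt ff ff ff ff),
  (d0, d38, 1266, 1473, d2, d3, v11 g ff ff tt tt tt ff tt ff ff ff ff),
  (d0, d39, 1726, 829, d2, d3, v11 g ff ff ff tt ff tt ff ff ff ff ff),
  (d0, d40, 484, 461, d1, d7, v11 g ff ff ff tt tt ff tt tt ff ff ff),
  (d0, d41, 1381, 1128, d8, d9, v11 g ff ff ff ff tt tt ff ff ff ff ff),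
  (d0, d42, 392, 47, d1, d8, v11 g ff ff ff tt ff tt ff tt tt ff ff),
  (d0, d43, 1220, 599, d2, d7, v11 g ff tt ff ff ff tt tt ff ff ff ff),
  (d0, d44, 622, 622, d1, d8, v11 g ff tt tt ff tt ff ff ff ff ff ff),
  (d1, d0, 1425, 1425, d4, d0, v11 g ff ff tt tt tt ff ff ff ff ff ff),
  (d1, d2, 2000, 1655, d11, d1, v11 g ff tt tt tt ff ff ff ff ff ff ff),
  (d1, d3, 919, 666, d2, d5, v11 g ff tt ff ff tt tt ff tt ff ff ff),
  (d1, d4, 1586, 1563, d2, d6, v11 g ff ff ff tt ff ff tt ff ff ff ff),
  (d1, d7, 1494, 459, d9, d3, v11 g ff ff ff tt ff ff ff ff ff ff ff),
  (d1, d8, 1057, 275, d20, d3, v11 g ff tt ff ff tt ff ff ff ff ff ff),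
  (d1, d9, 804, 1632, d1, d3, v11 g ff tt tt tt ff tt tt ff tt ff ff),
  (d1, d10, 873, 68, d1, d8, v11 g ff tt ff ff tt ff ff ff tt ff ff),
  (d1, d11, 482, 344, d2, d6, v11 g ff tt ff ff tt tt ff ff ff ff ff),
  (d1, d12, 1333, 1379, d6, d2, v11 g ff ff ff tt ff ff ff ff ff ff ff),
  (d1, d13, 1287, 1678, d11, d2, v11 g ff ff ff tt ff ff ff ff ff ff ff),
  (d1, d14, 183, 1264, d1, d5, v11 g ff ff tt tt ff tt tt ff ff ff ff),
  (d1, d15, 298, 735, d1, d4, v11 g ff ff ff ff tt tt ff ff ff ff ff),
  (d1, d16, 1011, 1310, d1, d5, v11 g ff tt tt ff ff tt ff tt ff ff ff),
  (d1, d17, 1747, 1931, d34, d7, v11 g ff tt ff ff ff ff ff ff ff ff ff),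
  (d1, d18, 988, 1701, d1, d6, v11 g ff tt tt ff tt ff ff ff ff ff ff),
  (d1, d19, 1195, 1862, d10, d5, v11 g ff ff ff tt ff ff ff ff ff ff ff),
  (d1, d20, 22, 1954, d1, d2, v11 g ff ff tt ff tt tt ff ff ff ff ff),
  (d1, d21, 528, 252, d1, d9, v11 g ff tt tt tt tt ff tt ff ff tt ff),
  (d1, d23, 1172, 896, d1, d1, v11 g ff ff ff tt tt tt tt ff ff ff ff),
  (d1, d25, 1609, 229, d3, d9, v11 g ff tt ff ff tt ff tt tt ff ff ff),
  (d1, d26, 1770, 436, d1, d9, v11 g ff ff ff tt tt ff ff ff ff ff ff),
  (d1, d27, 1540, 1724, d3, d8, v11 g ff tt ff ff tt ff tt ff ff ff ff),
  (d1, d28, 114, 413, d1, d4, v11 g ff ff ff ff ff tt tt ff ff ff ff),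
  (d1, d29, 689, 1126, d1, d4, v11 g ff tt ff ff ff ff ff ff ff tt ff),
  (d1, d30, 160, 1241, d1, d3, v11 g ff tt ff ff ff tt ff ff ff ff ff),
  (d1, d31, 1793, 137, d11, d6, v11 g ff ff tt tt tt ff ff ff ff ff ff),
  (d1, d32, 45, 91, d1, d8, v11 g ff tt ff tt tt tt ff ff tt ff ff),
  (d1, d33, 1080, 942, d1, d10, v11 g ff tt ff tt ff ff ff ff ff tt ff),
  (d1, d34, 1356, 551, d1, d5, v11 g ff ff ff ff tt tt tt ff ff ff ff),
  (d1, d35, 1839, 620, d12, d1, v11 g ff tt ff ff ff ff ff ff ff ff ff),
  (d1, d36, 1149, 367, d1, d6, v11 g ff tt tt ff tt ff ff ff tt ff ff),
  (d1, d37, 965, 1977, d1, d5, v11 g ff tt tt ff ff tt tt ff ff ff ff),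
  (d1, d38, 643, 850, d1, d4, v11 g ff ff tt ff tt ff tt tt ff ff ff),
  (d1, d39, 1103, 206, d2, d6, v11 g ff tt tt ff tt ff ff ff ff ff ff),
  (d1, d40, 1908, 1885, d26, d7, v11 g ff tt ff ff ff ff ff ff ff ff ff),
  (d1, d41, 758, 505, d1, d9, v11 g ff tt tt ff tt ff tt ff ff ff ff),
  (d1, d42, 1816, 1471, d4, d4, v11 g ff tt tt tt ff tt ff ff tt ff ff),
  (d1, d43, 597, 2023, d12, d2, v11 g ff ff ff tt ff ff ff ff ff ff ff),
  (d1, d44, 2046, 2046, d3, d0, v11 g ff tt ff ff ff ff ff ff ff ff ff)]"

definition ol :: "(nat \<times> nat \<times> 'a \<times> nat \<times> 'a \<times> nat) list" where "ol = [
  (1841, 944, v11 g tt tt ff tt ff tt ff ff tt ff ff, d19, v11 g ff tt ff ff ff tt tt ff ff ff ff, d19),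
  (1680, 898, v11 g ff ff ff tt tt ff ff ff ff ff ff, d3, v11 g tt ff tt tt ff tt tt ff ff ff ff, d3),
  (1956, 2002, v11 g tt tt ff ff ff tt tt ff ff ff ff, d5, v11 g tt tt tt tt ff tt tt ff ff ff ff, d5),
  (1910, 254, v11 g tt tt tt ff ff tt ff tt ff ff ff, d45, v11 g ff tt tt tt ff tt ff tt ff ff ff, d45),
  (921, 1358, v11 g tt ff ff tt ff ff ff ff ff ff ff, d8, v11 g ff ff tt tt tt tt tt tt ff ff ff, d8),
  (323, 507, v11 g ff ff ff ff ff tt ff ff ff ff ff, d1, v11 g ff ff tt tt tt ff ff tt ff ff ff, d1),
  (645, 530, v11 g tt tt tt ff tt ff tt tt ff ff ff, d8, v11 g ff ff ff tt ff tt ff tt ff ff ff, d8),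
  (737, 1036, v11 g tt ff tt ff tt tt ff tt ff ff ff, d3, v11 g tt ff ff tt ff tt ff tt ff ff ff, d3),
  (1588, 553, v11 g ff ff tt ff tt tt ff ff ff ff ff, d28, v11 g tt tt ff ff tt tt tt ff ff ff ff, d28),
  (1448, 827, v11 g tt tt ff tt ff ff ff ff ff tt ff, d27, v11 g ff ff tt tt ff ff ff ff ff ff ff, d27),
  (1218, 321, v11 g ff tt tt ff ff ff ff ff ff ff ff, d18, v11 g ff ff ff tt tt ff ff tt ff ff ff, d18),
  (574, 781, v11 g tt tt ff ff tt tt ff tt ff ff ff, d1, v11 g ff ff tt tt tt ff tt tt ff ff ff, d1),
  (390, 1034, v11 g ff ff tt tt tt tt tt tt ff ff ff, d11, v11 g tt ff ff tt ff ff ff ff ff tt ff, d11),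
  (1517, 1402, v11 g ff ff tt tt ff tt ff ff ff ff ff, d2, v11 g tt ff tt tt tt tt ff tt tt ff ff, d2)]"

lemmas comp_simps = rr.simps un_simps un2_simps pw_simps v_add v_one v_tg v_sq v_mult v_eq v_eq_0 v_eq_1 bit_simps
  frs.simps conj_of.simps list.pred_inject case_prod_conv simp_thms

text \<open>The walk has \<open>1023 / 11 = 93 = 3 * 31\<close> steps; the intermediate tests are at
  the quotients 31 and 3.\<close>

lemma good_cert: "list_all (dgood d93 [d3, d31] d11 (v11 g False True False False False False False False False False False)) gl"
  unfolding gl_def by (simp only: comp_simps dgood_simps)

lemmas good = good_cert[unfolded dgood_def]

lemma bad_cert: "list_all dbad bl"
  unfolding bl_def by (simp only: comp_simps dbad_simp)

lemmas bad = bad_cert[unfolded dbad_def]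

lemma ori_cert: "list_all dori ol"
  unfolding ol_def by (simp only: comp_simps dori_simp)

lemmas ori = ori_cert[unfolded dori_def]

theorem classes: "num_iso_classes TYPE('a) = 14" "all_nonorientable TYPE('a)"
proof -
  interpret exponent_coords 11 "TYPE('a)" 1425 24 2 88 by (rule coords)
  have upt: "take (un d2) digits = [0..<2]" "take (un d88) digits = [0..<88]"
    by (simp_all add: un_def dd take_digits_upt)
  have cov: "list_all (\<lambda>a. list_all (\<lambda>b. 0 < a \<and> 2 * a < 2 \<or> (a = 0 \<or> 2 * a = 2) \<and> 2 * b \<le> 88 \<longrightarrow>
      (a, b) \<in> set (map (\<lambda>(a, b, _). (a, b)) gl) \<union> set (map (\<lambda>(a, b, _). (a, b)) bl)) (take (un d88) digits)) (take (un d2) digits)"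
    by (simp only: list_tab_simps un_simps) (simp add: gl_def bl_def dd)
  have cover: "half_pairs 2 88 \<subseteq> set (map (\<lambda>(a, b, _). (a, b)) gl) \<union> set (map (\<lambda>(a, b, _). (a, b)) bl)"
  proof (rule subsetI)
    fix p assume "p \<in> half_pairs 2 88"
    then have "fst p \<in> set [0..<2]" "snd p \<in> set [0..<88]" "(\<lambda>a b. 0 < a \<and> 2 * a < 2 \<or> (a = 0 \<or> 2 * a = 2) \<and> 2 * b \<le> 88) (fst p) (snd p)"
      unfolding half_pairs_def by (simp_all only: set_upt mem_Collect_eq case_prod_beta atLeastLessThan_iff zero_le simp_thms)
    moreover have "\<forall>a\<in>set [0..<2]. \<forall>b\<in>set [0..<88]. 0 < a \<and> 2 * a < 2 \<or> (a = 0 \<or> 2 * a = 2) \<and> 2 * b \<le> 88 \<longrightarrow> (a, b) \<in> set (map (\<lambda>(a, b, _). (a, b)) gl) \<union> set (map (\<lambda>(a, b, _). (a, b)) bl)"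
      using cov by (simp only: upt list_all_iff)
    ultimately have "(fst p, snd p) \<in> set (map (\<lambda>(a, b, _). (a, b)) gl) \<union> set (map (\<lambda>(a, b, _). (a, b)) bl)" by metis
    then show "p \<in> set (map (\<lambda>(a, b, _). (a, b)) gl) \<union> set (map (\<lambda>(a, b, _). (a, b)) bl)" by (simp only: prod.collapse)
  qed
  have half: "set (map (\<lambda>(a, b, _). (a, b)) gl) \<subseteq> half_pairs 2 88" and dist: "distinct (map (\<lambda>(a, b, _). (a, b)) gl)"
    and len: "length gl = 14"
    by (simp_all add: gl_def half_pairs_def dd)
  have gl: "list_all (\<lambda>(a, b, t, t', c). t = (1425 ^ a * 24 ^ b) mod n \<and> t * t' mod n = 1 \<and> 0 < c \<and> c < 11) gl"
    by (simp add: gl_def dd)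
  have bl: "list_all (\<lambda>(a, b, t, t', k, c, y). t = (1425 ^ a * 24 ^ b) mod n \<and> t * t' mod n = 1 \<and> 0 < k \<and>
      (k * 11 < 2 ^ (11 - 1) - 1 \<or> c = 0 \<and> k < 2 ^ (11 - 1) - 1)) bl"
    by (simp add: bl_def dd)
  have x: "v11 g False True False False False False False False False False False \<noteq> 0" "v11 g False True False False False False False False False False False \<noteq> 1" by (simp_all add: v_eq_0 v_eq_1)
  have N: "d11 = 11" "d93 * 11 = 2 ^ (11 - 1) - 1" "0 < d93" "d93 = prod_list [3, 31]"
    and q: "\<forall>p\<in>set [3, 31]. prime p \<and> d93 div p \<in> set [d3, d31]" by (simp_all add: dd)
  note r = direct_classes[OF cover half dist gl good x N q bl bad]
  show "num_iso_classes TYPE('a) = 14" using r(1) len by simp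
  show "all_nonorientable TYPE('a)" by (rule r(2)[OF _ ori]) (simp add: gl_def ol_def)
qed

end

lemma classes_11:
  assumes card: "card (UNIV :: 'a::{field,finite} set) = 2 ^ 11"
  shows "num_iso_classes TYPE('a) = 14 \<and> all_nonorientable TYPE('a)"
proof -
  interpret binary_field 11 "TYPE('a)" by unfold_locales (use card in simp_all)
  obtain g :: 'a where "g ^ 11 = poly (bpoly [True, False, True, False, False, False, False, False, False, False, False]) g"
    by (rule ex_root[of "[True, False, True, False, False, False, False, False, False, False, False]" "[True, True, True, True, True, True, True, True, True, True, True]" 11]) (simp_all add: timesX_def numeral_eq_Suc)
  then have "g ^ 11 = 1 + g ^ 2" by (simp add: eval_nat_numeral algebra_simps)
  from gf11.classes[OF gf11.intro[OF card this]] show ?thesis by simp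
qed

section \<open>Roots of the defining polynomials of degree 13, 17 and 19\<close>

lemma root_13:
  assumes card: "card (UNIV :: 'a::{field,finite} set) = 2 ^ 13"
  shows "\<exists>g::'a. g ^ 13 = 1 + g + g ^ 3 + g ^ 4"
proof -
  interpret binary_field 13 "TYPE('a)" by unfold_locales (use card in simp_all)
  obtain g :: 'a where "g ^ 13 = poly (bpoly [True, True, False, True, True, False, False, False, False, False, False, False, False]) g"
    by (rule ex_root[of "[True, True, False, True, True, False, False, False, False, False, False, False, False]" "[True, True, True, True, True, True, True, True, True, True, True, True, True]" 13]) (simp_all add: timesX_def numeral_eq_Suc)
  then have "g ^ 13 = 1 + g + g ^ 3 + g ^ 4" by (simp add: eval_nat_numeral algebra_simps)
  then show ?thesis by blast
qed

lemma root_17: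
  assumes card: "card (UNIV :: 'a::{field,finite} set) = 2 ^ 17"
  shows "\<exists>g::'a. g ^ 17 = 1 + g ^ 3"
proof -
  interpret binary_field 17 "TYPE('a)" by unfold_locales (use card in simp_all)
  obtain g :: 'a where "g ^ 17 = poly (bpoly [True, False, False, True, False, False, False, False, False, False, False, False, False, False, False, False, False]) g"
    by (rule ex_root[of "[True, False, False, True, False, False, False, False, False, False, False, False, False, False, False, False, False]" "[True, True, True, True, True, True, True, True, True, True, True, True, True, True, True, True, True]" 17]) (simp_all add: timesX_def numeral_eq_Suc)
  then have "g ^ 17 = 1 + g ^ 3" by (simp add: eval_nat_numeral algebra_simps)
  then show ?thesis by blast
qed

lemma root_19:
  assumes card: "card (UNIV :: 'a::{field,finite} set) = 2 ^ 19"
  shows "\<exists>g::'a. g ^ 19 = 1 + g + g ^ 2 + g ^ 5"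
proof -
  interpret binary_field 19 "TYPE('a)" by unfold_locales (use card in simp_all)
  obtain g :: 'a where "g ^ 19 = poly (bpoly [True, True, True, False, False, True, False, False, False, False, False, False, False, False, False, False, False, False, False]) g"
    by (rule ex_root[of "[True, True, True, False, False, True, False, False, False, False, False, False, False, False, False, False, False, False, False]" "[True, True, True, True, True, True, True, True, True, True, True, True, True, True, True, True, True, True, True]" 19]) (simp_all add: timesX_def numeral_eq_Suc)
  then have "g ^ 19 = 1 + g + g ^ 2 + g ^ 5" by (simp add: eval_nat_numeral algebra_simps)
  then show ?thesis by blast
qed

lemmas [simp] = un_simps un2_simps ix_simps hi_simps hi_0 decode3_simps lt_simps

section \<open>Addition tables for the labels\<close>

lemma sc_tab_13: "list_all (\<lambda>(x, y). sc d13 x = y) (zip (take (un d13) digits) (tl (take (un d13) digits) @ [d0]))"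
  using sc_tab[of 13] by (simp only: un_def) (simp add: dd)

text \<open>The numeral is 13 in binary, once for the length of a row and once for the number of
  rows. Each of the three large fields needs addition modulo \<open>m\<close>, \<open>L\<close> and
  \<open>H\<close>, nine tables in all.\<close>

lemma sum_tab_13: "tr_all (sum_ok d13) (fst (orb (sum_row d13 (num.Bit1 (num.Bit0 (num.Bit1 num.One)))) (num.Bit1 (num.Bit0 (num.Bit1 num.One))) (d0, d0, d0)))"
  by (simp only: sum_ok_all d0_def)

lemmas sc13 = sc_tab_13[simplified list_tab_simps un_simps]
lemmas sum13 [simp] = sum_tab_13[simplified orb_simps sc13 fst_conv tr_all.simps sum_ok_simp]

lemma sc_tab_35: "list_all (\<lambda>(x, y). sc d35 x = y) (zip (take (un d35) digits) (tl (take (un d35) digits) @ [d0]))"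
  using sc_tab[of 35] by (simp only: un_def) (simp add: dd)

lemma sum_tab_35: "tr_all (sum_ok d35) (fst (orb (sum_row d35 (num.Bit1 (num.Bit1 (num.Bit0 (num.Bit0 (num.Bit0 num.One)))))) (num.Bit1 (num.Bit1 (num.Bit0 (num.Bit0 (num.Bit0 num.One))))) (d0, d0, d0)))"
  by (simp only: sum_ok_all d0_def)

lemmas sc35 = sc_tab_35[simplified list_tab_simps un_simps]
lemmas sum35 [simp] = sum_tab_35[simplified orb_simps sc35 fst_conv tr_all.simps sum_ok_simp]

lemma sc_tab_18: "list_all (\<lambda>(x, y). sc d18 x = y) (zip (take (un d18) digits) (tl (take (un d18) digits) @ [d0]))"
  using sc_tab[of 18] by (simp only: un_def) (simp add: dd)

lemma sum_tab_18: "tr_all (sum_ok d18) (fst (orb (sum_row d18 (num.Bit0 (num.Bit1 (num.Bit0 (num.Bit0 num.One))))) (num.Bit0 (num.Bit1 (num.Bit0 (num.Bit0 num.One)))) (d0, d0, d0)))"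
  by (simp only: sum_ok_all d0_def)

lemmas sc18 = sc_tab_18[simplified list_tab_simps un_simps]
lemmas sum18 [simp] = sum_tab_18[simplified orb_simps sc18 fst_conv tr_all.simps sum_ok_simp]

lemma sc_tab_17: "list_all (\<lambda>(x, y). sc d17 x = y) (zip (take (un d17) digits) (tl (take (un d17) digits) @ [d0]))"
  using sc_tab[of 17] by (simp only: un_def) (simp add: dd)

lemma sum_tab_17: "tr_all (sum_ok d17) (fst (orb (sum_row d17 (num.Bit1 (num.Bit0 (num.Bit0 (num.Bit0 num.One))))) (num.Bit1 (num.Bit0 (num.Bit0 (num.Bit0 num.One)))) (d0, d0, d0)))"
  by (simp only: sum_ok_all d0_def)

lemmas sc17 = sc_tab_17[simplified list_tab_simps un_simps]
lemmas sum17 [simp] = sum_tab_17[simplified orb_simps sc17 fst_conv tr_all.simps sum_ok_simp]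

lemma sc_tab_257: "list_all (\<lambda>(x, y). sc d257 x = y) (zip (take (un d257) digits) (tl (take (un d257) digits) @ [d0]))"
  using sc_tab[of 257] by (simp only: un_def) (simp add: dd)

lemma sum_tab_257: "tr_all (sum_ok d257) (fst (orb (sum_row d257 (num.Bit1 (num.Bit0 (num.Bit0 (num.Bit0 (num.Bit0 (num.Bit0 (num.Bit0 (num.Bit0 num.One))))))))) (num.Bit1 (num.Bit0 (num.Bit0 (num.Bit0 (num.Bit0 (num.Bit0 (num.Bit0 (num.Bit0 num.One)))))))) (d0, d0, d0)))"
  by (simp only: sum_ok_all d0_def)

lemmas sc257 = sc_tab_257[simplified list_tab_simps un_simps]
lemmas sum257 [simp] = sum_tab_257[simplified orb_simps sc257 fst_conv tr_all.simps sum_ok_simp]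

lemma sc_tab_30: "list_all (\<lambda>(x, y). sc d30 x = y) (zip (take (un d30) digits) (tl (take (un d30) digits) @ [d0]))"
  using sc_tab[of 30] by (simp only: un_def) (simp add: dd)

lemma sum_tab_30: "tr_all (sum_ok d30) (fst (orb (sum_row d30 (num.Bit0 (num.Bit1 (num.Bit1 (num.Bit1 num.One))))) (num.Bit0 (num.Bit1 (num.Bit1 (num.Bit1 num.One)))) (d0, d0, d0)))"
  by (simp only: sum_ok_all d0_def)

lemmas sc30 = sc_tab_30[simplified list_tab_simps un_simps]
lemmas sum30 [simp] = sum_tab_30[simplified orb_simps sc30 fst_conv tr_all.simps sum_ok_simp]

lemma sc_tab_19: "list_all (\<lambda>(x, y). sc d19 x = y) (zip (take (un d19) digits) (tl (take (un d19) digits) @ [d0]))"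
  using sc_tab[of 19] by (simp only: un_def) (simp add: dd)

lemma sum_tab_19: "tr_all (sum_ok d19) (fst (orb (sum_row d19 (num.Bit1 (num.Bit1 (num.Bit0 (num.Bit0 num.One))))) (num.Bit1 (num.Bit1 (num.Bit0 (num.Bit0 num.One)))) (d0, d0, d0)))"
  by (simp only: sum_ok_all d0_def)

lemmas sc19 = sc_tab_19[simplified list_tab_simps un_simps]
lemmas sum19 [simp] = sum_tab_19[simplified orb_simps sc19 fst_conv tr_all.simps sum_ok_simp]

lemma sc_tab_189: "list_all (\<lambda>(x, y). sc d189 x = y) (zip (take (un d189) digits) (tl (take (un d189) digits) @ [d0]))"
  using sc_tab[of 189] by (simp only: un_def) (simp add: dd)

lemma sum_tab_189: "tr_all (sum_ok d189) (fst (orb (sum_row d189 (num.Bit1 (num.Bit0 (num.Bit1 (num.Bit1 (num.Bit1 (num.Bit1 (num.Bit0 num.One)))))))) (num.Bit1 (num.Bit0 (num.Bit1 (num.Bit1 (num.Bit1 (num.Bit1 (num.Bit0 num.One))))))) (d0, d0, d0)))"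
  by (simp only: sum_ok_all d0_def)

lemmas sc189 = sc_tab_189[simplified list_tab_simps un_simps]
lemmas sum189 [simp] = sum_tab_189[simplified orb_simps sc189 fst_conv tr_all.simps sum_ok_simp]

lemma sc_tab_146: "list_all (\<lambda>(x, y). sc d146 x = y) (zip (take (un d146) digits) (tl (take (un d146) digits) @ [d0]))"
  using sc_tab[of 146] by (simp only: un_def) (simp add: dd)

lemma sum_tab_146: "tr_all (sum_ok d146) (fst (orb (sum_row d146 (num.Bit0 (num.Bit1 (num.Bit0 (num.Bit0 (num.Bit1 (num.Bit0 (num.Bit0 num.One)))))))) (num.Bit0 (num.Bit1 (num.Bit0 (num.Bit0 (num.Bit1 (num.Bit0 (num.Bit0 num.One))))))) (d0, d0, d0)))"
  by (simp only: sum_ok_all d0_def)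

lemmas sc146 = sc_tab_146[simplified list_tab_simps un_simps]
lemmas sum146 [simp] = sum_tab_146[simplified orb_simps sc146 fst_conv tr_all.simps sum_ok_simp]

section \<open>The field of degree 13\<close>

definition v13 :: "'b::field \<Rightarrow> bool \<Rightarrow> bool \<Rightarrow> bool \<Rightarrow> bool \<Rightarrow> bool \<Rightarrow> bool \<Rightarrow> bool \<Rightarrow> bool \<Rightarrow> bool \<Rightarrow> bool \<Rightarrow> bool \<Rightarrow> bool \<Rightarrow> bool \<Rightarrow> 'b" where
  "v13 g b0 b1 b2 b3 b4 b5 b6 b7 b8 b9 b10 b11 b12 =
    of_bool b0 + of_bool b1 * g + of_bool b2 * g ^ 2 + of_bool b3 * g ^ 3 + of_bool b4 * g ^ 4 +
    of_bool b5 * g ^ 5 + of_bool b6 * g ^ 6 + of_bool b7 * g ^ 7 + of_bool b8 * g ^ 8 +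
    of_bool b9 * g ^ 9 + of_bool b10 * g ^ 10 + of_bool b11 * g ^ 11 + of_bool b12 * g ^ 12"

locale gf13 =
  fixes g :: "'a::{field,finite}"
  assumes card_gf: "card (UNIV :: 'a set) = 2 ^ 13" and root: "g ^ 13 = 1 + g + g ^ 3 + g ^ 4"
begin

sublocale binary_field 13 "TYPE('a)"
  by unfold_locales (use card_gf in simp_all)

lemma g_ne: "g \<noteq> 0" "g \<noteq> 1"
  using root by (auto simp: numeral_simps)

lemma g_pow:
  "g ^ 14 = g + g ^ 2 + g ^ 4 + g ^ 5"
  "g ^ 15 = g ^ 2 + g ^ 3 + g ^ 5 + g ^ 6"
  "g ^ 16 = g ^ 3 + g ^ 4 + g ^ 6 + g ^ 7"
  "g ^ 17 = g ^ 4 + g ^ 5 + g ^ 7 + g ^ 8"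
  "g ^ 18 = g ^ 5 + g ^ 6 + g ^ 8 + g ^ 9"
  "g ^ 19 = g ^ 6 + g ^ 7 + g ^ 9 + g ^ 10"
  "g ^ 20 = g ^ 7 + g ^ 8 + g ^ 10 + g ^ 11"
  "g ^ 21 = g ^ 8 + g ^ 9 + g ^ 11 + g ^ 12"
  "g ^ 22 = 1 + g + g ^ 3 + g ^ 4 + g ^ 9 + g ^ 10 + g ^ 12"
  "g ^ 23 = 1 + g ^ 2 + g ^ 3 + g ^ 5 + g ^ 10 + g ^ 11"
  "g ^ 24 = g + g ^ 3 + g ^ 4 + g ^ 6 + g ^ 11 + g ^ 12"
proof -
  have p14: "g ^ 14 = g + g ^ 2 + g ^ 4 + g ^ 5"
    using power_add[of g 1 13]
    by (simp add: root distrib_left char2_simps flip: power_Suc power_Suc2 power_add power2_eq_square)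
  have p15: "g ^ 15 = g ^ 2 + g ^ 3 + g ^ 5 + g ^ 6"
    using power_add[of g 2 13]
    by (simp add: root p14 distrib_left char2_simps flip: power_Suc power_Suc2 power_add power2_eq_square)
  have p16: "g ^ 16 = g ^ 3 + g ^ 4 + g ^ 6 + g ^ 7"
    using power_add[of g 3 13]
    by (simp add: root p14 p15 distrib_left char2_simps flip: power_Suc power_Suc2 power_add power2_eq_square)
  have p17: "g ^ 17 = g ^ 4 + g ^ 5 + g ^ 7 + g ^ 8"
    using power_add[of g 4 13]
    by (simp add: root p14 p15 p16 distrib_left char2_simps flip: power_Suc power_Suc2 power_add power2_eq_square)
  have p18: "g ^ 18 = g ^ 5 + g ^ 6 + g ^ 8 + g ^ 9"
    using power_add[of g 5 13]
    by (simp add: root p14 p15 p16 p17 distrib_left char2_simps flip: power_Suc power_Suc2 power_add power2_eq_square)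
  have p19: "g ^ 19 = g ^ 6 + g ^ 7 + g ^ 9 + g ^ 10"
    using power_add[of g 6 13]
    by (simp add: root p14 p15 p16 p17 distrib_left char2_simps flip: power_Suc power_Suc2 power_add power2_eq_square)
  have p20: "g ^ 20 = g ^ 7 + g ^ 8 + g ^ 10 + g ^ 11"
    using power_add[of g 7 13]
    by (simp add: root p14 p15 p16 p17 distrib_left char2_simps flip: power_Suc power_Suc2 power_add power2_eq_square)
  have p21: "g ^ 21 = g ^ 8 + g ^ 9 + g ^ 11 + g ^ 12"
    using power_add[of g 8 13]
    by (simp add: root p14 p15 p16 p17 distrib_left char2_simps flip: power_Suc power_Suc2 power_add power2_eq_square)
  have p22: "g ^ 22 = 1 + g + g ^ 3 + g ^ 4 + g ^ 9 + g ^ 10 + g ^ 12"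
    using power_add[of g 9 13]
    by (simp add: root p14 p15 p16 p17 distrib_left char2_simps flip: power_Suc power_Suc2 power_add power2_eq_square)
  have p23: "g ^ 23 = 1 + g ^ 2 + g ^ 3 + g ^ 5 + g ^ 10 + g ^ 11"
    using power_add[of g 10 13]
    by (simp add: root p14 p15 p16 p17 distrib_left char2_simps flip: power_Suc power_Suc2 power_add power2_eq_square)
  have p24: "g ^ 24 = g + g ^ 3 + g ^ 4 + g ^ 6 + g ^ 11 + g ^ 12"
    using power_add[of g 11 13]
    by (simp add: root p14 p15 p16 p17 distrib_left char2_simps flip: power_Suc power_Suc2 power_add power2_eq_square)
  show "g ^ 14 = g + g ^ 2 + g ^ 4 + g ^ 5" "g ^ 15 = g ^ 2 + g ^ 3 + g ^ 5 + g ^ 6" "g ^ 16 = g ^ 3 + g ^ 4 + g ^ 6 + g ^ 7" "g ^ 17 = g ^ 4 + g ^ 5 + g ^ 7 + g ^ 8" "g ^ 18 = g ^ 5 + g ^ 6 + g ^ 8 + g ^ 9" "g ^ 19 = g ^ 6 + g ^ 7 + g ^ 9 + g ^ 10" "g ^ 20 = g ^ 7 + g ^ 8 + g ^ 10 + g ^ 11" "g ^ 21 = g ^ 8 + g ^ 9 + g ^ 11 + g ^ 12" "g ^ 22 = 1 + g + g ^ 3 + g ^ 4 + g ^ 9 + g ^ 10 + g ^ 12" "g ^ 23 = 1 + g ^ 2 + g ^ 3 + g ^ 5 + g ^ 10 + g ^ 11" "g ^ 24 = g + g ^ 3 + g ^ 4 + g ^ 6 + g ^ 11 + g ^ 12"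
    by (fact p14 p15 p16 p17 p18 p19 p20 p21 p22 p23 p24)+
qed

lemma v_add: "v13 g b0 b1 b2 b3 b4 b5 b6 b7 b8 b9 b10 b11 b12 + v13 g c0 c1 c2 c3 c4 c5 c6 c7 c8 c9 c10 c11 c12 =
  v13 g (xr b0 c0) (xr b1 c1) (xr b2 c2) (xr b3 c3) (xr b4 c4) (xr b5 c5) (xr b6 c6) (xr b7 c7) (xr b8 c8) (xr b9 c9) (xr b10 c10) (xr b11 c11) (xr b12 c12)"
  by (simp add: v13_def of_bool_xr distrib_right ac_simps)

lemma v_one: "1 + v13 g b0 b1 b2 b3 b4 b5 b6 b7 b8 b9 b10 b11 b12 = v13 g (\<not> b0) b1 b2 b3 b4 b5 b6 b7 b8 b9 b10 b11 b12"
  by (simp add: v13_def of_bool_not ac_simps)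

lemma v_tg:
  "tg g (v13 g b0 b1 b2 b3 b4 b5 b6 b7 b8 b9 b10 b11 False) = v13 g False b0 b1 b2 b3 b4 b5 b6 b7 b8 b9 b10 b11"
  "tg g (v13 g b0 b1 b2 b3 b4 b5 b6 b7 b8 b9 b10 b11 True) = v13 g True (\<not> b0) b1 (\<not> b2) (\<not> b3) b4 b5 b6 b7 b8 b9 b10 b11"
  by (simp_all only: v13_def tg_simps root of_bool_not of_bool_eq mult_1 mult_zero_left add_0_left add_0_right distrib_left distrib_right add_num_simps arith_simps add.assoc add.commute add.left_commute)

lemma v_sq: "sq (v13 g b0 b1 b2 b3 b4 b5 b6 b7 b8 b9 b10 b11 b12) =
    v13 g (xr b0 b11) (xr (xr b7 b11) b12) (xr b1 b7) (xr (xr b8 b11) b12) (xr (xr (xr (xr b2 b7) b8) b11) b12) (xr b7 b9) (xr (xr (xr b3 b8) b9) b12) (xr b8 b10) (xr (xr b4 b9) b10) (xr b9 b11) (xr (xr b5 b10) b11) (xr b10 b12) (xr (xr b6 b11) b12)"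
  by (simp only: v13_def sq_add sq_simps sq_def[of g] arith_simps mult_1_right root g_pow of_bool_xr distrib_left distrib_right add.assoc add.commute add.left_commute)

lemma v_mult: "v13 g b0 b1 b2 b3 b4 b5 b6 b7 b8 b9 b10 b11 b12 * X =
    cnd b0 X (tg g (cnd b1 X (tg g (cnd b2 X (tg g (cnd b3 X (tg g (cnd b4 X (tg g (cnd b5 X (tg g (cnd b6 X (tg g (cnd b7 X (tg g (cnd b8 X (tg g (cnd b9 X (tg g (cnd b10 X (tg g (cnd b11 X (tg g (cnd b12 X 0))))))))))))))))))))))))"
  by (simp only: v13_def horner_simps add_num_simps)

lemma v_g: "v13 g False True False False False False False False False False False False False = g" and v_zero: "v13 g False False False False False False False False False False False False False = 0"
  by (simp_all add: v13_def)

end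

text \<open>Fixing the two generators inside constants keeps their numerals out of every term of a
  walk.\<close>

definition E13 where "E13 = elm 893 5468"
definition R13 where "R13 = runm 893 5468"
definition S13 where "S13 = samem 893 5468"
definition K13 where "K13 = walk_samem 893 5468"
definition Q13 where "Q13 = walk_longm 893 5468"
definition G13 where "G13 = goodm 893 5468"
definition F13 where "F13 = good_nextm 893 5468"
definition CG13 where "CG13 = cert_good 893 5468"
definition CO13 where "CO13 = cert_ori 893 5468"
definition CB13 where "CB13 = cert_liftbad 893 5468"
definition I13 where "I13 = itm 893 5468"
text \<open>In blocks of 72 and a rest, the partial sums are 45, 63, 105 and 315: the quotients of
  315 by 7, 5 and 3, and \<open>315 = 4095 / 13\<close> itself.\<close>

definition seg13 :: "(nat \<times> nat) list" where "seg13 = [(d0, d45), (d0, d18), (d0, d42), (d2, d66)]"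
definition good13_0 :: "cert list" where "good13_0 = [
  (d0, d0, d8, d10, d7, (d5, d21, d0, d9), (d5, d21, d1, d10)),
  (d1, d34, d9, d9, d11, (d12, d25, d13, d4), (d12, d24, d13, d4)),
  (d1, d34, d16, d2, d7, (d21, d4, d10, d1), (d21, d3, d3, d12)),
  (d2, d33, d10, d8, d7, (d3, d33, d10, d1), (d3, d31, d9, d0)),
  (d5, d30, d2, d16, d12, (d9, d25, d4, d13), (d9, d20, d11, d2)),
  (d7, d28, d4, d14, d3, (d12, d6, d4, d13), (d12, d34, d9, d0)),
  (d9, d26, d11, d7, d6, (d1, d12, d4, d13), (d1, d3, d2, d11)),
  (d11, d24, d17, d1, d11, (d12, d2, d7, d16), (d12, d26, d17, d8)),
  (d12, d23, d3, d15, d12, (d1, d9, d15, d6), (d1, d32, d3, d12)),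
  (d13, d22, d3, d15, d1, (d11, d26, d17, d8), (d11, d13, d5, d14)),
  (d15, d20, d8, d10, d6, (d3, d32, d0, d9), (d3, d17, d1, d10)),
  (d17, d18, d3, d15, d10, (d26, d12, d16, d7), (d26, d30, d4, d13))]"
definition good13 where "good13 = good13_0"
text \<open>These walks avoid the conjugates of their start at all the cuts, so up to conjugacy they
  have full length, but they close with twist 0. Thus they cannot be refuted by an early return on
  the cycle of \<open>g\<close> modulo Frobenius and are listed apart.\<close>

definition lift13 :: "(nat \<times> nat \<times> nat \<times> nat) list" where "lift13 = [(d11, d24, d7, d11), (d12, d23, d10, d8), (d14, d21, d10, d8)]"
definition full13 where "full13 = map cert_pair good13 @ map (\<lambda>(u, nu, v, nv). (u, v)) lift13"
definition vs13 :: "(nat \<times> nat) list" where "vs13 = [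
  (d0, d0), (d1, d17), (d2, d16), (d3, d15), (d4, d14), (d5, d13), (d6, d12), (d7, d11), (d8, d10),
  (d9, d9), (d10, d8), (d11, d7), (d12, d6), (d13, d5), (d14, d4), (d15, d3), (d16, d2), (d17, d1)]"
definition vh13 :: "(nat \<times> nat) list" where "vh13 = [
  (d0, d0), (d1, d17), (d2, d16), (d3, d15), (d4, d14), (d5, d13), (d6, d12), (d7, d11), (d8, d10),
  (d9, d9)]"
definition W13 where "W13 = rowm 893 5468 full13 ix d4"
definition N13 where "N13 = entm 893 5468 full13 ix d4"
text \<open>Modulo 8191 the number 17 is \<open>2 ^ 7 * 893 * 5468\<close>, so the 17th power moves
  along the diagonal of the labels; 6 is -7 modulo 13.\<close>

definition nx13 :: "nat \<times> nat \<times> nat \<times> nat \<times> 'b::field \<Rightarrow> nat \<times> nat \<times> nat \<times> nat \<times> 'b" where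
  "nx13 s = (case s of (j, nj, a, b, x) \<Rightarrow> (pl d13 j d7, pl d13 nj d6, pl d35 a d1, pl d18 b d1, x * sq (sq (sq (sq x)))))"
text \<open>A string serves all second coordinates in turn, with three letters for a deferral or a
  walk of at most three rotations and five letters for a longer one.\<close>

definition rows13_0 :: "(nat \<times> nat \<times> string) list" where "rows13_0 = [
  (d1, d34, ''CKwAFCAAAOwAIDKwADMIMAMwAtEFACQYDIMAAkAGwAVJLAERMAFwARLMAAHwADAAkAEwAU''),
  (d2, d33, ''GRMAAwADAQwAOACMEIwAGACMAJMCQwADFIABFwAEAAkCDYCQwADKGMHJwAEOJABOwADHNM''),
  (d3, d32, ''IGADPAACwAaAFwAICRALOAECMACwArEAwADBBwAMIMAFIMCJwAFADwAKLCwAFADwA.EOwADCHwAG''),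
  (d4, d31, ''BLwAFKLMKQAAJwAiGRABHALFAAIwADCPYJHAAOAEPAACwCEMAAMAAEHADKMCBwAD''),
  (d5, d30, ''AQwAJAFwAPAAkNGMAKwADACwAGAAwAbKHACEwAEFPACRYCIMIGMAEwAYABwADEIALMAADwAD''),
  (d6, d29, ''CQABJwADGKYCOwAEDHwAJBAwAKLFMCFwAIAAwBKEBwAFACwA!AAwAxAHYXIABPwANAGwA1BHwAIBKA''),
  (d7, d28, ''IRMAOwAQEHYAAwCHAAkFPMLCMQJMKFAIDABPADPADFMCKwAGCBwAIHKADLMBEA''),
  (d8, d27, ''AIYBGYCHwAEKKMGOwAEKRACLMANwAHJQMSOAAIwAHCKMADwA1HBAWCAAPMIRYDPY''),
  (d9, d26, ''ACwBDAAwBKBJMALwADJIMEPMBRAAEwAbAQwALWDAJOwAFAAkBHAKDAMMMBIwAFAKwAoUDM''),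
  (d10, d25, ''PFAHGADFwAEAKwAjYBMAAwARAGwALCAAAGAKFABKMGEAEDMQCABAwAJBKwAOZGAAGY''),
  (d11, d24, ''JIYEMwADHCAILwADGLwADBFMANMAAkCEAMCMDLYHRMACAACwA6NJADDwAENPMAAk''),
  (d12, d23, ''KEAGAABDwAjAAkQAACIAFAACKYBPwAHBAwAHAAkXNAAHwAVANACRwAEACwAUACwAVHGwAE''),
  (d13, d22, ''QJAAAwAhNFAAAkAFwAYAOwAPBCwAKbQALGAEQwAEDFAAIwASCMwARGLMJQYEBYMFAREA''),
  (d14, d21, ''PHAFCAAGwAHCLMbEAREAKPADHAJMAENAAAkPAARKMERYCGYSJAGAMUDA''),
  (d15, d20, ''KBAAMwAKANwA5AHwAOIKAINYBPwAINGAAAkEQMSIAJOAAEwAiBMwADAQADJYFOwAECFA''),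
  (d16, d19, ''BFYABwArDKYODAPBMFJYAPwAGAAwAQCQAABADFABNMCOAANwAEAHMBIwASYJACBM''),
  (d17, d18, ''AOAGDAKHAAAkBKMRAASHYFNYOHAdMATBAIMABQwAHKHABFwAESKAPJAXKA'')]"
definition rows13 where "rows13 = rows13_0"

context gf13
begin

text \<open>The orders 13, 35 and 18 are pairwise coprime with product 8190, which at the same time
  proves 8191 prime.\<close>

lemma coords: "exponent_coords TYPE('a) 13 893 5468 35 18" and prime_n: "prime n"
proof -
  have "ord n 893 = prod_list [5, 7]" "ord n 5468 = prod_list [2, 3, 3]"
    by (rule ord_pmI; simp add: pm_simps sqm_def)+
  then have o: "ord n 893 = 35" "ord n 5468 = 18" by simp_all
  have "coprime (35::nat) (13 * 18)" "coprime (18::nat) (13 * 35)" "n - 1 = 13 * 35 * 18"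
    using coprime_bezout[of 35 107 "13 * 18" 16] coprime_bezout[of 18 177 "13 * 35" 7] by simp_all
  from cyclic_coords[OF o this] show "exponent_coords TYPE('a) 13 893 5468 35 18" "prime n" .
qed

sublocale label_field 13 "TYPE('a)" 893 5468 35 18 g
  by (intro label_field.intro coords label_field_axioms.intro) (use g_ne prime_order[OF prime_n] in auto)

lemma nx_simp: "nx13 (j, nj, a, b, x) = (pl d13 j d7, pl d13 nj d6, pl d35 a d1, pl d18 b d1, x * sq (sq (sq (sq x))))"
  by (simp add: nx13_def)

lemma nx_ok: "okp s \<Longrightarrow> okp (nx13 s)"
proof -
  assume "okp s"
  moreover obtain j nj a b x where s: "s = (j, nj, a, b, x)" by (cases s)
  moreover have "x * sq (sq (sq (sq x))) = x ^ 17" by (simp add: sq_def flip: power_mult power_Suc)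
  ultimately show ?thesis
    using okp_next[of j nj a b x 17 7 6] by (simp add: nx_simp dd cong_def)
qed

text \<open>The numeral is \<open>630 = 35 * 18\<close>, one entry for each pair of labels.\<close>

lemma tab_ok: "tr_all okp (fst (orb (leaf nx13) (num.Bit0 (num.Bit1 (num.Bit1 (num.Bit0 (num.Bit1 (num.Bit1 (num.Bit1 (num.Bit0 (num.Bit0 num.One))))))))) (d0, d0, d0, d0, v13 g False True False False False False False False False False False False False)))"
  by (intro orb_leaf_all nx_ok) (simp_all add: okp_def v_g elm_def dd)

lemmas tab = tab_ok[simplified orb_simps fst_conv nx_simp sum13 sum35 sum18 v_add v_tg v_sq v_mult bit_simps]

lemma lookp_simp: "lookp (j, nj, a, b, x) \<longleftrightarrow> (\<forall>e. fr e x = E13 g (pl d13 e j) a b)"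
  by (simp add: lookp_def E13_def dd)

lemma stepp_simp: "stepp (j, nj, a, b, x) \<longleftrightarrow>
    (\<forall>k i u v w z. R13 g (Suc k) i a b u v w z = nxr k i (fr nj (1 + x)) u v w z)"
  by (simp add: stepp_def R13_def)

lemma nxr_simp: "nxr k i (E13 g c a b) u v w z = R13 g k (pl d13 i c) (pl d35 a u) (pl d18 b v) w z u v"
  by (simp add: nxr_E R13_def E13_def dd)

(* The simplifier tries unconditional rules first: the trivial premise gives the table priority. *)
lemma fr_simp: "xr True False \<Longrightarrow> fr e (v13 g b0 b1 b2 b3 b4 b5 b6 b7 b8 b9 b10 b11 b12) = fr (pl d13 e d12) (sq (v13 g b0 b1 b2 b3 b4 b5 b6 b7 b8 b9 b10 b11 b12))"
  using fr_step[of e "v13 g b0 b1 b2 b3 b4 b5 b6 b7 b8 b9 b10 b11 b12"] by (simp add: sq_def dd)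

lemmas look = okp_all_lookp[OF tab, simplified tr_all.simps lookp_simp simp_thms]

text \<open>Adding 1, searching the conjugacy class by squaring and reading off the label are
  carried out once for each pair \<open>(a, b)\<close>; afterwards a half step is a single
  rule.\<close>

lemmas step = okp_all_stepp[OF tab, simplified tr_all.simps stepp_simp nxr_simp v_one v_sq
  fr_simp look sum13 bit_simps simp_thms]

lemma walk_simps:
  "R13 g 0 j a b u v w z = E13 g j a b" "I13 0 x u v w z = x"
  "I13 (Suc k) (E13 g j a b) u v w z = I13 k (R13 g suc144 j a b u v w z) u v w z"
  "S13 g a b (E13 g j a b) = True"
  "K13 g k a b u nu v nv = S13 g a b (R13 g k d0 a b nu nv u v)"
  "Q13 g k l a b u nu v nv = S13 g a b (I13 (un l) (R13 g k d0 a b nu nv u v) nu nv u v)"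
  by (simp_all add: R13_def E13_def I13_def S13_def K13_def Q13_def R_0 itm_0 itm_suc144 samem_E walk_samem_def walk_longm_def)

lemmas row_simps13 = row_simps[of 893 5468 full13 "d4" g, folded W13_def N13_def]
lemmas ent_simps13 = ent_simps[of 893 5468 full13 "d4" g, folded N13_def K13_def Q13_def]
lemmas good_simps13 = good_simps[of 893 5468 g, folded G13_def F13_def E13_def R13_def I13_def S13_def]

lemma cert_simps:
  "CG13 g ss (u, nu, v, nv, c, o1, o2) = G13 g nu nv u v ss c (E13 g d0 d0 d0)"
  "CB13 g ss (u, nu, v, nv) = G13 g nu nv u v ss d0 (E13 g d0 d0 d0)"
  "CO13 g (u, nu, v, nv, c, (k, a, b, b'), (l, e, f, f')) \<longleftrightarrow>
    R13 g (un2 k) d0 a b nu nv u v = E13 g d0 a b' \<and> R13 g (un2 l) d0 e f u v nu nv = E13 g d0 e f'"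
  by (simp_all add: CG13_def CB13_def CO13_def G13_def E13_def R13_def cert_good_def cert_liftbad_def cert_ori_def)

lemma full_mem: "list_all (\<lambda>x. (x \<in> set full13) = True) (map cert_pair good13 @ map (\<lambda>(u, nu, v, nv). (u, v)) lift13)"
  by (simp add: full13_def list_all_iff)

lemmas full_simps = full_mem[simplified good13_def good13_0_def lift13_def list.map append_Cons append_Nil
  cert_pair_def case_prod_conv list.pred_inject simp_thms]

text \<open>A nonzero label in either position rules out a conjugate of \<open>g\<close>.\<close>

lemma same_tab: "list_all (\<lambda>x. \<forall>i b. S13 g d0 d0 (E13 g i x b) = False) (tl (take (un d35) digits)) \<and>
    list_all (\<lambda>x. \<forall>i. S13 g d0 d0 (E13 g i d0 x) = False) (tl (take (un d18) digits))"
proof -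
  have "set (tl (take k digits)) = {1..<k}" if "k \<le> 258" for k
    by (simp only: take_digits_upt[OF that] tl_upt set_upt One_nat_def)
  then show ?thesis by (auto simp: list_all_iff un_def S13_def E13_def dd samem_00)
qed

lemmas same_simps = same_tab[simplified list_tab_simps un_simps]

context
  notes step [simp] walk_simps [simp] row_simps13 [simp] ent_simps13 [simp] good_simps13 [simp] full_simps [simp] cert_simps [simp]
    same_simps [simp] suc144_simp [simp] decode3.simps [simp del]
begin

lemma rows_0: "list_all (\<lambda>(u, nu, s). W13 g u nu vs13 s) rows13_0"
  unfolding rows13_0_def vs13_def by simp

text \<open>For first coordinate 0, second coordinates up to \<open>18 / 2\<close> represent all
  pairs up to sign.\<close>

lemma row_0: "W13 g d0 d0 vh13 ''AAAIFAACMdJACMMBLMACMBEAAAkAAY''"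
  unfolding vh13_def by simp

lemma good_0: "list_all (CG13 g seg13) good13_0"
  unfolding good13_0_def seg13_def by simp

lemma ori_0: "list_all (CO13 g) good13_0"
  unfolding good13_0_def by simp

lemma lift_0: "list_all (CB13 g seg13) lift13"
  unfolding lift13_def seg13_def by simp

end

theorem classes: "num_iso_classes TYPE('a) = 12" "all_nonorientable TYPE('a)"
proof -
  have rows: "list_all (\<lambda>(u, nu, s). rowm 893 5468 full13 ix d4 g u nu vs13 s) rows13"
    using rows_0 by (simp only: rows13_def W13_def list_all_append simp_thms)
  note row0 = row_0[unfolded W13_def]
  have good: "list_all (cert_good 893 5468 g seg13) good13"
    using good_0 by (simp only: good13_def CG13_def list_all_append simp_thms)
  have ori: "list_all (cert_ori 893 5468 g) good13"
    using ori_0 by (simp only: good13_def CO13_def list_all_append simp_thms)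
  note lift = lift_0[unfolded CB13_def]
  have ar: "list_all (cert_arith 13 35 18 9) good13"
    by (simp add: good13_def good13_0_def cert_arith_def dd)
  have dist: "distinct (map cert_pair good13)" and len: "length good13 = 12"
    by (simp_all add: good13_def good13_0_def cert_pair_def dd)
  have us: "map fst rows13 = [1..<(35 + 1) div 2]" "list_all (\<lambda>(u, nu, s). (u + nu) mod 35 = 0) rows13"
    by (simp_all add: rows13_def rows13_0_def dd upt_conv_Cons)
  have vs: "map fst vs13 = [0..<18]" "list_all (\<lambda>(v, nv). (v + nv) mod 18 = 0) vs13"
    by (simp_all add: vs13_def dd upt_conv_Cons)
  have vh: "map fst vh13 = [0..<18 div 2 + 1]" "list_all (\<lambda>(v, nv). (v + nv) mod 18 = 0) vh13"
    by (simp_all add: vh13_def dd upt_conv_Cons)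
  have bl: "list_all (\<lambda>(u, nu, v, nv). (u + nu) mod 35 = 0 \<and> (v + nv) mod 18 = 0) lift13"
    by (simp add: lift13_def dd)
  have N: "sum_list (map amount seg13) = 315" by (simp add: seg13_def amount_def dd)
  have q: "\<forall>p\<in>set [3, 3, 5, 7]. prime p \<and> (\<exists>k\<in>{0<..<length seg13}. 315 div p = sum_list (map amount (take k seg13)))"
    (is "\<forall>p\<in>_. _ \<and> (\<exists>k\<in>_. ?Q p k)")
  proof -
    have "?Q 3 3" "?Q 5 2" "?Q 7 1" by (simp_all add: seg13_def amount_def dd)
    moreover have "length seg13 = 4" by (simp add: seg13_def)
    ultimately show ?thesis by (auto intro: bexI[of _ 3] bexI[of _ 2] bexI[of _ 1])
  qed
  have h: "n dvd 5468 ^ 9 + 1"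
  proof -
    \<comment> \<open>Half of the order 18 gives the power -1.\<close>
    have "pm n 5468 9 = 8190" by (simp add: pm_simps sqm_def)
    then have "(5468 ^ 9 + 1) mod n = (8190 + 1) mod n" unfolding pm_def by (metis mod_add_left_eq)
    then show ?thesis by (simp add: mod_eq_0_iff_dvd)
  qed
  have pr: "(315::nat) = prod_list [3, 3, 5, 7]" by simp
  have odd: "odd (35::nat)" and bd: "72 * d4 * 13 < 2 ^ (13 - 1) - 1" "1 \<le> d4"
    and N': "315 * 13 = 2 ^ (13 - 1) - (1::nat)" "0 < (315::nat)" by (simp_all add: dd)
  note r = certified_classes[OF odd bd h rows row0 us vs vh full13_def good ori ar lift bl N N' pr q dist]
  show "num_iso_classes TYPE('a) = 12" using r(1) len by simp
  show "all_nonorientable TYPE('a)" using r(2) by simp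
qed

end

lemma classes_13:
  assumes card: "card (UNIV :: 'a::{field,finite} set) = 2 ^ 13"
  shows "num_iso_classes TYPE('a) = 12 \<and> all_nonorientable TYPE('a)"
proof -
  obtain g :: 'a where "g ^ 13 = 1 + g + g ^ 3 + g ^ 4" using root_13[OF card] by blast
  from gf13.classes[OF gf13.intro[OF card this]] show ?thesis by simp
qed

section \<open>The field of degree 17\<close>

definition v17 :: "'b::field \<Rightarrow> bool \<Rightarrow> bool \<Rightarrow> bool \<Rightarrow> bool \<Rightarrow> bool \<Rightarrow> bool \<Rightarrow> bool \<Rightarrow> bool \<Rightarrow> bool \<Rightarrow> bool \<Rightarrow> bool \<Rightarrow> bool \<Rightarrow> bool \<Rightarrow> bool \<Rightarrow> bool \<Rightarrow> bool \<Rightarrow> bool \<Rightarrow> 'b" where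
  "v17 g b0 b1 b2 b3 b4 b5 b6 b7 b8 b9 b10 b11 b12 b13 b14 b15 b16 =
    of_bool b0 + of_bool b1 * g + of_bool b2 * g ^ 2 + of_bool b3 * g ^ 3 + of_bool b4 * g ^ 4 +
    of_bool b5 * g ^ 5 + of_bool b6 * g ^ 6 + of_bool b7 * g ^ 7 + of_bool b8 * g ^ 8 +
    of_bool b9 * g ^ 9 + of_bool b10 * g ^ 10 + of_bool b11 * g ^ 11 + of_bool b12 * g ^ 12 +
    of_bool b13 * g ^ 13 + of_bool b14 * g ^ 14 + of_bool b15 * g ^ 15 + of_bool b16 * g ^ 16"

locale gf17 =
  fixes g :: "'a::{field,finite}"
  assumes card_gf: "card (UNIV :: 'a set) = 2 ^ 17" and root: "g ^ 17 = 1 + g ^ 3"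
begin

sublocale binary_field 17 "TYPE('a)"
  by unfold_locales (use card_gf in simp_all)

lemma g_ne: "g \<noteq> 0" "g \<noteq> 1"
  using root by (auto simp: numeral_simps)

lemma g_pow:
  "g ^ 18 = g + g ^ 4"
  "g ^ 19 = g ^ 2 + g ^ 5"
  "g ^ 20 = g ^ 3 + g ^ 6"
  "g ^ 21 = g ^ 4 + g ^ 7"
  "g ^ 22 = g ^ 5 + g ^ 8"
  "g ^ 23 = g ^ 6 + g ^ 9"
  "g ^ 24 = g ^ 7 + g ^ 10"
  "g ^ 25 = g ^ 8 + g ^ 11"
  "g ^ 26 = g ^ 9 + g ^ 12"
  "g ^ 27 = g ^ 10 + g ^ 13"
  "g ^ 28 = g ^ 11 + g ^ 14"
  "g ^ 29 = g ^ 12 + g ^ 15"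
  "g ^ 30 = g ^ 13 + g ^ 16"
  "g ^ 31 = 1 + g ^ 3 + g ^ 14"
  "g ^ 32 = g + g ^ 4 + g ^ 15"
proof -
  have p18: "g ^ 18 = g + g ^ 4"
    using power_add[of g 1 17]
    by (simp add: root distrib_left char2_simps flip: power_Suc power_Suc2 power_add power2_eq_square)
  have p19: "g ^ 19 = g ^ 2 + g ^ 5"
    using power_add[of g 2 17]
    by (simp add: root p18 distrib_left char2_simps flip: power_Suc power_Suc2 power_add power2_eq_square)
  have p20: "g ^ 20 = g ^ 3 + g ^ 6"
    using power_add[of g 3 17]
    by (simp add: root p18 p19 distrib_left char2_simps flip: power_Suc power_Suc2 power_add power2_eq_square)
  have p21: "g ^ 21 = g ^ 4 + g ^ 7"
    using power_add[of g 4 17]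
    by (simp add: root p18 p19 p20 distrib_left char2_simps flip: power_Suc power_Suc2 power_add power2_eq_square)
  have p22: "g ^ 22 = g ^ 5 + g ^ 8"
    using power_add[of g 5 17]
    by (simp add: root p18 p19 p20 distrib_left char2_simps flip: power_Suc power_Suc2 power_add power2_eq_square)
  have p23: "g ^ 23 = g ^ 6 + g ^ 9"
    using power_add[of g 6 17]
    by (simp add: root p18 p19 p20 distrib_left char2_simps flip: power_Suc power_Suc2 power_add power2_eq_square)
  have p24: "g ^ 24 = g ^ 7 + g ^ 10"
    using power_add[of g 7 17]
    by (simp add: root p18 p19 p20 distrib_left char2_simps flip: power_Suc power_Suc2 power_add power2_eq_square)
  have p25: "g ^ 25 = g ^ 8 + g ^ 11"
    using power_add[of g 8 17]
    by (simp add: root p18 p19 p20 distrib_left char2_simps flip: power_Suc power_Suc2 power_add power2_eq_square)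
  have p26: "g ^ 26 = g ^ 9 + g ^ 12"
    using power_add[of g 9 17]
    by (simp add: root p18 p19 p20 distrib_left char2_simps flip: power_Suc power_Suc2 power_add power2_eq_square)
  have p27: "g ^ 27 = g ^ 10 + g ^ 13"
    using power_add[of g 10 17]
    by (simp add: root p18 p19 p20 distrib_left char2_simps flip: power_Suc power_Suc2 power_add power2_eq_square)
  have p28: "g ^ 28 = g ^ 11 + g ^ 14"
    using power_add[of g 11 17]
    by (simp add: root p18 p19 p20 distrib_left char2_simps flip: power_Suc power_Suc2 power_add power2_eq_square)
  have p29: "g ^ 29 = g ^ 12 + g ^ 15"
    using power_add[of g 12 17]
    by (simp add: root p18 p19 p20 distrib_left char2_simps flip: power_Suc power_Suc2 power_add power2_eq_square)
  have p30: "g ^ 30 = g ^ 13 + g ^ 16"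
    using power_add[of g 13 17]
    by (simp add: root p18 p19 p20 distrib_left char2_simps flip: power_Suc power_Suc2 power_add power2_eq_square)
  have p31: "g ^ 31 = 1 + g ^ 3 + g ^ 14"
    using power_add[of g 14 17]
    by (simp add: root p18 p19 p20 distrib_left char2_simps flip: power_Suc power_Suc2 power_add power2_eq_square)
  have p32: "g ^ 32 = g + g ^ 4 + g ^ 15"
    using power_add[of g 15 17]
    by (simp add: root p18 p19 p20 distrib_left char2_simps flip: power_Suc power_Suc2 power_add power2_eq_square)
  show "g ^ 18 = g + g ^ 4" "g ^ 19 = g ^ 2 + g ^ 5" "g ^ 20 = g ^ 3 + g ^ 6" "g ^ 21 = g ^ 4 + g ^ 7" "g ^ 22 = g ^ 5 + g ^ 8" "g ^ 23 = g ^ 6 + g ^ 9" "g ^ 24 = g ^ 7 + g ^ 10" "g ^ 25 = g ^ 8 + g ^ 11" "g ^ 26 = g ^ 9 + g ^ 12" "g ^ 27 = g ^ 10 + g ^ 13" "g ^ 28 = g ^ 11 + g ^ 14" "g ^ 29 = g ^ 12 + g ^ 15" "g ^ 30 = g ^ 13 + g ^ 16" "g ^ 31 = 1 + g ^ 3 + g ^ 14" "g ^ 32 = g + g ^ 4 + g ^ 15"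
    by (fact p18 p19 p20 p21 p22 p23 p24 p25 p26 p27 p28 p29 p30 p31 p32)+
qed

lemma v_add: "v17 g b0 b1 b2 b3 b4 b5 b6 b7 b8 b9 b10 b11 b12 b13 b14 b15 b16 + v17 g c0 c1 c2 c3 c4 c5 c6 c7 c8 c9 c10 c11 c12 c13 c14 c15 c16 =
  v17 g (xr b0 c0) (xr b1 c1) (xr b2 c2) (xr b3 c3) (xr b4 c4) (xr b5 c5) (xr b6 c6) (xr b7 c7) (xr b8 c8) (xr b9 c9) (xr b10 c10) (xr b11 c11) (xr b12 c12) (xr b13 c13) (xr b14 c14) (xr b15 c15) (xr b16 c16)"
  by (simp add: v17_def of_bool_xr distrib_right ac_simps)

lemma v_one: "1 + v17 g b0 b1 b2 b3 b4 b5 b6 b7 b8 b9 b10 b11 b12 b13 b14 b15 b16 = v17 g (\<not> b0) b1 b2 b3 b4 b5 b6 b7 b8 b9 b10 b11 b12 b13 b14 b15 b16"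
  by (simp add: v17_def of_bool_not ac_simps)

lemma v_tg:
  "tg g (v17 g b0 b1 b2 b3 b4 b5 b6 b7 b8 b9 b10 b11 b12 b13 b14 b15 False) = v17 g False b0 b1 b2 b3 b4 b5 b6 b7 b8 b9 b10 b11 b12 b13 b14 b15"
  "tg g (v17 g b0 b1 b2 b3 b4 b5 b6 b7 b8 b9 b10 b11 b12 b13 b14 b15 True) = v17 g True b0 b1 (\<not> b2) b3 b4 b5 b6 b7 b8 b9 b10 b11 b12 b13 b14 b15"
  by (simp_all only: v17_def tg_simps root of_bool_not of_bool_eq mult_1 mult_zero_left add_0_left add_0_right distrib_left distrib_right add_num_simps arith_simps add.assoc add.commute add.left_commute)

lemma v_sq: "sq (v17 g b0 b1 b2 b3 b4 b5 b6 b7 b8 b9 b10 b11 b12 b13 b14 b15 b16) =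
    v17 g b0 (xr b9 b16) b1 b10 (xr (xr b2 b9) b16) b11 (xr b3 b10) b12 (xr b4 b11) b13 (xr b5 b12) b14 (xr b6 b13) b15 (xr b7 b14) b16 (xr b8 b15)"
  by (simp only: v17_def sq_add sq_simps sq_def[of g] arith_simps mult_1_right root g_pow of_bool_xr distrib_left distrib_right add.assoc add.commute add.left_commute)

lemma v_mult: "v17 g b0 b1 b2 b3 b4 b5 b6 b7 b8 b9 b10 b11 b12 b13 b14 b15 b16 * X =
    cnd b0 X (tg g (cnd b1 X (tg g (cnd b2 X (tg g (cnd b3 X (tg g (cnd b4 X (tg g (cnd b5 X (tg g (cnd b6 X (tg g (cnd b7 X (tg g (cnd b8 X (tg g (cnd b9 X (tg g (cnd b10 X (tg g (cnd b11 X (tg g (cnd b12 X (tg g (cnd b13 X (tg g (cnd b14 X (tg g (cnd b15 X (tg g (cnd b16 X 0))))))))))))))))))))))))))))))))"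
  by (simp only: v17_def horner_simps add_num_simps)

lemma v_g: "v17 g False True False False False False False False False False False False False False False False False = g" and v_zero: "v17 g False False False False False False False False False False False False False False False False False = 0"
  by (simp_all add: v17_def)

end

definition E17 where "E17 = elm 47471 129014"
definition R17 where "R17 = runm 47471 129014"
definition S17 where "S17 = samem 47471 129014"
definition K17 where "K17 = walk_samem 47471 129014"
definition Q17 where "Q17 = walk_longm 47471 129014"
definition G17 where "G17 = goodm 47471 129014"
definition F17 where "F17 = good_nextm 47471 129014"
definition CG17 where "CG17 = cert_good 47471 129014"
definition CO17 where "CO17 = cert_ori 47471 129014"
definition CB17 where "CB17 = cert_liftbad 47471 129014"
definition I17 where "I17 = itm 47471 129014"
text \<open>Partial sums 15, 771, 1285 and 3855: the quotients of 3855 by 257, 5 and 3, and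
  \<open>3855 = 65535 / 17\<close> itself.\<close>

definition seg17 :: "(nat \<times> nat) list" where "seg17 = [(d0, d15), (d10, d36), (d7, d10), (d35, d50)]"
definition good17_0 :: "cert list" where "good17_0 = [
  (d6, d251, d10, d20, d5, (d5, d102, d8, d23), (d5, d96, d13, d28)),
  (d9, d248, d26, d4, d15, (d1, d58, d25, d10), (d1, d49, d14, d29)),
  (d11, d246, d26, d4, d12, (d2, d40, d11, d26), (d2, d29, d0, d15)),
  (d15, d242, d23, d7, d14, (d24, d71, d5, d20), (d24, d56, d27, d12)),
  (d16, d241, d24, d6, d3, (d3, d194, d3, d18), (d3, d178, d24, d9)),
  (d17, d240, d18, d12, d14, (d5, d235, d22, d7), (d5, d218, d19, d4)),
  (d22, d235, d24, d6, d7, (d6, d81, d13, d28), (d6, d59, d4, d19)),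
  (d24, d233, d14, d16, d10, (d41, d217, d9, d24), (d41, d193, d10, d25)),
  (d25, d232, d6, d24, d16, (d15, d5, d14, d29), (d15, d237, d23, d8)),
  (d26, d231, d21, d9, d16, (d14, d184, d14, d29), (d14, d158, d8, d23)),
  (d26, d231, d26, d4, d9, (d18, d196, d20, d5), (d18, d170, d9, d24)),
  (d30, d227, d16, d14, d4, (d6, d91, d1, d16), (d6, d61, d0, d15)),
  (d30, d227, d23, d7, d11, (d25, d110, d26, d11), (d25, d80, d18, d3)),
  (d31, d226, d4, d26, d6, (d61, d12, d8, d23), (d61, d238, d19, d4)),
  (d31, d226, d6, d24, d11, (d1, d153, d1, d16), (d1, d122, d10, d25)),
  (d31, d226, d18, d12, d4, (d10, d174, d6, d21), (d10, d143, d3, d18)),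
  (d33, d224, d25, d5, d6, (d9, d177, d18, d3), (d9, d144, d8, d23)),
  (d35, d222, d16, d14, d6, (d20, d96, d26, d11), (d20, d61, d25, d10)),
  (d36, d221, d7, d23, d3, (d1, d179, d24, d9), (d1, d143, d2, d17)),
  (d37, d220, d22, d8, d10, (d2, d58, d11, d26), (d2, d21, d4, d19)),
  (d40, d217, d22, d8, d9, (d9, d254, d19, d4), (d9, d214, d12, d27)),
  (d45, d212, d1, d29, d9, (d6, d251, d1, d16), (d6, d206, d15, d0)),
  (d45, d212, d9, d21, d15, (d39, d217, d20, d5), (d39, d172, d26, d11)),
  (d50, d207, d24, d6, d16, (d8, d35, d9, d24), (d8, d242, d0, d15)),
  (d51, d206, d4, d26, d4, (d9, d79, d2, d17), (d9, d28, d13, d28)),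
  (d53, d204, d6, d24, d8, (d19, d191, d27, d12), (d19, d138, d6, d21)),
  (d54, d203, d26, d4, d10, (d44, d36, d26, d11), (d44, d239, d15, d0)),
  (d55, d202, d1, d29, d1, (d13, d21, d13, d28), (d13, d223, d27, d12)),
  (d56, d201, d17, d13, d2, (d4, d66, d21, d6), (d4, d10, d19, d4)),
  (d58, d199, d4, d26, d3, (d36, d92, d15, d0), (d36, d34, d26, d11)),
  (d64, d193, d0, d0, d16, (d16, d15, d29, d14), (d16, d208, d14, d29)),
  (d65, d192, d22, d8, d16, (d16, d0, d0, d15), (d16, d192, d23, d8)),
  (d65, d192, d28, d2, d3, (d38, d198, d8, d23), (d38, d133, d25, d10))]"
definition good17_1 :: "cert list" where "good17_1 = [
  (d66, d191, d18, d12, d15, (d2, d34, d0, d15), (d2, d225, d19, d4)),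
  (d67, d190, d2, d28, d9, (d14, d60, d23, d8), (d14, d250, d6, d21)),
  (d67, d190, d27, d3, d4, (d4, d59, d13, d28), (d4, d249, d1, d16)),
  (d69, d188, d5, d25, d9, (d23, d143, d23, d8), (d23, d74, d3, d18)),
  (d69, d188, d17, d13, d1, (d5, d109, d26, d11), (d5, d40, d24, d9)),
  (d70, d187, d24, d6, d13, (d43, d131, d0, d15), (d43, d61, d21, d6)),
  (d76, d181, d12, d18, d13, (d1, d209, d20, d5), (d1, d133, d23, d8)),
  (d78, d179, d9, d21, d11, (d8, d59, d17, d2), (d8, d238, d23, d8)),
  (d78, d179, d26, d4, d3, (d2, d76, d17, d2), (d2, d255, d6, d21)),
  (d81, d176, d11, d19, d13, (d6, d208, d0, d15), (d6, d127, d4, d19)),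
  (d85, d172, d14, d16, d12, (d9, d230, d16, d1), (d9, d145, d17, d2)),
  (d88, d169, d4, d26, d9, (d36, d82, d4, d19), (d36, d251, d15, d0)),
  (d88, d169, d9, d21, d15, (d39, d16, d4, d19), (d39, d185, d10, d25)),
  (d88, d169, d10, d20, d6, (d6, d235, d8, d23), (d6, d147, d13, d28)),
  (d88, d169, d18, d12, d5, (d17, d86, d28, d13), (d17, d255, d25, d10)),
  (d89, d168, d26, d4, d6, (d16, d156, d7, d22), (d16, d67, d26, d11)),
  (d98, d159, d12, d18, d3, (d16, d213, d16, d1), (d16, d115, d19, d4)),
  (d98, d159, d29, d1, d1, (d7, d181, d22, d7), (d7, d83, d8, d23)),
  (d99, d158, d15, d15, d15, (d3, d88, d19, d4), (d3, d246, d19, d4)),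
  (d100, d157, d16, d14, d12, (d4, d39, d29, d14), (d4, d196, d28, d13)),
  (d101, d156, d2, d28, d2, (d3, d95, d19, d4), (d3, d251, d2, d17)),
  (d103, d154, d2, d28, d14, (d31, d121, d12, d27), (d31, d18, d25, d10)),
  (d103, d154, d4, d26, d8, (d13, d154, d24, d9), (d13, d51, d5, d20)),
  (d109, d148, d8, d22, d6, (d33, d219, d27, d12), (d33, d110, d4, d19)),
  (d111, d146, d12, d18, d2, (d6, d196, d7, d22), (d6, d85, d10, d25)),
  (d113, d144, d12, d18, d6, (d19, d109, d24, d9), (d19, d253, d27, d12)),
  (d114, d143, d16, d14, d9, (d3, d95, d21, d6), (d3, d238, d20, d5)),
  (d114, d143, d29, d1, d11, (d65, d25, d19, d4), (d65, d168, d5, d20)),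
  (d118, d139, d26, d4, d6, (d45, d76, d6, d21), (d45, d215, d25, d10)),
  (d122, d135, d9, d21, d1, (d71, d63, d17, d2), (d71, d198, d23, d8)),
  (d126, d131, d5, d25, d5, (d44, d255, d22, d7), (d44, d129, d2, d17)),
  (d127, d130, d27, d3, d9, (d9, d220, d12, d27), (d9, d93, d0, d15))]"
definition good17 where "good17 = good17_0 @ good17_1"
text \<open>Exponents whose walk avoids conjugates at the cuts but ends with twist 0, so that it
  splits into several closed walks.\<close>

definition lift17 :: "(nat \<times> nat \<times> nat \<times> nat) list" where "lift17 = [(d2, d255, d5, d25), (d54, d203, d19, d11), (d65, d192, d12, d18), (d85, d172, d5, d25), (d101, d156, d10, d20)]"
definition full17 where "full17 = map cert_pair good17 @ map (\<lambda>(u, nu, v, nv). (u, v)) lift17"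
definition vs17 :: "(nat \<times> nat) list" where "vs17 = [
  (d0, d0), (d1, d29), (d2, d28), (d3, d27), (d4, d26), (d5, d25), (d6, d24), (d7, d23), (d8, d22),
  (d9, d21), (d10, d20), (d11, d19), (d12, d18), (d13, d17), (d14, d16), (d15, d15), (d16, d14),
  (d17, d13), (d18, d12), (d19, d11), (d20, d10), (d21, d9), (d22, d8), (d23, d7), (d24, d6),
  (d25, d5), (d26, d4), (d27, d3), (d28, d2), (d29, d1)]"
definition vh17 :: "(nat \<times> nat) list" where "vh17 = [
  (d0, d0), (d1, d29), (d2, d28), (d3, d27), (d4, d26), (d5, d25), (d6, d24), (d7, d23), (d8, d22),
  (d9, d21), (d10, d20), (d11, d19), (d12, d18), (d13, d17), (d14, d16), (d15, d15)]"
definition W17 where "W17 = rowm 47471 129014 full17 ix d53"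
definition N17 where "N17 = entm 47471 129014 full17 ix d53"
text \<open>Modulo 131071 the number 3 is \<open>2 ^ 13 * 47471 * 129014\<close>, so cubing moves
  along the diagonal of the labels; 4 is -13 modulo 17.\<close>

definition nx17 :: "nat \<times> nat \<times> nat \<times> nat \<times> 'b::field \<Rightarrow> nat \<times> nat \<times> nat \<times> nat \<times> 'b" where
  "nx17 s = (case s of (j, nj, a, b, x) \<Rightarrow> (pl d17 j d13, pl d17 nj d4, pl d257 a d1, pl d30 b d1, x * sq x))"
definition rows17_0 :: "(nat \<times> nat \<times> string) list" where "rows17_0 = [
  (d1, d256, ''BPwAF-VCWJBjQwAGNWYXDwAeEDwAFYAABPBQOAIbYLTAaLC=BAAKY?LAKEYkEMicAYcBFbBKZMECwA?ldBXRAeWCxPAAGwCGGawASOIM''),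
  (d2, d255, ''ACwAzYKwAORSBTFwAODBAAAkgawAGQEMCRwAXHPwAECIMldMCHBwNBAdwAm5EADdwAWFFOgHwAFcSAACwE4IMAPbZQAwAEDIwAORWBCYAGHMJaMHEA''),
  (d3, d254, ''XaMnWMHRwAV;SBZDwAEncBOUxADEFCjMAVIwAELVwAULbwALvIAWJwALCJwBD0JAGaMyNBPbBNWBYXBOLwAF/QwAHXbwASYSYLPwAGAIMFXAjaMuNA''),
  (d4, d253, ''0VB6TADKwAvANwBsJAA7GBrZCVRNBKwA-EVNAcwBzcGMAFwAzSCCURBFdwAWGWwAH!LATGAacwAIlBNDCwAnAFwHxNUB9MBAGwD?sCArUBAawAIADwA+''),
  (d5, d252, ''eUwAJ=SCFdwAGCOwCsAOwG-BQwAmCZMzAB4SMYPAnVAlTBBFMRWBrGBXSYJZAvWAPZMPOwALIFACMwAQAZwAv1ENJRwADfOAvUBwWCMIADbA''),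
  (d6, d251, '';PNXcwAGHBM7SBHVADDBAawB:hFN3IM;KYAAkhHwAD/ZwADKMMBQwAIAZwE8AdwADKCwAEDJYlMBOdwADrPAHcwADTXBBYwAHOTAfXAHUwAf;aAhOY''),
  (d7, d250, ''5NBKHwAi;JAPBwAGAOwALBBwBvHAwAUHCwAbCSwAsAWwAF/FwAD4PwAFbaACOABOwBdAFAKHYBUA;AYRCwAECSwAnHSwAaIdBOSYDdwAMAQwAMpDACKBJSwAD,bA''),
  (d8, d249, ''PcNGCARGxAEOaCBTwASkFwAFBCODEwAiRZMIdAAAwBHUDBPBAJUwAHaGAkAMATwAYkENtAABdwAEHQwAGUUBGNwAfBSCjaMETwAXnFMEDwAFIdYSJA''),
  (d9, d248, ''EIwADlXBjXAwWCKZYRZATHwAGKawADMGwADLIBeECEBwAOEPwAEcJA!SBKEAKRAKDYBVwADDGARbABbwAg.WBAENXNA1PBAAkYPAqACQLB''),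
  (d10, d247, ''HVwAnAIwImAGwGkAawANgBA6aBAIwEPFRCSGwAEjNA,OCKMxAEGcwAILQwAIAHwCcZTM/HC5NBATwBWyZBAIwAhsWAFFwAI!cBKQMOYwAUNcAABMKGMAZwBz''),
  (d11, d246, ''cIACbAAYwAVTawAKBSwAiUSwATBJwAInACICCUSwAG=EA6IYWdAOOAkPNDIMoTAaJBraC!IADMD4BBZKApXZ:SMFEwAUAAk1ZMSYwAE4CA''),
  (d12, d245, ''GCMXDMyAALCwADfVAEBwAyCVMlWZARwAuBTwBBJIOXHY5SBAPBDAwAfTbMfBMgJwAD6ABLYBPYwAGHGMKRYBEwA5CPYAAwYmDLwARTAMBIwAbNCA''),
  (d13, d244, ''0KChXAGMAjUMIOwATTSCbHwADqRwAEZAAJWD+VA1bAWKA,KApCBJYYWAAOOAACwF;BFwCDANwC5RIYSGwAE7FCkAABRwAvbWMWKYPDBadwAF''),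
  (d14, d243, ''OcwAKYEwAGPQBEAAqbAVRArdABEY3aAJUxAEKFMDXYaRACEY;WBVSCuTACOwAKmMARaY/AAgHMBBwAH9FBADwZVDQBBNwA8IWwAK+cBMUC''),
  (d15, d242, ''oEwAD+GMcYCHZDrcCZbMebYNOwAKhSBLKMsZAiBBAOwAMnXM.aBLABGPAMAwAPjZYXNACbwAM8HAeZAAAkIdAACwC=3LB1IAiUAPLB''),
  (d16, d241, ''RaBHJwANHQArVBRSBZCMiCABHwAE;NBmJCDDYyANBXYENwAFASCIUwAHKGMCLwAqUFAMOMnRM.VAjJAEYMAAkBINtPwAFjGMaSwAFAKwA='')]"
definition rows17_1 :: "(nat \<times> nat \<times> string) list" where "rows17_1 = [
  (d17, d240, ''2cCQAwADTMwAFpKZ4HBIFBGXBCEwAWARwAROVMbLBBDwBJdRYQMwAEBcAFRwAdVMwAQBIwArAAkUCDfKC=VM+CwADURNFPwAXlTwADpcBJXwAGZBYEHwAF''),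
  (d18, d239, ''ABwFIESwAPJPAcBCUOZLEwAO2DBgJAwEBbBAWRYIKwADLBAqPwADAFwDFPKYRaAIHwAFBbwAQoCAWSBADwAczECdGBLZARPwAGLDwAE/KAqWwADUEM''),
  (d19, d238, ''5FNWQBGXABbwBH2GAHdwAGAawDcARwB-ALwC!0Ca;AYBdwAH!dAxOM-MA=XA-AA6ZAacwADjCAACwLWWaAGJwAJ;BA0CCVAA;CAIVwAI3UwAEANM''),
  (d20, d237, ''GSBBXwA:bbAjYATawADfUAdOBHAYUIBABwNhYOZAKwDtCIwATfbAbKMyPMFawAKJWY3GBNUwAEGKMAEwJuJEABGwAHBHwAlYOBAKwBMpTBROwADyGwAD''),
  (d21, d236, ''cAALUwAHGGYBNDkKBDMAEAMMXCAWAAOwAHCcwAJADwLzNNAKBwARAQwAILdwAExVAAAwZZpOYDYwAL.VAYcA-dAzbAKQwAZNVB.RCACwCadPA+YA''),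
  (d22, d235, ''FPCbSwAL6cBUXwAKCEwAKMDAeDAIDBACwFESHwAXMGNBcAFSwAXDLwAXEBwAIDPwAksWYTRAPUYWOwAG8IAATwAKAYBJTAAAkxUAGEAeQN0EADTwBF''),
  (d23, d234, ''tZwADCQM+BMDBwAQAFwAGCIwAICBwAbjYM0IBWNwAFGSMdZAUQMrPNCLwBMZDNUADTCAvRBJUNQcwAI-VwADCBwAOyYBKKANZwAJYcYWFYQYxAFCKwAH''),
  (d24, d233, ''8CM!FAdaBHTACMwAQmCwAF5HAHRxADAUwAK;YBvUBASwCIPDMhTAAAkIRwAFHLBkSNAGwCIqRBAQwMB9TAKBwAb3LBFHMKcwADAZB:MNEPYfBB''),
  (d25, d232, ''ASwBE:GCBEwAJdCBAEwAnJWYAAkGVYWAC7CCAGwAFAFwAlBOwAwGCwADpawAEESwAEANwAFGbZRbMQGwAHuGCZIAADwOBaZwAGBLwBPAIwBaAGwB2LGMUUMTcY''),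
  (d26, d231, ''BIwAFMWAsHA7HMZJAYCwAGCQwAbHbBrGAUIwAIWYwAGGbAEJAQTwAK=YwADaHBJLNBcA,CAYbAgAYAAk4ZA=CY=GAGcwAQAAktBMDMwAUEBwA4''),
  (d27, d230, ''4JA+LYGACWGCjLMBBwCUPHwAUvSNDOwAETLNBBALQAEHwAjGUMaKwAJQFM+LAGdClEAPEMAQwADAWwAIoXYwCACLATcA,ZAOGwAEQVM:HB''),
  (d28, d229, ''AZwAM+KAAAwAaBEwBjFcwAGQEwADABwHmVZBcaCvbAadAcHwAE?SBgOAvYwADABwKHtdwAGXCCOXwAH-IwADYIAzJAgZYQYxAEABwShUQAdLAyOMgDaBXwA1''),
  (d29, d228, ''kSBiBBbOAKWCIMwADydwAHTOBCHCxUAEECmRwAHCAwAsESwAMDYwAeUSAADwWkKCDMWwAOfCAKUwALIJM+UBsLwAQkXwADYSNXNMqIYsLBBdwAHnPY''),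
  (d30, d227, ''QRYyBAcWBbcBHbwAF.FBrcC,ZNHIwAEHOwALCCwAG1JBGJY2CAACwKKMQwAHAAkDAwAHESMtaMiUwADeOwALXTAAAkLKwADAEwOVAMABIwEAwMAcSA''),
  (d31, d226, ''iGAEQwAD;NBBIwBeAAkRZwAKAAkAIADFwAIBTwAMAFwMuOYMAQBUdCDVwAZMEwAScJM+ZAAAkSBYIOwAfGEwAOpEBSJALJMAEwDfBJwAT5SCJZAsMwAF''),
  (d32, d225, ''LQwAJAAwED/GAQRwAFtFAnVBULBcJAALwEC-dYLKYBRwAePVYKIwAEgWwAFPBAGRY5BYSFAvPMaVwADFBMcJYAEwALEIwAGBAwBVPEMADwCm:MBJHC'')]"
definition rows17_2 :: "(nat \<times> nat \<times> string) list" where "rows17_2 = [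
  (d33, d224, ''LHwAXREwAOAKwAj6DAACwAx.KAAawADebAxcAvHwAD;ZBVXM8IwAESGBhFBDawAF;CwAFVLOqAAJJM0IYRBwANBIwA5TTMSQAAAkXVAAPwALSGZ6NA''),
  (d34, d223, ''DMwADGWBQOwAS5KB!MADaBAQwAmbKBdZwAGeJBtNAAawAEyCYFCDAbwASuQBVVBJKwAK5KZKJAYPBfVA=MMBTwAGcGNABwAX3CBFHwAP8SAARwAD''),
  (d35, d222, ''EAwALBNwAHIBwANFNwAGVJBiFAuCANKMDMwAJVQwADLCwAaUAwAFIBBFHYyaAUYYAAk-WYoSA3ABURYrFCEYwAD,YBALwAdUQBhAMcDMoSwAEhCA''),
  (d36, d221, ''?XBfCAQawADJJADSBcTwAEkYYAAksZAFMwA3aZwAEcaAAQwCOADwRDPBwAESUZWWBtAwADeNBFJA.RCIFBZOBGGA3SBHawADKRATUNdBMZNA''),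
  (d37, d220, ''CBwArNLAubBBMwAu8EwAEXcBLHCAAwDECJwAIoFAXLwAGAAwUQrbM+aM=PATAMGbY8FMOSCFDwAEBIwA+TBwAGAAkoJwAKBNADPBHMBBLwAmCSBXXwAH''),
  (d38, d219, ''CYwAOBUwAVQVMHMwAKJGNuKATEBfLwADqIAjJAtBYHLwAcFFCDRwAODCYyANcXAATwAbUIAREMDZAgKDADwIf2GACawAIEGwAPAIwGdYcNTFY9UA''),
  (d39, d218, ''RNAdZNACwawlXBDVZEBwAaNRBzPBZEMZAA:NAEJwALATwEQFHwAMVXM9WAAJwAl8AB5IYOHwAa4YACKwAMnOYETBJGwADCUwAK=MBBJwAhpdwADpTA''),
  (d40, d217, ''CMwBaCBwAFfaCKANHNBhXCOUMsCAaBAAGwD0-LAANwG0BOAqHBSWAAUwAJSbOAVwAO1ZwADiGAKawAaAEwZaAAk!IwAHzSAAYwAQ/YAKVwAUHBDjPA''),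
  (d41, d216, ''BPwAGtawADVIYNPADZYUEMmTMHVwAIARwAiqVwADKGNAEwAOAIwMSGMwAzcUOGUYGGwAGVIARCAHZAeCAdNwAGvMBFbM:NYJQCGEwAUUYMZPMkdC''),
  (d42, d215, ''RRMNEYvJwAEYWABdANaBwXMCQNzKwAJhDYJbwALIdwAEBMwAKSINECwAMNZwAMDNwAWQNM.BBAEwEr5OAHJZ0PBrBB:YMJLM-NAAGwJ=UJAFXD''),
  (d43, d214, ''AEwHuoFNZaN2BBcEA5MBEIMIawAGTLBpYAjQwAFzAYAEwGIXLBjOAhZB:ABLUwAE1QMHGBCbwAEARwCyCOCZGBEaYuKAABwU4TPwADJXBLOB''),
  (d44, d213, ''ENwADKFwAJUVZhSMLCwAN!VMLcNJFMSJODPY=OBAAwGKBFwAFIAwAIJGYIQwAmADwC1GUAHPwAg5VAHTwAEsFMyXBPZNAUA=OZPDBALwA9ABwB7PBwAF''),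
  (d45, d212, ''qQwAEAAkITA0IAAcwBILTMPYwADBGwAdnXAAAkiXALUMALAARwAOsOYAIwCv:cMFJAkHMxWBiEM0LAALwE4oNNsPMGNA5GBCcwAEfJMoEB''),
  (d46, d211, ''DJNAUwAXAYwAgLRBbZBABwRycEwASCKBGOAjLwAGGWwA26DAAJwAVEOADCCFMNoNYNMwAEWPMhOACBwBRyBYkcAmdAhcCQLBTcBWIMtBAoMM''),
  (d47, d210, ''yUMYbAOUCIICzHA7BAITBCBwB2HBAOaCKKCHHwAGAXwASeABWVYVbNkHwAIUDMUVNjFB0ZATYBMJwAKNPwAFBGwALLawADPFxADcGwAGECAYOY''),
  (d48, d209, ''HHwANBVYAIwBq;PALSwADkEBRBAKZYIYY9ZB7XAGaAGZCDBwAVNVwAFGUYLXwAKBFwAj0OwADMIwAMRAwADRBYyJAHDwAkUPAHTwAWIPwAGANwG?aGAAAwL/'')]"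
definition rows17_3 :: "(nat \<times> nat \<times> string) list" where "rows17_3 = [
  (d49, d208, ''CJwAKkGwAEAOwAVBDwEqNBwAFFBMQIwAEhcBJLwAKbWY5UB3CwADPAwAJCawADADwAEhKwAFJOAGBwAbhDAWOAPWMFMwASUawAEsMMLKA,BBKPwAEJHAaOwAGAFY''),
  (d50, d207, ''jOBeEwAGDUwAOLMCHDwAEyMBAMwD.YRB?NMFOAKUNuIYMPMPcBtABKFYcGMLYDAGwA14VMeNAhZZGYASKMAAkaFYuIAiCMJKwAZeCY''),
  (d51, d206, ''LZMJXwAEbdDAVwBtAAkuLBMAwAF?YYBHNBZwAJwawALzABMAwALBdwBDAJwCHSTC+JMcABGXwAUATwAJ.SBUXwAOBZwAZzIAMEYtQABHxAEzXAjCBGDY''),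
  (d52, d205, ''fBN9EB,CNIdApBA!ZCXMBKXB:HA5WAMAAQQAVPBAJwCxENwAeeUwAHdACEDMOHNCEBqbAAZxAGpbABGwAyPHwAJ+dMmUMnDCmSAAVwAw''),
  (d53, d204, ''mZM,JBNIMBRwBdeJBVPAAAkGYADBwAJBEAbZYUQYHBwAD9bCSDBaQMTMwATDawADkLBZVMBIwAnNBwAMBGaAbA!ZAADwAeBQwALECYICwADRYB''),
  (d54, d203, ''oZAeQAxIZSOMDLBMAAOVwAUkMwAMEBAASwD+NWwAoPSwANARAMWBPVMrTB;KMxIBkNYAAkMAYFTMDUYEBYYCAcNNAAkzMYZFwAF8BB''),
  (d55, d202, ''3cMAAkUMMGQwAPycBYHA7FAuLwAFEawAibdBRKYAAwBe2FYpRASEA9FBcSwAHNVNSaAGFAfIwAHnEZOCMUHAtNBwWOYFBDUMZbBDQA''),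
  (d56, d201, ''HXwAD-NAnDCJJwAEDXBLABbXCECwATRcAQCwAIAFwHAiACDawAfACwAhPWCCHwAe:WAAAk5VAZGA0UBoMYgYBvEAKXMDawA0YaAZCACbwADBZwB2''),
  (d57, d200, ''BZYCKwASAJwFaFOwAMXbABNwCEvJAPYwAOHFwADAPwAPABMRFMONBGWwAZJEwAaEUwAEDLwAL7AYABwA!VCACJN1PC0NwAFMAA=MNkNMkPMKSwADrdZ-TA''),
  (d58, d199, ''DLACbwAEEAwASqHYAAkABwT9GAA4RAaSBKcwAXIYBPCMNABcHYFLwAIAAwL!KaYBVwADCIwAQEDwATsHA0MBDZwAzAIAAOwAdVWwAE6FAAAwBYGEBDKA''),
  (d59, d198, ''IdwAEQbCTDAjLCFIMKGBGAwAUBIwAxVPB-OMGIAiSABYwAk7HwAD?OABYwANBdwA5AAwENYOBBZA/GAycwADcLBeJwAEpYwADqQADRwAZCawAqKAMsaA''),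
  (d60, d197, ''6MAAUwCX.SZNAYeLCEAYdNNNRY3UwAU2GMBUwAFBIwAKdBC+GAELwAtJYYFMY1QB0RAHWYBCwAb9XMHVwAFfMAuKCAaMAOM3HAHMA7XB''),
  (d61, d196, ''AJwCeqaBHYwAEMKwADTJAscANVApRwADMAMZXwAUpDBLLwAGjRMDNwAxNZwAF!SBCOBaSwAEBMwAFbFAMdYbbAWGCyQM:YCKdYNIwAD/dArcwADALwBV''),
  (d62, d195, ''CXMBcwAJWAAQXYuVABWwAFRLM5HOOTwAGAEYsEBQdAAEwP?gQMFcwAI5GZ!YAsHNCdwAWIPwALJZwARYYMAEwDj9FYUDBSYwAOGbwADedMDaMBMwAO''),
  (d63, d194, ''ACwRmHBYHFMFSwAqLZwAFzXNVJODHMaPMCYwAYTdB:ABSBMsHMeNBHAwARJSwAD0dMLABfLCZPAaGwAErPBZNA+AwADDIwAVGVMsPM4EwAFYawAI''),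
  (d64, d193, ''AAkXbAuXM3DAXbATXBQCArcM-cAGUwAHzLA.aBJLwAHBBwAKhdB5bCCENAJwFmEcwAgUHM;SNYUAfKCABAAWwCRLHASBCAcwAeDIwAEqON'')]"
definition rows17_4 :: "(nat \<times> nat \<times> string) list" where "rows17_4 = [
  (d65, d192, ''KTwAEIFwBYAHwCMKWwADtXwAFRHMVBwALYPBIAwATAHwCGHIArLAAAkTbwAa3WMnHMZLwAI9AMFWwAI.aB;XBoTBAAkAVwAHScMoYCrLYDRMAAkLRwAN''),
  (d66, d191, ''JTBFLCDKwAKCTwAdnWMqVA3bCBMwC+EKwAW0QAXSwADJBAkEwADZJBCMwA,GKwAD8HA:PCAAkobAAEwCgRUwAJTFwADIAM,MMtTC5IA!FMCKYNMwAG''),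
  (d67, d190, ''kCBPWAAAk1MwAEADwCLARAFGMyOAvZAeHC7dMkbACFwADmLAqQwADzAC1JBEGwALbJBIVY-cAXbAAbNraA3LA3ABEXMAAkJRwAkBAwAE''),
  (d68, d189, ''JHwAFYVAlaYAXwAGBLwAJgQBAXwBz0GAgQN9VCDGwARXGwADAABGXwAbqbMKLwALIRwAF9KAYQAvFALRM2bAXGMXHADOwASBCwA!QZYUOA2dYFNM''),
  (d69, d188, ''BDwAOBOwAI2UAADwP;zHMAAkdOMDPwAGBYC2LMfYBPGwAJlBAHJBGNM,KMZXYAAkHMCZbAARwCmYVMBEwADfFAZWwAEWYYMLwAFIcYaNwAEFZB''),
  (d70, d187, ''HWwAbANwAN/ECaGYALwFs.DAYVwAJBHwB3.EwAD/FA;IAAAwY:EWwAQJJwAFORAFFwAKuNBgNChDAgBMCbwAJ3BMOAwAFCUwATAAkGcCnXB?bwADFHwAUhSC''),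
  (d71, d186, ''=NCDFA5FANSwAXdPwALOEMABwJjGQwAudHM6RADEMACwBHCOBQFwASDbwA6ABwA5hZBkVBBDwB0SSwADSUBFNBGHwAEDMwAQiCAPWAPcMSDMBCwAXMCA''),
  (d72, d185, ''0cCAOATKBARwAIOKwANLMAGJwAhpKBDTwA+8RAKNwAHYCY6DALOwADAbwAKJDwAGORAXRMXSC6WYQCB7EMAAwN3.UBQGBvDMCSMaGMAEwWYGBA''),
  (d73, d184, ''4QMCQwAEUSCEIBAMwEi8RMjZY?dCdVAQSMDMAcGN0AAAAwAcKUAACwMmcSwAEXDwAIsUCAVwAFfbANZwADcaMeCwAELYYuDCBTwAWaNBVEwAQDUwAN''),
  (d74, d183, ''kMwADANwA?eZBRIAAGwD,FWwAEJEwAEKOwAeHLYrZMAIwEcDNAWEwAG0KBDLwAJBEwAxmSMUXM8IAAEwBnDGwAozLwADSTwAGrUBpAMBWMNMBeYYFDwAM/LB''),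
  (d75, d182, ''UKYzYAOGwAGMAwAWtMayJMLQwARZOBgKAbaAACwC7QTYeOAIXYZdABbAiLMzKN5JOtMCYQARAwAJUIwAHZbwAH4cCpCAJIYQZMMOwAIPQM''),
  (d76, d181, ''4WAUQAAWwAOAFAQBMJPwAEBJwBACMwA;oAARKwAOtQCZbAAAkEdNAIwE=HDBFWwA+ODAhVAmIMQVAsLYBKwAIySMHWAABwYVKDMuIBAGAAKwBQ''),
  (d77, d180, ''UMMROAFZwApjaAAHwArSSYRcAPGwALGAAjXwAJDbwAXRLBBbwArSLMwFYRcCGDwA7DIwAfXVADBABbwAfCXwBXBBwAa;PBVEY1MMsZCACwTDSLwAFAJwGx''),
  (d78, d179, ''rRYEKwAg/BBQEAcaARGBLbwAGHUAOTCAAkLBASNAyGAHONXMB=BBAKwBNAKwAuARwAMBOwB;2SYWTACUwAHLNNqVAzOBAAkMRAFJwAM5DB''),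
  (d79, d178, ''9NADICEBwBNZIASXMAFwI:ATwA?AJwDYvIYAAwU,AQwE71XCABwAJ8IYNTAEawAKBCwAJUawAEmLMACwB6DcwAaCHCBPwBgAWwAdOJAGOwAZITwAIEEYMOCAAwRW''),
  (d80, d177, ''AEwADABwUZzSCpRA.OARcBADwVC1UADYadBCACYAPwC:JEwADfFA!GArCwADmbMIICSBD-MARDwAFZJAGAwAfodY1QANIwAbAEwKOkKMrNY2ZM'')]"
definition rows17_5 :: "(nat \<times> nat \<times> string) list" where "rows17_5 = [
  (d81, d176, ''lTAAKwCZXMMkZACOwAjFNwAXBBwA?aQBgLMRPwADKBOAAkhLB6PCBSwBQmAC:VAKIODcwAD0QAQQwAEBbwA9FdwAsAGwD8kNAIJwAEKNwAHcHM1ZA4IA''),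
  (d82, d175, ''mAwAD7KA5XAgcAdONHEwAHcLwAGfXADcA5RA1IA4RYfVNJdwAIGEA8FArGABSwAEVQCBcwAkwBBgOAAdwAiVWBGJAMFwAIjcAERwAL:MBGEY''),
  (d83, d174, ''gZBGUYAOwAbQbCKEM+HAQaATBCQHYxaMmKMEXBZPA3EMACwHobDA?JBAEwGbpbYJOAaVCjMwAGDYwASDCwAILPYNGMoPwAEEYBDZAAZwE=''),
  (d84, d173, ''GZCgDCQZABEwA!eEYYRMvDAZUwAE5JCsUBaPB.MBkbM8VABVwAgOJBSWwAEGIwAhucAHPMBNwB9YHAEbwAHMAwAFEcA1DYgSwADRZMpMAldY''),
  (d85, d172, ''CUwAFITA;SwADcIAyDYAAkATwAWUDAPNwAMACwBQBJMzMB?OYOdCAAkATwA=jdAVCYAEwBtRNNhHCbHBaFA,LAAYwAVPBMGVYDCwAU;HYlEwAI''),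
  (d86, d171, ''=TACPNCZwBZENMEYNwFBmLAKFwAFFJwAGBFwADIKBOJBDSwALBAwAFQCwADdLwAErLAKNwAJORAWMwAI2ZAAMwCi.HBwQAwTwAGdMALdMCcDrcwADwQwAE''),
  (d87, d170, ''SDY3IMUNCMTMZQAIPwAWDBYTSAMZYLCMfNDcXAAAwWrEQwAPLKCPZNSCOuSA/WBXCCINZzBBIUwAKESBmZwADaIAQLAGIAHcYAMwAN''),
  (d88, d169, ''aTYzKBOOAQEBAAkuAwADKIAXQBBTMAAkAAkIcYYRB-cYFcwATQQwADDPwBHnWMAAkRRwAGUIBLTwAHYLNIZCQCwADRFB:YCJZwAsjLBmYA''),
  (d89, d168, ''CTwAeLFATcZ4GAxIAQTBJEwAPRbwAQLYA,VA2cBcGMWcB/RANbAvPAACwB8LTACLwApUJAFEwAGYHMVVBTCAHYAARwAxAAkAAwS?uJBtCM''),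
  (d90, d167, ''pUMDYwADWWwAEFSwASKLBwSMGMMQANASwA,LUwAD7WMsPwAFLcwAPTYwANEKwAFLSM.VCJGwATkTCFXwAKABwV.EKwAUWaAHWwAHUKCEFwAEJFYBLwALHNAHHC''),
  (d91, d166, ''=PY/DAvdAKJMKTB/WCkEAoEYAFwANASwAGeTwAEDSAaKBQDASVA.UAYHMAUwDNdCYMIYEEwAvdaM7RCAAwAFLIwARhXCkAMYNCKcwASnFY''),
  (d92, d165, ''BVwBtsdBGcCKCCRUwAPGENQRBFKC7OAFJMCGwAEMAwAWRdANZALBABdCjMMDDOmTxAEFYAjOBpLwAHlMAYWMVVYFUBZIABQwAilRwAEdJA''),
  (d93, d164, ''VJBBGwADYRBCCMHGA+UBgWZBSYORMCQAXZBbNALKC6LMAEwAuPXwAICWwAI8dAuOAmGCOSMIBCSDAUHBgTwAF3LNNYMFHMCQwAIVbA''),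
  (d94, d163, ''=cAHSY-YBOWA.KY6IAESwAdKZAAMwAUsMwAEmEwAEAYwBeaPAFGwAGycBGUwAEZSMGSNBaCPYwAEeZDAEwBOEQwAJVPAlAMCLwA4HUwAZkbAbNwAJmdA''),
  (d95, d162, ''ITwAKGUBBXwAkJDBjZMPQASLNHOwAESEwAKLcBAPwE2AEwBA9IBoXMFcwAcXVYVKYCCMIKwAIAHwFjCbwAObKwADqZBrCBXMAiTNiQMUSALdAecA''),
  (d96, d161, ''pXAAEwHDEDwAZ-DBCZMWAAIWMwYwAJKTMFDMndZAHwCOaBMAPASFAAAwHUoVCRGBBMBABwU.hbYHMBBIA=SCOMwAD4VYEGwASQOYVLAHHA'')]"
definition rows17_6 :: "(nat \<times> nat \<times> string) list" where "rows17_6 = [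
  (d97, d160, ''hLACWM/EYLNM,aAiOwAGAKwBQALwASFcwADpDC;bAwEYDDwAaAAwChMCABNwATnKY/EABCwAEAOwBBQAYdRwAKGbwATyEAdBNAOwAGgaMFPwAIRcAHaA''),
  (d98, d159, ''AUwAHrFA8HMqYwADCVwAPkGB3KwAEyIAnHwAEARwAFFQwAIrZYAAk6awAD!ZOmENGYwAERdMGWNBSwAEkGZcLBoSYEPwAJAbwBcSKAWaMBAMLIAAAk''),
  (d99, d158, ''IbwAECPY3PNDRNQNAXTAPJM7SBZMBOSB7VCDQBBJwAEAFYVSMAAkrTA4EBuZAQNYCJwBWZMMOQwAEPOAxOAVTwAIEHwARwNBldBESwAE''),
  (d100, d157, ''PLwAIxTAFCDDCwAHAZwAeUQM+FABAwAZhSwADCXwA+tAAbMBqLNLFABMBJbwAMAAkeLCrcAAawBWGaAHACLMwAP:FwAFnZACPAJCMAHwK,VaBACwAT''),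
  (d101, d156, ''gKAREwAHAAk1IA-dMFWM6EANMBrCYCEDAAkYKMNUAVCMzFCqbA-TAFNwAPrTACSwBAyICKFwAEOXBrCACKwASKCYtawADQaB.BMmaY''),
  (d102, d155, ''VdAHGwAOBMwAPAAwBO:ABBQwAILLwANZMwADAOwEYFIDJEAQPwAF-cYBMAUBwAD5RBdYAEKwAO3FwAFQEwAWpTBHOMPFwAFVbASXAGNwAemPARBCNKwAIBFwAH''),
  (d103, d154, ''8MMCGwAJAAk2CBAAk/QwAEyDAKcwAStENrVYgKBpCYoQwAFiOAbIAeMBBZwAgLWwAJBGYvJAnBBAFwAnUOAESwAdeHYRdMEUACawADVCY7WC''),
  (d104, d153, ''LDwAScUMTawAFLNwAYCLwAcoQOHbMAWwA4ILwAFEZwAT;WAfJwAEbKB/JA+LBDNwAJPUBUOABLMDYwAESXNTcA1ZAzKBCAwA-EZwAMFKMBMwAbBcwAIAGwG7''),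
  (d105, d152, ''NCBKDwADCOwAgKPwAJcUA,JNAAwPxDPZ0aMBAwA71BAXRADLMGBwAJ,OABSwA+WCMWXwAFYSYJBwAK3TA6HM3aAfdwAKaVYCTYLQwAGACwHqFcwAzVTB''),
  (d106, d151, ''GSMEAwAEATwC/-EMEFwAEHLMALALZBKXBdBwAEdQwATCGONBY3IAHbBCcwADWMAeOwAOnKwADTDYFBwALNLwAGWAYNaMEIYMSCCIBALwAgjdNNZM''),
  (d107, d150, ''rNBCMwAU=XCjDMcDY5EAECwA.BFwAKuGCCAwCbVKZiEASRwADBIwAGaMB=PMIQwAigZwAFpKZIUwAJBVwAPsQwAGfFYEPwADAGwAMUNwAEycBXTwAFjGAIYB''),
  (d108, d149, ''zTwADMLYBCCHIAXTAQdwADBJwA!.VBFFCGCCcMMJMYJDAeSBYMADTwBxAPwC?NawADVbAAEwawTUDWWwADAONTSYjXwADMOwAGZQB;BAlOBmdwAE''),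
  (d109, d148, ''DJAHDwAMDFwAVBLwAM1BAJRAAEwMsuGAAAkAGwL;WVMPDARLOISwALkEACQwAGlNMXLDjBwAKCawAXYSAqNwAG/SAAAwFY8bAjcN/HChbBYLAVTB''),
  (d110, d147, ''/CAAVwANWWADDwA!baAAEYFNMAAwAoRPAQaADCAdRwAEmIZFYwAOJBwAH7RA6QAGMwALXUN0RCANMtDA/YwAESCwAT5YAFGwAO=ZAgZwADFPYBTwAM''),
  (d111, d146, ''FRCINBAQwBwCGwAXzYMJcwAEtRMUHMcUCXHwADbIwAEuVBAAkTFwADAYwFyecMAEwA5EPMAVASQAJSAIJAAEDiSC?OAXEMGZCBZAZYwAELEA''),
  (d112, d145, ''qQAGLA0FwAEABwFFlCAaAAXCwAGOIwAGpVwAEjMwAGFdwAsFGwAP5RACCC;SMSSMXIBFawADLWAAPATBAbOCgPNADwHEKRwAdgTBWACAGwBcGdCWVA'')]"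
definition rows17_7 :: "(nat \<times> nat \<times> string) list" where "rows17_7 = [
  (d113, d144, '';CYATwDWhOB9aM8RAAHwA:WCAZBwAFKWwAHuKMeJYDYwAVAAkAGwAR9VBNOwAMjLZMSAAAwW8?OADcwAKDbwAssdBZKCIBwAPQWYkIB7RAodAuFM''),
  (d114, d143, ''JACJbAADwH!.BM6RACHwAP5MMAIACcwAURKBSLYSSwAGbDACWwATATwAn6AwADAAk5SCXbwAGDYwAT=LMFWABTwAEABwEQyWCHLwADhHwADlaAABwBDAAk''),
  (d115, d142, ''OdAKOAOAY/JAAGwAWHCCbECJDwAVNYC,cAAPwANyAwADFdwAumKwADKEwASSGBvbA5dABCwAGAAwIcrTADBwAFgaMBXwAIAYwAVHRwA-FLwAMJAwADgEAUKwAG''),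
  (d116, d141, ''TKCUBBBBwAhUdOWGYAHwAZFZA?OANTBBFwAYvEAdHAEOwAEWOAqdMIAA,XMNbwAD5UMODBiAMCawAJMIwAE?aAMEDABwKxCAwAOOTwALEOwAPjGA''),
  (d117, d140, ''DKADLAkKZAQwIXGCBdTwADBXBOLMAEwCREXwANCEwAJJCYOBAUXAvKMwQwAD4TBPdwAD1bM1DACawADHcwAKCHwAVBOwASuJB,dMqFC0HAASwAldHY''),
  (d118, d139, ''HFYXdwAGAXAAOwC8CUwAGlPYjMACHwALQMBQDBuMwAFqFNlRMMWwAFYIBkLY0bApBMDawAWBdwAEPPAAAMCHwAscEA9XA-cAAAkXWwAMAAwKljWB''),
  (d119, d138, ''YbADNwAO6JBkHAAAwBJSEwAEqLwAGBZwAQ2EMSUCfHMBawA-XUNBSwAKBPwAa/VAALwAR/ZwAEpRA4BAOYwARRKZwYwADABwQ;iAMSBAeDZ;awADDKwAF4JA''),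
  (d120, d137, ''.OAABwF+hMZmVBABwF03TANcADQwBD7cA3DAGXwAlQKACBwBXrQNFZwARWHwAEEVNcCwADTMYsMASRMGFMCdwAZHBwAF3DYnKOEDYGdwAKwXBbRM''),
  (d121, d136, ''TBwAJsMAiXMLVYHWYEZAFPwAtaMBSXAHAwAHBGwAeCZwAKAPwBvMEAaXNgHBMBwAHPXMBEBABwNx4CAAMMjTBAVwDFhaCBKwAgMKMOYAMFArTwAD''),
  (d122, d135, ''gQAfWMOXANTAmAwAD.MZOdwAETHMSACAAkZaA7cCmJwADAHwA6RPMaLAnPA=SCnXBHSA5EAHPYKBCURBWQMZawADCMAHNADEwAEABwEu''),
  (d123, d134, ''VCAAbwA4JTAkOwAFBGwBqMRAgKADKwBheCAnCB:SwAFdYC/ABoZADZMQbwANmNBADwAlQVAADwASGRYABwZSUHYOJCDZwAIGWwArpWAbZwAD0LABcxAE''),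
  (d124, d133, ''BFwADaCCNWMeZANLCdEwAECTwASGVMnKMQDZTEwAEedwAEDWwAZLQB1SMIHwAJ?TACEwAi:MBIZwAOOJMXLwADzcBDHwAXGYwAGAAwI=hZMDcwAFBGwAUbSY''),
  (d125, d132, ''AZwB3PGMBQwASDAwA8kSAnNMAMwA1tDAoEwAD7PMqOBtFwAFAJwAvAAwA7TFwADAAwV4JSYMIYFdwAJkLwAHnUwAQnEBCBwAuFEMhcOPOwAECZwAVEOAGdY8YC''),
  (d126, d131, ''fGwAEUaMGPNfQAAGwFAAAk;AMQPBAUwAsCXwAizKBXLATHMDVwATPbBFYAcPAIBY,dASTZ0BBMTNTCwAFxHAHWAfHwAJIVZgAAAOwDWyJM''),
  (d127, d130, ''TVAKIM0XwAJPTwAV/NMfFwAHHCwAW,bAabwALHIwAGuMwADDKwAMlQMWEABEwBCqQZ3NAPOwAO.AAfVNBKwCiMIwASfDAVOwAEbbBEaBURwAFAAkYMwADpIB''),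
  (d128, d129, ''OMwAFCbMnHMCGwAPEBwAgmJCqJYdIB,CMRWB,bxADNWwADHACkHAVJxADJMwAJBAwDYGIwATZdYANwCZBQMBbwAYHBwAE6RMbBB5ZMEEwAbAJwGRjQCAQwBC'')]"
definition rows17 where "rows17 = rows17_0 @ rows17_1 @ rows17_2 @ rows17_3 @ rows17_4 @ rows17_5 @ rows17_6 @ rows17_7"

context gf17
begin

text \<open>The orders 17, 257 and 30 are pairwise coprime with product 131070.\<close>

lemma coords: "exponent_coords TYPE('a) 17 47471 129014 257 30" and prime_n: "prime n"
proof -
  have "ord n 47471 = prod_list [257]" "ord n 129014 = prod_list [2, 3, 5]"
    by (rule ord_pmI; simp add: pm_simps sqm_def)+
  then have o: "ord n 47471 = 257" "ord n 129014 = 30" by simp_all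
  have "coprime (257::nat) (17 * 30)" "coprime (30::nat) (17 * 257)" "n - 1 = 17 * 257 * 30"
    using coprime_bezout[of 257 383 "17 * 30" 193] coprime_bezout[of 30 1602 "17 * 257" 11] by simp_all
  from cyclic_coords[OF o this] show "exponent_coords TYPE('a) 17 47471 129014 257 30" "prime n" .
qed

sublocale label_field 17 "TYPE('a)" 47471 129014 257 30 g
  by (intro label_field.intro coords label_field_axioms.intro) (use g_ne prime_order[OF prime_n] in auto)

lemma nx_simp: "nx17 (j, nj, a, b, x) = (pl d17 j d13, pl d17 nj d4, pl d257 a d1, pl d30 b d1, x * sq x)"
  by (simp add: nx17_def)

lemma nx_ok: "okp s \<Longrightarrow> okp (nx17 s)"
proof -
  assume "okp s"
  moreover obtain j nj a b x where s: "s = (j, nj, a, b, x)" by (cases s)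
  moreover have "x * sq x = x ^ 3" by (simp add: sq_def flip: power_mult power_Suc)
  ultimately show ?thesis
    using okp_next[of j nj a b x 3 13 4] by (simp add: nx_simp dd cong_def)
qed

text \<open>The numeral is \<open>7710 = 257 * 30\<close>.\<close>

lemma tab_ok: "tr_all okp (fst (orb (leaf nx17) (num.Bit0 (num.Bit1 (num.Bit1 (num.Bit1 (num.Bit1 (num.Bit0 (num.Bit0 (num.Bit0 (num.Bit0 (num.Bit1 (num.Bit1 (num.Bit1 num.One)))))))))))) (d0, d0, d0, d0, v17 g False True False False False False False False False False False False False False False False False)))"
  by (intro orb_leaf_all nx_ok) (simp_all add: okp_def v_g elm_def dd)

lemmas tab = tab_ok[simplified orb_simps fst_conv nx_simp sum17 sum257 sum30 v_add v_tg v_sq v_mult bit_simps]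

lemma lookp_simp: "lookp (j, nj, a, b, x) \<longleftrightarrow> (\<forall>e. fr e x = E17 g (pl d17 e j) a b)"
  by (simp add: lookp_def E17_def dd)

lemma stepp_simp: "stepp (j, nj, a, b, x) \<longleftrightarrow>
    (\<forall>k i u v w z. R17 g (Suc k) i a b u v w z = nxr k i (fr nj (1 + x)) u v w z)"
  by (simp add: stepp_def R17_def)

lemma nxr_simp: "nxr k i (E17 g c a b) u v w z = R17 g k (pl d17 i c) (pl d257 a u) (pl d30 b v) w z u v"
  by (simp add: nxr_E R17_def E17_def dd)

lemma fr_simp: "xr True False \<Longrightarrow> fr e (v17 g b0 b1 b2 b3 b4 b5 b6 b7 b8 b9 b10 b11 b12 b13 b14 b15 b16) = fr (pl d17 e d16) (sq (v17 g b0 b1 b2 b3 b4 b5 b6 b7 b8 b9 b10 b11 b12 b13 b14 b15 b16))"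
  using fr_step[of e "v17 g b0 b1 b2 b3 b4 b5 b6 b7 b8 b9 b10 b11 b12 b13 b14 b15 b16"] by (simp add: sq_def dd)

lemmas look = okp_all_lookp[OF tab, simplified tr_all.simps lookp_simp simp_thms]

lemmas step = okp_all_stepp[OF tab, simplified tr_all.simps stepp_simp nxr_simp v_one v_sq
  fr_simp look sum17 bit_simps simp_thms]

lemma walk_simps:
  "R17 g 0 j a b u v w z = E17 g j a b" "I17 0 x u v w z = x"
  "I17 (Suc k) (E17 g j a b) u v w z = I17 k (R17 g suc144 j a b u v w z) u v w z"
  "S17 g a b (E17 g j a b) = True"
  "K17 g k a b u nu v nv = S17 g a b (R17 g k d0 a b nu nv u v)"
  "Q17 g k l a b u nu v nv = S17 g a b (I17 (un l) (R17 g k d0 a b nu nv u v) nu nv u v)"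
  by (simp_all add: R17_def E17_def I17_def S17_def K17_def Q17_def R_0 itm_0 itm_suc144 samem_E walk_samem_def walk_longm_def)

lemmas row_simps17 = row_simps[of 47471 129014 full17 "d53" g, folded W17_def N17_def]
lemmas ent_simps17 = ent_simps[of 47471 129014 full17 "d53" g, folded N17_def K17_def Q17_def]
lemmas good_simps17 = good_simps[of 47471 129014 g, folded G17_def F17_def E17_def R17_def I17_def S17_def]

lemma cert_simps:
  "CG17 g ss (u, nu, v, nv, c, o1, o2) = G17 g nu nv u v ss c (E17 g d0 d0 d0)"
  "CB17 g ss (u, nu, v, nv) = G17 g nu nv u v ss d0 (E17 g d0 d0 d0)"
  "CO17 g (u, nu, v, nv, c, (k, a, b, b'), (l, e, f, f')) \<longleftrightarrow>
    R17 g (un2 k) d0 a b nu nv u v = E17 g d0 a b' \<and> R17 g (un2 l) d0 e f u v nu nv = E17 g d0 e f'"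
  by (simp_all add: CG17_def CB17_def CO17_def G17_def E17_def R17_def cert_good_def cert_liftbad_def cert_ori_def)

lemma full_mem: "list_all (\<lambda>x. (x \<in> set full17) = True) (map cert_pair good17 @ map (\<lambda>(u, nu, v, nv). (u, v)) lift17)"
  by (simp add: full17_def list_all_iff)

lemmas full_simps = full_mem[simplified good17_def good17_0_def good17_1_def lift17_def list.map append_Cons append_Nil
  cert_pair_def case_prod_conv list.pred_inject simp_thms]

lemma same_tab: "list_all (\<lambda>x. \<forall>i b. S17 g d0 d0 (E17 g i x b) = False) (tl (take (un d257) digits)) \<and>
    list_all (\<lambda>x. \<forall>i. S17 g d0 d0 (E17 g i d0 x) = False) (tl (take (un d30) digits))"
proof -
  have "set (tl (take k digits)) = {1..<k}" if "k \<le> 258" for k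
    by (simp only: take_digits_upt[OF that] tl_upt set_upt One_nat_def)
  then show ?thesis by (auto simp: list_all_iff un_def S17_def E17_def dd samem_00)
qed

lemmas same_simps = same_tab[simplified list_tab_simps un_simps]

context
  notes step [simp] walk_simps [simp] row_simps17 [simp] ent_simps17 [simp] good_simps17 [simp] full_simps [simp] cert_simps [simp]
    same_simps [simp] suc144_simp [simp] decode3.simps [simp del]
begin

lemma rows_0: "list_all (\<lambda>(u, nu, s). W17 g u nu vs17 s) rows17_0"
  unfolding rows17_0_def vs17_def by simp

lemma rows_1: "list_all (\<lambda>(u, nu, s). W17 g u nu vs17 s) rows17_1"
  unfolding rows17_1_def vs17_def by simp

lemma rows_2: "list_all (\<lambda>(u, nu, s). W17 g u nu vs17 s) rows17_2"
  unfolding rows17_2_def vs17_def by simp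

lemma rows_3: "list_all (\<lambda>(u, nu, s). W17 g u nu vs17 s) rows17_3"
  unfolding rows17_3_def vs17_def by simp

lemma rows_4: "list_all (\<lambda>(u, nu, s). W17 g u nu vs17 s) rows17_4"
  unfolding rows17_4_def vs17_def by simp

lemma rows_5: "list_all (\<lambda>(u, nu, s). W17 g u nu vs17 s) rows17_5"
  unfolding rows17_5_def vs17_def by simp

lemma rows_6: "list_all (\<lambda>(u, nu, s). W17 g u nu vs17 s) rows17_6"
  unfolding rows17_6_def vs17_def by simp

lemma rows_7: "list_all (\<lambda>(u, nu, s). W17 g u nu vs17 s) rows17_7"
  unfolding rows17_7_def vs17_def by simp

lemma row_0: "W17 g d0 d0 vh17 ''AAADLA-OAyQBQGBFdYFCwAG0OMFbwBEadwAH5MBREDBDwEX!ZMhOMAAY''"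
  unfolding vh17_def by simp

lemma good_0: "list_all (CG17 g seg17) good17_0"
  unfolding good17_0_def seg17_def by simp

lemma ori_0: "list_all (CO17 g) good17_0"
  unfolding good17_0_def by simp

lemma good_1: "list_all (CG17 g seg17) good17_1"
  unfolding good17_1_def seg17_def by simp

lemma ori_1: "list_all (CO17 g) good17_1"
  unfolding good17_1_def by simp

lemma lift_0: "list_all (CB17 g seg17) lift17"
  unfolding lift17_def seg17_def by simp

end

theorem classes: "num_iso_classes TYPE('a) = 65" "all_nonorientable TYPE('a)"
proof -
  have rows: "list_all (\<lambda>(u, nu, s). rowm 47471 129014 full17 ix d53 g u nu vs17 s) rows17"
    using rows_0 rows_1 rows_2 rows_3 rows_4 rows_5 rows_6 rows_7 by (simp only: rows17_def W17_def list_all_append simp_thms)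
  note row0 = row_0[unfolded W17_def]
  have good: "list_all (cert_good 47471 129014 g seg17) good17"
    using good_0 good_1 by (simp only: good17_def CG17_def list_all_append simp_thms)
  have ori: "list_all (cert_ori 47471 129014 g) good17"
    using ori_0 ori_1 by (simp only: good17_def CO17_def list_all_append simp_thms)
  note lift = lift_0[unfolded CB17_def]
  have ar: "list_all (cert_arith 17 257 30 15) good17"
    by (simp add: good17_def good17_0_def good17_1_def cert_arith_def dd)
  have dist: "distinct (map cert_pair good17)" and len: "length good17 = 65"
    by (simp_all add: good17_def good17_0_def good17_1_def cert_pair_def dd)
  have us: "map fst rows17 = [1..<(257 + 1) div 2]" "list_all (\<lambda>(u, nu, s). (u + nu) mod 257 = 0) rows17"
    by (simp_all add: rows17_def rows17_0_def rows17_1_def rows17_2_def rows17_3_def rows17_4_def rows17_5_def rows17_6_def rows17_7_def dd upt_conv_Cons)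
  have vs: "map fst vs17 = [0..<30]" "list_all (\<lambda>(v, nv). (v + nv) mod 30 = 0) vs17"
    by (simp_all add: vs17_def dd upt_conv_Cons)
  have vh: "map fst vh17 = [0..<30 div 2 + 1]" "list_all (\<lambda>(v, nv). (v + nv) mod 30 = 0) vh17"
    by (simp_all add: vh17_def dd upt_conv_Cons)
  have bl: "list_all (\<lambda>(u, nu, v, nv). (u + nu) mod 257 = 0 \<and> (v + nv) mod 30 = 0) lift17"
    by (simp add: lift17_def dd)
  have N: "sum_list (map amount seg17) = 3855" by (simp add: seg17_def amount_def dd)
  have q: "\<forall>p\<in>set [3, 5, 257]. prime p \<and> (\<exists>k\<in>{0<..<length seg17}. 3855 div p = sum_list (map amount (take k seg17)))"
    (is "\<forall>p\<in>_. _ \<and> (\<exists>k\<in>_. ?Q p k)")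
  proof -
    have "?Q 3 3" "?Q 5 2" "?Q 257 1" by (simp_all add: seg17_def amount_def dd)
    moreover have "length seg17 = 4" by (simp add: seg17_def)
    ultimately show ?thesis by (auto intro: bexI[of _ 3] bexI[of _ 2] bexI[of _ 1])
  qed
  have h: "n dvd 129014 ^ 15 + 1"
  proof -
    \<comment> \<open>Half of the order 30 gives the power -1.\<close>
    have "pm n 129014 15 = 131070" by (simp add: pm_simps sqm_def)
    then have "(129014 ^ 15 + 1) mod n = (131070 + 1) mod n" unfolding pm_def by (metis mod_add_left_eq)
    then show ?thesis by (simp add: mod_eq_0_iff_dvd)
  qed
  have pr: "(3855::nat) = prod_list [3, 5, 257]" by simp
  have odd: "odd (257::nat)" and bd: "72 * d53 * 17 < 2 ^ (17 - 1) - 1" "1 \<le> d53"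
    and N': "3855 * 17 = 2 ^ (17 - 1) - (1::nat)" "0 < (3855::nat)" by (simp_all add: dd)
  note r = certified_classes[OF odd bd h rows row0 us vs vh full17_def good ori ar lift bl N N' pr q dist]
  show "num_iso_classes TYPE('a) = 65" using r(1) len by simp
  show "all_nonorientable TYPE('a)" using r(2) by simp
qed

end

lemma classes_17:
  assumes card: "card (UNIV :: 'a::{field,finite} set) = 2 ^ 17"
  shows "num_iso_classes TYPE('a) = 65 \<and> all_nonorientable TYPE('a)"
proof -
  obtain g :: 'a where "g ^ 17 = 1 + g ^ 3" using root_17[OF card] by blast
  from gf17.classes[OF gf17.intro[OF card this]] show ?thesis by simp
qed

section \<open>The field of degree 19\<close>

definition v19 :: "'b::field \<Rightarrow> bool \<Rightarrow> bool \<Rightarrow> bool \<Rightarrow> bool \<Rightarrow> bool \<Rightarrow> bool \<Rightarrow> bool \<Rightarrow> bool \<Rightarrow> bool \<Rightarrow> bool \<Rightarrow> bool \<Rightarrow> bool \<Rightarrow> bool \<Rightarrow> bool \<Rightarrow> bool \<Rightarrow> bool \<Rightarrow> bool \<Rightarrow> bool \<Rightarrow> bool \<Rightarrow> 'b" where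
  "v19 g b0 b1 b2 b3 b4 b5 b6 b7 b8 b9 b10 b11 b12 b13 b14 b15 b16 b17 b18 =
    of_bool b0 + of_bool b1 * g + of_bool b2 * g ^ 2 + of_bool b3 * g ^ 3 + of_bool b4 * g ^ 4 +
    of_bool b5 * g ^ 5 + of_bool b6 * g ^ 6 + of_bool b7 * g ^ 7 + of_bool b8 * g ^ 8 +
    of_bool b9 * g ^ 9 + of_bool b10 * g ^ 10 + of_bool b11 * g ^ 11 + of_bool b12 * g ^ 12 +
    of_bool b13 * g ^ 13 + of_bool b14 * g ^ 14 + of_bool b15 * g ^ 15 + of_bool b16 * g ^ 16 +
    of_bool b17 * g ^ 17 + of_bool b18 * g ^ 18"

locale gf19 =
  fixes g :: "'a::{field,finite}"
  assumes card_gf: "card (UNIV :: 'a set) = 2 ^ 19" and root: "g ^ 19 = 1 + g + g ^ 2 + g ^ 5"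
begin

sublocale binary_field 19 "TYPE('a)"
  by unfold_locales (use card_gf in simp_all)

lemma g_ne: "g \<noteq> 0" "g \<noteq> 1"
  using root by (auto simp: numeral_simps)

lemma g_pow:
  "g ^ 20 = g + g ^ 2 + g ^ 3 + g ^ 6"
  "g ^ 21 = g ^ 2 + g ^ 3 + g ^ 4 + g ^ 7"
  "g ^ 22 = g ^ 3 + g ^ 4 + g ^ 5 + g ^ 8"
  "g ^ 23 = g ^ 4 + g ^ 5 + g ^ 6 + g ^ 9"
  "g ^ 24 = g ^ 5 + g ^ 6 + g ^ 7 + g ^ 10"
  "g ^ 25 = g ^ 6 + g ^ 7 + g ^ 8 + g ^ 11"
  "g ^ 26 = g ^ 7 + g ^ 8 + g ^ 9 + g ^ 12"
  "g ^ 27 = g ^ 8 + g ^ 9 + g ^ 10 + g ^ 13"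
  "g ^ 28 = g ^ 9 + g ^ 10 + g ^ 11 + g ^ 14"
  "g ^ 29 = g ^ 10 + g ^ 11 + g ^ 12 + g ^ 15"
  "g ^ 30 = g ^ 11 + g ^ 12 + g ^ 13 + g ^ 16"
  "g ^ 31 = g ^ 12 + g ^ 13 + g ^ 14 + g ^ 17"
  "g ^ 32 = g ^ 13 + g ^ 14 + g ^ 15 + g ^ 18"
  "g ^ 33 = 1 + g + g ^ 2 + g ^ 5 + g ^ 14 + g ^ 15 + g ^ 16"
  "g ^ 34 = g + g ^ 2 + g ^ 3 + g ^ 6 + g ^ 15 + g ^ 16 + g ^ 17"
  "g ^ 35 = g ^ 2 + g ^ 3 + g ^ 4 + g ^ 7 + g ^ 16 + g ^ 17 + g ^ 18"
  "g ^ 36 = 1 + g + g ^ 2 + g ^ 3 + g ^ 4 + g ^ 8 + g ^ 17 + g ^ 18"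
proof -
  have p20: "g ^ 20 = g + g ^ 2 + g ^ 3 + g ^ 6"
    using power_add[of g 1 19]
    by (simp add: root distrib_left char2_simps flip: power_Suc power_Suc2 power_add power2_eq_square)
  have p21: "g ^ 21 = g ^ 2 + g ^ 3 + g ^ 4 + g ^ 7"
    using power_add[of g 2 19]
    by (simp add: root p20 distrib_left char2_simps flip: power_Suc power_Suc2 power_add power2_eq_square)
  have p22: "g ^ 22 = g ^ 3 + g ^ 4 + g ^ 5 + g ^ 8"
    using power_add[of g 3 19]
    by (simp add: root p20 p21 distrib_left char2_simps flip: power_Suc power_Suc2 power_add power2_eq_square)
  have p23: "g ^ 23 = g ^ 4 + g ^ 5 + g ^ 6 + g ^ 9"
    using power_add[of g 4 19]
    by (simp add: root p20 p21 p22 distrib_left char2_simps flip: power_Suc power_Suc2 power_add power2_eq_square)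
  have p24: "g ^ 24 = g ^ 5 + g ^ 6 + g ^ 7 + g ^ 10"
    using power_add[of g 5 19]
    by (simp add: root p20 p21 p22 p23 distrib_left char2_simps flip: power_Suc power_Suc2 power_add power2_eq_square)
  have p25: "g ^ 25 = g ^ 6 + g ^ 7 + g ^ 8 + g ^ 11"
    using power_add[of g 6 19]
    by (simp add: root p20 p21 p22 p23 p24 distrib_left char2_simps flip: power_Suc power_Suc2 power_add power2_eq_square)
  have p26: "g ^ 26 = g ^ 7 + g ^ 8 + g ^ 9 + g ^ 12"
    using power_add[of g 7 19]
    by (simp add: root p20 p21 p22 p23 p24 distrib_left char2_simps flip: power_Suc power_Suc2 power_add power2_eq_square)
  have p27: "g ^ 27 = g ^ 8 + g ^ 9 + g ^ 10 + g ^ 13"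
    using power_add[of g 8 19]
    by (simp add: root p20 p21 p22 p23 p24 distrib_left char2_simps flip: power_Suc power_Suc2 power_add power2_eq_square)
  have p28: "g ^ 28 = g ^ 9 + g ^ 10 + g ^ 11 + g ^ 14"
    using power_add[of g 9 19]
    by (simp add: root p20 p21 p22 p23 p24 distrib_left char2_simps flip: power_Suc power_Suc2 power_add power2_eq_square)
  have p29: "g ^ 29 = g ^ 10 + g ^ 11 + g ^ 12 + g ^ 15"
    using power_add[of g 10 19]
    by (simp add: root p20 p21 p22 p23 p24 distrib_left char2_simps flip: power_Suc power_Suc2 power_add power2_eq_square)
  have p30: "g ^ 30 = g ^ 11 + g ^ 12 + g ^ 13 + g ^ 16"
    using power_add[of g 11 19]
    by (simp add: root p20 p21 p22 p23 p24 distrib_left char2_simps flip: power_Suc power_Suc2 power_add power2_eq_square)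
  have p31: "g ^ 31 = g ^ 12 + g ^ 13 + g ^ 14 + g ^ 17"
    using power_add[of g 12 19]
    by (simp add: root p20 p21 p22 p23 p24 distrib_left char2_simps flip: power_Suc power_Suc2 power_add power2_eq_square)
  have p32: "g ^ 32 = g ^ 13 + g ^ 14 + g ^ 15 + g ^ 18"
    using power_add[of g 13 19]
    by (simp add: root p20 p21 p22 p23 p24 distrib_left char2_simps flip: power_Suc power_Suc2 power_add power2_eq_square)
  have p33: "g ^ 33 = 1 + g + g ^ 2 + g ^ 5 + g ^ 14 + g ^ 15 + g ^ 16"
    using power_add[of g 14 19]
    by (simp add: root p20 p21 p22 p23 p24 distrib_left char2_simps flip: power_Suc power_Suc2 power_add power2_eq_square)
  have p34: "g ^ 34 = g + g ^ 2 + g ^ 3 + g ^ 6 + g ^ 15 + g ^ 16 + g ^ 17"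
    using power_add[of g 15 19]
    by (simp add: root p20 p21 p22 p23 p24 distrib_left char2_simps flip: power_Suc power_Suc2 power_add power2_eq_square)
  have p35: "g ^ 35 = g ^ 2 + g ^ 3 + g ^ 4 + g ^ 7 + g ^ 16 + g ^ 17 + g ^ 18"
    using power_add[of g 16 19]
    by (simp add: root p20 p21 p22 p23 p24 distrib_left char2_simps flip: power_Suc power_Suc2 power_add power2_eq_square)
  have p36: "g ^ 36 = 1 + g + g ^ 2 + g ^ 3 + g ^ 4 + g ^ 8 + g ^ 17 + g ^ 18"
    using power_add[of g 17 19]
    by (simp add: root p20 p21 p22 p23 p24 distrib_left char2_simps flip: power_Suc power_Suc2 power_add power2_eq_square)
  show "g ^ 20 = g + g ^ 2 + g ^ 3 + g ^ 6" "g ^ 21 = g ^ 2 + g ^ 3 + g ^ 4 + g ^ 7" "g ^ 22 = g ^ 3 + g ^ 4 + g ^ 5 + g ^ 8" "g ^ 23 = g ^ 4 + g ^ 5 + g ^ 6 + g ^ 9" "g ^ 24 = g ^ 5 + g ^ 6 + g ^ 7 + g ^ 10" "g ^ 25 = g ^ 6 + g ^ 7 + g ^ 8 + g ^ 11" "g ^ 26 = g ^ 7 + g ^ 8 + g ^ 9 + g ^ 12" "g ^ 27 = g ^ 8 + g ^ 9 + g ^ 10 + g ^ 13" "g ^ 28 = g ^ 9 + g ^ 10 + g ^ 11 + g ^ 14" "g ^ 29 = g ^ 10 + g ^ 11 + g ^ 12 + g ^ 15" "g ^ 30 = g ^ 11 + g ^ 12 + g ^ 13 + g ^ 16" "g ^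 31 = g ^ 12 + g ^ 13 + g ^ 14 + g ^ 17" "g ^ 32 = g ^ 13 + g ^ 14 + g ^ 15 + g ^ 18" "g ^ 33 = 1 + g + g ^ 2 + g ^ 5 + g ^ 14 + g ^ 15 + g ^ 16" "g ^ 34 = g + g ^ 2 + g ^ 3 + g ^ 6 + g ^ 15 + g ^ 16 + g ^ 17" "g ^ 35 = g ^ 2 + g ^ 3 + g ^ 4 + g ^ 7 + g ^ 16 + g ^ 17 + g ^ 18" "g ^ 36 = 1 + g + g ^ 2 + g ^ 3 + g ^ 4 + g ^ 8 + g ^ 17 + g ^ 18"
    by (fact p20 p21 p22 p23 p24 p25 p26 p27 p28 p29 p30 p31 p32 p33 p34 p35 p36)+
qed

lemma v_add: "v19 g b0 b1 b2 b3 b4 b5 b6 b7 b8 b9 b10 b11 b12 b13 b14 b15 b16 b17 b18 + v19 g c0 c1 c2 c3 c4 c5 c6 c7 c8 c9 c10 c11 c12 c13 c14 c15 c16 c17 c18 =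
  v19 g (xr b0 c0) (xr b1 c1) (xr b2 c2) (xr b3 c3) (xr b4 c4) (xr b5 c5) (xr b6 c6) (xr b7 c7) (xr b8 c8) (xr b9 c9) (xr b10 c10) (xr b11 c11) (xr b12 c12) (xr b13 c13) (xr b14 c14) (xr b15 c15) (xr b16 c16) (xr b17 c17) (xr b18 c18)"
  by (simp add: v19_def of_bool_xr distrib_right ac_simps)

lemma v_one: "1 + v19 g b0 b1 b2 b3 b4 b5 b6 b7 b8 b9 b10 b11 b12 b13 b14 b15 b16 b17 b18 = v19 g (\<not> b0) b1 b2 b3 b4 b5 b6 b7 b8 b9 b10 b11 b12 b13 b14 b15 b16 b17 b18"
  by (simp add: v19_def of_bool_not ac_simps)

lemma v_tg:
  "tg g (v19 g b0 b1 b2 b3 b4 b5 b6 b7 b8 b9 b10 b11 b12 b13 b14 b15 b16 b17 False) = v19 g False b0 b1 b2 b3 b4 b5 b6 b7 b8 b9 b10 b11 b12 b13 b14 b15 b16 b17"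
  "tg g (v19 g b0 b1 b2 b3 b4 b5 b6 b7 b8 b9 b10 b11 b12 b13 b14 b15 b16 b17 True) = v19 g True (\<not> b0) (\<not> b1) b2 b3 (\<not> b4) b5 b6 b7 b8 b9 b10 b11 b12 b13 b14 b15 b16 b17"
  by (simp_all only: v19_def tg_simps root of_bool_not of_bool_eq mult_1 mult_zero_left add_0_left add_0_right distrib_left distrib_right add_num_simps arith_simps add.assoc add.commute add.left_commute)

lemma v_sq: "sq (v19 g b0 b1 b2 b3 b4 b5 b6 b7 b8 b9 b10 b11 b12 b13 b14 b15 b16 b17 b18) =
    v19 g (xr b0 b18) (xr (xr b10 b17) b18) (xr (xr (xr b1 b10) b17) b18) (xr (xr (xr b10 b11) b17) b18) (xr (xr b2 b11) b18) (xr b11 b12) (xr (xr (xr b3 b10) b12) b17) (xr b12 b13) (xr (xr (xr b4 b11) b13) b18) (xr b13 b14) (xr (xr b5 b12) b14) (xr b14 b15) (xr (xr b6 b13) b15) (xr b15 b16) (xr (xr b7 b14) b16) (xr b16 b17) (xr (xr b8 b15) b17) (xr b17 b18) (xr (xr b9 b16) b18)"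
  by (simp only: v19_def sq_add sq_simps sq_def[of g] arith_simps mult_1_right root g_pow of_bool_xr distrib_left distrib_right add.assoc add.commute add.left_commute)

lemma v_mult: "v19 g b0 b1 b2 b3 b4 b5 b6 b7 b8 b9 b10 b11 b12 b13 b14 b15 b16 b17 b18 * X =
    cnd b0 X (tg g (cnd b1 X (tg g (cnd b2 X (tg g (cnd b3 X (tg g (cnd b4 X (tg g (cnd b5 X (tg g (cnd b6 X (tg g (cnd b7 X (tg g (cnd b8 X (tg g (cnd b9 X (tg g (cnd b10 X (tg g (cnd b11 X (tg g (cnd b12 X (tg g (cnd b13 X (tg g (cnd b14 X (tg g (cnd b15 X (tg g (cnd b16 X (tg g (cnd b17 X (tg g (cnd b18 X 0))))))))))))))))))))))))))))))))))))"
  by (simp only: v19_def horner_simps add_num_simps)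

lemma v_g: "v19 g False True False False False False False False False False False False False False False False False False False = g" and v_zero: "v19 g False False False False False False False False False False False False False False False False False False False = 0"
  by (simp_all add: v19_def)

end

definition E19 where "E19 = elm 422765 124965"
definition R19 where "R19 = runm 422765 124965"
definition S19 where "S19 = samem 422765 124965"
definition K19 where "K19 = walk_samem 422765 124965"
definition Q19 where "Q19 = walk_longm 422765 124965"
definition G19 where "G19 = goodm 422765 124965"
definition F19 where "F19 = good_nextm 422765 124965"
definition CG19 where "CG19 = cert_good 422765 124965"
definition CO19 where "CO19 = cert_ori 422765 124965"
definition CB19 where "CB19 = cert_liftbad 422765 124965"
definition I19 where "I19 = itm 422765 124965"
text \<open>Partial sums 189, 1971, 4599 and 13797: the quotients of 13797 by 73, 7 and 3, and
  \<open>13797 = 262143 / 19\<close> itself.\<close>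

definition seg19 :: "(nat \<times> nat) list" where "seg19 = [(d2, d45), (d24, d54), (d36, d36), (d127, d54)]"
definition good19_0 :: "cert list" where "good19_0 = [
  (d1, d188, d137, d9, d18, (d7, d182, d48, d121), (d7, d181, d130, d57)),
  (d2, d187, d122, d24, d8, (d5, d13, d86, d13), (d5, d11, d37, d110)),
  (d4, d185, d48, d98, d16, (d12, d81, d21, d94), (d12, d77, d46, d119)),
  (d4, d185, d106, d40, d18, (d50, d42, d41, d114), (d50, d38, d8, d81)),
  (d4, d185, d112, d34, d10, (d24, d13, d145, d72), (d24, d9, d106, d33)),
  (d6, d183, d54, d92, d10, (d2, d132, d97, d24), (d2, d126, d116, d43)),
  (d6, d183, d59, d87, d7, (d10, d99, d111, d38), (d10, d93, d125, d52)),
  (d6, d183, d60, d86, d8, (d7, d139, d63, d136), (d7, d133, d76, d3)),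
  (d7, d182, d16, d130, d18, (d15, d31, d6, d79), (d15, d24, d63, d136)),
  (d8, d181, d3, d143, d7, (d27, d34, d95, d22), (d27, d26, d19, d92)),
  (d8, d181, d63, d83, d14, (d2, d8, d77, d4), (d2, d0, d87, d14)),
  (d8, d181, d83, d63, d12, (d12, d124, d94, d21), (d12, d116, d84, d11)),
  (d8, d181, d133, d13, d7, (d5, d121, d51, d124), (d5, d113, d137, d64)),
  (d9, d180, d13, d133, d6, (d35, d79, d143, d70), (d35, d70, d57, d130)),
  (d14, d175, d67, d79, d11, (d9, d77, d50, d123), (d9, d63, d56, d129)),
  (d17, d172, d4, d142, d5, (d16, d74, d2, d75), (d16, d57, d71, d144)),
  (d18, d171, d31, d115, d8, (d3, d84, d96, d23), (d3, d66, d138, d65)),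
  (d18, d171, d139, d7, d15, (d34, d90, d141, d68), (d34, d72, d75, d2)),
  (d19, d170, d104, d42, d11, (d20, d136, d2, d75), (d20, d117, d117, d44)),
  (d19, d170, d136, d10, d15, (d16, d175, d25, d98), (d16, d156, d108, d35)),
  (d20, d169, d4, d142, d6, (d13, d91, d128, d55), (d13, d71, d51, d124)),
  (d21, d168, d16, d130, d11, (d98, d4, d95, d22), (d98, d172, d6, d79))]"
definition good19_1 :: "cert list" where "good19_1 = [
  (d22, d167, d107, d39, d8, (d58, d124, d136, d63), (d58, d102, d102, d29)),
  (d23, d166, d117, d29, d14, (d19, d0, d84, d11), (d19, d166, d40, d113)),
  (d24, d165, d140, d6, d6, (d13, d154, d53, d126), (d13, d130, d132, d59)),
  (d26, d163, d2, d144, d10, (d16, d58, d135, d62), (d16, d32, d60, d133)),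
  (d26, d163, d120, d26, d3, (d9, d3, d142, d69), (d9, d166, d95, d22)),
  (d27, d162, d48, d98, d8, (d7, d18, d109, d36), (d7, d180, d134, d61)),
  (d28, d161, d110, d36, d6, (d33, d52, d8, d81), (d33, d24, d117, d44)),
  (d32, d157, d119, d27, d16, (d27, d89, d92, d19), (d27, d57, d46, d119)),
  (d33, d156, d94, d52, d2, (d59, d143, d33, d106), (d59, d110, d12, d85)),
  (d33, d156, d133, d13, d11, (d26, d62, d100, d27), (d26, d29, d40, d113)),
  (d34, d155, d135, d11, d9, (d26, d20, d67, d140), (d26, d175, d5, d78)),
  (d34, d155, d144, d2, d3, (d24, d55, d94, d21), (d24, d21, d23, d96)),
  (d35, d154, d89, d57, d11, (d14, d113, d122, d49), (d14, d78, d106, d33)),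
  (d36, d153, d80, d66, d9, (d40, d107, d134, d61), (d40, d71, d127, d54)),
  (d36, d153, d83, d63, d1, (d12, d86, d64, d137), (d12, d50, d54, d127)),
  (d37, d152, d57, d89, d9, (d66, d161, d94, d21), (d66, d124, d110, d37)),
  (d37, d152, d78, d68, d7, (d10, d83, d144, d71), (d10, d46, d139, d66)),
  (d40, d149, d29, d117, d15, (d9, d23, d100, d27), (d9, d172, d144, d71)),
  (d41, d148, d52, d94, d13, (d6, d46, d92, d19), (d6, d5, d113, d40)),
  (d41, d148, d64, d82, d12, (d24, d173, d96, d23), (d24, d132, d105, d32)),
  (d42, d147, d72, d74, d10, (d7, d75, d42, d115), (d7, d33, d43, d116)),
  (d44, d145, d39, d107, d17, (d13, d90, d9, d82), (d13, d46, d43, d116))]"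
definition good19_2 :: "cert list" where "good19_2 = [
  (d44, d145, d52, d94, d7, (d1, d112, d70, d143), (d1, d68, d91, d18)),
  (d44, d145, d68, d78, d12, (d8, d42, d124, d51), (d8, d187, d129, d56)),
  (d45, d144, d132, d14, d3, (d13, d141, d63, d136), (d13, d96, d4, d77)),
  (d46, d143, d66, d80, d1, (d69, d157, d127, d54), (d69, d111, d134, d61)),
  (d49, d140, d132, d14, d6, (d18, d123, d2, d75), (d18, d74, d89, d16)),
  (d49, d140, d145, d1, d12, (d11, d180, d15, d88), (d11, d131, d89, d16)),
  (d50, d139, d23, d123, d6, (d10, d78, d109, d36), (d10, d28, d13, d86)),
  (d51, d138, d15, d131, d5, (d12, d87, d31, d104), (d12, d36, d89, d16)),
  (d51, d138, d63, d83, d11, (d2, d90, d121, d48), (d2, d39, d131, d58)),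
  (d53, d136, d141, d5, d14, (d36, d77, d39, d112), (d36, d24, d117, d44)),
  (d55, d134, d7, d139, d4, (d21, d70, d58, d131), (d21, d15, d124, d51)),
  (d56, d133, d112, d34, d10, (d7, d117, d121, d48), (d7, d61, d82, d9)),
  (d56, d133, d129, d17, d12, (d95, d109, d100, d27), (d95, d53, d44, d117)),
  (d59, d130, d24, d122, d16, (d46, d28, d13, d86), (d46, d158, d62, d135)),
  (d60, d129, d48, d98, d4, (d6, d165, d126, d53), (d6, d105, d5, d78)),
  (d60, d129, d60, d86, d13, (d69, d161, d18, d91), (d69, d101, d31, d104)),
  (d61, d128, d11, d135, d10, (d12, d55, d100, d27), (d12, d183, d16, d89)),
  (d62, d127, d57, d89, d7, (d2, d94, d47, d120), (d2, d32, d63, d136)),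
  (d62, d127, d138, d8, d18, (d8, d110, d32, d105), (d8, d48, d113, d40)),
  (d63, d126, d21, d125, d11, (d10, d35, d125, d52), (d10, d161, d31, d104)),
  (d65, d124, d61, d85, d6, (d32, d4, d144, d71), (d32, d128, d10, d83)),
  (d65, d124, d96, d50, d8, (d59, d130, d145, d72), (d59, d65, d122, d49))]"
definition good19_3 :: "cert list" where "good19_3 = [
  (d66, d123, d52, d94, d17, (d49, d93, d60, d133), (d49, d27, d81, d8)),
  (d66, d123, d140, d6, d3, (d49, d154, d41, d114), (d49, d88, d120, d47)),
  (d67, d122, d89, d57, d14, (d70, d141, d132, d59), (d70, d74, d116, d43)),
  (d67, d122, d144, d2, d1, (d30, d186, d93, d20), (d30, d119, d22, d95)),
  (d71, d118, d33, d113, d13, (d8, d123, d16, d89), (d8, d52, d56, d129)),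
  (d72, d117, d12, d134, d6, (d3, d31, d96, d23), (d3, d148, d11, d84)),
  (d72, d117, d41, d105, d12, (d2, d133, d128, d55), (d2, d61, d14, d87)),
  (d72, d117, d98, d48, d1, (d10, d134, d22, d95), (d10, d62, d143, d70)),
  (d78, d111, d138, d8, d2, (d4, d132, d138, d65), (d4, d54, d73, d0)),
  (d82, d107, d120, d26, d16, (d33, d181, d34, d107), (d33, d99, d133, d60)),
  (d83, d106, d49, d97, d9, (d11, d149, d6, d79), (d11, d66, d30, d103)),
  (d84, d105, d101, d45, d13, (d23, d188, d144, d71), (d23, d104, d116, d43)),
  (d85, d104, d94, d52, d9, (d56, d143, d86, d13), (d56, d58, d65, d138)),
  (d85, d104, d136, d10, d11, (d7, d128, d107, d34), (d7, d43, d44, d117)),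
  (d87, d102, d39, d107, d5, (d3, d145, d97, d24), (d3, d58, d131, d58)),
  (d89, d100, d9, d137, d2, (d10, d116, d87, d14), (d10, d27, d5, d78)),
  (d89, d100, d54, d92, d16, (d7, d69, d139, d66), (d7, d169, d12, d85)),
  (d90, d99, d19, d127, d18, (d55, d22, d26, d99), (d55, d121, d80, d7)),
  (d90, d99, d49, d97, d14, (d5, d89, d50, d123), (d5, d92, d52, d125)),
  (d92, d97, d135, d11, d4, (d27, d75, d43, d116), (d27, d172, d127, d54)),
  (d93, d96, d104, d42, d15, (d25, d113, d62, d135), (d25, d20, d31, d104)),
  (d94, d95, d110, d36, d18, (d3, d16, d14, d87), (d3, d111, d123, d50))]"
definition good19 where "good19 = good19_0 @ good19_1 @ good19_2 @ good19_3"
definition lift19 :: "(nat \<times> nat \<times> nat \<times> nat) list" where "lift19 = [(d26, d163, d91, d55), (d51, d138, d116, d30), (d58, d131, d54, d92), (d65, d124, d6, d140), (d70, d119, d128, d18)]"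
definition full19 where "full19 = map cert_pair good19 @ map (\<lambda>(u, nu, v, nv). (u, v)) lift19"
definition vs19 :: "(nat \<times> nat) list" where "vs19 = [
  (d0, d0), (d1, d145), (d2, d144), (d3, d143), (d4, d142), (d5, d141), (d6, d140), (d7, d139),
  (d8, d138), (d9, d137), (d10, d136), (d11, d135), (d12, d134), (d13, d133), (d14, d132),
  (d15, d131), (d16, d130), (d17, d129), (d18, d128), (d19, d127), (d20, d126), (d21, d125),
  (d22, d124), (d23, d123), (d24, d122), (d25, d121), (d26, d120), (d27, d119), (d28, d118),
  (d29, d117), (d30, d116), (d31, d115), (d32, d114), (d33, d113), (d34, d112), (d35, d111),
  (d36, d110), (d37, d109), (d38, d108), (d39, d107), (d40, d106), (d41, d105), (d42, d104),
  (d43, d103), (d44, d102), (d45, d101), (d46, d100), (d47, d99), (d48, d98), (d49, d97),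
  (d50, d96), (d51, d95), (d52, d94), (d53, d93), (d54, d92), (d55, d91), (d56, d90), (d57, d89),
  (d58, d88), (d59, d87), (d60, d86), (d61, d85), (d62, d84), (d63, d83), (d64, d82), (d65, d81),
  (d66, d80), (d67, d79), (d68, d78), (d69, d77), (d70, d76), (d71, d75), (d72, d74), (d73, d73),
  (d74, d72), (d75, d71), (d76, d70), (d77, d69), (d78, d68), (d79, d67), (d80, d66), (d81, d65),
  (d82, d64), (d83, d63), (d84, d62), (d85, d61), (d86, d60), (d87, d59), (d88, d58), (d89, d57),
  (d90, d56), (d91, d55), (d92, d54), (d93, d53), (d94, d52), (d95, d51), (d96, d50), (d97, d49),
  (d98, d48), (d99, d47), (d100, d46), (d101, d45), (d102, d44), (d103, d43), (d104, d42),
  (d105, d41), (d106, d40), (d107, d39), (d108, d38), (d109, d37), (d110, d36), (d111, d35),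
  (d112, d34), (d113, d33), (d114, d32), (d115, d31), (d116, d30), (d117, d29), (d118, d28),
  (d119, d27), (d120, d26), (d121, d25), (d122, d24), (d123, d23), (d124, d22), (d125, d21),
  (d126, d20), (d127, d19), (d128, d18), (d129, d17), (d130, d16), (d131, d15), (d132, d14),
  (d133, d13), (d134, d12), (d135, d11), (d136, d10), (d137, d9), (d138, d8), (d139, d7),
  (d140, d6), (d141, d5), (d142, d4), (d143, d3), (d144, d2), (d145, d1)]"
definition vh19 :: "(nat \<times> nat) list" where "vh19 = [
  (d0, d0), (d1, d145), (d2, d144), (d3, d143), (d4, d142), (d5, d141), (d6, d140), (d7, d139),
  (d8, d138), (d9, d137), (d10, d136), (d11, d135), (d12, d134), (d13, d133), (d14, d132),
  (d15, d131), (d16, d130), (d17, d129), (d18, d128), (d19, d127), (d20, d126), (d21, d125),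
  (d22, d124), (d23, d123), (d24, d122), (d25, d121), (d26, d120), (d27, d119), (d28, d118),
  (d29, d117), (d30, d116), (d31, d115), (d32, d114), (d33, d113), (d34, d112), (d35, d111),
  (d36, d110), (d37, d109), (d38, d108), (d39, d107), (d40, d106), (d41, d105), (d42, d104),
  (d43, d103), (d44, d102), (d45, d101), (d46, d100), (d47, d99), (d48, d98), (d49, d97),
  (d50, d96), (d51, d95), (d52, d94), (d53, d93), (d54, d92), (d55, d91), (d56, d90), (d57, d89),
  (d58, d88), (d59, d87), (d60, d86), (d61, d85), (d62, d84), (d63, d83), (d64, d82), (d65, d81),
  (d66, d80), (d67, d79), (d68, d78), (d69, d77), (d70, d76), (d71, d75), (d72, d74), (d73, d73)]"
definition W19 where "W19 = rowm 422765 124965 full19 ix d144"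
definition N19 where "N19 = entm 422765 124965 full19 ix d144"
text \<open>Modulo 524287 the number 3 is \<open>2 ^ 14 * 422765 * 124965\<close>, so cubing moves
  along the diagonal of the labels; 5 is -14 modulo 19.\<close>

definition nx19 :: "nat \<times> nat \<times> nat \<times> nat \<times> 'b::field \<Rightarrow> nat \<times> nat \<times> nat \<times> nat \<times> 'b" where
  "nx19 s = (case s of (j, nj, a, b, x) \<Rightarrow> (pl d19 j d14, pl d19 nj d5, pl d189 a d1, pl d146 b d1, x * sq x))"
definition rows19_0 :: "(nat \<times> nat \<times> string) list" where "rows19_0 = [
  (d1, d188, ''0nBBREr1ca3NNZwAJ==MB=YAuwAZTOMND0ADFn0ARBNwA.Gw0AWuIBBrwAkSVwAE5/BCi0B+HoYdfMucMOtc;RQEMEADwTK8cAEWwAfOgCB?1AE.+wADCiQduEWcEC:wADs5AE?FODwAVk9AAewCeWBEUAEnmwAEEWMK2FKbwAKUQAK4FD;B/sFHDwAEB/wBGAdwBxlqAAAwVWVLE+8AIlwAHg:B:UEAUwJzU,QAs0AkCJ0AOzQNnsQBvYBI0AvWswAEu1EHUwAnVh0ADt1ELhEYTwAKI9YSG0ADLyAITwAGOfAAmwCob,MXiCzrNsXEJPduVAJr0AEAl0AH-IYzUQRmAo-BA70A0CHNYpwADpqEkBFEjBOWcAi0A1fiFAO0AXV,EAhwJs=,AU.wADRKGGB4AFlhEaVECe0AQpCBWKMAs0AWZiCB50ADAXwB-E0EtBML.QI?wAFABwGkACwBKxsAHnwADEeAOg0AL93M=qMbbA4QQI70ANmjF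XvEs5EBXwBUQRQAAkO,0AG8TABDwAMUDYh3EojECn0AMU7wAF''),
  (d2, d187, ''PIEDxwAKeORvgQVywAEJGA-yFKjwAJGLEEbAC,wAvAf0AFAAwBm7UMA;0ASmVAQ6FPdFVrQdqFAn0C.lTwAFBE0B7CZwAIKEFD9wAJAq0AISYAWcYHJAXYB?IEB-wAyJrQa3AEW0ALStAu4EAIwG0VwQC8wAFrvEL1wATDJBmaQcbECyEp9Ee9MngwAF/DEAh0AGAz0AJ8QEiqMCBGTREWFwADAi0Av/kMSrCtyBw7AC40AOQwMEIEA60ALC/MfKEI:EEfGntMA70AbpRF1vAkYcKNwAVx;AZ,ErLQEWALzAA90AQRewAO=oAEYQyjFyJMLaEmwAr+EQ6QGxMQj0AGSWcA3ECEwAazgFNFwAIG!QEQ0AILgFw7QXYZIxR0SFMaAKiAa;F0AcH4wAGV,YAbwDXJXcd9ArxEysBA0MDD0AFm!BBhwA6C.wAjAAk0mEUrFDiA24cCrAVdQI0YBNwBAhBcj-AF1wAFlzYw7Yi7MDdwAHZFFNS0ADF30AFD5QAwwAi4OMSywAFIWc''),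
  (d3, d186, ''dBAEiAnpBr-QLgEF30ADxZAAPwQZInwATAEwMCFzASBwAEdAQukAu9AESECeEAEwH7ZIE9CAuEAY50AD1iYL=RnQAItMAEwYeDZwAISmFANwALBwchTwAGJ+ALdBZvFIfwAPHy0ADh0YNyBVnwAJBNQAAwSrAPQCwA9MFV:MAawAWPywAGNI0AVEDwAV6?AkUBA80ADe-QVAMM90AF2ac9,A1EABm0CgS4FAFwg,:/FH/EeO0AEMYAErQ6aAAAwQf?VESmFAOwAo1xEEOdVxFG,0AJL!0AJKwwAMsMQxZYcEYJ8QStwAESFQI90AFDFAaQAF7ECFwAOBI0ARPXEKMEQPEAVwAPAI0AwE;MT:wAEgfFI/wAEAOwE9YIQKVACv0A-0UQxnFHtRTSBK,0AFDYwAQH!Ac/ANyZT?FE+cPdFlbAQvGizwAEtAAKBBJj0ADZOEAswAEa.E;mMA60AyAAwh-NywAPA,0BFftMPlQVBUAowBKE6wAwkqAdLQAlwEs2iAUjADmwADkJwAHLIwAKDAwAIxmYcuAAX0B!''),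
  (d4, d185, ''AHwHtXWcP9YW/wANCzwAGH!0AOLmQTZMBXwAHEswATA=0CD:bYObwADNs1AE05A2SFGP0ADKX0AFGFwADMU0ADAzwAeA?0AhHxANVQPA0AKl!YBxARJEBE0AIDXwBPE+0AuB3wA-!4BQncZLcOv0AFdeFxFQCS0AHGfwAEBWwArToMAaMjzBADwnrL+EB8Q3=RAAkH2wAE/MMEn0AFB?0AtbxAHSYPAAK?wANM=E/YABrMABwbDGCYId0AMFvwAHA;ERKAj9FX!ARvMyDFANwCdAiwOGgSEDiwAO=:AP,ECd0AGJ-FCNQAdYDWwAVE=wAMHW0AICJwAaRHM74QWgEB;wAKGQwAFABwgqjDELSYakFzOMVC0AI:4FHTE6.QH4MBxYBRAAA8JE8xNBJ0AlPsY9oEAAkAfwR;x6EPmAa8cnuBAAkApwBFEKwAGA30B,CRwAOm4c/=MPG0AJGvwARO?0AIEl0ASAJQQ:wAJ1l0ADSjFJk0AGIUwAHa.0AEReAcQF0r0ADBC0AVaKAkhA.EBVZckcBBRwAPP7AR6GEoQAcwBgpfRUQQ''),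
  (d5, d184, ''-pQB.wAiBnEBO0APx7QU2ACNBV.0AIH2wAGRCA.:ADj0AHSzELt0AE/1FAAwCRH/BHLME20APBP0AmK1wAHZiwAFS!wADLgwAPB?0AbBgMCX0AIQ2wAHRdYIv0AJBE0CvABw!jABwEjTn0AEARSD!QP=EFjEOwMGywARtwFAdwDKP:ML7Eg8FJmwANd!EZ!0AH,UMADwIpnPYACwr5HXwAGRCE8GBAowA1ByAMtwAFPLAd5cg.MLHAu.BEd0AkQ31ADOrQUpYGKwADAMwMAM+Bf7QRjwAGLt0AEA,GLFwADNSwAXAj0AoCXAGKwAIAe0AxiAIzuBFJwAIULAH-BafMlVEERE./EoAAGxCOcCA?0B76XECWwALABwwlI8wAIN/wAHirAAWwD5ACwV=rwQZDwADFXQAE0AONcA;0QH7wALBfwB35SYc?CanFk6E;AEANwAwadEA-0B8f/YH7wAEMoMY/cVnwAKWncDpwAPB-wCLOYBA,wB5JPBG=wAQByYm8wAD4/Aa?AALwA3LqchtBFiwAMRV0AM,NEfSBlFMk.C+RAldQAV0AJRRF''),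
  (d6, d183, ''2DEAIwEiyIFB70DZr9wAEneBKAIL1E,vAPEGO3wAIABwQuVHcBXwAD74FAUYCZ0AFAPwBOAD0AefAMxd0ADPG0AEaPcAtwAPViQM2wAIceFCLAF=wAEBs0AED-0A8TSEANwExZCEA.0AqWBJ9fBUkCopQVTFAz0B?m1EBR0ADK?MAF0AKEMwADBZwAcCb0ARhHMKcALz0ADvyNLi0APWlYAAkq9wAGMo0AHO!EPTwADAAkAAkT5YBUwAzG8MWs0AGDr0ANel0ADTfAGQYJFCBg0AJDFwAZ!0AEA0AKF.wAFHSYbAwADhpBGfQDNwAEwic54AEBJDzEQZFGvAC:0Abr9AJmwAM0IBuPMSGQLmZA.c5HAWk0AEO2wADsTQnQMIQMB!0AbC=NYSAHJMHU0AFLhFEvBqeEesBKyAWwRCYQi/EhrYJiwAE2CFY-wAD1nFf9AAM0AFNNwAEDuwAIBvwC5/HAfXBF-BElwAED!GpCEG20APRSFbAMODE,uEKNBK+FDawAehOEo=Ad8BAS0A;5XBBJwCrHHEk2BGuwAD'')]"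
definition rows19_1 :: "(nat \<times> nat \<times> string) list" where "rows19_1 = [
  (d7, d182, ''4pAHgYv;FAEMLFAqCAHk0AEEV0AK-LFdKACxwAKA9wBYVYMVlQN=MtvEAAkE+wAICfwAHCvwAHP5AbmA:IEZG0AEXDBL-ZUXEbsAVVAPA0AIHz0AMDK0A2B=AAQwMsPa0AFPGECTEAIwAKpswAD2aYA-cPvE;BwAD3UAhYEAMwDYepwAEtdF/OAAmwAPR5wADb5EX/AEjB7!ANqwADA=ADaFza0AJW4BJGwAHAlEUWEGYwAIwVE,2MOn0ADHeBCkwA0neMAIwEsADwbTAO0HCjDFEM0AcoVCTPGReQCCwAEfDFK40APKJAziFCPCBbQOuAD=wAUGl0AMCj0ALVRBGT0AJohElfA/EFNNwAKFS0AgVB4AIHlYIxwAFh6E8aYnKGbO0ADAGwCByJBAXwAZKQcitFFdwAMLFwAH+vAi1QloAFOBBGNg2AGCAt:wAJNvM?KwAD8CE2LEBd0AsA50BHET0AFU7Yd-BAAwyBA:EdxEP6Qw7EU5ETJYPH0ADAHwB6GPAZH0AKv.FBjwAR,KFx!BdmNAB4A!:AwAEAtwDr''),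
  (d8, d181, ''AEw46ubZGY0AtAAkyhYXxYG1wAHE/0ADkW0ADCOQbwE5pEAcwA0gaE/cQrcMhDFef0AGC8QEc0AHAqwBKAGw!VAewDkBowBIBz0APapM:hE7LEYRAb6FEtA=AQR4BoqAA.wD!c+ZVocPIGFAwAMHzMZaANFQHkQCxQAYwClqDFVyGp8ATt0AF1;ECjwAD.,E:uAA9wCWwgADGwAqCA0AVGxG2PwADAqwAjjJFAIwChgARAAkv3Ms0EhMAAq0B-rvFANwF6AREHTQ?3EOX0AD;QAFvBn!YyhADk0AFgpQf=EBV0CFbSFAAkNsFdlwAD9MQDAEgAcA6wAG0TADFwAbk0wAHG,0AFKU0ADAX0ARAj0DAS5ETGE2xETPQYdEpREV8QXOFAQ0A1IPEP1wADTqEUQMVUMBq0AQW=AA0wEmuhFY;ASwR3:RhLAC+0Aw7qEx2EB00A=UvAw8MMt0AKHs0AKEBwAGAB0AejoQNTwAD6RBY3EAAkTI0AJMxCAfwCsM6QxlAu,AE00A4E6wAnAawEmAIwAZA5wAF4=A''),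
  (d9, d180, ''AVwANBMwAEJ2NAqwBSu2EJtcB=wAVKVwADDSEdCAAUwYxD9wArAKwBXAAk5rQC.cFowAYAF0M-ONMFaFC.EXBYCnwAOPKECg0AUANwALFOwAGB.MdBMI0wAEm6B3o0ADXAAALwHaAGRAQwHtK:0AL/7By:wADFjwAG2;FF;ASZ0AENOAB0wAelNMBY0A5AuwC.T/MqaEVlBCtAOaEQbEsjcA/wBKDpcAfwAuySAE8cIZ0ALi;AcpFOVGI!0AFBR0AFYgFACwSQKCYNIE?FASBET!EvdEBgQJn0ATnBAIkxAE=5AqGArsBn?B!fAJZECnwAFY+AKG0AXELwAOJVMP5wAHBGwAJqrAEQ0AYCF0ALXBAADwAIA4wAQCSYBIwADAawDDCT0AMRJFREMD8EI0BXAYbtFraYSOwAKCSECD0ADMf0AHA3wB:?AAY0cX.wADFL0AaQFEWsCWDE?fAnOMBy0AcgwwAD?2EB:cClclcQzeFJ;0AI5wBW:EbF0AHh,EJnwAjk3RMcYswMW:BjPFda0AF6.EAu0AUEp0AOLU0AJCKc''),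
  (d10, d179, ''D:wAD/uAE.EB:0ADVR0AFQQAXwQCE0AG1BEDt0AQOZ0AIf-QN90AE,iAThEO4YBrwAVOWBNABSu0AGBzwAEAAwAIKzwAInZcDJ0AVyfAASwBYB2wADV60AMABwQrBPYXwEEi0AXH:FD9YckEDCwAQEABT,MCx0AWCLwAIsWQm4ArhBEpwA+AA4AIcTwADK;BHv0AGFK0AR7ZA,BUWbA9oEBw0BAIPETJATZwADI10AF,AAXmR?GAbUYC.0AgFvAZUEI9BhxMTCEAgwADZ7BKT0AGA!wAg,UERSATd0ADD=wAgchdHAJaFQB7wBA5SwADO1FBywAvMuAS5RA/0AWCXA!xEU!AS0wADy,EAIwCdaqRqsBAHwIFDs0AP4BIvgRI9Yo8BVYYF-YM-GapQyyRbmQD9AALwPSAd0AFIVAeLNDDwADnTNM70AKfEEvjEa=YvwEAr0FQSQwAJ7XAEy0AEL+MPYwAJAswAnJBI;QATx0AKD,MAPwa3G:wAOKRMMYFHm0AHCP0BKj?wAEJgwAILXwAKDZMDQAdgAFoEU/cHN0AGTOwAD''),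
  (d11, d178, ''SDwAFAFwNGu=BAnwIwA!wDh0IBNk0AHVcRBQ0AFPHGHk0ADUXQntBDQwAJb.MMoYKkwAS3fE8?ABX0AGIBIC60BK8HADYGfvwADCuQE4Q?5QAvwC0cRQU-QH/Q!uASR0AHYsQAZwSdD/0AIMJEq=cNxEAnwDkF5wAmPkcdQcDCYWZ0AJT-BKt0ADLPMP/wAEXxEC0EBB0CvAuYDCYAXwEyBUwAeHpwAMBTwA4qIEAG0AIQ=RIOwAXCi0A6kj0AGg-EaBASEQB60AFPIER/cT?EglABw0AkBWwAHBSY1ec9IwADInwAdH?0AMKmAALwIwVNwAECQ0AEA50BNHpMA90DNbV0AEBUFfmM.bEZywADEN0AVAewHRFBwAXAE0Ad9ME4EBlyE/nFeKEADMPG0ALKCM=HE6rBnlMS1EIP0AHmVAN8BCIBV?MLP0AR3:FOdMfPEQ=AHdwAGdGMuSEBK0AFE!CR!AFQQ32EAqFGKQ=?ECNBEME4TMSbwAJAI0AE63A8GA3VEHmwAZ9QQtzQ7cBIzAZCBA!0AGyHECbwAJ''),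
  (d12, d177, ''wTRIz0AFZHMBxwAMc,EAGwUWx6wAGJrcvEAf.MD6F?kAo.cK8QPL0ADXvc/AEQ6EJpFBoFD2wAHRbBtDMDf0AD/TA;bEn!EK0YD50A2ChwAJWL0AHI?wAdw?QAPwA.24M09BA=0AHYx0AGrNAZ!QDoBDTwAbf:0AEWFcNbwAF!mAWJEOzF;7ASaEGc0AQsEFBHwBkCxF8xBOlFpqYGaQvWBdbAH.QccEANwAbAPwAUMyEd:FBM0AbD3wAQpIEA2wDkBqwAWK+F,lETCEMIMF/wAxqmBBT0Au;PQQc0AELNYAgwAUNgwAEFY0A4SEA7eABh0ADEQEb;FAfwAlHLwAHVYYzAQACwB7IzEGrB:PQZQAAB4Af9HAnTEvBIIvwAcssMGVMD4YDawBIgbwADZRAAsFDoFruBFtwAMX?QK70AOACwYJJ,ECA0AYFrYAX0BMQs0ALAlwA.Kd0AD=fQvZAIFwADqdRF5wAFCt0AjTnwAJWm0AFA?NQhBAB0BopNA7DAAewEpCtA.5EE-wBDy+QKMBaRMKOM6ZBVyA'')]"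
definition rows19_2 :: "(nat \<times> nat \<times> string) list" where "rows19_2 = [
  (d13, d176, ''A-wA8BYMAOc5BJBcYFR0AGFJwARBxwBZAF0B.RAI1?BG1wAFk8MG9MYQEHWcxXAF-EmeBoqYYb0AKCo0AqAQwB3AwxAEpTAglEHUYDZwADAjwAPADwBYuYAA60A21aNemFGC0AIhgMMzEi7EA-wD:TCA44EAY0ERDkwASQxANvBAJwC?PpB;nADdFixwAGWVEm?QEQwASJj0AJN=cGiEn5ApiArPFRV0AWMQ0AKY;0AHhkFB4MFu0AdI5AsINApwAQGG0ADUzQB60BRJVEH:QZDAuBUJJEPvwAFYFCDQFMRFz50ADjBwADBaYSTFmkBCs0A7nBIB:EM3Ac4BiGAoIFGj0AXYF0AFGBgAZwI7OFcILwAIJ6Qd1wAJS7MQQwATOxYmUMCa0AKBgcYOAVaQcsAE2wAehoEAP0A,AI0CRAh0ANM3wADDO0AHQBEFoEQLwAF1nF;nYAI0BHYxBAC0A7cSMBp0AElwAG4Q0INuLwAE69BTvEFdwAWIiQHsNl2AGNEojYH+wAKc:wAIL,QHSAc+YuDAUpwASajA''),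
  (d14, d175, ''iIAV2E/9EKd0AE?nADlEDBBXBwAFWAEmpEAWwHyQVACLwALg5wAD20QMFYAswGiF10AXAV0A51.A8.FBv0ANIFER8YTYAAJwnhUeQAU0AD,ZE;JE=HECOwARLGwANQAwAEGcwAbCRMGC0ANA/wAkyhAD?YjZdBbdHDcJcEO?Af8EBKwAlG7AVvEBPBJyQA;0BP0AQFNA=hBJmwAbJ-MJ3FI=0ADerEAG0Bb=0ADJBD4wArFIAp-EdBAAAkHINwAEb?E=AImg0AD3sAD,0AiNY0ALDMMK?EHaBURF+WEuAIAjwAtrqA2GEClwA=GJwAFO0RV0MBxwAjS0Bc4cI=ETV0AEI1wAU0BI;ocXEEBr0A0BMQZFBP/NTdAAqwAl=SAkMQ0JcE70AjQIcN8wAJ=oMTQQAHwAlIaE9vE+JQIG0AFW!AiXAQTFVQRCrwAcKx0ANFcMhlQKKwAFk0EADwDcJsEH6c4xQoXECMEACwAjO?MAP0AkCcROnE3iAa+MXbwAIAEwBXCsECYYYaBLfM''),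
  (d15, d174, ''S/0AEopER=YW.QCM0ADIfFAWwIWB/wAEM8FlyE0hApHFQLA/JwADA;wAVCRMC6wARtZAEWwAPC10AGAdwC2A;wCipRAazcCTQA0wAH05ENBQBMM7yErbEOUwADABwgGNyBKzCXxYJowAEyYECTFzrcaaEBh0BrbhB5xFAMwIPB-0CAXC0ADCj0AhIMEACwV0Ip0AK3,E9;EAKwN2fOAMaQ;aQBq0CLRu0AHSZAMUE!xAhXBVIQrUEVBwAEqaAJUFAGwO.E7wAMCBJF5E9CYDCQBKwAYMc0AJcsEijEO0YAAw,=DQBfeFCGEh!CBeBR;0ADiVQC=0AKN.EBwwArSFBNDCHccI/QljBhuMNzwAJe,Bj5MD10AQwRFF8wAK::EDZwATHF0ALEIQN3QSRMRaFtHQdmFFSwBKAQ0G?AY0CJrtRFy0AFj;wAFX4cSLd=lMmjAS:A-VAAo0AHPpwAE3fARnwAIE0wAhAY0AVAEwFjQhMzoFBnwAucMF:eNA-AZsMEHwBUH20AGnjQCzMFGAWoBRhQmENyP0AF''),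
  (d16, d173, ''F4wAS:mBhCQ:fBBWwA.DKwANlcEvdcxBAAOMafCBBwASxsF03QC,wAFMuGBjwAoAVwMJrTMJvcXzFRqFJ!EDi0AuAw0AUPiwAFI+cNGEdu0ADKxBCHNPMAD/AO.0AHA,wAwlsAEA0ATLoMwJEZVFWwAD!MlTMLRM1RECU0AjIWwADA4wCWZSEA9wAWmnAAVwIZGAMATwA?S4wAFjBMrUMM3AWfYs.EmeFDSwAFABwKmLzAApwA?CBFHNwAOXwAghMM2ME?wAgl3MCL0A6BJAETwALAIwFMA8wAeAfwA/SxRCq0AYNAAAVwG4Ev0AHXIQaZwAKABwd=V?E+qExd0AEN/xADJLwASh6FK4BMNEezEXsCF/wAEa0MB.wBW1gFFZAK4AObwAKGfE5tMJ5QMUEDdQKf0APDSEAZwUGG8FViMsAJTF0AGJ:C1iEPrGA!wAlivEe/E3;Y3kFKENhVwADP/wAHFYcKGwAIC6dAgwBhBYwAlSY0AE;iEYpE5iFAx0C9AiwAtYn0AFA-wALeeEWuFGnwAJ/9c+tBw.BRnB''),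
  (d17, d172, ''AvwHYmYQgMcNfAAAkLnE3CFcbQOGCL.wADLJADMwAdPrAPSA7SAG3wAICg0ADZsYW=AtBA92BK40ALFIAAFwA=pEEX4A?IENcQfMMBcwBkv4E2FMAI0BrcqwALFPYhQEAHwF2aQAHfEmWFB1EOPwAFjNATqQhJAHv0Ah,=AAHwJRa!YyiwADv7MJL0A2B:wAosTMAdwRQw.BAl0AkAD0BjMkwAEi,AADwE4PNAYeQNTBOdBFQQDh0AMFjFAvwAOQk0AEUsAA;wFEN;YpCAevE9IMSh0ADK7AyywADrWAC6CcpEJqwAI-wAZcEfMEAuwBcKvG/xFFs0AK/90ADF30AGFKGh?MoAMAIwBld6ERsBX/FZyAFXE=lBBQ0AbAbEACQDSACywAHFPAJB4AHT0FDA4AFD30AeC;wAeU1REk0ATA0QPWQ0pA3vENcY,jMIeEBJ0ATI2QGaYfRMAEwEwahBBaMZ-QGsAJk0AGuBE-QMI70ARFcRSkAU+0AFDZwAILfwAGRQwAHohccjQCicB3cHB0AG''),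
  (d18, d171, ''JH0AICJ0AHCVEPaQK+AC50AlE30APmBwADBAwCVAZQOqwAIUeGPE0AH+QAYFwAEAlwCcmnEmwF35QRc0AMAD0AJY8NViwAFZKAEBwAOd5EyxMHB4AE0Yc7EEGKcAAkEL0AFYnE0EAJBwAGhtBg,B8zQB.wAE0cFtmAAe0AYroQCg0AjK3MKuBe.FGxwAFRd0ADXIFz-Me:MU3FALwCHKe0AJ/vA4yAfMA2WB7;AczEa5AB;0A=;=EBRwAR+yMHnNp4MARwEy+CMB!wAJMh0AH.AFAr0B4s-EZ7AFX0AIhtBs/AQSwALU2cKV0AKUlERxEqGMhDFANFF.0AduhFAawHcICECVAXGRUfAFowAFkxM/AEi1AI3MGdGA00Ax!0MON0AFOUERDAa2N0EYD?MaLQH?FLZYIgFW-En,YWQ0AEBf0AK=9AOOFAAwBDOD0AJQ6MCrwANN4wAOBmwBaAZwC7Q8wADuXMN2wAHDNEc!QhMAHQBLswAUS6BJQwATA.EIhwAWb-RAAkrbEFuwARAQwC6AT0BPDp0AQXuY'')]"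
definition rows19_3 :: "(nat \<times> nat \<times> string) list" where "rows19_3 = [
  (d19, d170, ''I?B0PBy1BsAIupcAtwBeyRcrAUAAwAGiL0ADACw3LbCwALHKMOTwAKF0EUpYGaELdNbkAVvQCZF,BIxBITKcL?0ANZ:EwoBidAAqBb4NxpcEu0AIM?RED0AjJqAEU0AGldBECAAHwB22uETyMI-wADhXBAAwR-JPwAS4gEQYFBcEA3FY9F=kQ1OAD?0AjRYwAFFpwA9RFFT5ARXGCy0AE2yEANwE1QYwAGU8EIRcLHcfpckXAAfwCYn3QEkwAF8vQA00CeG.0AYLfB13ER3wADorEWIE:IM/TEx2FedM3NEQWcx6cTbCF/EW3wAQF4GA4wEAArwA3RKGJmYC80A5fFBwsABzAPGBDb0AFRMFVXCAFw4gALwNxCc0ATAAkO9wAFckEMuGLwAJcQKmAa0QvyQYWFjoQW7EBs0AwwKANnwAIAAwHmycERyYLJBSLBfWAADwHWAAw/qB?QAl0AMZQFBZ0ADwwBUjwADD=wAjFl0Ai7+QAAkALwr.AhAm?B3LEABweJkuBX00ADx3FJ/wAH''),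
  (d20, d169, ''HoEACwNPuGBAmYAAk/YYB2wAUJGQ=Agk0AEiEIWwARDPwAjMlEaWEwXEbcFCZ0ArHKwAQrXEEi0AFtnEBEwBEDIE+;BS8EAOwFY2CEYDwAMBcwAJYjBAxYBp0AyMEcJuYABwBC;DAWGM6fFA.wAVCL0Ah99Q36EKQ0AJJDB0;AQNAW-EO1wAOn10ADA9wAIElwAhFj0AEI1wAPS6ABF0BVAowCFCI0A:AW0AioiEJwA3BMoUwADK8dE1QAkwB!I70AMTsQMwNjwA0,QYpMgdEC?c+AE09AO4AEB4AJ2BgT/FJBIcWwAEe:YI3EBV0AGWlwAFEoBBM0APSAF3XEDC0AHCAF.nBDO0AHDrY=3YXY0ADA:wBWaSFMZEZ-MOhAu2ElAMDkYQXAMbMKHEGIcBk0AxdM0ADOswAMAlwAFM.0AEr+MQSwAFA70AEAvE0;YU.ci!MaOwADNc0AFJ70AKCuQCTc!JBGi0AOHj0ADIFwADEHNdAACqwAKkKAbRE/0MABw/;OKAA3wAEs9BKPcADcFoRZIF.EFP-E''),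
  (d21, d168, ''A!wBeAg0ANKN0AKGFQOPwAJFrQB2wAbH2wAaQ!FgrMNlALT0AFefFsGATTcUEFAAk+hcD70ATEVQsm0ADAmG-JECCwBPIZwAjFCYx2QBb0AS,HQd5EAw0AnE00ATm6AA!wA3Yu0ADGoRMd0ANnEAxzQMLwAD4/cA1wA9V4c2:ALIMY/AB/0ADD.RERGCzwA5m1MBZwAIUc0AOAXwAubIEFAGWV0AKjqwAFCHEPTBSFYlqAZTM8SFv+EmPED+EALwK1CMwAklCEYjYSZwADNDQE5wAEDDwA5vY0AEeewAEECYccAkdQCSMilECb0Ab3DEAbwDIFXMOgBA!BK:EgcEAiwA-ME0APFLwAOUbBCZQlwAAi0B+Lw0AEC.AujwAECuYaccPiwANaJwADJr0AMRrAUVAf6EA;wB.9wBDCQRDAlPQ56NkZMZjMH:cmRB!gMGDM0IA0+EQhwAM9HQAlwBSV+F5RAAD0AbJ5wAHYAQAzwAl:AIBPwCcfREC40AJgjwAE9lMEkE10F,YBwt0AEAHwDDUmwAEYjABlwA:Et1AF''),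
  (d22, d167, ''Gc0AFLJEBEwBRD20AQA90AeOhQRwcNJNC,wA0q5FeewAE1lEo-NMAGY7M;YAn9ED90AkLZAW0cN3MRHC:+EykEgZEnwMAA4EQcJQbtE-AQ.QEYz0ADBowAKaH0AGMx0ADWCFC:EVUYO;YD9wAqHs0AVB2AhMYfBcgxEWMAd3dDM0ARAEwcdDqwAUC0YE90AHmiEKCwAGBr0AEZeYeRQCBMAE0B.Bf0AODG0AR?kAy8QmWESKA9jEHfwAHJDEGvBAqwAKAg0AMZ0ETdF1dBJhcCUwBJN:ADoEyCBDbwAFS4QNaFOn0AFy;EJuQpTEweQBL0AE/AJENAEu0APBf0AdA?wAhAK0AIDXcL!B0pMAqwAFA.EAEwOFDuQ77BWqAAq0AhGlMA:wAaDA4AzAAkQMwAFEABPZ0AFKPB8hAJZYpjMJAEs.EbFwAFAmwBqAKwBiDPwA-PTMAywBpcBAesEnPAAJwFtYBwAGnqQCAwA6AqEcsAdXA7fQ!KQJ3wAGDUFLiAAH0ASktAF=1ADRZCOO0ALemAA0wAILfB''),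
  (d23, d166, ''VzQQ50ADACwBJAMwEFmrF2/FAY0A+A!FovFvfRK+AAGwAD1kEI/GAywC;AUwBeR5ADiBDdQK;E3+MjAEEdwAFFpcAW0AYJp0AVp2QZ=0AGoGABpwA,LP0AP/eYbiwAGQJAsvwADeNEfuQY7EWcMJQAcEEJjwALAA0FKA7wAf:5E1QAFmwAF+:EIqAI6wATCaMXNFP8wADgPcK+QANwBEBzwARu?QQ3wADNdYCYwAkg7EKoCCmCY5wALDqQTE0AFNqAG=wAGOmMPKEG4QYJBkSQCy0AHMDAQVBTZcW+cNAwAIAnwAIVP0AGIpQA80ALJ9BLBFBHBHsEFFBAR0A8Y5MCS0AOFgwAEOewAFKQEAJwBr,N0AGAwBDS0Ac83F:;BzMEAFwyx4?AUDRPA0AE:=EHgAT9c=lAf6c5REHJ0AFAV0DxpkANFQA,0AqAAktlAy:A8REJG0AJe?BI:FUbBAk0CGB0cTnM5aBOXAI5NAsF0FEq0MKKGByNMZwAFALwB,HA4ALG:AyxQFR0Agf:BAz0BCAAwW/!6B''),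
  (d24, d165, ''I/Gj4Ex1YYh0AIAt0BiCUAs6AMa0AP1eEA;NLqEFl0AFKtQu2EFcBAe0A.AjwLwAB8UqKfEAA0AsQ70ADODcZFBAa0AEddAVABBVEMkGBvwAjG0EmzBJLwAQIvAnZcFTFH?AD3QfwADG0Abq9MNbQPIwAHhxQIGMHIYL6MmmMZBctQAqqEAowBDEJ0AMgJ0ADDP0AGAwwAtP+AFn0AEh3E0QAE=AAiwAWd=FfaMA?NqbRAIwAWAicJpEU1EbSEE10AMnwFKvB2vBES0ARUzNA5wBwA+0AQA5wCh.WFNgwAPD90AEiocAZAGQMAQ0AzNp0AGaJwAKAx0ADikQuwYZLMK5cGA0AWD-wAPd1EapwADUjAC7YW+EvvAox0AES1E.AESWctnBAGwUGAAwZPARwALB6wAHAKwCuCL0BHT-QI?F-xABu0BAc;wADJKQA;0AGtgAhWQAw0BAn5ARjEUC0ADJ1wAEKHwAJkYF+/FLqBs/BaW0ANa,FFLwAHAr0B5H!0AHqcFvgwADHb0AUEpwAIAAkMU0APCr0AXTVQ:GQBuwAE'')]"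
definition rows19_4 :: "(nat \<times> nat \<times> string) list" where "rows19_4 = [
  (d25, d164, ''PkQL+0AHB,wBBAd0BaOC0AEjGM;6BEowADK:EFOwAnBmwADBH0AJLtFxFQBb0A?DxANGAV/ELBwAGEBQNL0ANADwX?CdwAZBk0AGftwAD!4BdBFCf0AGB70AFBI0AjJ6ABaEnGEe4BA30A9F:BHSwADFtQRVEIoEDvwAG-:AmnEZFFMeFj;B0QEA3wAbLH0AHBf0AaN=FfiMAMwEd,RQXBQi-BvME!nEctwADxyAA2AzTEPSAHjFA2wFeBR0AVFV0AHV?wAG!WcStA8?MABwGqAAw!2HS0AKHUwATCX0AJAYwBPEcwANBC0A;Dy0AFbGMFQwASAWwEVH2Y?VEA0wAsrmYLO0AGU0Ns=0ADCdwAvNhQEd0AEOgABEwAfDWYFUwALj/wADtYQZ6ASYcLXE1pBB=wAFSj0ADckAJsAGl0AahGBFxEMawAVAu0AbnDMiJM-:YCuwAqUaAAI0API.0AFd5MN3AvyACkwBPH3BMCMT3EjmAA!0ApAKwL,H-wAYF30AGAvwAHxyYFL0AMDLQy=QLuwAEoN0AGfWEA5wC9vYEBlYDYwAEEpwAuGjwAIAT0Bd''),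
  (d26, d163, ''OgGGpYAAkMi0AGAq0AFQJNEcc-HQAJwAGAzwA617E2/ECc0AHp9FAr0CF,iQBU0Ck;bABTwBdNSwANH,EAcEC60AwYrwAJ+XAhY0AEBUwAdWH0ALbd0AG0DALDwAhS?AAj0BNADwAVXiCcz0AKsEF7;YAfwDTIiwAFilEJ,EgfBFGEmUwAE+VEPfEAN0BgATwA,Fw0ALCTQnkMBrwAnEm0AF3!AD=0ALAZFVq0AFs6MJvAMu0AMBnEPSFWiQGp0AESMwAOEL0AbC,0AdO/AZHFANwC-hEEZSBgWADx0AI10BEi0AfAvwATbUwAHcwABxET3YA=0BtvpMN/0AGB,0AOYQ0APEuRhLFJo0AV-7FAAk!-BAD0AMUNFbKwAFDxAhFQYCFAbwEoI2EAFwVCNUwAFqAY+vA3h0ADS4E5cE0tEbVEB30AtwwBC00AFA:0ApJJ0APk7ATIFA80A/BpwA/3/EAAkAYwGFAsACy0AqC/CRcAKoQAGwR-F8EAEwBQAZcK4MAXc1gwAD1BMAcwASKUECSY:4EEZwAEh6cDdwAmL8QH=GV8wADCQ0Bu''),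
  (d27, d162, ''kKELRwADQTEVWMHz0APMWwALB-wA:H90AP0NBAdwTMyREIAwADJiQNYMAAwA8IIFMuwAPGjcqcFD7cK20ALBC0A=h;wAD!RE7YB;2EA!EJG0AEyFMXvcM;wAKWU0AEN60AGrQAeuAFHwANBXFBGwADBUwA;FlwAFA90AmZwYnEwAEJB4AM0.AukcckNA;0AlAAkBq0A63vFAlFCM0AjAAwAEAh0A1IxwAEZ+EAY0AII!wASIjFkLFCtRj9FWR0ALD!AOxCNg0AGN?cBBICLwAmB60Bc?,Ay7FFtQJREI,0APKVYGJAU00AOCzFD30AFPcYXRcWABpVAwjABF0AWAkYV9Qe7FFB0AL62ExuBYdwAFDtwATI6AyZQSTYABgAiwA0ACwbNPrwAEFj0AGPucCJMT;FR1CAQwATAnQRiwAEQFFB4wA9LGwAHZ8Ahl0AHCdMBz0ApqkNPewAFQ+A+mBGmBHywANAOwGSBGwAMHcEGq0AMqJAB8YALwqFAA8L;FKAeDce5FcN0AFd4Adp0AFOGMdP0AElgNCc0AEm+QUdwAFFLwADLn0AGpVE''),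
  (d28, d161, ''C2FDFc54AMtBd9Y74EK/0AEAR0C9AJwCkLy0AHN+cfUQCP0AGAt0AHy7wAEBqwAJIL0ATVFMAswBG+vYEBFAdwApqcEBQwA0Hk0AdNkQ:+M:rA4!ADd0AUAHwi8QFcJXMKGQDOMB=wAOmhEAYwAQAy0APR8EqGF9eQucAD=BJD0AKRxAhuEAEwGVt,MADw6WGOQSjEA5wAFOAJ:8QA3wAvZ-AATwE7biAANwAsF=MAGwEBLnwAGC2BAd0DQrJdUzQELwAMAAwbaD0wAGAf0AaDQCR+AO3A4/EE2wALAo0ASd9AJg0AI2gEAlwAEl1A!WAIJADHwAcFtwAE4/AHZ0AEWf0AEb?AQkwADEq0AEOpEx7EHCEHVwAEO6wADSBwAG;nAKzCC,0AkCF0AF8JAX.AALwDTQH0AGhtA4=BkjEJowAGAAk:DAE=wAIANwJhL50ADC8GAmwALr8EVLQJZAsUQLFMDS0AXHVwAhda0AG+eEIxwAEtZBmdBZNMD-0AJNbEE4wADJ9wADM0wADA40BR/GEAYwMtghMNSYJlBpkBuWECxYI/QCqwAE''),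
  (d29, d160, ''CQwA5CGQDL0AYRIAE.ADwcJ5wAeQ!cJzwAiB.0AKL1Qr4QhYMNy0AE3.AOwFA=wADDPwAEL6wAEJBJFWE8nAIfBDOMq9QBhwBsWkEHJwAKtFFBGwADM7EUKECs0ANB.wAIYvMIs0Adc?AC1FddEv8ESOwAEh!Eo.E?HAAG0AE5N0ADHL0AgxeEBqwAIBf0AP3QAzqAjSAADw:YDV0ASndBzUED-0AHA/wBXNiwAFOEEjrAbtYOfAaBEDx0AzjUcofEdHYJ.Cy5cjlQF4wAEvaAEzQhYRC9wAVf+AQmAr+MGdwAGIcEc,FUpEJC0AHGSwAFLiwAG8IAA2Bx!NnyM=lAAQ0DIDIwAOM3AZLMJNcNPwAO?OACi0AD7fAAswBKgYcAKwDZET0ARAx0AkEYwAFKD0AHY/EW7ESeEHMEVOwAFAHwCDIzEPzMMqAAl0AL4/MPa0ADFFNO1QBNwAQTBAyYA4kQzbQC5wAGluEUjMBY0AeAvcA70A8K+AR-cuzQanFN0BdlAjSAloBf.MC50AOMLYrIALyc''),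
  (d30, d159, ''wsRHA4ADlwAIgwAHA?wBIAVwCXTUEjDAihQlPwADUgEP+0AELdQaVBL.0ADPlERZFh3AP?wAFUgMcaEviAS=0AEAU0BlCPMBsEu+Ax7QH+0AM29Rh/FnmMAkcJ+0AH?IFBn0AEBOwCLpNMyYYfawAECjwAJS+0AKz;0ADouAAkwA1C5cC?0AQvxBhcQCnwBcAF0AZGb0AcAAwFzJcwAGyuwAEABwttsEBDv0AoNZwADK=EIDwAFaJAGZY=oAv4QgtAtsAA!wAIJYwAVPBMG1B2-BMyQbT0ADRNAuSAODQ:0AQ=YICwADEGwAH0PAD!AfoE;YFALQDMwAf7;ECQcrjN3QAAAwAEE4EH1FX;EQpwAETDE/dBNXBAb0ApACwJ.b6FMlEcDBqNEAtFq?FVVwAKN;wAGmZAKxAGMwAGC?wAcm+EBg0AJbBBykAG0A+;B=TAC+Qw-FHW0AQk:Aa9EQrcilMlfAApwAqDBAI/wAFxvA8dAZ1AI/wAHKlA+zFcScDDGNU0AFDpwAZ.!AmdQ9EA-7A8YM'')]"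
definition rows19_5 :: "(nat \<times> nat \<times> string) list" where "rows19_5 = [
  (d31, d158, ''C3wAE:tFEOwA2RtQFCMj!MeEFCE0ANEywAEACwC9Ax0B9BawAHN1EAg0A:8UExQQeDMXXBCawDfBd0Aih;AAEG=kQHvwAOQqEpFEHrBOQFAHwAU-nA5sEk2BPbA0BQa!AX9wADx=E9tMAFwG8BgEkhE2PAA+wCFzsMIg0ADEkwAPrIBABwaUIU0AGL8wAFAdwAOHKEJVQEQAr;BAdwECWFEWFEBBwAwdAZHWwAHagFJREAa0B7ZZAwWYA.0BM=xArSEoKEXAQFgwA=EA0AWFC0Aj3mEMy0ARGx0AFTn0AHMqAJ10AWZtBZP0AIxpABIwCc=tE!uMfZEY0AA80BUB80CPdrMXAwAGO3E/PAAFwNrHKwAH4qBBF0ADKwBVWQEZ0AT!-ME;wAVIMwAFBe0BvIOwAFAzwAHp+BBc0AJFlEEMAD+Q7!AJ7wANANwA4aOEdPMijcpiABhEN8AM2Qa0wAGgBAg5BSVBzrFAl0ANpgAR/czwBABwM:g1AH10AGC/wAZJnMHbEH20AnTKFHrBP.FKXwAFh9BeZYDGwAEFhwAP''),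
  (d32, d157, ''88FDU0AFAVwEr;0FQE0AGwccSWwADl30AEIfA;FBDRFk9MLfYKNNO=ENEEBf0AHTiAAK0AMZTQD+dmVQDVQAVwAqroMICwADyqEYDQqDMF=0AFC5wAMPIdAdwAEAY0AxH0wALK,AzrMITEEgGNa0AEF.MFZAH1wANKPcWmExlYBIwA6VwA4AcrMEimF/2AIcYCEE!xEWB0AHo40ADK/wAFG:wAGvVQUCMQLQUPEC+0Atf=MV+QrIEOxMAwwB:!wEE-Q;PEERE45YEuFC6wAFAtwD3MRACGwAsEtQAB8A-FU0AL,5AEQ0Ab2aFLfAJB4AUdLYelBK4QFKB:3EbyAcHwAEh30AEDVwAI!SQ?aY6OAby0AEMtABe0ANArwBLD/GAz0AFApwAVH10AJsiAAi0AGYmwAD0HAtmACYwAEFxQkvQEf0AFt+AnGECSwAtAAkAUwXVH.wAHOw0AEs!BT00ADB-wALAMwEV/DBAewAPDkcPHQBawBNjEMHt0AFF2EG=AJ!wAHDDAahEs3Q2fMAFwBlguEepwAFJIEA9C''),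
  (d33, d156, ''IO0AHH,Q-oFS2ABnwA.Q8wAFASwAxOy0ADaTMACwL1PaEOrEWcwAICQwAUF,wAHN-EDXwASFf0AMAHwBJEA0AEANwFZPS0ADWEY8lAi0AAP0CpQkc2IAA90AEAHwKGRoERxAAIwB7AI0Aa:oECqAIswAYVcEA!B2zAg?BAJwLuCh0AEBMwADDTFAEwQ7Z!YHXBKtCSXBC7cGB0ADB7QyfALZwAF-8Q4AAZ+BepMMFBBFwAQQ7EB70AdAUEAn0AFBcBA/wIE4YACBwAEAbwAiIk0AL2kFEC0AKP3ckSADC0AEE/wA/AbwAvA!cpxAooQBU0BhAEwAOSLYAs0AHAt0AIw5EOFBHy0ADeORHPQgdcHZwAMAn0ASAAkFNwAGJM0AFALwFQO:BCcwAMGlFEcwAQijYHRQdnEqpESlBAGwYCHowAOegBMoE8DAS=0ADPDEBMwAM;BAJ2EcdEAewEfFSBB.wAaCtEHqwARMHcb?BTJFNacd6Y2bFmwAF?AI-wAEBpQAAkcxAY3AI8wAFILAE0AnwEj9EAfwA0,ZQHoEAd0AlN?Y''),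
  (d34, d155, ''B7wATUiMHcGJHCDtwAOG-0AOIr0AGEBIBc0BMMzMR-MBw0Azl+MMGwAED20AbC.wAfBtYHJAPMYM4M/KBErwAwP=0AHL!wAWXGwAFoxwAEHd0AFCcwAMaW0AFUBAAV0AHgWYCl0APJQcs0EAAwOGA?0A9qpQP?0AGDT0Ae3jABHwAFElYJ,M2AMCH0AVBBwBFBUYqOEQg0AHC!0ARlSQR=YP!EEsMMaEdXQd0Ba3MC;0AD3ywADAmwCbABwyEh;ACe0ALfpB4BEwOAOXcAswA8EGQL0BJvAGxYU6EA7wAKG2ccFYAHwIXk3MBp0AGmkcPYcFUEVPEeQAoMAe=wADJaAk+YArwDSHz0ADAmwD9vDFvyALA0AFHJ0AEtGBAHwCpDD0AcG-wAaHmwALKE0AFB1EZUFABwyOG,MKMc8pFD,0ASI;RiyMF1wAtAW0AbDxwAI1ZRW1EA40B8,QEdCFAt0B?H-BN,AENwAHqKMIHEbFAAFwAGCTBT7ANd0AE2YFPnRAfwAXE3YAAkA1wC/r/ANyEqmA3wEMaAzNASQMAAk!KE''),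
  (d35, d154, ''Dw0ALPbEPuQTSAI-EDEEy2ELU0ADYmwADAw0AJZFAGl0ADF4AAFwBWAXMBCQ+BUdMBXAQGWAA3EbdwAEAGwF15wNBLwADTj0ADbeQcqFPFM8rEqG0ADM!AAm0B0BKwBIAwwAo;HAERwAEAWNMLwAJZeF41MDhwAFAhwC9OVwADe!0AEWuwAEt3cz1E6pNcbBydBkUFA.0BA-HY-YEAOFApwH!AZwBkaFMTyYL/MlBE99AviQCFwAMMpwAJCBwAZxKAEkwAJBvwAGCvwAED3AEFYU;QX:QK3wAKd?EEGwA!UBEM!wADNtATAASMAIyYtqFXIMa1FFWMAU0ADAAkHvEAN0BcAKwAre5B3;cTPYNRAAXwGNCbwAJqzMxAAg,BB=wAgDNYBhwBqSJBeEQtkABk0AQUeQTBFP;MawAO+AI/RLaMxBIygBKywAGNPwAPB,wAEndEUdAwBJQ;YzSQ-HAD+0AYDbAADwBiA4cQtMA,0AJKqGAywDa;rB=20AEP=wAJP7wAJEO0ALADw1vlbEt9AAYED.cJIwAD''),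
  (d36, d153, ''B:0ADc6ANcwAMAvcLnwAIC;wAQF,ECkQHv0AgAIwksASwGDBn0Amo+EPQAVa0AECBwAFOZwAGIHZW8BATwB+AFwCJAB8I!SoEWFEFlAPvBA0wA=ANQ+CFM-0AEVLEAHwTxcsAKXBoABM-0ADo4Q2-AANwr!NRwADWsAeEEBdcb?MCpwADBB4ASACwqtJYwAEM?YrEFAO0AFB,wBCBFQA2QDs0AEtJAqtQGKEbz0AKJDABKM+nEHVwARLRYC4cHWAWkRLBwAMG:wAItnE2wE?7AEAAyZ0AIDHwAH,KFc/wADCiwAOI70AHGQEAAkmKENQ0ALAAkjDBAywCiK4wADA,wDRIncbGMR=QWxAQKYXHwADI7QF10AIAcBmnAFp0AFA.wAXX=QsKAK;ETJEaqQACwAHHBYAEwFcfjA7rAS-OAxwDSCy0ASc+FI2MBX0ADCi0AGlmQ46Bt5ABZAAbwEZoEFlKcpVM0yFgzQ9s0AD5qAGf0APxyAkxMMdABmwALEzwAFw:A+:Q1zARTECSwAKD5wAN;lFrUEAgwATfnBlaB'')]"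
definition rows19_6 :: "(nat \<times> nat \<times> string) list" where "rows19_6 = [
  (d37, d152, ''AuwAKOiQGl0AGrqBC2FkaFA?wAQSE0AE1dBK!0AQAvwFFiaNANwAHJtwAMGBcLpwAFEyczrEYoAE=wAHBt0ALqxwAEmuMCYwAEAHwAzBJwAK13E54FB-0ASIqc,UAB=YAfwRrIHMnWAL,wAFdHBYUMK4EB,0AHH70AHu1EiO0ADEtwANc8Fo:ESvCK4wAEIxMKtEJKGt?QA90ANyRAb9AkEFFqYAAk5pEHXAJmwAHB,0AyM7FE40ALKKER60AEn2wADC40ADY?EzvB=zA-iFpMBM0MF3FK-MSVMR6EAAkADw;Xnl0AE5SMZRAsWAAHcN5MbiwAEDHwAMA,wFVVxNc/BXVEH9wAYCMwAMEC0AIJsMAVwEca1NZp0AFntwAFuxMAXwJhI70ARLMAcWYQ=EfFM7qQTIACG0AHJr0AEAQwApxsAHrwAFB00AD6dMLTwALJ0BEdMGZ0AJpLEBfwBFy?MDnEeNA1iMdycb9YSWwAJauAwPAfXZa1M+RABPYV/NGaABg0ATnt0ADF50AH9AwAEFoElj0ADAk0HLAawDNAnwDV''),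
  (d38, d151, ''C;0A,B/0AFFhwADYUEE-AIbZN:QCfwAUAxwBxHgwALEgwAHfeFAKwAaIJYQONt+EHfwAIAs0AF5KAL!0ADpjMMB0ASCWQYkFBGwDcUKMKwEBJNUIEEWYRfFBN0A/AUAWBAkSBGxwAtM=EGoQBCAAIwD,B=0AYlcAO/wAIESxAEGuZwAFhucj3wADArA?sEF!wAYiLwADANwHLK7wAEAlwFjmDAAK0AjHc0ADx9BFgwAnCtwAsLJR1FFYJAATwAQA=1ADEGc49RGzwAENeEJOBAmwAINkEClYEVwADSXEqxAE-YIbBAqBHdBBowAb4pAVvEH;APOcCbMU90ADCuMGe0ADNDCv:MBBwAIrSBkgFBA0C.AbwDDJnM-rEvPEG8QbU0AHCN0AWv3BX7F8tFTcEBxYAY0B92HAAgwAHAXwDRnfcatAZWEDMQ3EABP0AOAgwAHUbBlhFB!YK;0AGl5E-YBND0AMAKMAfwA2UZQ.0AN2QdBUAYwHUN6wAKQk0AE9bcI?0AHt.FhfYt:A6!AeG0AD?OEb=AN;wAEnzA''),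
  (d39, d150, ''LA4AEXI0AGUDB7hEHxAaAUUwwAM2kFCEwADbMF;cAAQwAy.cQ;KADucAvYoTEbQFTqRGGwAOJxGCNwADLNBVjANKwAGV-wAFYqFAIwAFNI0AJLUQblEBuwArL0ESyEAF0A,/WEwZBALwK7pJQBj0AwXycDU0AF,!EGkwAHMjEFDwAICu0ANOYMo9EvpQG+wAFDDcIbRwoAo4AAkwF,AJwFXVEBGfQRwQT,AH3BEz0ATWo0AEg0AADwAGAo0A3RrMHR0Am-8FAm0AL+qBJa0APOCASQAS6BR/cCD0AFKvFY.APRAC/wAESFwADm4FXt0ADISBOtME;0AV/YQaEFAA8E1JuAAOwL:F80AL0iBJY0AIksEZUBO0Yy2A9HcEINLyA1RBF!0A0DH0AGtKEAYwJdi-Az60AEe4Ft1B26AjJQMEF8HAg9MmXAAE0AoK9Fd/AAt0ApuvQAZ0Cqb.EeJEf0wAFbtAkjEJ0FA+MM0AtRFBh0A-GCE7-QACwX/31BbYBBZwAZAp0BKAmwGJNAASbQapcG2wAD''),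
  (d40, d149, ''SYQE;R9CEaswAEXfEH10AOUwwAGeaQU1MocCt4MEYwAD9sFAowFiGAFoIB5cMb2wAE+,EEsQOAEANcaxwAGOFETIwAFpfFKX0AiAmwBCA?0AJAAkIIwAGiRwAHp/EAewADg8wAEV4Ef.ABF0AqA3wALEowAew2QNxBCv0ADD0CAkwCDuVA.W0AHD9wAOJuRVGAXfACT0AG2R0ADGABSzAMLADX0BwLbwALRpM+hFc40ADbNY9AEANwAVL+MA=0AEK0FG:AT=E+MASMMmXFM20ANCA4AHkaFKeM87Am+EB-0AKpkQA3A08MEwQGLwAEAxcU=MC2wADUuwAKx5MAABcZEAJwF7FeAVFEUuMpxEB4wA1AAwg.FJwADXyMAc0ApBF0AGGjABp0ADASwF1Ae0AlYWAAAwKMA20CE9IAJ9NEO0Ag-uFEKwAHgOwAD7UFFtATEwAQOlFpoM!gEzaEAmwDyE-ARDQCkwAbXnBi8AbzEV7EZaBLvA1OAhcwAIgpBGZwAIAC0AjdWBU/E8gFMhCKzGBzwD-Be0GsQ=MBJM''),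
  (d41, d148, ''FtNTbcA=0AEH5Y!JEBEMAGwCP6fEw-BEa0AH!OAA.wBQBUwB/DF0AF5BA+6EadYATwBWoEcQ4BGOYBJwAecPMa+Fg9EiIEHc0AGMrdQuAI7BAXwB+BQ0AHQeMQrQ7GEY=wAHJD0AICu0AS-aMJ?0AOtKFJVwARiTwAHp4EDx0AE7NBUlQG+ECU0ALCqBkiFHGEAAkBuQT9wAHAM0Hkf;NYMCaQcH10AeQvGAbMV=cVfMAAkxJQRIwAJEqAicMisEgsEczE2PAARwGGHFEDOwAb/zAkTMYxFg6YPEwAFFh0AGLTQZPATvMEJEcFEWvAiFEDUwAJ!mBA?wAmEjQGOAh7AABwaXFUwATHNAR=0AGzfEoeEC30AnA3EAAwC!GY0ALiLE22EhZE=!APF0ADnfwAECEwAUAWwADFIwAGADwD1rdQoMCAiwBPB+wA?QcAjxACLwANL7ECZCULQR.BrmADT0AHeCAR+ErsBiVFV:YABwPFg=R;GAA+wAGIFRTqwAECu0AECgCAowCzMzwAJE-wAOQIQdfM''),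
  (d42, d147, ''MBJ4yEBcc/:ADOwAkHQCJ+YGB0ATPxAkIBEn0AWTPMD4ALCFg?BGxA-;wAEfFFdWAJHQiRAuNQNwAYZABbwAFHbwAGV0wAHg:wAEX2AGBwAEn7ECNwAZOn0ASq=QMRAY?ctjBlIE;AMxAAAE0B+akQBi0BHD30AFm?AD4FCawAKG.QABwB+flMB8wALJoMLENEBEP5BAqNM-wAGEeQGZEM+wAMCXE;oEB,0AjfvEMuQT/E!uES6A9mBHIGdAEAbwGYAAktzM,oR:9AF2EC;0BCB0BDswAFBBIFAYkSAD.0ARA0wDMkCGAS0AdYpE2GFHqMXfwAEFEABQ0AKjaEFZwAKAMcc0A:tBm6AbqwADoWFAG0BvWPECE0BCFh0AMA9wEdoMQcFCAXwCH+MEG.YAyAsPAB.wAPSywAMwUEHfcJ0FN?wADLBB2GE2kFQ90AKJEYIyAPL0AFtTYi7YFKNOBAFjMC/wB9E/wASIscl!G==YR90ADbzAZ4FBiwAdS/AK.ER9AbawAEZnEAJQ'')]"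
definition rows19_7 :: "(nat \<times> nat \<times> string) list" where "rows19_7 = [
  (d43, d146, ''AwMDgwAFAEwGEglYZuAbFYAUwHXakFUvAAIwASr.0AFkRcF70AENPAAAwEWDj0ASAC0AgAA4ALBb0AQDT0BBDBwATFPB05QAD0ARBhAPHEI7QAf0BgkEYLQAPBIA:YVjcgqGhXcA/wAhLuQAFwDCPaQhbFFPwAPCSGHl0ADAnwAoIeAcuwAF+8AA80AiX4QFfwAWI!YAywMqKmwAEAFwx8AB0GyF-0AE;iA6bENt0AVRi0AIppM4WQO5YZmBpfBFcBa3Y-JBm=MDdAG6cj/cLqAX:AluEH,wAEZ2wAE+!0ADAgwBvhRQWZQhpAl-A5xFIcMkQAS0AFWF!KF7CAGpGnHAtCQF10ADNlRM-wAFA70AF5kAyIA24AKG0AGQ2Q6RBBWwA6FmYIowAS2CcvIQK,0ADWmMHmARaAIA4ADwZBT.wAERcMRuwADBA4ADObAA2APYGhcAX30AGMPACR0AKg8AIPECU0AFTwMOsFAKwDVJq0AEydEDKMFg0AQpLAFJwAJFWwAIH1AJ!Age0AEGK0AHFfQe1MbtcQQF''),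
  (d44, d145, ''8+FiDA4tFU3BmKBNT0AEYAgCAwAbP9wAEA?0AYRdQRVAeEwADaTMDhBAJwD8EdYBg0AVDoMMFYN!M+DANJMA3wBnABwAKvGBkwMddEjlFE0Y;5QCAU:=YAywCo/yAAxcBFwA6TaCibAAAkO4YKf0AFT8MAE8DCLrGK3EBKE2RAP1EGnMDAEAzwC2AAk3RQjoEDu0AKTv0AFSvEY:AA;wCRAX0AD,yECWYFtMCB4ApFX0AMFU0ARoOEAAkAO0AMA3EvgFI0NOTAP/NhsECTMITE-tEA4wAGP!YTfFQ?EAQwIVKvEFwcEvEx?E4WEp=ABNwATAX0BMKH0AGJpwAUSQBL5AALwCnhp0AEEB4AaC4wAEDvwAGFGMGBwAOC/cajGHJAABwDOFRwAIZXwAFNkEIi0AEBp0AEsfcBuAAa0AFd4ROqEe+AJTwAD.AU/5ALhRVkE.YcN20AGAJwDBIZwADDXYFewAEMJ0AK10ABxwAiVj0AHD3BACwB0b=CBswAtMeGNo0APfQAk/FJcBFONZ/MBFwC.=aA''),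
  (d45, d144, ''D7FgRAAz0BG:RBqaFAu0At8.F-cA5cA1aEl:Au,MGWEnZEB9wAldfQnRANL0AEkDAMAAPyYH:cOFwADH?0AEatMKq0AJ7+ENiwAFJQ0AQbmcQcQDu0AEOsGYiAWhwADKiEEfMCi0AFFpwANNLF5TAwJQdKAB10BPFSFA20DVCvwA1Y=AIDBDvQaBER?0AEPhBa7AAZwARibwAFGkABV0AjSkQQVEMhA=9NSWEC9wAnMAwAHk8EAMwAgw3ARyMCe0AExpQg1EbNEBP0AFTiBB5QJHMI50AEtZBTnYOHcB0wAGNdFAl0BrLfAHzBsKcd6Y/6BCewASqNN1OAAE8B,a+N/fAACwy7pcAGvYCHwA/BGwBjA6wBOBPFDu0AQSRNzbASTwAEC:wAN1bAeGEH;0AHF5QJN0AJJ90AEcsFb.wAHYsEJ/wAFt/FAv0AJPrwAFkBECKMJi0AGCWAW+wADA=wC7FHMLvM=BJA+wB/CVwAISc0AEAAkZmE?3Q5oFAS0A4LDwAZFc0AMsdM+awAE8AANHA2EwADlcMZLQ''),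
  (d46, d143, ''BcwAD9:QNaFDKQEPQTVcHm0AGRhMApwAfVnAHBBADwB9FDE,0EDJwAeCtwBAA1GCpY?eABb0A5DC0AFL/A-bFA1wCK7oEEiAFAwAMZswADKawAKAzwB8EW0AQK5CHlcz1AH70AE-oF:GBGNcHlwAPpuAzOAAEwA:9UEApGBf0AFA1wCWN1wAFcmQjhYf+BBU0ADlLAFNwAGDgwADCBAdzRA3wAFB2wAKOvwAbBHBGD0ALrgBQMALicClFD/0AJAAkHTwAJdEQzrE:pQA-wAGB.wArS=AGqFQ=FVPYEDwAGJH0AKq/EFKSAa0CVAAw:v7fc;uEf+NAewGTbCBBtwAE2QMlzwADA7MCZCO2wAM0-BH?wAIFeQOCE1aNC4wAD5-wAEFDEY,FE40AFC,AXiEEwwA0AIwb?h/ESYAE2ECV0AEkkAWpMJ3EXFM46MTAZUnwAEp=AOP0ADvFYbzMH9wAHKQABdRpBAVNEYv0AFk:QuIBx3FH.AADwP5aHYAsQFwY0fFqkAHeQCvEDXwAJmXEf3BDYAIr0AI''),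
  (d47, d142, ''ZkEoOYJP0AXH70AWI.AB=wAIkWYv-QEC0AWAHwDrGBg:-EAKweFU2AAvwAECUwAHA.0ANA,wAHCNwAxB-0AZX4wADkkdpBJaWQAAw?JRoBBEwANXDMAHwGePkc;WACUQRdBKmwAHAvBB!0AgEp0AVH:MF!wAUGJ0AeDBETuAWDEN+0AMQXwAIY-EXmFLXNczELkAA!EaNAZawADJRALO0AGA,wAFLgwAchkFJa1ADhp0AEXvwADGpF87AInwA-BGwAeM3YuVYDXAJyBAb0ARNIQzSAp0M?GQIMMgkM;hAb8Q?/Ek3wADK9MJE0AEasEEbwAQL8BHnYCGM.fEFP0AUGw0A0AH0ClEOwAIfodApCnyEKLND,0AJD!YFxwAGAl0AzP50AEA=ME20ALqyEZCM2NEUABHK0AI67Md;wAFAHwTnERwAIVbMyjELiMJ90AFE70AQBmwAIBi0AFayAFU0AWBnAG;0AGT5cFcwADFPMY?QXmBA30AMfVEuNQFeCM8wAECMwAKl8AabQzIwADRFFoWESBAc7MsoAXUcAPwC,UaAY9B''),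
  (d48, d141, ''TMQ+WEK=YLEQFsZO7ApUFM1QpuAH?wAflxFBdwASjKE7EFNrQx?ARCGAwwJZAGwJCCZMBtwAYD3wAXSq0AE5IclrECLYCj0AQN+QwLENuF2dE0IED+QIJ0ADJ/0AIIoFzYAB1QMtGAM0BAOSQVlwAFM+MGKcrxFF/cJLAifCU1Fl=FAu0BnAFwBLAA8SyCK0AHhV0ADGI0ADN?wAIAK0CkL10AGG:FA=QKCR+3cCA0AEkLESsRNfwAKucAC80ALh:AD?wAMMAwAHpIYLB4AJ7HAEDEErA3.MhAEOpECW0AuAIwOdFQFP.Ad50ADHAF56B2QAmaMltcVrBt-EBA4AcAtwAdaJAAxwC;ZKwAD2LFG;0AUSFAAJ0A9AKwLRC2FAqwAFZ8AIv0ALWqEhSAAU0AqAA0AFtuEpEEh0FSGEAAwxIWVFqsQD!FLFwADAdwDa7EMHpNAWwCB8UMDHwAEUuQAfcBWEAywALNFMO2MYgE;WAC,cv/B/ZAHtwAO=:QAXwADsGQTHA3wEJ.GGyYT7MNLM'')]"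
definition rows19_8 :: "(nat \<times> nat \<times> string) list" where "rows19_8 = [
  (d49, d140, ''EnBAXwARj?0ADAC0AEHjwAKFFEG90ADcdA=CwAFWoFxmAK=A0PAWQAqwcHvwAD2oEhMAA50BDBoAF.0AEI5FNNwAFgX0ADw,FA3wA:PiYjEEeNMBywBMG1EDlMB8cW7clUwAFq4BSkQkSAAowAILZ0ASLf0ARAowEa06ch0EAZwBMuzFewFgREO/EB4wAD!=BBPwAfF,wAkAE0BXPr0AECnFAM0DRKW0ADplABmwAYkwFbUwAFIPE2bANVAQcEBiwAZAUwCvYuAI3wAJICADLEG=0ADVyMq=EADwBPIiRXRAVTwADBa0BWcnYAvM2uAxdEWeF.2BB:0CDO8REjcLjwAEBKwAbn4ATfM;MEp=AL:AACwCWD,cmQAkZAEyEBSMCyFSb0AFwNADAwAIAdMADwCcGFwARWxAjiMcMwAFAp0AoAI0AWDY0BOQ2MKHcIWBnw0AEEgwAcQVQWhQpiAo!QAAwjANZEJP0AFCa0A-AewA+VwwAGEU0AEc-cAAkiyBExcrIACy0AbVlAEZAa-0AH+hAAB4AdINBYEEWsEAAk''),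
  (d50, d139, ''BH0AFAowAMZeEIPQfEQAs0CMfiwAFADwNyFaFv4BcSGRuYpnBABKnH0AEXjwADMwA9-E-QAj3EAwwBEe;BaBNAAkv4RBD0AYF;MHswAIRGGCP0B5SYYRAAM+AIjQF50AObQF=zECJ0AIOtwAMch0AJQiNf3cQ6BHHEA;wADPOMCGwAqNUAA40BKVAQCI0AUEu0AENxYU;wAFA-wCrEo0Aio7A4qE9JFAp0Bd-rEI5B4EBJT0AHVYB.c0AEipED,ATKFBTA.2EB9wAXMbwAEQLwADUscELwAGi?QfQFs/BLNwAEM;QrDYG;0AHGLE2,E;QMvEwADOhAIrwAUAiwBg1jMDJwAPd1QD.FlzEAfwAjB80BAGcAtJA/iE=KQBswDFrl0AGSYAv7QL20ANWKwAGFCwAFAgwD2,4Ad5EKAgU?wAEh?ENIQEuEALcdBEClcnZFyOFneBd/AstAAe0AlB70ATSAJAHwaBSKYAYcsfMhfGu5EgAAOpYeNwADcnAf8AAI0FTA7wCzBDwAa5EMAGweL6=AAfwFJXWE''),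
  (d51, d138, ''a0EIGwAEm-FNsFHKwAMAWwCAH8AO:MBZAYpB49chmMKrEC00AGXvMAAk4XEBrQKxAPI1ADY,YGhwArQ+ERqcP=MdfAyrAP:YH7wATBxM0NBGRBAr0AS6aBQ40AJL?Fel0ADy,QCjwAaBswAMidFSKcBX0BEteQB!FEN0AG7yQnUES;0ADDxAIDAX3QArwC5K5wAEwrQB1QGIwAFOXASnwAH1C0ADQ0QCL0AzSmCAAk/0ASaAADwT;W5MWIEGjc3FAaACPvcNNEgCQpOQ=vAQiFnTEIPEW;wAEJGEb2BCBwAJLOwADq-AFY0AHNnQ2TBfTFCkwAQA-FAwwFXAYwN4lvABQEnbFM-GFsMbPMSWwADD!wA8DC0AELZwADgcQEN0ALAL0BBqWMIfABN0Ak6-AHbwARiSMa?AAX0AjBx0ANAAkffAVkwAFGBwAXUvFScEPbQyyFB20BwPR0AMARwADAJwEFC=wAFZRB0bBzBATF0AEaCFBq0Aag8AIIEAc0AgB0wApBI0A8-tAG5AQuwAFcqFWZAK-M''),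
  (d52, d137, ''Oj0ADUs0AFAyEy9A0kAKb0AGAgwAjomMevEB4wAHA-0BBmrYKVwAGC2FAHwBs1qFY=CFASLOYT5Y-UBaZBSmEEHQgHEdBMAzwBwAUwAEMPYK2wALIPEE/wARI6wAdEywAEj;ATAAMZwAJL3wAMThAYHMrFcGyYNF0AOaZAVbYA8FS/E1.EoMEAKwAhA?0AKdVQ/.wAFFk0ANmdBP5QlFAEWBBeN3VA2J0ADEjEXFAAkBjSMR/MKYACjAl2AZ.YCA4AKAHwQYP/RWv0AD--ALXE1?A3-EnQ0AG0F0ADrUAMBEiNcP+0AHBWQP=YPgFkVYQFc50EB;wAPZ+BKnAZ0BYFcP4AFUwBER6wADR5E3h0AEVaFE;0AGHbYljFy5ABlMBuAlKQCS0BRkTwAF8eE;8AAAwAaAgFfgADM0Aa?AIVbA.aBJCwAK24EWc0AFLbwAFEP0AHtEQAFwF=Ac0Ae-wwADCKwAJM+AqGwAFnoBUZEZ:AA:Gr=AB8ELJEZ5QqlAE20AWLcABPwA6UtEA4wB3NAJ''),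
  (d53, d136, ''FwEANwEvXAAB?0A-AAwBFPAGZ!MiAJGe0Aw0IQ15ALjwAXC80ArQ!0AEZ7MG+Mdl0ADCD0AnAf0AZdm0AFjWYWfM8sAwJAAAwk+A2wCcX!EbQAYVwAEJkYDHwAXCmwAIIvQA/wA;KHYW/EAn0AYSYwADeQMC-0AKAOwASAAwIZjRQL6QKN0Agi?Q5bEB?wAHG!wAGWZYPCwADUVAAt0AyAdwAmAMwCTpBAc:EPvwAEBo0Bl/0E1vEACwiDAv0AIziBQ.cPiwAEjTBwtEOCc+KAAEw;SSCQH00AEyEAD!wALB-0ADAjdA5wCyEF0AUM-cmEEEl0ADKqAGuwAR/7AP3MBCAN5EARwd-FuCa1FBGwBGG80ADGwQmwBAb0AeAWwDmChMMLCGaYNeYA6wBJIzANEEA1AnqMRIwAEAAwj4BjwAnSJwAUhKABmwA9B;ESCwANNhEfqRCeQD6wArLNAdB4ADIFYgHEAb0A7n7FXZBLrGKrABPwAJAHwCiMnAMOBBX0AFlFN/TFBfwA:QCEwkBAFwRMAM0A5ADwMFZEEAAkA4wAoAWwApHREBSA''),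
  (d54, d135, ''CbwAJ78EJaEV:wAQCC0ADAg0AqFC0AEbMRY:Mr4YELYBTwDcZrYGGwAGkYAR,QvZEeEwADSuc6QBrCAvpwADF3wARGScAK0BcE?wAaJJ0AHlRMALEA6wADE=cOCQTvEACwZ9J80ADN6wAHRNc=5E/sAHKAB!wAVWnMJlEhYF2+FS.ACo0AMKl0AGFF0AGMfMXkQCR0AELbcj;EfWBAUwAXsPBcsMAtwElNBJC5c;UAJswANPaBSaE/3AEu0AgBqwDUAAwE2CO0A-LUEE1wAKSAEQxQD+AF6BQtYB60AGACwAOC2Eo=Q27AA;0BmI/ElzcFYwADCQ0AJX,AAcwBvNNQK2GUnEMswADEdwAR0RAgnQAE0E?fwMahBFpENVA6NADA0AEBywDrh;BDE0AFa9EDOFAAwi-PdQI/wAWH7wALAE0CevHAc7CbxQ?XEEbEIiECrwBAPWCApwB9DVwADShEmMYAgwC9tWADFQi!Eg?ACWwARlTYPaMl.cU!A3RRN70AK8AMGGA1qAAswD.I.wAEBm0A+o.EG8wALy1d'')]"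
definition rows19_9 :: "(nat \<times> nat \<times> string) list" where "rows19_9 = [
  (d55, d134, ''CBKjAINYMZiAhyBBBwCdklAAAk2bwAF!wcB9wAWTRCd8cAx0AXGOwAQPAYJ=A.?cAYwAy9xQTVBHT0AFTtQzXBH!ABA0Awh5BDp0AGw3AAzwBuj9EAbwGWYZAH?YvlwADlBBHm0A:PDQJVABYwALp6wAFbJESwcpMFACw=yCjEA40AuMuwAFAEwDJOqBQKQ7B4AEAQwAXAn0BK6QBO2wAGT9AW0EAXwA7AowA?VIAEu0ADAkwADI2wAMLiwAEO.BECMnKARl0AEKqwAaS;Q!uMEFEArFpJQRUYHw0AHMQA0;0AFg8FYfCLNBE6wAGP,AEawADIb0AL9xBW!E4cALMYSOc41AVtRFKwAGAPwKk.lFK:QfsAFywATXgEH6ACRQGmMtnExEQV?wAEPdwAFnVE3?AqcAbnGX4YAgwBVBwwAKAEwExRVAl-wAKxmQCCMi/EF8E.PAwDEAJwH=u.QADwHx-1QGNRDXwAKQrYwTMD=0AcuaM0=RGNwAGayAwywAGNnA;VAehQAewDtL6wAGLM0ADB,wA9sHMJjA''),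
  (d56, d133, ''DbwAKBEwAor70AEON0AHuawAHMsE/KB+;wAEE-EbywADK20AEFRwAzh!BxzMR8wASCzcK20ADeNAU9wAEAtENB0APc6EnQB0tENIAA=wAM/ZE;1BqBgAWwP6G.cgKAEtwAF=iBAxwFeagAXm0ADH80ADM3B0KBTQAYWFC.EirElr0AE=BADhcSFcOVGPR0AMOewAFMYFIrYGdC9tYj.FCG0AKC3AgdE8GFq,RNOFKjECfwAmyJAiNEFL0AK;!Ak3cAIwWxlxMB?0AGAC0BJHT0AXAYwNoa70ADM4wAFZeBxZFtPABTwAKu2wADA:0AGAIwPYa9wAE/yQ6tMAOBAHwDir!EDjwAJFWMAPwCEji0ADIB4ApYJFQyFTBEQ+YGYNLg0AEAAwBYPCYWbMBpEX0cJYBDBwADraAZ+APAEkaAAAkLBIFsByVQg9M42QEI0Aje!MC+0AYQzcthcEQwAKIaAV1Em?NI1Af3MAAkVjclHA!7APGwAGCNQD7wAlFpEPHA4;Mex0AENb0ADU2MAt0BhAI0AWE3MC3Q''),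
  (d57, d132, ''bSBAfwFnPsAEwYAP0AIMEQFtMBLwCDAHwAFQUAoyc7-AFsMPKwADfSBALwAP-nF0,cAnwD5IgwAYdxMAAwPMA80ANIHACXcCtR/tcAiwBU0QYDDABCwA6L.0AFotAC9wADZZAJs0AfPPQm3FO+wAHFZwAGAe0A3E3wAOqzQL+EirE?mMDY0AFDeFGPwAQAAwCV2;FD!0AUlCAC2wADIT0AZuEED!0ALNLNRNNBYENS0AHWeAHowAaAU0AKIxwAKAAwNcdMQB,MBewAFmmASFRreAL20ADALwCUD?EigMGfAA6wARegEbxA5sAA?wAOJ1ADlACd0AE5p0ADIFBlrM78Ey9QHzwAITBUQLAD4wAxZ-QE/AGowAEevQLbwAECo0B0NTwAGFZcU?YAdwAEr4MddQB.wAy56Fq/ANgEV90AH0mwAGCt0ARDCcZ-BEF0AIc-ABZwAFA4wEMN-0AHFPwAxp60ADAEwgwEqMgawADTCYR;Ak-EAxwCMN,ARkwAFOSwAGPV0ATwrAGIFgIFqzBEPEA7MAC0AFaOAAYwDAM?wAFAR0BOA!EAKwAP''),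
  (d58, d131, ''AmwA+FtFoyAayEc/GCCwAjLsEJEAD!0AFi2AgXRBiwFx5vwAFMqQmSBV6wAEH.QISMFk0AO:8ALqFBB4AEZWEUZNWJEzvEAJwCTIoE6pB74FA.wAMHnEUGwADUY0AHiGQcnEAnwC,amEHyQD80AwGDERVA5icACwC6bIEoFARSMC10AFN8YA,Em=NkBM9yAqFEAAko8cAa0Cl2IArgAVNAO?Qm8Az+BIm0AFg4BAEwYDEbE1hBwSEL5EwAE?lAfRAHZwAMALwCgiVwADckMg2Ac?AkqEJPFtAAeVEts0AENl0AEBs0ADN2AmSZx6EYtBBewCCxYAAGwrcDVB0YFpRF2TNMJNAA8Pr+oMVyFWTwAKTzBh5Fx-Y=sAAY0DD?AAs1AICwAEU2QADwAEzWAMU0AF7uEJHAB3wAbbuQL60AD-pAYkEDAJq+QItAAFwPpCu0BSAT0CEGu0AJA,wBfHW0AKmSEC50AtsvEx0QL5EDVwAMA4FVKAMxBnBIRkF!vQQ50AUzYABdM;QN''),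
  (d59, d130, ''MkQCl0AYA/wAFeXAD9EOR0AIE4E1YEDYGIVASAEDvEWaQM.cNlEAHwTPAqwCXX1EO00AMc;YCXFtuAjSwADD.0APAAkAgwAPAVwNaUCMIeYVIEMJ0ADAs0AKOfEq?FD7wAKNqQC20AFH7FAc0AV!fAD4M+4ACBwAEFDwAHB:0AKBmwAERZMQ7AMzADnCHXED50A!U.0ADWIANdABS0BLk2A3jADc0AHQkEEmME4wANk+MwcMHw0ADjzFOJMWmEwycq6AAIwHIHn0AXAXxAEAKwQWK=0AKJc0ADAIwDBgHEKfQGX0ANCawApA:wFjbTASAcCBEAC0B5RAEQTY8JAPWCVNQAzwAJA.wArD/wANB6MEw0APC0wAEArwFYHqED,AHZA/3AtaQaAAIfYE-0AQX+EL6wAEA4wAIkzFILMUfEP=MCv0AEgcAqqcHG0AXFvFOA0ADB80A;AD0AGAk0BbweAEmAMZMU:Eq7EAAwl9AjBSGQI2FC6wBKP3wAD4!QDJwAQOqRV:0AEGUYMI0ASG?AD3wAKACwnbGkwANBvwATKPwAEc9M''),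
  (d60, d129, ''LjMMlBmtEwrEUfEBVwBDL3Yb;QC5wAKX+0AHVLAloEQsAqwEGNAkBFAhwGR9EBjQABMwAS/QAK3ELA4AHPABK;AAfwAFXgGR;E0YBB:0BGbt0ADkMYi:EB5RBMFY;Yx=AKzCCg0AUBSwAeI/GE6MFNMLb0ALfzEKnF-bZAwwC;AAkCkwA0QJ0AIEA0AGBL0AUF8MF0Ex=ATF0AEuEEA0wB1s,EAAkAS0A1KSFCM0A1QwEL6EAxwAwbVQCnMbTwADNbwAEEdFiZ0AEBPBTQwAEGwFAJ0B+DMwAF4/0AEBo0AJ;DEAbQH:AVLY1dBA50AealFrhwAIhGBAa0CrAo0AEhOACc0AIDbQ.8EviA:UBEUEERNttEW/YGQ0ANJF0AECawARCD0AFpiAfRAYXQKeBh;FN=wADCX0ASFN0ATHFEBR0AEFHBAQcE,0AEJwQlJAMGwAELBE5EYEi0AGE-wAdBQwANutEJXAC1YWeMNn0ADc?0AEEtEGF0AErFQIowAbUcwAF=nFAmFV,0AKA2wAEIlYAOAegEIpY.yB'')]"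
definition rows19_10 :: "(nat \<times> nat \<times> string) list" where "rows19_10 = [
  (d61, d128, ''VWN05AF2BAd0AYx,ANgFCcMNFY2QE;0EZnAAAkCUQpcwAIZnAhpwADZk0AJRswAGxzAACwFxOS0AOkGxADdDNdrA--FRTwADAI0AFA70AXAdEY,EkIBM0QPlQE7QN7wAHHGMYkMH6Ea5F;uBr4c3dEwkBpsAKKYvvAGAFEzwAGM-GKmAIMc7NwADAdwHzS9FDCwAOp4AAHwf,BqwAFBUEOCAs:cSlAM?RgDFhpEhoASFFJNwAIFKGYlBI5MCZ0AOqJET=F05YDhQv9EXiFdsBCo0AO9TQ8?EJEBGawAJGaMC,Bk3FLtQUGcU0cAsGE2YAiBUKYSF0AEMyACDAKeN73BAIwMeo8BF,QLpESkACyCSiEYEQTcwAIVvQH1A:KBgnFRZAwsAAG8WcE+wAPJLwAQ,gAmjYLVEALwUGDdwAX2DEA80ANBEwBRBdEM40ALh2M=.AF5wA8VsAA;0AxkIwADQY0AHAewA8J8MF7wAEJ,wAQLNBHCFj0c3:wAIFfACK0B9BA0BCQdA''),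
  (d62, d127, ''H7wAEJC0AHItMDVwAose0AFI8YDr0AYf1ERTwAFb+QGx0AD3XBImYULwAIgfCBEAsZEQKBRiA7iFITwAIC.wAq;yQ3?AabEXxQALwI-eYEyDE!3EK5FY3wAEABwwC5hBQEwAFZYwAFBT0A-AEwAJAEwAiG6N!8Ql70AE9TwAFJ?B.YMdTBPEYMa0ADauBO50AFaMBiawAECywAJYCBPwQLbNA3wA6AAkFLcQi0ALPsEAA8PXpBE=/EB00AHCswAdrucGhwAjEA0AcG+wAT/5YWeAImA-TBBfwARIkQGSQo!Q.;QXIQCZ0AMD60AEfaFAuwJeKswAKImA9/BAlwBRAAwI/DCExJcN0ARxF-wALkEAUwB8UiAAiwDWsURDo0AFAD0G!A2wAo2FAnyBHEMbBASVwAEcmQBlYA30ALVZMGwFGrERIAkS0AKMFBiyAABwE9oc0ADRq0AHgGEQtAAFwVZB6wAZLSGapEcQC2YEIywAOAj0AR!WACzMM-0AGA90AGCOcA.wAKCr0AWz.BAAkAeEmpEELQE,0Aa/5ABE0AE5sE''),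
  (d63, d126, ''DVBBYwATGfAv3BB5wAICBwA6BgRXVEBbwAQCXwAF1pAAtwEXUt0AI:AILWYH-wAEEpF0qwAEOGwAEoqMLG0ALAAkePwAFP+QAb0AHHJcc,EA1MAuwCR:9EEzwALRJcG7wAFHT0AFAk0BxAWwELAyQOBMPvAp3BJX0AHV!YIJAXvwAMLkFAo0A:AFwAKu5AN1AAUwKNq/cyD0ADxbF62EJ9AE!wAGIIQvlFA4BL10AEAt0C!w=wADpBEw;ANF0AGC:EAUwAMoiEA2wFnXOBpcBspQAJEifBBHwAn0J0AEBiAR=0AFSjA!tQQYF;HAAwwADCfwAIc,AwZE1YBY.Q0XBp.RBJ0AFpxQHFQyZ0AG4vEAJwP=JV0AOI4MAqwGJBB0AOKyAAM0AR0FYdpAufED9wAQYXwAJoWBjm0AEDs0AUFRwAgteEHcAfPEAJEXgYR5EVjQ:5BSZ0ADzsA8,BRuEHBMgJcAAwSHjsAAUwCZTKEEKGaOwAEDg0ALAqwFCr+EdnAAnwJUUoAAowG9A=0AXBvwAs=0wADCI0ARHIA3kQE.QBP0AK''),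
  (d64, d125, ''FcBLmFd9YIRG+oE0tAAYwTrAPwAIXowAGqjAFtwADEUwAFLlFTLBUUwAEJA4ADIpwADJeBA+wAXdJFCu0AFqnAAHwY4DG0AHAt0A8kgNib0AEcacCFAPG0AIBK0AFgkBJr0AFF,cBYwADx?M!iAGkwAF7tQ.5EUSwAJd1EF2EwycXcAABw9WKhcABwVTAn0A-g4NKeEWhwAELCwAHASwAEFtQPFE=3ECj0AHJ3NAPwGnKmYVWMJMAY5QaKEAv0ApMVEMPwAQKfQBYwAN!MBA;wAVAFQBZAALwA=AY0AIbeMJeABqcBXwD.BfwAPtqApiQelM=RYXNEBJwAiAx0DPC80Af2,E0kFJbQDGEA,0AxXl0AGI?wAHqhAZlECKMhkM3NE24FY7AEmMN;AU2NBZwBulCQXOcYmEAcwG01=AoMCcJBACwDRzNMPZEjwAaZQAqBFlwAGkAUFuYaUEAfwDgAMwZ4Dp0AJBUALDENcQB/EioMAV0AIIbEptEANwB?QCwAFOlER4BRLM3vFNWEHXAm6AfKFw+A''),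
  (d65, d124, ''QvwAPBL0ATxgANqYCrBd2EAAkABwHRQ6cW:EDPwADvgE5xEDuwAMw+EG0wADQW0AI5XAAf0AxBowA;N5cB/wCst=Y;3AB:QAcwFLA;0AJU:cYbAnuMK30AIE9BEF0AFfLQp:ERrYAOFQ10AJAEwG-OXMCt0APBo0AEBKwDEloF0wQQ.wAMaKAAA4BEDKMWFQjlFJcEKwEEkAX-FXyEAJwIiKaA;HEayAAvwAPAAkBjwAXZBwADo1wAHj2EVpQAJA6QA15YUFQY.BDeMFo0ADU3wAEBu0BqAx0BlJZFSGMBYwAMBsMCtFpeFLABn4AorEAM0DZDv0AHY!0AEAXwBd;.AAwwBUDRCAbYAiwClEJ0AHAAkAqwDhAAws:C5wAjCS0ASnnFB8wB6c6E5xAFt0AHGcQX7YRrAA!0Bym1wADw.ELzEC,EM90AOAjwByFD0AgIm0ASMLAA3wHnC5MAHwAYBpB1FYAh0BFCPNB-0AS;iA=lMA1Aha0AEE9wArMQwAWhREAHwBLjhwAELF0AHYu0AEcUFGPMkA4AFjfFLEwAKGL0AgmgQHFA''),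
  (d66, d123, ''v8FDQFCM0AedxMG/0ARvwwADNBcBC0AaEjBLzEC6F13ckVwAGCYwANpHQHCwAE5-BJe0AJA9wBqAhwCuA5wApCLwA4A=wDlJpwADCq0ADA.0BHK9wAKfZBPANMbQyiAk3Bj/wADG6A2wRC6wADAb0AZBn0AINTAbTBkhwAEj1AP3EH9M2qYR1wAIBfwAxAywA3F?wAEG;cBi0APQxEAAkNKcg7ElLEBKwB5I9Ee2N0zE-3AdMEW;QKg0AJEC0APB+0AHNu0ADN?Q+kA;XEAf0ArHJAVHQB9wASn/AE-wAVH;dV8AT30AMfOQBnQwvFxaAC+wAwNtEFm0AOPSEt:AF:wADAOEBEwAwQJxADPsEMPEzi0ADzHEDWBHMwAG4qFH7FP:0ADASwJDAfwB7KrFLdFGcwAwBD0A8BFwB!Bh0A+zBILnNnZEntB.8FNiEl1E5-cdIRZeAARwHiBG0AFHWESKME50AKJXACmFI0EzvELyADnwAJAg0Ajw-BB6wApw3AZ3Ecac,9BKZwAH6tAJ?EAAk0aAEd0AjFVwATI8AAXwB8'')]"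
definition rows19_11 :: "(nat \<times> nat \<times> string) list" where "rows19_11 = [
  (d67, d122, ''V;AhSYEc0ADCsAUa0AEOYMgmBmvECI0AFJE0AOA:wAECIwA?DOcATwAS-pAKf0AGGY0AYKtAcpFX/APRwAGHA1ADgE0ADAZwCRvwEA0wBRgtwADANwASM.wAHJJAhJcZjwAFqfEfM0AEBTwAgO10ADDrADcQBG0AuEjwAEP8FGUABT0B2Y/AyEANOwADZFM:=AVPBLx0AGh3EIBGsGFYKFAVwClDl0AHIr0AQBjwAEDr0AYOwRFkEo,QL+0AdV?AAVRjaMb5YASwFhI3wADJg0AMR:AMPcHoAD2wAJgAQcV0AFA5wA8JCQ?vMA0wAcMoEb5MgzQXGFBM0CMAG0DO9REe-MIT0ADAAkZ/FLCZAFwAqctQ/NAGAAOuEH3BA-0AUz7FrSQcJBFC0ADAp0Bxl8MJ+0AFGl0AE2VBC.wAGRIABZwAIr,AMu0AHWC0AEcOMbBARUAl+FyVQR7FIe0AELrwALcZFDRQxpMfFwADGq0AHGqEYSFA1wAvK.MA;0C-kXB2zMJcAEvA1,MJjBoYwADAFw:WBFAXVFAFwKDAF0E.AAkEvwAE''),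
  (d68, d121, ''BNYNuclDwAGAHwD.JV0AICZwAvOX0AHAe0ARZWckqQU.wAFOtEE,wALiwwAEAw0AfA;EBlEfVADH0AMF/wASWIwAG5YAmz0AEkcBtjABtYaMEV,0ADGP0AJAzAW/wAGgFBWcECBcB9wAMFacIdAb80ADOpEZ5RATwNwJGQI60AEDSwAEA,wDDB0wA4LN0AEGL0AOADwAiCowA+BdMi.MV7cAb0ADY.E1vAJF0ADApwAXClwAFEs0ANQeCXgAD-AA/MDR0Aov4BMVQM8FEa0AQ,tFAewASAn0AINPAsXBieMDM0AG5P0ADC-wAHC:C;gEGHEPLMC!wAzAJwF.AxFoeEWkFEdwAPAJwdkKXYIAIPmAnwMvOYMQ0ADouMpAMw8AB!YGzwANUjA2,AAzYBTwAIABwgNW?NYLMFyctpEy3cAhwDbEeOG/wAEuU0AJiZQAAwatpoQK=0AI-wEelEdHBkNML5AAdwC,330ADkrEXZQAxwATH8wAFbMAWUE03AS=MEj0AUdCAx0ECeQ3/EBx0AFBkwCEygEEC0AKY5EAXwAbFawAWe7E''),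
  (d69, d120, ''mZ0ADBsBBD0AjvSBDYwAf0zAAIAWrYLfwANBDBGl0AO:UBiLwADVxMAVwEaR/BBoARAIjgBLJYd6ADj0AJCI0AUVH0AIKJAc-EE:0AFAtYfvANOAzHQAXwL9fpQYsFKI0AI5Pcr8QB!wAUECQEFwAUJZ0AFA!0ADXB0AHAg0AV88FGbwAgLMcj9MB.wAFt1cLe0AF+:BhDwAE1WMweB0QMtjAmvEfrY+IcAs0AwBV0AIA!wAkEqMJ1cAC8UJiOEAMwAOJWEHNEAkwJT6,AB80Ad2QEo+QCfEA.0AFCQ0AGyWQJZEFLFAk0BAB10AZ1SEAB4Aqc9cBTwATxucn5wAF.RFAgwAJXfAAxG1jAVYAq/MSkADpwATHvwAEP-0AGNpwAHCL0AOzYAGmwAMYBAFcBo1FY,0ADjCMXMBMp0AMHK0AKp2QB8wAXfNQAMwQRAJwfTA2QP;EJ8wALTNAHbFR7EmcER.cFfwALO3BX10AFhLAlpRAWwGDBvwAKV=AGeFL2REs0AXhvMA+wDjJOBACwJSUrAC1wAHCWMF3wAE-EMCu0AF''),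
  (d70, d119, ''ezAFVEAZ0AMA20BMhYMC-AAAwKXREAGd0AQFQ0AG73wAF=EAPjEA!0HaFmwAJJ2wAdI;QDhEE!wAPAWwAoIJ0AMAFwFq2gAHABB60ADE5cALwd4A50BpFpwADEcB/6FOpwAIOnRxyY9lQB+YAFwZKB+0AHBh0A+tpE;YYL7Y4+AcBZbyAaXFlMAt0ByOQAG0FQAXMG=0AExQFI0wAKDXwAMc!AXS0AKPVQAiwA6J=Al=QKQ0AEA,0AlDYBX=EAEwAJOOwAE9vAXTwAITaMXjGH-wAK;tAX=czVEl3BHuMFWMKLBL2EQKwAFN2FgtQOrwAJIsQOTEATwEZ?mBOSwAIBo0A0F7EbPAGSxADD1wAEaeAW?ECiRt!wAGAAwD5HB4AETr0AEc+NALwMYPBB0rBXVFxyAHLwAD9nED+wAEU!A=zMLDENf0AN4HBAO0A0bMQazAaSE9eFCD0AMToA4mB2HMD!GAGw+dMq0AG+DAAAkKzASUAR5Ei=EAw0AJNcEJV0AW9pca4EWm0ADOsQDsEUQALiAJUQQ1wAKA/0Ak''),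
  (d71, d118, ''1fMapAL!wAITz0AJ5rFAq0AMAA8QRNF0ADaGMhXM7lQLxAD9wAUydcD6MUe0ADklA8ZAY7ENLwARnKBOgwAGBpwAPAe0AkN.AAIwEYT!0AEAvC4+A5+Asp0ADAGwAuJR0AEAAku-AHGwAHWIBCmwAaBHwArI9MNiwAEHpwAGAcwBOA=wFfVBAJKwAIq-AmeEAa0BUU2wAFJIcBVC/OAxDMJEAm+cD!wAn5eEA1wGEP0EBJ0AZGB0AFUG0AJHpwAVf,FTmQCCAuaYK1AA/wAPV3ZB:wAOAE0ASI!0ALFywApExMQUwAHCO0A8gVAWs0ADJBIAFwBw5scGoAiGFD7AX:Bc1MkdQZMFx6FmiFx!EDqFBQ0Ad=sA0YQlOEIo0AKYFAFx0AEWkEh+AMtwAJe?0ADmzAA-wCBJawADFkca1CTSN;jMSJAEeNKbAW?ABSwAZujwAEH!0AM//AQDB7bEAW0Btp5En?FWEYG-QA2wADIqQIGwAoW5ApFAP-0AEwJMDUwA1nVABV0BQCcwA7uuMu0FAXwBiIWcUtdV3B8REN.B''),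
  (d72, d117, ''27wADfFE?BEf/BhuAABwA7h.0AIAYwB.dlEDO0ADH1YJOMAAkR=0AEf:QKJFUtAvyAHgER-BwUwAEKOwAEoXEAjwANGD0ADN4dRWAAAwkYAMwNVdnEAAwKazlBIuBBbwALpQE:eBMsElHCFREkJARFQAAkDX0AJS-APW0AEG3YFS0Asi=ECwAGa0ANPLYa7E5oEC/E.6APEAAIwB20KMC=wAHDBQDMwAFEi0AvE1YCWwAXAYwAFKZAp1YFi0AMhFF/ME5YYAAwNaGnBlIA5QEY9AUbABqwAOb3AbMA0J0ADG8wADfXQH1AOvwAHZEEfmEWowAFB;M?2AD3FIcAwtEGE0AKRa0AFAFwGRBcR/AJAAkDecOO0AJEqBf3AGz0AaFMwAvd!Y,uMV=APhB1jAC7FAsMEFYm?EA8wASJk0AFR-MqHMf-QEqwAI0IAM,0AIQ-YI50ADBq0Bg240AFz,FciMHc0AYZGAAVwId-NA9sARzFf?ECC0ALASwFbI,0AFACwT?xWcLiEaw0AFM?Aj-F=SAa5A'')]"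
definition rows19_12 :: "(nat \<times> nat \<times> string) list" where "rows19_12 = [
  (d73, d116, ''z=AK;FK.cE!0AGTGAnUBAWwALGjBVAJv5BWyG1pAOFYgqFEp0BGSxEILAMQ0AGHqEVuwAF=BA5TEEmYAGwAxTJAQrwADIg0AJIaGG+Y:HcLWwADDlAmfMSe0AGQoYF/QUOF!0FElwADaQEwAFMfGB+0AVS+wAHBlwAKiyY8BB?NEJq0AIPmEDUdARwGXuRMA.wISQlAoOQYSwADBQwCoZTQAQ0AaN:APsB5LYw5EVhMZwEo=wADOlwAPhpEHzAU5Y4YAsbAK:wAHJaANiAk,YwcARtBCs0ADB0wAD5MFX6MiRED9BTW0AFdYA-3A0IADUwAhBM0AGAEwCCa:ACO0AfBA0AGXRcH;AAzwEha,0AFBvwCRA80A5hqB.rEPd0AF8AEt+EABwFwksQAUNEeEBTwAP,fMC4BHk0AlQpQBRcs!MsOESpC2vBMB0AWAZwAMSvQnyMO=MA+0Cxv7B04Mm?QD/0AHLxcAJwCoT9YncQAA0CVdW0ADg?MZIcrtASSQ!iMtxEAa0AwBrwEWZxAbbC''),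
  (d74, d115, ''H1NMlEz4ADfGCVwAJWXwAHArwAoK?wAID9wAJA?0AIcQRBewAfAB0A-AmwCaELMAswDsAcwAGlJMKlwAEOVAR/BRRwAGD6AFj0AEYR0AHEFYkkYQxGAB8WEHP0AVAuwAVHIBe,E4oEuuFE2EU20ADF1EqrMaxAAeAB:0AgH70AQF9B7eEAGwDeABwIlN,RTCYYtBHDwAVX40ADF.wAgdOQBzwDeCf0AN0tEEc0AUG30AM?2YIQRkI0AFCvwBuFQwAEafBEXwAOYIwAEOXwANB2wALM2Eq6AmLEaKBMsMIpwADPmAe+AsREQDRSqcVSMAtwAEAAwbmACw=EAkwAED0BL,EZTQu-Q;KA=nEE7YeOFcBE+:ED6YTxEE:QTRQLMwAEXI0AKX4AKnB=KQy?AAH0A!CG0AdXTFB70AUi1EI;YXIEcIBGsAAQwA/AAwypN?AyVECZ0AQi6AObMU3AJZBOb0AEAKwPNKFwAF3rwAED+0AETUEcLwAFK+NaIwAI?2AFPcAPwVBMawADvsQLN0AHI0BkYEf:wADBEwBJPWE41Y8CcDpwBO''),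
  (d75, d114, ''KnwADG:AItEAH0AGS?YB=wAPAl0ALjyFQqYCR0ARZoEMh0AETzE!fEERMX.MeiEIGwAVAb0AUGawAW-+BW6QVCMN!F+mNaEAAOESOYZ,EBs0AEGBwAKQYFDAwAfC00AYBsAam0ADeRQmqcENEXcAXiYtZE,QEWB4AGAowAPClwAKGDwATBpcyeBRTEfaRl8EDDMPcwASC+0AMf.0ADAoM.2c;!BBcRAq0CBm1AtUcyrQcQCRsYJywAEDHwA565MA,wAOhtQDp0ARbHwADSV0AFIlEsuAL-BMuQ3VB3JADIwAImKAlTZY9M?SQJHwAET1BY=0AFnwM6KcRMwAKAb0APZuA-cBLcAa6Ae?MilYP4wAFAb0BsDYBLOwAQjMAJBwAHe5Fe8RuHEABwTxfAIFPYAH0A-yXABrYQ7wAGTxcG1AzjFLp0ADAFwAWNe0AgRfQMvwANW+Q?cEdB4AEb.QH/0AEARwAlL=AhtEAKwEKYFEwuQ3YAGAKAIwAdCG0Ac7sAAAwcbIWEEJwAQC:0BmBVwAED-AFB0AEIq0AH''),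
  (d76, d113, ''lXwAG0gADjE7REqRAEPECd0Akq7FAswAEklEh;BJTcBe0ADFdcD80ARMTFT2AHAIvyEGI0AKNtCHtwAEJAUKD0ADBIwAET70AItlBRqB=4MBNwA2BwwAIZA0ADE-0AterAFscuvEKUwANA2wA/KnwANl8YGIwAFA9A/QAJjEUKMCJ0AlzncdTM8xEHV0ANW.EHKEIscX9AqUAJddw2EAkwA0o/QR4GFtcIkwAEE5E9UcB.0BDT5E=;FCh0AM==QSfwASAAwuPzoFY,FB+YGl0AFJ2wADJv0AGo+BA.EJNQz7A3qEMJQAn0BYQ?cI-wAFAkwQ6f?YfcE-CEA00APBn0COsM0ADAQwJtT9Q3/0ADNTYJAIknEBw0AoOPQi:QQx0AFo3FADAGI0B!WIE0?Q3uQ8zBjiQCrcX8EE20AFDq0AgF9wAMK8Em=BA;0BrA40Cm04B23FDVwAHKtAOrQLJ0AHAi0B9QtwASe6c94ED+wAb/UE5RAZtBg;EA,wA!Bu0A/ElMZUBsFFUrECrwAE!3EWdEBMAB;0AQ''),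
  (d77, d112, ''JFR=7EAC0A=AY0DnSLMJuGAYwM?E10Aco0AAYwBVBowAMLTESXwAFayFoAUoaAEF0AHmBMGCQAkwAEG9CHeRCG0APn4FDG0AGN+EAA0ASAIwBxG7F:2ABawAbu;AOTYLZEBN0AVI5AH40AFRz0ANQXR9gY5/EE7wAUnNwADTEwAIFTFHz0AuLGwAqfjwADGsBgBwADBsAAFAF10APDbMAm1AE?5QDyFBH0A!DeQCPMxUAfCBA2wAWsiwAHZLwADCnwAjSrFHjBA2GBk0AxCDBu6AIJMA3wF-CXMVY0AIgVAhbAEc0AEd8BZVAJkwAFpXMB?wBJe?QUrEIfASPQlbADAAH90ADARwHho4AK,CATBRmcF:0AJBBwAiM;QIGwAdABAAl0CKCqAA7wAGJ!cDKMhfAiqM9sEqXAE.QDiB9gAIQAm,AcbAFw0ANYvEAAwmxG8wAiAs0AGGjwARmWQNPEVq0ADCYwARtp0ADi.BPiwADAC0C,a7wADC+0ARD20AJv9FFD0AM;IBA+wCCAwGBtEIqN/nEWbQOwFdnF3nE1ZA''),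
  (d78, d111, ''T!FJl0AYCCwAKCHwAXEY0ADEi0AD;-F+TMJvEiSY=VBRI0AI.EFaSAB?0AT?,BAJ0AEIi0AH6KBFSwAnD6QING4pMFt0APH2BMcwATJ.GApRAAwCzFzFA30AWTGE,gYOB4AEH5cRg0AFrtEE20AEB3wBfLDMIY0ADBnwAkCX0AJCOwALG,BMbwAEE,AR=0ADJDEJ.FlIEMK0AheoMJS0ASVfMVAVgqFzsABkwAQ5t0ADR5B3sALOwADBc0A9AwwAGBAwAHmuMM3QDgR.1EFiwBEMFwAEAKwAHb;AXjYYHEuHEDuwAd8kEi:EAG8QP6JAzqwAGBBwAEBoY;pwAD-oMKP0AK/XcDoRPGYA70ASZCQ-6AqqELz0ADADwEuJoRAawKfAdwADCWcVY0AEFPBStYO3AzoFv.AhrET.0APA:wA4erQdmEAd0AR1LAk:YebwAEKBAc8BXeBA00BmKwcFg0AH:yFCJ0AFvMwAFG-0ALBn0BwTHAK50AEMG0AELGwAEA90CeADwBOx1MZ=MuUEGvQAe0B-AAkGd0AIaHAAu0AMvRB6GEJZBAL0Aa'')]"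
definition rows19_13 :: "(nat \<times> nat \<times> string) list" where "rows19_13 = [
  (d79, d110, ''?DQ0;EJXwARfzQAh0AvqRAN-0AKpIYdHFB?wCKKrBUMERxADhQGrY;pAGZFAowCylFEcJMAKwJHGqRAU0AYUB4AEGSwAKYPYXTMvVEDxMW1AHb0ALKCA/hAs3MXKwAFKK0ANGYwAEofACf0AeCIYxTEtsE;0BFe0AJAo0Ad7gFIzMx?cVEMEk0ASMVBB?wAh6;QHTYqqYOiANSAMX0AGW1CAhQKACUvBAo0DVAE0CAnYcXxcKH0AHZ4AO5wAMB=AOTETqwALC5BEvwAN5fBAiwA9qIEAI0AFUhBAowBbRDBFe0AEPIQAkEqgcv?EukQAcwAdA!wBPEGwAdG00ADfzMA2wAD?MBiB4AEa00ADX=EAlwApVlcx?EB8wAeX7R0eENr0AI!DBov0AEx2EGi0ATH40AJG10AGnB4AGUB4AF79AXoAFPwASezBCv0AEKOAN-0AIo,ENSBQjC-CEMVZAGwGy8:ElPRG0ABRwDKoIEGA0AGRvYAI0AmVoABD0AW9mFT!Y6UFSgFj=BACwT+OOwAJ;!AADw,dUjwADH!Q''),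
  (d80, d109, ''/:AA/wC5I:QAA8PDHIwA3FF0A3F+wAQBTABbAN-0AQRaB/jAHS0ALcmACwwAEYNQABwIMCOwAFPSwAKFA0AF8MACB0BfG1BmbcZKEZTBxHNHBAFmEJz0AJAVwFLA=0Aq;jAA=QYHMZWEArwDHn=A=gEJDwAJKA0AFZO0AHpi0AEPy0AGYVAE-EDBwAQ6dABL0ApF8QTrwAHb+BAFwEbD/FXmCAN0COZcBTcEC3wAFI4wAlbcAC90AUG4wAJe-Aw+Ab,Yc8wADTKEAQcw-BOIwAHGpEC20AGwIEC10ADA/wAsGi0AIJ-0AnExEEQ0AOK3wAFTA0AQAqwGYzMQB5QBI0AHR8AN=ASTcAawAHNEEJWAjaEjZACewAbhtF2pEPHYmeccD0AFj7AQMM9eEofFXiFAJwAiADwBwG4wAGAHwA.s?cM4MfxQv7EE10ANOa0ADMZ0ADjeAAAdIG0AEeFF9TEqAA2gEP80ADq1BADw,;XsFya0AIw-Ec+AeeEBD0AkzxFF5YBg0ATACwA?vTFLEMNtER0ARe0AGCuCAHwQ2-TADAFAA0A9''),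
  (d81, d108, ''mTFAJ0BMCJwA+0PA.kAFKwAJPi0ADI7wAXABwD8DfFAQwEQhjEtEE?2Ag60AD6SAVYYAFw:HA+0ADAywAdZ1AVKEd/EvyQYcFw7EDhNmoEBWYg40AEFQ0AP=:Qai0ADBA4AWldwADACwH1GmcA4wAHCb0AHRFFw4wAGMgEaqQAGwbDB+Fk1FXfcO/0ADAd0AaABwAbfT0AEer0AJKyMYuFWcAB/wA4T/EQD0AGNEGS2MANEIQFIhcqUMD;cE+0AUPAAElRCV0BneX0AGk7EKoMUhFD+wAml7AAgwEIZjMItADrwAg-lAOjcOmAUe0AEXiBYNRndEMeQ1SEhdQa3QBz0BMBjwALKB0ADCjCD/wAKQ5BbOMMOMZtEGAMZmEGCwASR1EI+0AW=eBBbYZ/wAE2DB?jMACwBSAi0AWPuY7uBLGwAQUiEABw5,SvCRpEQ=AGN0AX5KEtKEh/QCIEMDdcoED8wA5fjwADJlQ/xAo7EAMwI;JzE5QF1vRHIwAFAVwDqb4M9,ARDQAawFVxaEDZwAZCW0AFAQwA16GQ''),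
  (d82, d107, ''n;wAK4zQG!A;;AI?EIbwAQbyAB?wAKADwGv0?EAIwLfCPEEWwAaS1cY!AVZAqxAyVEKOMAo0BLl!BXlcUnRKA0AJ+zMmKwAEQhMDowAH5HAOEAkPAA1wADJGAiIdFTYf=EA80Aj=7EiWMQ2EOowAFAfwA+fywADGbwAGe,A.pEuEMLlBI-0ADAPwELSK0AFAKwDdVOE8:E8,Bd8AF70ARB0wC2yEQWJwAFbjAF=0AMBc0AR!KElrQACwrjCvwARRV0ADwPAYTAq.EDnABzQcG0ADAdwAVSXEz4AKxwADa3AAe0AQKHAAi0EUBb0AWE1wAND50AmL+0ALxa0AEfrMBiwBJO8wAHQKcwkAHBA7swAHW,0AKFmYU00ADPwEeJEB/0Be6-AVJECkxAD9REG/0AjwKABawAJA/0BRm3QPqRw?EfXBECFRfEKyAv.FcAMyDEM6wAKG9wADAAkI:0AYcuwADkbEh60AD6dAkpYDo0AEeI0AIF4wAEACwDuz.EBjwAKskALn0AFmKENXwAEW1cAowArH;RN90AXTPwADIjBRHE-OQAZ0Bk''),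
  (d83, d106, ''c;F0FYLEcU,AB70BHAdMVU0AGD!EKfQB2wAGzAEO1FFD0AECD0AO?IEJX0AFJLFFzcBWwAJEJEn9Q0iBYmEuREIn0AFU?wADK50AMELEMRAN50AEsmYAR0ARBwFc?A+nEUSwAI6wFt.MAJwbuFyA=;F00BDc0AGalQmXAAuwCRXxEg!cVBEAAkCDwAuGZYGlF=:ABFwCLMa0ADKyE4OFdcwAEEjwAWB,0Az5+YEcQ0!QAd0BBTWAI1wAKM;Z4XQH5YBFYMawAIAkwARO9AHU0ADAYwDoEQwADI4wADjkFUuwAGWwwAJATcNwYABwAS5xZD,wA8hgMAK0AO7zMPvwADDzM8WMN0MUtYQnAAAwsgFSBCfwAII5ECrwALNhEMRYMcAKIQe4C-wFBZwAEnWQEywAHUXYSBIKEwAFB2ZfIEm3APcMkhFAx0C4h3YnqwADDbEZQAloFQ6wAFBZEL30AOmAgF7BtKcIbEmkQIw0ADm1QD90AIilMBiwAUSQCM3MBCwAZU1Q3QB830ADIawAKMHAC-wA5A90AG''),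
  (d84, d105, ''ynAHUwAZ:gEXfEA=wAjAAwI+b.QB2wBKRJQgx0AGf0NtDFAGwAiA1wCUAowA+DYwAwy:EHrE020ADx4YPLFBgwBHq9ACfwAYehQnyA5YFAGwAFA.MIoY7nEAEwE5igMYqM2lMjmQexEjYFMbAqaFl-YAFwP=siAMUY3!MG,AADwOwAS0Cd=AYEmwAJSiAsG0ADG70Al8zQznBnbFO0wAFCSBUf0ADK2FPewAInbFAqwAKI,QwdANRwATOLECe0AII,ENGwAEmLBI:EgGAqiADLwA9EV0AMoswAEAH0CVZw0AHi!AMJMm4EGbwAJwSBlscS:EAE0AoDs0ADSeMDsAAFwCBGq0AHBSEE8cv0QUbwAFFz0AEJGACKYK+0ADASwDMAAkAB4AIPAwADHt0AJwKczIEA8FZoQaTAGG0AH4qFAhwCsAD0AMCAYAM0ALCEE?30ADArwAPggFQ/EAz0AwmkFveESdM11EnX0ADA+wAYBRwADz4AJU0ANJk0APCUMMp0AK3fEim0AFlE0ADC9EsYEC!BV/EMQAEjwAzQiBTuAnwM'')]"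
definition rows19_14 :: "(nat \<times> nat \<times> string) list" where "rows19_14 = [
  (d85, d104, ''BZwBjAn0AfL.0ADmuFGcwAjeYEFH0Ab;RQYmEVFMXuwAEFuwAXBywA2N8FOwA8xEYJEIaYofFEN0ADAfwHHE80AEGvAUIAVUMAr0BTDKwAHFUFGNFAwwJdeYBDnwATF9wAGMk0AMBY0AOAuwBjCEQfREOG0ARcDAPyAAzBVO0ADIFBKj0AJC6wBZAE0ANAQ0AHSIwAGAYwAJqnQ5dAAmwAr9hA0nBal0AEBo0ALK6MAQwEZxpANXBMTcDtEVf0AD-8Ad8BjeBo6EBB4AdEtBe;FCQAr/AA4wAMGi0AUELwAgKwEMBQBjwApTtYcewADKg0AL7jQTPMa0ABw0AwC;0ARZyEABw8rDrwAQD50A4EB4AIvaEB60AkAAkFYEK8Fm7E=;AI4MBFwCvEf0AqAhwAjCj0AQL.MD+wBcBCYEvACQwAOTBwAHI0QBN0A1o+E9rE3vcKuGF?EACwCyR60AF+pBAXwTAqdFQbwATXnFB5wBJNrAH/FD!wA=S0QAXMObBAbwFIIRQU-ELKd6?EAAkEQ0AXDXwANAMwALSCQ76MA70ARdQwAKGwFphA''),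
  (d86, d103, ''F9F5;EQpECNF.6c?2ALyAC?0ADa,MQRAEZAH:cTz0ADi0EAHwFk.fEE+EBjwAHCjEVYMAKwUxAd0AGM7Mr6AspN4SFlrcGbwAM-nAc-MAJ0ADG,0AXZkEFXYwLAHE0AGA/0ASpCwAED?wBwgrMAj0AR/cAMJwAEl;GACwz-A0xADC,0ASZXMVn0AEstANBFAuwDeSmQ68AADwao1AIEVFU:FA0wEUG0wAFYmMDM0AQA5wEAe-cV5wAGDfFYDGFzwAMH8BPuEt1MMJEDaFB.0BwlUEgfALEFR?FCbE;ZQXEQFNwARGYwADf7GB-wAjhbFIL0APiLQDqRocYFywAGuvEXeMeCEYgMFuc0/Ar+AAHwAWMEcVKwAGJ:0AD+0BAAwSDJTFJEAGhwAHP-Rm8MIxFDG0AMA90AfFLwAVAs0ANQGwAF!9EARwAdAnwAFibA6yY18EAKwN,Q50ADJv0AG6eAeUAPLQ=:AGpwAFV2GAdEBDMT.Q9oEJm0ADZFFBj0AsHVMX0AI?YPWEDmwAV7=Y4PMvoQqPwAD''),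
  (d87, d102, ''GZcH7MFjwAE:=QO20APKt0ALmFEVAEPx0AEOREBaFfmEC!0AOO.E9=0AEAB4A.3MFAIwVbE7wAKpjMvpEVJ0AEAt0AIAe0AXLeAiQBNR0ADF1AK-NXAch5FC+0AH3=QUiwAGWbwAHC4wAFVEEFXBAwEAAkaacQdc0aYYUwAHBlwEDTQQt?EGaAAAwAFAQwIa+pBAocAP0ALITwAFUVEVAEdbABWwAQg,wAEOwc-nApuB=HBUB0AGAGwH?WywAFTbcIh0AGBwwAOLBBAGwAkBuwBaL6NDs0AYTvGAd0DCWqFAzwA,ZjMCAwCCIeMJgwAFf30ADEW0AMATwG,PsEo8QqyE9mFGW0AJCA4ADhbA23AVj0AEUXBAl0AOc1wADBjQEKwANBAgCMwAWQJE2-AxPEAXwBPZXAHxNvvAAB0AIEG0AECXQFFwAtA6wAeR+EAOwBRdX0AML?0AEJtwAHGdwAGAhwBFNj0AFGTFBDMAZwN;ipAS1wADZpEqrEWZBFd0AYBr0AUplcCX0AfEj0AH?jAG,EN2wAIC40A,MPwAJtREPXADf0AM5HEi,EAF0C3IVA''),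
  (d88, d101, ''JPwAFZQwAEG3AA;0D3=vMExwAECi0AZCpQHvQkdQrewADEdYB0wAJCN0AzAKcwBByrBAA8GyPywADCIMI.0AGGeFg0AAYwAYAewAF8eQP-FA;wADSFBTP0AGAxwBHAFwHD:mB3tNdFcfpQTOEUAMACwWv6+M9xBR3wAGcfEL2cEkMWqAfMASAEAS0I.74EMP0AOHrYudAAkwD2s4EJbwAJ;SAI00AD4XA6sBcKMEKYJb0AFLcwADLi0ADXmEAbwBKs1AIqQL;ALdwAHaFFA2wERiaEsdBwqAHMQ67ENUch5BADwb4KUA!wFB0wAkCJ0ADvgFXDEMJEBVCADwuTAKwL6A3wBRC5CLOBouEDf0AXIeMCY0Amu8FH50AEJbBqgABh0AEAA8X31PwAEDGwAFY9Ff=EwLEMwAD7FJA4AGAT0A20=FHFQLMQS7AeKFQ6NIcQIOAUwAAm0BKxkEwyEMLwAEImwAGG30AQBFcyHQAPwAvV9AAswCVDiQLpFpPMz9A30QyQYrTB5dMaGcEiYBZM4.EAj0AG''),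
  (d89, d100, ''22AmowAEboQL20AG:F0AEXbBXnwAECkwADIL0AFAAk,0B0AEH+ANTE+8FcuFABwHaARwE1R7FpRcFi0AIA8cv9EAcwBRKGFrDEAO0AJc=EAjwAsV?ctAJalAXFwADf?AXkABwwAnQMA,xEAb0AUA=0AKSeAD,0AHQbBCqwAIfpEPZ0ADBJwAUWZEAI0AJGeMOBAAFYA;0BWPZAAAkRgNAdwBdbRcJbERP0AHBa0AQE6FBBwAEGOwAE/TATPGHe0AGDSwApAJwlgKcRFUA6pABo0ADt6YAnwAeTAwADAKwCJZIFQUECnMUnCK40AFa/crKMX!MAowAHaCF8sAGcQAxwAtLi0AOuvEKAwAECOwAUSt0AD1c0ADwvASgAp6EnJMBewADMecP!EBtwANVyG=4EP20AEIeEMIMAQwEbQrwAOWHEI7EBcwAteuQ-mAdNBy1AOj0AOI.A/pMH50Asm+EBPwAFU,wAEDzwAOPZYAH0Bb2lFN.0ANJBAAhwKJAswD-AkwA.CzYPJEUEEc:EP-1ADkPEsUYx;EEA0ANCqwBbBD0AhCQwA=''),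
  (d90, d99, ''ENEAtwFGMkRg9CW3MnGQt?EsABYYMIPMsDEopECawAWOB4AV6-Fm,ACY0AGGSQS;cAAkd!0ADJoEhhEACwStKmwAEjcFGdwAOG1wAIbKMcaMCLwAGA40AFSRBAE0AMGJ0AE/MAUtFUyMjzYnWFolELCGAO0AMh0wADDH0AwR-Go9AAzELgMAAkC!wAEafBtkMM7BEI0Af.8A20EabMR0wAPrNQJy0ADzWYA.wB-AbMIewALSPESGwAEC00AFAMwQdACwT+V50AGLNMA1wAQE;cOb0ADo7YAEwAH0GAZPcDZ0AKmpcWLEk=YCBUA40AsBdwAfSA4ADAVcTtwAEU9AGO0ADGrwAEU0BAC8UAF/0AbZsCNQQ!;Ew,A=gEEHwAPHeQYOQ7LEU:0AE9HB/wFq?F/MYDuwARQuAED0ATV4FSwMCNwAJF?EPgEAl0AQA40A1EXwAOz7QABwHPAmwEeMlEQ,AAd0AmbdEAdQX9ECowAN1/FA-wA?IdwAEf?QuYMo;MA5wAUF2wATB80Aie/EpBQA-0B!HMwAJAqwBNCRwASAcwA2'')]"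
definition rows19_15 :: "(nat \<times> nat \<times> string) list" where "rows19_15 = [
  (d91, d98, ''GdGAC0ArF9BACwS;DKwA0FHwA2KM0AD22EYsA.nAAcwBJ79FF-M/;MAEwF,CC0AIO,MSeECW0AIKO0ANQpwALB,wAFHnYKCwAMAYwASBgCFiYmjADPRF7MFQ0AJGhwA0BewA:5=EMfYpKEPzQ/cAgaA0BQoFECYwAEDTQzWQre0ADCS0ADGgBOmBAxAK6B+nEKyM5IQZ1AEmQBz0AP/dABD0AlDuwAFa2BAY0Ag/?EgA0ADVK0AFAAw:KNlQYTGEOE.yQVjwADhEEuY0ADzmEC4CC4YdmMAf0DzYKFrYBDc0AEOeQG90AbnbFC1wAGnKMBI0AEAOwGrZqQAOYDA0AFDWwAIoMYD4F3+Ad6wAD0MBGP0A,rEAN!wAEjKwAEhMQFCBDP0AGB=0AK;AIRcwAFCc0AHADwAmN!0AGBX0AGDLECvwADAwwA6n,0AD2/EboEAUwIKgx0AHBJwBFy8ED-YTbQEpwAU.QMAuwAIj3YOVwAD-3wAEXWAwkB5IEDl0AQAD8VNJW0AGGe0AEmCRzP0ADhKQC7Q67AFiwAdRpcENMV0wAELcwAbCCwAK''),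
  (d92, d97, ''M!0AFA-RJWFFOwAYZLAFU0AEAAw,cg0AAs0Bd3FA7LEQYwAHOL0APApwAFBS0AKCV0AY;gEG!wAFHAAQ;0AFTTAd?QAlwDKTaCseMDh0ATfY0AFDNBAgwAhFhwAEstAADwfcFpQ=pEmgwALf+FFkYO+QIa0AFQ=EX=QdaBAU0A!BjwD.DsAPwwAFRyBBLwAwVD0ADBtFJWEN2BZyMQBRB?YJsACDwAQKV0AFX+E4pABYBxYMBYwC0ntEAw0AICZwAJD9wAVFR0AIw-cp6wADJlwAFADwpKhYMAewCsAD0AuEZ0ALAvwBJAAwCE.WEfl0AEVkEHEAO?EJ,ABr0AIKXcBowATemQAEwCEfORK3MTSFOhEEQMibGiiBTPc97ExfE;4QTCEJC0AUUTAg;0ADX5EUTwADQMEFFA/jEJuwAIIzwAECiEJ4AAPwB.BXwALERwAcqmACMcrpRJ8CJRENXB;GFGq0ADN8dFw0AraNM280AGhYEKNwADPTYTQFS?F3fAA4wAHAAk/MAA-wAzhdRLBYo4AEiQ5RAIwGKawAEjL0AF''),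
  (d93, d96, ''AYwFsSpEBwQAD0BOAhwAV.eEd4BGKwAEC0wAeAKwJDc-AV.cS6A;wAa0QhKwAIGLcnVBxqMkgMfTMuHEBS0ADHv0AF=0FLjc-oFA10AObC0ADDKZGzwAGO:YeFRK1ELfwAEIIwADBD0A!HsNBFwC2kkEKG0AYzGBdiAbDEBVwCTBG0ADB9BvMAIjRoyMS,wAF5LES?wAEWoBRAIb4YDNwAYmEwAFgvcloALIAX/AHBcN6QjnQQmMb+QTxBj;ARyM!dEMRwADUWcBzwCTRZwAQEg0AKCcGAs0AFRKAAV0AGVANAmwAuX=wAEBqwA,ZKYIWNA0wBMneAJMQAUwPPY.MmPEFZ0AP?6ENNAIp0AFADwArCBwA+EM0ADGVEpeAAQwIv+KM;jAAAkCkZN.EC!0A8BucAaEfaAT-AAv0AQHcEUlQANwCgl5QM8QAW0AwGdMBpQEZwALASwAGC10AXAfwANMRABtwAFbRQA0wBDqsEefMBYEhSQSAQB7AWOBTKB.k0ADKGMf!AfbAeOE5LEZ9YQOEAqwAg''),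
  (d94, d95, ''Ek0AK77FDb0AtFfQsgABJwAG!cAzB4ADi1EGsEAxwAao0wADn:MPvwAEG90AJIQYfFwAE2o0AGCtwAUTCEAKwCFDmwAh:/MAQwH;GrwAFACwL.-8wADiEAAh0B-y8wAERZCIIEKwFVWA,.wADaAwAFyMMbNQhBgGw0APkbwAEAWwCvQGAo6MBswAf!.E?iAO+0AKg,Nz4B:mEZbAr=YA+ES:FTpwADfzQyTEOdBAHBAEG0dE3JQJK0ADNRwAI1-QbtEf0wAHP/BADwJmSgwAEBUwAiemFgswAFGA4AE4?EkDAELwAdH2YDiwAaGRwAOTScpgAArEAfwApIWwA2N70AJAMwDJAkwAeCj0AEu0MqyE3IAHZQY:AnMARgMaKMi,McVYTlAaGEx3FroAKSEN3wAPTZMB.wBvG3EAg0CNAAkJ2MF+EzeE.7AATwB2elESm0AGcX0AHG0EASwCfQpFa2BCYwAqF7CBIwAH75ECCwAHEJADg0AZANwAUM=FAHZuRFylAB8ZpTQdZAblBAy0A7gdMAIwLaX0cbpFBN0AWI,wAD'')]"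
definition rows19 where "rows19 = rows19_0 @ rows19_1 @ rows19_2 @ rows19_3 @ rows19_4 @ rows19_5 @ rows19_6 @ rows19_7 @ rows19_8 @ rows19_9 @ rows19_10 @ rows19_11 @ rows19_12 @ rows19_13 @ rows19_14 @ rows19_15"

context gf19
begin

text \<open>The orders 19, \<open>189 = 27 * 7\<close> and \<open>146 = 2 * 73\<close> are pairwise
  coprime with product 524286.\<close>

lemma coords: "exponent_coords TYPE('a) 19 422765 124965 189 146" and prime_n: "prime n"
proof -
  have "ord n 422765 = prod_list [3, 3, 3, 7]" "ord n 124965 = prod_list [2, 73]"
    by (rule ord_pmI; simp add: pm_simps sqm_def)+
  then have o: "ord n 422765 = 189" "ord n 124965 = 146" by simp_all
  have "coprime (189::nat) (19 * 146)" "coprime (146::nat) (19 * 189)" "n - 1 = 19 * 189 * 146"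
    using coprime_bezout[of 189 455 "19 * 146" 31] coprime_bezout[of 146 2435 "19 * 189" 99] by simp_all
  from cyclic_coords[OF o this] show "exponent_coords TYPE('a) 19 422765 124965 189 146" "prime n" .
qed

sublocale label_field 19 "TYPE('a)" 422765 124965 189 146 g
  by (intro label_field.intro coords label_field_axioms.intro) (use g_ne prime_order[OF prime_n] in auto)

lemma nx_simp: "nx19 (j, nj, a, b, x) = (pl d19 j d14, pl d19 nj d5, pl d189 a d1, pl d146 b d1, x * sq x)"
  by (simp add: nx19_def)

lemma nx_ok: "okp s \<Longrightarrow> okp (nx19 s)"
proof -
  assume "okp s"
  moreover obtain j nj a b x where s: "s = (j, nj, a, b, x)" by (cases s)
  moreover have "x * sq x = x ^ 3" by (simp add: sq_def flip: power_mult power_Suc)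
  ultimately show ?thesis
    using okp_next[of j nj a b x 3 14 5] by (simp add: nx_simp dd cong_def)
qed

text \<open>The numeral is \<open>27594 = 189 * 146\<close>.\<close>

lemma tab_ok: "tr_all okp (fst (orb (leaf nx19) (num.Bit0 (num.Bit1 (num.Bit0 (num.Bit1 (num.Bit0 (num.Bit0 (num.Bit1 (num.Bit1 (num.Bit1 (num.Bit1 (num.Bit0 (num.Bit1 (num.Bit0 (num.Bit1 num.One)))))))))))))) (d0, d0, d0, d0, v19 g False True False False False False False False False False False False False False False False False False False)))"
  by (intro orb_leaf_all nx_ok) (simp_all add: okp_def v_g elm_def dd)

lemmas tab = tab_ok[simplified orb_simps fst_conv nx_simp sum19 sum189 sum146 v_add v_tg v_sq v_mult bit_simps]

lemma lookp_simp: "lookp (j, nj, a, b, x) \<longleftrightarrow> (\<forall>e. fr e x = E19 g (pl d19 e j) a b)"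
  by (simp add: lookp_def E19_def dd)

lemma stepp_simp: "stepp (j, nj, a, b, x) \<longleftrightarrow>
    (\<forall>k i u v w z. R19 g (Suc k) i a b u v w z = nxr k i (fr nj (1 + x)) u v w z)"
  by (simp add: stepp_def R19_def)

lemma nxr_simp: "nxr k i (E19 g c a b) u v w z = R19 g k (pl d19 i c) (pl d189 a u) (pl d146 b v) w z u v"
  by (simp add: nxr_E R19_def E19_def dd)

lemma fr_simp: "xr True False \<Longrightarrow> fr e (v19 g b0 b1 b2 b3 b4 b5 b6 b7 b8 b9 b10 b11 b12 b13 b14 b15 b16 b17 b18) = fr (pl d19 e d18) (sq (v19 g b0 b1 b2 b3 b4 b5 b6 b7 b8 b9 b10 b11 b12 b13 b14 b15 b16 b17 b18))"
  using fr_step[of e "v19 g b0 b1 b2 b3 b4 b5 b6 b7 b8 b9 b10 b11 b12 b13 b14 b15 b16 b17 b18"] by (simp add: sq_def dd)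

lemmas look = okp_all_lookp[OF tab, simplified tr_all.simps lookp_simp simp_thms]

lemmas step = okp_all_stepp[OF tab, simplified tr_all.simps stepp_simp nxr_simp v_one v_sq
  fr_simp look sum19 bit_simps simp_thms]

lemma walk_simps:
  "R19 g 0 j a b u v w z = E19 g j a b" "I19 0 x u v w z = x"
  "I19 (Suc k) (E19 g j a b) u v w z = I19 k (R19 g suc144 j a b u v w z) u v w z"
  "S19 g a b (E19 g j a b) = True"
  "K19 g k a b u nu v nv = S19 g a b (R19 g k d0 a b nu nv u v)"
  "Q19 g k l a b u nu v nv = S19 g a b (I19 (un l) (R19 g k d0 a b nu nv u v) nu nv u v)"
  by (simp_all add: R19_def E19_def I19_def S19_def K19_def Q19_def R_0 itm_0 itm_suc144 samem_E walk_samem_def walk_longm_def)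

lemmas row_simps19 = row_simps[of 422765 124965 full19 "d144" g, folded W19_def N19_def]
lemmas ent_simps19 = ent_simps[of 422765 124965 full19 "d144" g, folded N19_def K19_def Q19_def]
lemmas good_simps19 = good_simps[of 422765 124965 g, folded G19_def F19_def E19_def R19_def I19_def S19_def]

lemma cert_simps:
  "CG19 g ss (u, nu, v, nv, c, o1, o2) = G19 g nu nv u v ss c (E19 g d0 d0 d0)"
  "CB19 g ss (u, nu, v, nv) = G19 g nu nv u v ss d0 (E19 g d0 d0 d0)"
  "CO19 g (u, nu, v, nv, c, (k, a, b, b'), (l, e, f, f')) \<longleftrightarrow>
    R19 g (un2 k) d0 a b nu nv u v = E19 g d0 a b' \<and> R19 g (un2 l) d0 e f u v nu nv = E19 g d0 e f'"
  by (simp_all add: CG19_def CB19_def CO19_def G19_def E19_def R19_def cert_good_def cert_liftbad_def cert_ori_def)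

lemma full_mem: "list_all (\<lambda>x. (x \<in> set full19) = True) (map cert_pair good19 @ map (\<lambda>(u, nu, v, nv). (u, v)) lift19)"
  by (simp add: full19_def list_all_iff)

lemmas full_simps = full_mem[simplified good19_def good19_0_def good19_1_def good19_2_def good19_3_def lift19_def list.map append_Cons append_Nil
  cert_pair_def case_prod_conv list.pred_inject simp_thms]

lemma same_tab: "list_all (\<lambda>x. \<forall>i b. S19 g d0 d0 (E19 g i x b) = False) (tl (take (un d189) digits)) \<and>
    list_all (\<lambda>x. \<forall>i. S19 g d0 d0 (E19 g i d0 x) = False) (tl (take (un d146) digits))"
proof -
  have "set (tl (take k digits)) = {1..<k}" if "k \<le> 258" for k
    by (simp only: take_digits_upt[OF that] tl_upt set_upt One_nat_def)
  then show ?thesis by (auto simp: list_all_iff un_def S19_def E19_def dd samem_00)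
qed

lemmas same_simps = same_tab[simplified list_tab_simps un_simps]

context
  notes step [simp] walk_simps [simp] row_simps19 [simp] ent_simps19 [simp] good_simps19 [simp] full_simps [simp] cert_simps [simp]
    same_simps [simp] suc144_simp [simp] decode3.simps [simp del]
begin

lemma rows_0: "list_all (\<lambda>(u, nu, s). W19 g u nu vs19 s) rows19_0"
  unfolding rows19_0_def vs19_def by simp

lemma rows_1: "list_all (\<lambda>(u, nu, s). W19 g u nu vs19 s) rows19_1"
  unfolding rows19_1_def vs19_def by simp

lemma rows_2: "list_all (\<lambda>(u, nu, s). W19 g u nu vs19 s) rows19_2"
  unfolding rows19_2_def vs19_def by simp

lemma rows_3: "list_all (\<lambda>(u, nu, s). W19 g u nu vs19 s) rows19_3"
  unfolding rows19_3_def vs19_def by simp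

lemma rows_4: "list_all (\<lambda>(u, nu, s). W19 g u nu vs19 s) rows19_4"
  unfolding rows19_4_def vs19_def by simp

lemma rows_5: "list_all (\<lambda>(u, nu, s). W19 g u nu vs19 s) rows19_5"
  unfolding rows19_5_def vs19_def by simp

lemma rows_6: "list_all (\<lambda>(u, nu, s). W19 g u nu vs19 s) rows19_6"
  unfolding rows19_6_def vs19_def by simp

lemma rows_7: "list_all (\<lambda>(u, nu, s). W19 g u nu vs19 s) rows19_7"
  unfolding rows19_7_def vs19_def by simp

lemma rows_8: "list_all (\<lambda>(u, nu, s). W19 g u nu vs19 s) rows19_8"
  unfolding rows19_8_def vs19_def by simp

lemma rows_9: "list_all (\<lambda>(u, nu, s). W19 g u nu vs19 s) rows19_9"
  unfolding rows19_9_def vs19_def by simp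

lemma rows_10: "list_all (\<lambda>(u, nu, s). W19 g u nu vs19 s) rows19_10"
  unfolding rows19_10_def vs19_def by simp

lemma rows_11: "list_all (\<lambda>(u, nu, s). W19 g u nu vs19 s) rows19_11"
  unfolding rows19_11_def vs19_def by simp

lemma rows_12: "list_all (\<lambda>(u, nu, s). W19 g u nu vs19 s) rows19_12"
  unfolding rows19_12_def vs19_def by simp

lemma rows_13: "list_all (\<lambda>(u, nu, s). W19 g u nu vs19 s) rows19_13"
  unfolding rows19_13_def vs19_def by simp

lemma rows_14: "list_all (\<lambda>(u, nu, s). W19 g u nu vs19 s) rows19_14"
  unfolding rows19_14_def vs19_def by simp

lemma rows_15: "list_all (\<lambda>(u, nu, s). W19 g u nu vs19 s) rows19_15"
  unfolding rows19_15_def vs19_def by simp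

lemma row_0: "W19 g d0 d0 vh19 ''AAA;AE-vNAawBxywEE:0AFbsAgAMDA0AJEJwAGlycAMwA!p4A-oFI,QBTEA80EAz+BA/0AH2uAa+EDKMBgAV6YzeQT9wAHDl0AeCZEAMwB.QTEIp0AIPoZDbwAMwyAfNMlEE-5AWxEZTQEcwADJ/EkHAPJBZUcHBwATKe0ADqzwADXiwADz.BhXAG0RORQU+0ADE+0AtakBw-EwqFTBExbQGZAJxQYa0AIDdCSX0AGYiAs1EDYQA00AGW1wAEAV0AebswAFrvAmYEAAY''"
  unfolding vh19_def by simp

lemma good_0: "list_all (CG19 g seg19) good19_0"
  unfolding good19_0_def seg19_def by simp

lemma ori_0: "list_all (CO19 g) good19_0"
  unfolding good19_0_def by simp

lemma good_1: "list_all (CG19 g seg19) good19_1"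
  unfolding good19_1_def seg19_def by simp

lemma ori_1: "list_all (CO19 g) good19_1"
  unfolding good19_1_def by simp

lemma good_2: "list_all (CG19 g seg19) good19_2"
  unfolding good19_2_def seg19_def by simp

lemma ori_2: "list_all (CO19 g) good19_2"
  unfolding good19_2_def by simp

lemma good_3: "list_all (CG19 g seg19) good19_3"
  unfolding good19_3_def seg19_def by simp

lemma ori_3: "list_all (CO19 g) good19_3"
  unfolding good19_3_def by simp

lemma lift_0: "list_all (CB19 g seg19) lift19"
  unfolding lift19_def seg19_def by simp

end

theorem classes: "num_iso_classes TYPE('a) = 88" "all_nonorientable TYPE('a)"
proof -
  have rows: "list_all (\<lambda>(u, nu, s). rowm 422765 124965 full19 ix d144 g u nu vs19 s) rows19"
    using rows_0 rows_1 rows_2 rows_3 rows_4 rows_5 rows_6 rows_7 rows_8 rows_9 rows_10 rows_11 rows_12 rows_13 rows_14 rows_15 by (simp only: rows19_def W19_def list_all_append simp_thms)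
  note row0 = row_0[unfolded W19_def]
  have good: "list_all (cert_good 422765 124965 g seg19) good19"
    using good_0 good_1 good_2 good_3 by (simp only: good19_def CG19_def list_all_append simp_thms)
  have ori: "list_all (cert_ori 422765 124965 g) good19"
    using ori_0 ori_1 ori_2 ori_3 by (simp only: good19_def CO19_def list_all_append simp_thms)
  note lift = lift_0[unfolded CB19_def]
  have ar: "list_all (cert_arith 19 189 146 73) good19"
    by (simp add: good19_def good19_0_def good19_1_def good19_2_def good19_3_def cert_arith_def dd)
  have dist: "distinct (map cert_pair good19)" and len: "length good19 = 88"
    by (simp_all add: good19_def good19_0_def good19_1_def good19_2_def good19_3_def cert_pair_def dd)
  have us: "map fst rows19 = [1..<(189 + 1) div 2]" "list_all (\<lambda>(u, nu, s). (u + nu) mod 189 = 0) rows19"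
    by (simp_all add: rows19_def rows19_0_def rows19_1_def rows19_2_def rows19_3_def rows19_4_def rows19_5_def rows19_6_def rows19_7_def rows19_8_def rows19_9_def rows19_10_def rows19_11_def rows19_12_def rows19_13_def rows19_14_def rows19_15_def dd upt_conv_Cons)
  have vs: "map fst vs19 = [0..<146]" "list_all (\<lambda>(v, nv). (v + nv) mod 146 = 0) vs19"
    by (simp_all add: vs19_def dd upt_conv_Cons)
  have vh: "map fst vh19 = [0..<146 div 2 + 1]" "list_all (\<lambda>(v, nv). (v + nv) mod 146 = 0) vh19"
    by (simp_all add: vh19_def dd upt_conv_Cons)
  have bl: "list_all (\<lambda>(u, nu, v, nv). (u + nu) mod 189 = 0 \<and> (v + nv) mod 146 = 0) lift19"
    by (simp add: lift19_def dd)
  have N: "sum_list (map amount seg19) = 13797" by (simp add: seg19_def amount_def dd)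
  have q: "\<forall>p\<in>set [3, 3, 3, 7, 73]. prime p \<and> (\<exists>k\<in>{0<..<length seg19}. 13797 div p = sum_list (map amount (take k seg19)))"
    (is "\<forall>p\<in>_. _ \<and> (\<exists>k\<in>_. ?Q p k)")
  proof -
    have "?Q 3 3" "?Q 7 2" "?Q 73 1" by (simp_all add: seg19_def amount_def dd)
    moreover have "length seg19 = 4" by (simp add: seg19_def)
    ultimately show ?thesis by (auto intro: bexI[of _ 3] bexI[of _ 2] bexI[of _ 1])
  qed
  have h: "n dvd 124965 ^ 73 + 1"
  proof -
    \<comment> \<open>Half of the order 146 gives the power -1.\<close>
    have "pm n 124965 73 = 524286" by (simp add: pm_simps sqm_def)
    then have "(124965 ^ 73 + 1) mod n = (524286 + 1) mod n" unfolding pm_def by (metis mod_add_left_eq)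
    then show ?thesis by (simp add: mod_eq_0_iff_dvd)
  qed
  have pr: "(13797::nat) = prod_list [3, 3, 3, 7, 73]" by simp
  have odd: "odd (189::nat)" and bd: "72 * d144 * 19 < 2 ^ (19 - 1) - 1" "1 \<le> d144"
    and N': "13797 * 19 = 2 ^ (19 - 1) - (1::nat)" "0 < (13797::nat)" by (simp_all add: dd)
  note r = certified_classes[OF odd bd h rows row0 us vs vh full19_def good ori ar lift bl N N' pr q dist]
  show "num_iso_classes TYPE('a) = 88" using r(1) len by simp
  show "all_nonorientable TYPE('a)" using r(2) by simp
qed

end

lemma classes_19:
  assumes card: "card (UNIV :: 'a::{field,finite} set) = 2 ^ 19"
  shows "num_iso_classes TYPE('a) = 88 \<and> all_nonorientable TYPE('a)"
proof -
  obtain g :: 'a where "g ^ 19 = 1 + g + g ^ 2 + g ^ 5" using root_19[OF card] by blast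
  from gf19.classes[OF gf19.intro[OF card this]] show ?thesis by simp
qed

theorem mainTheorem9:
  shows "(card (UNIV :: ('a3::{field,finite}) set) = 2 ^ 3 \<longrightarrow> num_iso_classes TYPE('a3) = 1)
   \<and> (card (UNIV :: ('a5::{field,finite}) set) = 2 ^ 5 \<longrightarrow>
        num_iso_classes TYPE('a5) = 1 \<and> all_nonorientable TYPE('a5))
   \<and> (card (UNIV :: ('a7::{field,finite}) set) = 2 ^ 7 \<longrightarrow>
        num_iso_classes TYPE('a7) = 4 \<and> all_nonorientable TYPE('a7))
   \<and> (card (UNIV :: ('a11::{field,finite}) set) = 2 ^ 11 \<longrightarrow>
        num_iso_classes TYPE('a11) = 14 \<and> all_nonorientable TYPE('a11))
   \<and> (card (UNIV :: ('a13::{field,finite}) set) = 2 ^ 13 \<longrightarrow>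
        num_iso_classes TYPE('a13) = 12 \<and> all_nonorientable TYPE('a13))
   \<and> (card (UNIV :: ('a17::{field,finite}) set) = 2 ^ 17 \<longrightarrow>
        num_iso_classes TYPE('a17) = 65 \<and> all_nonorientable TYPE('a17))
   \<and> (card (UNIV :: ('a19::{field,finite}) set) = 2 ^ 19 \<longrightarrow>
        num_iso_classes TYPE('a19) = 88 \<and> all_nonorientable TYPE('a19))"
  using classes_3[where 'a = 'a3] classes_5[where 'a = 'a5] classes_7[where 'a = 'a7] classes_11[where 'a = 'a11]
    classes_13[where 'a = 'a13] classes_17[where 'a = 'a17] classes_19[where 'a = 'a19] by blast

end
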